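(* Let $X$ be a complex manifold of complex dimension $n\ge 2$ with a cylindrical boundary $C(S)=\mathbb{R}\times S$ such that $H^1(S)=\{0\}$. Let $\omega$ and $\omega'$ be two Ricci-flat conical Kähler metrics on $X$ with $[\omega]=[\omega']\in H^2(X)$. If $$\|e^{\lambda t}(\omega-\omega')\|_{C^k}<\infty$$ for a constant $\lambda>n-2$ and an integer $k\ge 2$, then $\omega=\omega'$.
   Context: Let $(S,g_S)$ be a compact Riemannian manifold of dimension $2n-1$. The cone is $C(S)=\mathbb{R}_{>0}\times S$ with coordinate $r\in\mathbb{R}_{>0}$; putting $t=\log r$ one regards $C(S)$ as the cylinder $\mathbb{R}\times S$ with cylinder parameter $t$. The cylinder metric is $g_{\mathrm{cyl}}=dt^2+g_S$ and the cone metric is $g_{\mathrm{cone}}=dr^2+r^2g_S=r^2g_{\mathrm{cyl}}$. A manifold $X$ has a cylindrical boundary $C(S)$ if there is a compact set $K\subset X$ such that $X\setminus K$ is diffeomorphic to $C(S)=\mathbb{R}\times S$ (infinity of $X$ corresponds to $t\to+\infty$); $X\setminus K$ is identified with $C(S)$. The parameter $t$ is extended to a $C^\infty$ function on $X$ (agreeing with the cylinder parameter near infinity), and $r=e^t$. A Riemannian metric $\bar g$ on such an $X$ is cylindrical if $\|e^{\delta_0 t}(\bar g-g_{\mathrm{cyl}})\|_{C^{k_0}}<\infty$ on the end of $X$ for some $\delta_0>0$ and some integer $k_0>4$, i.e. $\bar g-g_{\mathrm{cyl}}$ and its $\nabla_{\mathrm{cyl}}$-derivatives up to order $k_0$ are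 $O(e^{-\delta_0t})$ as $t\to+\infty$. A Riemannian metric $g$ on $X$ is conical if $r^{-2}g=e^{-2t}g$ is cylindrical. A conical Kähler form/metric on $X$ is a Kähler form whose associated Riemannian metric is conical. All $C^k$-norms (also of differential forms) are taken with respect to the cylindrical metric: $\|a\|_{C^k}=\sum_{i=0}^k\sup|\nabla^i a|$. $H^\bullet$ denotes de Rham cohomology. *)

theory Defs
  imports "HOL-Analysis.Analysis"
begin

section \<open>Smooth functions between Euclidean spaces\<close>

text \<open>Meant for open sets; differentiability of all iterated directional derivatives
  (hence their continuity) at every order is the usual notion of a smooth function.\<close>

fun Ck_on :: "nat \<Rightarrow> 'e::euclidean_space set \<Rightarrow> ('e \<Rightarrow> 'f::euclidean_space) \<Rightarrow> bool" where
  "Ck_on 0 U f \<longleftrightarrow> continuous_on U f"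
| "Ck_on (Suc k) U f \<longleftrightarrow> (\<forall>x\<in>U. f differentiable (at x)) \<and>
     (\<forall>v. Ck_on k U (\<lambda>x. frechet_derivative f (at x) v))"

definition smooth_fun_on :: "'e::euclidean_space set \<Rightarrow> ('e \<Rightarrow> 'f::euclidean_space) \<Rightarrow> bool" where
  "smooth_fun_on U f \<longleftrightarrow> (\<forall>k. Ck_on k U f)"

section \<open>Manifolds\<close>

text \<open>The points of a manifold are all elements of a topological type; the manifold structure
  is an atlas (not necessarily maximal) of charts with values in a Euclidean space, whose
  dimension is the dimension of the manifold. A chart is a pair of its domain and its
  coordinate map; the values of the coordinate map outside the domain are irrelevant.\<close>

type_synonym ('x, 'e) chart = "'x set \<times> ('x \<Rightarrow> 'e)"

definition dom_of :: "('x, 'e) chart \<Rightarrow> 'x set" where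
  "dom_of c = fst c"

definition coord :: "('x, 'e) chart \<Rightarrow> 'x \<Rightarrow> 'e" where
  "coord c = snd c"

definition range_of :: "('x, 'e) chart \<Rightarrow> 'e set" where
  "range_of c = coord c ` dom_of c"

definition point :: "('x, 'e) chart \<Rightarrow> 'e \<Rightarrow> 'x" where
  "point c = inv_into (dom_of c) (coord c)"

definition overlap :: "('x, 'e) chart \<Rightarrow> ('x, 'e) chart \<Rightarrow> 'e set" where
  "overlap c d = coord c ` (dom_of c \<inter> dom_of d)"

definition transition :: "('x, 'e) chart \<Rightarrow> ('x, 'e) chart \<Rightarrow> 'e \<Rightarrow> 'e" where
  "transition c d = coord d \<circ> point c"

definition smooth_atlas ::
  "('x::{t2_space,second_countable_topology}, 'e::euclidean_space) chart set \<Rightarrow> bool" where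
  "smooth_atlas A \<longleftrightarrow>
     (\<Union>c\<in>A. dom_of c) = UNIV \<and>
     (\<forall>c\<in>A. open (dom_of c) \<and> open (range_of c) \<and>
        homeomorphism (dom_of c) (range_of c) (coord c) (point c)) \<and>
     (\<forall>c\<in>A. \<forall>d\<in>A. smooth_fun_on (overlap c d) (transition c d))"

text \<open>The transition maps are holomorphic: their real derivatives are complex linear.\<close>

definition complex_atlas ::
  "('x::{t2_space,second_countable_topology}, complex ^ 'n) chart set \<Rightarrow> bool" where
  "complex_atlas A \<longleftrightarrow> smooth_atlas A \<and>
     (\<forall>c\<in>A. \<forall>d\<in>A. \<forall>x\<in>overlap c d. \<forall>a v.
        frechet_derivative (transition c d) (at x) (a *s v) =
        a *s frechet_derivative (transition c d) (at x) v)"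

text \<open>Smoothness of a map on an open set \<open>U\<close>.\<close>

definition smooth_map_on ::
  "('x::topological_space, 'e::euclidean_space) chart set \<Rightarrow>
   ('y::topological_space, 'f::euclidean_space) chart set \<Rightarrow> 'x set \<Rightarrow> ('x \<Rightarrow> 'y) \<Rightarrow> bool" where
  "smooth_map_on A B U f \<longleftrightarrow> continuous_on U f \<and>
     (\<forall>c\<in>A. \<forall>d\<in>B. smooth_fun_on (coord c ` (dom_of c \<inter> U \<inter> f -` dom_of d))
        (coord d \<circ> f \<circ> point c))"

definition smooth_scalar ::
  "('x::topological_space, 'e::euclidean_space) chart set \<Rightarrow> ('x \<Rightarrow> real) \<Rightarrow> bool" where
  "smooth_scalar A f \<longleftrightarrow> (\<forall>c\<in>A. smooth_fun_on (range_of c) (f \<circ> point c))"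

section \<open>Covariant tensor fields\<close>

text \<open>A covariant tensor field of rank \<open>k\<close> is given by its local representatives: \<open>T c x vs\<close> is
  the value, at the point with coordinates \<open>x\<close> in the chart \<open>c\<close>, on the list \<open>vs\<close> of \<open>k\<close> tangent
  vectors, themselves expressed in the coordinates of \<open>c\<close>. Representatives vanish
  outside their proper domain, so that equality of tensor fields is HOL equality.\<close>

type_synonym 'e local_tensor = "'e \<Rightarrow> 'e list \<Rightarrow> real"
type_synonym ('x, 'e) tensor = "('x, 'e) chart \<Rightarrow> 'e local_tensor"

definition tensor_field ::
  "('x::topological_space, 'e::euclidean_space) chart set \<Rightarrow> nat \<Rightarrow> ('x, 'e) tensor \<Rightarrow> bool" where
  "tensor_field A k T \<longleftrightarrow>
     (\<forall>c x vs. \<not> (c \<in> A \<and> x \<in> range_of c \<and> length vs = k) \<longrightarrow> T c x vs = 0) \<and>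
     (\<forall>c\<in>A. \<forall>x\<in>range_of c. \<forall>vs. length vs = k \<longrightarrow>
        (\<forall>i<k. linear (\<lambda>v. T c x (vs[i := v])))) \<and>
     (\<forall>c\<in>A. \<forall>vs. length vs = k \<longrightarrow> smooth_fun_on (range_of c) (\<lambda>x. T c x vs)) \<and>
     (\<forall>c\<in>A. \<forall>d\<in>A. \<forall>x\<in>overlap c d. \<forall>vs. length vs = k \<longrightarrow>
        T c x vs = T d (transition c d x)
                     (map (frechet_derivative (transition c d) (at x)) vs))"

definition zero_tensor :: "('x, 'e) tensor" where
  "zero_tensor = (\<lambda>c x vs. 0)"

definition diff_tensor :: "('x, 'e) tensor \<Rightarrow> ('x, 'e) tensor \<Rightarrow> ('x, 'e) tensor" where
  "diff_tensor T T' = (\<lambda>c x vs. T c x vs - T' c x vs)"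

definition mult_tensor :: "('x \<Rightarrow> real) \<Rightarrow> ('x, 'e) tensor \<Rightarrow> ('x, 'e) tensor" where
  "mult_tensor f T = (\<lambda>c x vs. f (point c x) * T c x vs)"

text \<open>The result of the pullback does not depend on the chosen chart around the image point.\<close>

definition pullback ::
  "('x, 'e::euclidean_space) chart set \<Rightarrow> ('y, 'f::euclidean_space) chart set \<Rightarrow> nat \<Rightarrow>
   ('x \<Rightarrow> 'y) \<Rightarrow> ('y, 'f) tensor \<Rightarrow> ('x, 'e) tensor" where
  "pullback A B k f T = (\<lambda>c x vs.
     if c \<in> A \<and> x \<in> range_of c \<and> length vs = k then
       let d = (SOME d. d \<in> B \<and> f (point c x) \<in> dom_of d);
           F = coord d \<circ> f \<circ> point c
       in T d (F x) (map (frechet_derivative F (at x)) vs)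
     else 0)"

section \<open>Differential forms and de Rham cohomology\<close>

definition diff_form ::
  "('x::topological_space, 'e::euclidean_space) chart set \<Rightarrow> nat \<Rightarrow> ('x, 'e) tensor \<Rightarrow> bool" where
  "diff_form A k \<alpha> \<longleftrightarrow> tensor_field A k \<alpha> \<and>
     (\<forall>c x vs i j. length vs = k \<and> i < j \<and> j < k \<and> vs ! i = vs ! j \<longrightarrow> \<alpha> c x vs = 0)"

text \<open>Exterior derivative of a \<open>k\<close>-form; evaluated on constant coordinate vector fields, so the
  Lie bracket terms of the invariant formula vanish.\<close>

definition ext_deriv ::
  "('x, 'e::euclidean_space) chart set \<Rightarrow> nat \<Rightarrow> ('x, 'e) tensor \<Rightarrow> ('x, 'e) tensor" where
  "ext_deriv A k \<alpha> = (\<lambda>c x vs.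
     if c \<in> A \<and> x \<in> range_of c \<and> length vs = Suc k then
       (\<Sum>i\<le>k. (-1) ^ i *
          frechet_derivative (\<lambda>y. \<alpha> c y (take i vs @ drop (Suc i) vs)) (at x) (vs ! i))
     else 0)"

definition closed_form ::
  "('x::topological_space, 'e::euclidean_space) chart set \<Rightarrow> nat \<Rightarrow> ('x, 'e) tensor \<Rightarrow> bool" where
  "closed_form A k \<alpha> \<longleftrightarrow> diff_form A k \<alpha> \<and> ext_deriv A k \<alpha> = zero_tensor"

definition exact_form ::
  "('x::topological_space, 'e::euclidean_space) chart set \<Rightarrow> nat \<Rightarrow> ('x, 'e) tensor \<Rightarrow> bool" where
  "exact_form A k \<alpha> \<longleftrightarrow>
     (if k = 0 then \<alpha> = zero_tensor
      else \<exists>\<eta>. diff_form A (k - 1) \<eta> \<and> \<alpha> = ext_deriv A (k - 1) \<eta>)"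

definition deRham_class ::
  "('x::topological_space, 'e::euclidean_space) chart set \<Rightarrow> nat \<Rightarrow> ('x, 'e) tensor \<Rightarrow>
   ('x, 'e) tensor set" where
  "deRham_class A k \<alpha> = {\<beta>. closed_form A k \<beta> \<and> exact_form A k (diff_tensor \<beta> \<alpha>)}"

definition deRham ::
  "('x::topological_space, 'e::euclidean_space) chart set \<Rightarrow> nat \<Rightarrow> ('x, 'e) tensor set set" where
  "deRham A k = deRham_class A k ` {\<alpha>. closed_form A k \<alpha>}"

section \<open>Riemannian metrics\<close>

definition riemannian_metric ::
  "('x::topological_space, 'e::euclidean_space) chart set \<Rightarrow> ('x, 'e) tensor \<Rightarrow> bool" where
  "riemannian_metric A g \<longleftrightarrow> tensor_field A 2 g \<and>
     (\<forall>c\<in>A. \<forall>x\<in>range_of c. \<forall>u v. g c x [u, v] = g c x [v, u] \<and> (u \<noteq> 0 \<longrightarrow> g c x [u, u] > 0))"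

text \<open>Local formulas for the Levi-Civita connection: \<open>christoffel g x u v\<close> is
  \<open>\<nabla>\<^sub>u v\<close> at \<open>x\<close> for constant coordinate vector fields \<open>u\<close> and \<open>v\<close>, given by the Koszul formula.\<close>

definition christoffel ::
  "'e::euclidean_space local_tensor \<Rightarrow> 'e \<Rightarrow> 'e \<Rightarrow> 'e \<Rightarrow> 'e" where
  "christoffel g x u v = (THE z. \<forall>w. 2 * g x [z, w] =
     frechet_derivative (\<lambda>y. g y [v, w]) (at x) u +
     frechet_derivative (\<lambda>y. g y [u, w]) (at x) v -
     frechet_derivative (\<lambda>y. g y [u, v]) (at x) w)"

text \<open>Covariant derivative of a covariant tensor; the new (first) argument is the direction.\<close>

definition cov_deriv ::
  "'e::euclidean_space local_tensor \<Rightarrow> 'e local_tensor \<Rightarrow> 'e local_tensor" where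
  "cov_deriv g T x vs = (case vs of [] \<Rightarrow> 0 | v # ws \<Rightarrow>
     frechet_derivative (\<lambda>y. T y ws) (at x) v -
     (\<Sum>j<length ws. T x (ws[j := christoffel g x v (ws ! j)])))"

text \<open>\<open>R(u,v)w = \<nabla>\<^sub>u \<nabla>\<^sub>v w - \<nabla>\<^sub>v \<nabla>\<^sub>u w\<close> for constant coordinate vector fields,
  and \<open>Ric(v,w) = tr (u \<mapsto> R(u,v)w)\<close>.\<close>

definition riemann_curv ::
  "'e::euclidean_space local_tensor \<Rightarrow> 'e \<Rightarrow> 'e \<Rightarrow> 'e \<Rightarrow> 'e \<Rightarrow> 'e" where
  "riemann_curv g x u v w =
     frechet_derivative (\<lambda>y. christoffel g y v w) (at x) u +
     christoffel g x u (christoffel g x v w) -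
     frechet_derivative (\<lambda>y. christoffel g y u w) (at x) v -
     christoffel g x v (christoffel g x u w)"

definition ricci_curv ::
  "'e::euclidean_space local_tensor \<Rightarrow> 'e \<Rightarrow> 'e \<Rightarrow> 'e \<Rightarrow> real" where
  "ricci_curv g x v w = (\<Sum>b\<in>Basis. riemann_curv g x b v w \<bullet> b)"

definition ricci_flat ::
  "('x, 'e::euclidean_space) chart set \<Rightarrow> ('x, 'e) tensor \<Rightarrow> bool" where
  "ricci_flat A g \<longleftrightarrow> (\<forall>c\<in>A. \<forall>x\<in>range_of c. \<forall>v w. ricci_curv (g c) x v w = 0)"

text \<open>Pointwise norm of a rank \<open>k\<close> tensor: the components are taken in some \<open>g\<close>-orthonormal
  frame (indexed by the standard basis); the result is independent of the frame.\<close>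

definition orthonormal_frame ::
  "'e::euclidean_space local_tensor \<Rightarrow> 'e \<Rightarrow> ('e \<Rightarrow> 'e) \<Rightarrow> bool" where
  "orthonormal_frame g x F \<longleftrightarrow>
     (\<forall>a\<in>Basis. \<forall>b\<in>Basis. g x [F a, F b] = (if a = b then 1 else 0))"

definition tensor_norm ::
  "'e::euclidean_space local_tensor \<Rightarrow> nat \<Rightarrow> 'e local_tensor \<Rightarrow> 'e \<Rightarrow> real" where
  "tensor_norm g k T x =
     (let F = (SOME F. orthonormal_frame g x F)
      in sqrt (\<Sum>bs\<in>{bs. set bs \<subseteq> Basis \<and> length bs = k}. (T x (map F bs))\<^sup>2))"

section \<open>Cylinders\<close>

definition cyl_chart :: "('s, 'e) chart \<Rightarrow> (real \<times> 's, real \<times> 'e) chart" where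
  "cyl_chart c = (UNIV \<times> dom_of c, \<lambda>(t, s). (t, coord c s))"

definition cyl_atlas :: "('s, 'e) chart set \<Rightarrow> (real \<times> 's, real \<times> 'e) chart set" where
  "cyl_atlas A = cyl_chart ` A"

text \<open>\<open>g\<^sub>c\<^sub>y\<^sub>l = dt\<^sup>2 + g\<^sub>S\<close>; in the charts of \<open>cyl_atlas\<close> the first coordinate is \<open>t\<close>.\<close>

definition g_cyl ::
  "('s, 'e::euclidean_space) chart set \<Rightarrow> ('s, 'e) tensor \<Rightarrow> (real \<times> 's, real \<times> 'e) tensor" where
  "g_cyl A gS = (\<lambda>c x vs.
     if c \<in> cyl_atlas A \<and> x \<in> range_of c \<and> length vs = 2 then
       fst (vs ! 0) * fst (vs ! 1) + pullback (cyl_atlas A) A 2 snd gS c x vs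
     else 0)"

text \<open>The \<open>C\<^sup>k\<close>-norm, with respect to \<open>g_cyl\<close>, over \<open>{T..} \<times> S\<close> of a rank \<open>m\<close> tensor.\<close>

definition Ck_norm ::
  "('s, 'e::euclidean_space) chart set \<Rightarrow> ('s, 'e) tensor \<Rightarrow> real \<Rightarrow> nat \<Rightarrow> nat \<Rightarrow>
   (real \<times> 's, real \<times> 'e) tensor \<Rightarrow> ennreal" where
  "Ck_norm A gS T k m a = (\<Sum>i\<le>k. SUP (c, x)\<in>{(c, x). c \<in> cyl_atlas A \<and> x \<in> range_of c \<and> T \<le> fst x}.
     ennreal (tensor_norm (g_cyl A gS c) (m + i) ((cov_deriv (g_cyl A gS c) ^^ i) (a c)) x))"

text \<open>For smooth \<open>a\<close> and compact \<open>S\<close> the choice of \<open>T\<close> does not affect finiteness of the norm.\<close>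

definition Ck_finite_on_end ::
  "('s, 'e::euclidean_space) chart set \<Rightarrow> ('s, 'e) tensor \<Rightarrow> nat \<Rightarrow> nat \<Rightarrow>
   (real \<times> 's, real \<times> 'e) tensor \<Rightarrow> bool" where
  "Ck_finite_on_end A gS k m a \<longleftrightarrow> (\<exists>T. Ck_norm A gS T k m a < \<infinity>)"

section \<open>Manifolds with a cylindrical boundary\<close>

text \<open>The inverse \<open>\<Psi>\<close> of the identification of \<open>X - K\<close> with \<open>\<real> \<times> S\<close>. The last two conditions say
  that infinity of \<open>X\<close> corresponds to \<open>t \<rightarrow> +\<infinity>\<close>: the sets \<open>{t > T}\<close> are cofinal with the
  complements of compact sets.\<close>

definition cylindrical_boundary ::
  "('x::topological_space, 'd::euclidean_space) chart set \<Rightarrow>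
   ('s::topological_space, 'e::euclidean_space) chart set \<Rightarrow>
   'x set \<Rightarrow> (real \<times> 's \<Rightarrow> 'x) \<Rightarrow> bool" where
  "cylindrical_boundary AX AS K \<Psi> \<longleftrightarrow>
     compact K \<and>
     (\<exists>\<Phi>. homeomorphism UNIV (- K) \<Psi> \<Phi> \<and>
        smooth_map_on (cyl_atlas AS) AX UNIV \<Psi> \<and>
        smooth_map_on AX (cyl_atlas AS) (- K) \<Phi>) \<and>
     (\<forall>T. compact (- \<Psi> ` ({T<..} \<times> UNIV))) \<and>
     (\<forall>L. compact L \<longrightarrow> (\<exists>T. L \<inter> \<Psi> ` ({T<..} \<times> UNIV) = {}))"

definition extended_parameter ::
  "('x::topological_space, 'd::euclidean_space) chart set \<Rightarrow>
   (real \<times> 's \<Rightarrow> 'x) \<Rightarrow> ('x \<Rightarrow> real) \<Rightarrow> bool" where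
  "extended_parameter AX \<Psi> t \<longleftrightarrow> smooth_scalar AX t \<and> (\<exists>T. \<forall>u>T. \<forall>s. t (\<Psi> (u, s)) = u)"

definition cylindrical_metric ::
  "('x::topological_space, 'd::euclidean_space) chart set \<Rightarrow>
   ('s::topological_space, 'e::euclidean_space) chart set \<Rightarrow> ('s, 'e) tensor \<Rightarrow>
   (real \<times> 's \<Rightarrow> 'x) \<Rightarrow> ('x, 'd) tensor \<Rightarrow> bool" where
  "cylindrical_metric AX AS gS \<Psi> h \<longleftrightarrow> riemannian_metric AX h \<and>
     (\<exists>\<delta>>0. \<exists>k>4. Ck_finite_on_end AS gS k 2
        (mult_tensor (\<lambda>p. exp (\<delta> * fst p))
          (diff_tensor (pullback (cyl_atlas AS) AX 2 \<Psi> h) (g_cyl AS gS))))"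

definition conical_metric ::
  "('x::topological_space, 'd::euclidean_space) chart set \<Rightarrow>
   ('s::topological_space, 'e::euclidean_space) chart set \<Rightarrow> ('s, 'e) tensor \<Rightarrow>
   (real \<times> 's \<Rightarrow> 'x) \<Rightarrow> ('x \<Rightarrow> real) \<Rightarrow> ('x, 'd) tensor \<Rightarrow> bool" where
  "conical_metric AX AS gS \<Psi> t g \<longleftrightarrow> riemannian_metric AX g \<and>
     cylindrical_metric AX AS gS \<Psi> (mult_tensor (\<lambda>p. exp (- 2 * t p)) g)"

section \<open>Kaehler metrics\<close>

text \<open>Convention: \<open>g(u,v) = \<omega>(u,Jv)\<close>, where \<open>J\<close> is multiplication by \<open>\<i>\<close> in holomorphic charts.\<close>

definition kaehler_metric_of ::
  "('x, complex ^ 'n) tensor \<Rightarrow> ('x, complex ^ 'n) tensor" where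
  "kaehler_metric_of \<omega> = (\<lambda>c x vs. if length vs = 2 then \<omega> c x [vs ! 0, \<i> *s (vs ! 1)] else 0)"

definition kaehler_form ::
  "('x::topological_space, complex ^ 'n) chart set \<Rightarrow> ('x, complex ^ 'n) tensor \<Rightarrow> bool" where
  "kaehler_form A \<omega> \<longleftrightarrow> closed_form A 2 \<omega> \<and>
     (\<forall>c\<in>A. \<forall>x\<in>range_of c. \<forall>u v. \<omega> c x [\<i> *s u, \<i> *s v] = \<omega> c x [u, v]) \<and>
     (\<forall>c\<in>A. \<forall>x\<in>range_of c. \<forall>u. u \<noteq> 0 \<longrightarrow> \<omega> c x [u, \<i> *s u] > 0)"

definition conical_kaehler ::
  "('x::topological_space, complex ^ 'n) chart set \<Rightarrow>
   ('s::topological_space, 'e::euclidean_space) chart set \<Rightarrow> ('s, 'e) tensor \<Rightarrow>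
   (real \<times> 's \<Rightarrow> 'x) \<Rightarrow> ('x \<Rightarrow> real) \<Rightarrow> ('x, complex ^ 'n) tensor \<Rightarrow> bool" where
  "conical_kaehler AX AS gS \<Psi> t \<omega> \<longleftrightarrow> kaehler_form AX \<omega> \<and>
     conical_metric AX AS gS \<Psi> t (kaehler_metric_of \<omega>)"

end

theory Submission imports Defs "HOL-Complex_Analysis.Conformal_Mappings" begin

text \<open>Both metrics are Ricci flat, so the logarithm of the ratio of their volume forms is pluriharmonic;
  it tends to \<open>0\<close> at infinity, and by the maximum principle the volume forms agree.
  Write \<open>\<omega> - \<omega>' = d\<eta>\<close>. With respect to the common volume form, the divergence of the vector field
  \<open>W = g\<^sup>-\<^sup>1(\<eta> J) - g'\<^sup>-\<^sup>1(\<eta> J)\<close> is, up to sign, a function \<open>Q \<ge> 0\<close> that vanishes only where \<open>\<omega> = \<omega>'\<close>.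
  On the end, \<open>H\<^sup>1(S) = 0\<close> yields a function \<open>h\<close> such that \<open>\<eta> - dh\<close> decays like \<open>e\<^sup>-\<^sup>\<lambda>\<^sup>t\<close>. Replacing \<open>\<eta>\<close> by
  \<open>\<eta> - dh\<close> does not change the flux of \<open>W\<close> through \<open>{t \<approx> T}\<close>, which is therefore of order \<open>exp ((2 n - 4 - 2 \<lambda>) T)\<close>.
  Since \<open>\<lambda> > n - 2\<close>, the integral of \<open>Q\<close> vanishes.\<close>

section \<open>Continuously differentiable functions\<close>

text \<open>The exponent arises as follows. The difference of the two index raisings is
  \<open>- g^-1 (g - g') g'^-1\<close>. Measured in the cylinder metric, each raising contributes
  \<open>exp (- 2 t)\<close> and the middle factor \<open>exp (- lam t)\<close>. The corrected form
  contributes another \<open>exp (- lam t)\<close>, the differential of the cutoff stays bounded,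
  and a slab of unit length has volume of order \<open>exp (2 n t)\<close>. One obstacle is
  regularity. The decay hypothesis controls \<open>d\<eta>\<close> but not \<open>\<eta>\<close>,
  and the correcting function \<open>h\<close> comes from line integrals and is only C^1. Hence
  \<open>dh\<close> cannot be differentiated, and its vector field has no pointwise divergence. The
  derivative is therefore moved from \<open>h\<close> to the smooth cutoff before any integration by
  parts. Another is topology. The manifold may have several components, so the comparison of volumes
  is kept in the form of equal logarithmic derivatives of the two densities. This is enough to treat
  both Riemannian divergences as divergences for a single density, so that \<open>W\<close> can be
  integrated as one field.\<close>

abbreviation dir :: "('e::euclidean_space => 'f::euclidean_space) => 'e => 'e => 'f" where
  "dir f x \<equiv> frechet_derivative f (at x)"

lemma dir_eqI: "(f has_derivative D) (at x) ==> dir f x = D"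
  by (metis frechet_derivative_at)

lemma dir_works: "f differentiable (at x) ==> (f has_derivative dir f x) (at x)"
  by (simp add: frechet_derivative_works)

lemma dir_cong:
  assumes "open U" "x : U" "!!y. y : U ==> f y = g y"
  shows "dir f x = dir g x"
proof -
  have "(f has_derivative D) (at x) \<longleftrightarrow> (g has_derivative D) (at x)" for D
    using has_derivative_transform_within_open[OF _ assms(1,2), of f D UNIV g]
      has_derivative_transform_within_open[OF _ assms(1,2), of g D UNIV f] assms(3) by auto
  then show ?thesis unfolding frechet_derivative_def by simp
qed

lemma differentiable_cong_open:
  assumes "open U" "x : U" "!!y. y : U ==> f y = g y"
  shows "f differentiable (at x) \<longleftrightarrow> g differentiable (at x)"
  using has_derivative_transform_within_open[OF _ assms(1,2), of f _ UNIV g]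
      has_derivative_transform_within_open[OF _ assms(1,2), of g _ UNIV f] assms(3)
  unfolding differentiable_def by auto

lemma Ck_on_cong:
  assumes "open U" "!!y. y : U ==> f y = g y"
  shows "Ck_on k U f \<longleftrightarrow> Ck_on k U g"
  using assms(2)
proof (induction k arbitrary: f g)
  case 0
  then show ?case by (simp cong: continuous_on_cong)
next
  case (Suc k)
  have d: "dir f x = dir g x" if "x : U" for x using dir_cong[OF assms(1) that Suc.prems] by simp
  have "Ck_on k U (%x. dir f x v) \<longleftrightarrow> Ck_on k U (%x. dir g x v)" for v
    by (rule Suc.IH) (simp add: d)
  moreover have "f differentiable (at x) \<longleftrightarrow> g differentiable (at x)" if "x : U" for x
    using differentiable_cong_open[OF assms(1) that Suc.prems] by simp
  ultimately show ?case by simp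
qed

lemma Ck_on_subset: "Ck_on k U f ==> V \<subseteq> U ==> Ck_on k V f"
  by (induction k arbitrary: f) (auto intro: continuous_on_subset)

lemma Ck_on_SucD: "Ck_on (Suc k) U f ==> Ck_on k U f"
proof (induction k arbitrary: f)
  case 0
  then show ?case
    by (simp add: continuous_at_imp_continuous_on differentiable_imp_continuous_within)
next
  case (Suc k)
  then show ?case by (metis Ck_on.simps(2))
qed

lemma Ck_on_le: "Ck_on k U f ==> j <= k ==> Ck_on j U f"
proof (induction k)
  case (Suc k)
  then show ?case using Ck_on_SucD[of k U f] by (metis le_Suc_eq)
qed simp

lemma Ck_on_imp_continuous: "Ck_on k U f ==> continuous_on U f"
  using Ck_on_le[of k U f 0] by simp

lemma Ck_on_imp_differentiable: "Ck_on k U f ==> 0 < k ==> x : U ==> f differentiable (at x)"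
  by (cases k) auto

lemma Ck_on_dir: "Ck_on (Suc k) U f ==> Ck_on k U (%x. dir f x v)"
  by simp

text \<open>Derivatives at a point only see a neighbourhood, so the induction reduces to local
  continuity. This serves functions defined by cases, such as extensions by zero.\<close>

lemma Ck_on_local:
  assumes "!!x. x : U ==> EX V. open V & x : V & Ck_on k V f"
  shows "Ck_on k U f"
  using assms
proof (induction k arbitrary: f)
  case 0
  have "isCont f x" if "x : U" for x
    using 0[OF that] by (auto simp: continuous_on_eq_continuous_at)
  then show ?case by (simp add: continuous_at_imp_continuous_on)
next
  case (Suc k)
  have "f differentiable (at x)" if "x : U" for x using Suc.prems[OF that] by auto
  moreover have "Ck_on k U (%x. dir f x v)" for v
    by (rule Suc.IH) (use Suc.prems in force)
  ultimately show ?case by simp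
qed

lemma Ck_on_const [simp]: "Ck_on k U (%x. c)"
proof (induction k arbitrary: c)
  case (Suc k)
  have "dir (%x::'a. c) x = (%v. 0)" for x by (rule dir_eqI) simp
  then show ?case using Suc by simp
qed simp

lemma Ck_on_bounded_linear: "bounded_linear f ==> Ck_on k U f"
proof (cases k)
  case 0
  then show "bounded_linear f ==> ?thesis" by (simp add: linear_continuous_on)
next
  case (Suc j)
  assume f: "bounded_linear f"
  then have "dir f x = f" for x by (intro dir_eqI bounded_linear_imp_has_derivative)
  then show ?thesis using f Suc by (auto intro: bounded_linear_imp_differentiable)
qed

lemma Ck_on_add:
  assumes "open U" "Ck_on k U f" "Ck_on k U g"
  shows "Ck_on k U (%x. f x + g x)"
  using assms(2,3)
proof (induction k arbitrary: f g)
  case 0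
  then show ?case by (auto intro: continuous_intros)
next
  case (Suc k)
  have d: "dir (%x. f x + g x) x = (%v. dir f x v + dir g x v)" if "x : U" for x
    by (rule dir_eqI) (use Suc.prems that in \<open>auto intro!: derivative_eq_intros dir_works\<close>)
  have "Ck_on k U (%x. dir (%x. f x + g x) x v)" for v
    using Suc.IH[of "%x. dir f x v" "%x. dir g x v"] Suc.prems
    by (subst Ck_on_cong[OF assms(1), of _ "%x. dir f x v + dir g x v"]) (auto simp: d)
  then show ?case using Suc.prems by (auto intro: derivative_intros)
qed

lemma Ck_on_sum:
  assumes "open U" "!!i. i : I ==> Ck_on k U (f i)"
  shows "Ck_on k U (%x. SUM i:I. f i x)"
proof (cases "finite I")
  case True
  then show ?thesis using assms(2) by (induction I) (auto intro: Ck_on_add[OF assms(1)])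
qed simp

text \<open>The product rule yields two terms of the same shape, so the induction closes for general
  \<open>f\<close> and \<open>g\<close>. Multiplication, scaling and the inner product are
  instances.\<close>

lemma Ck_on_bilinear:
  assumes "open U" "bounded_bilinear h" "Ck_on k U f" "Ck_on k U g"
  shows "Ck_on k U (%x. h (f x) (g x))"
  using assms(3,4)
proof (induction k arbitrary: f g)
  case 0
  then show ?case using bounded_bilinear.continuous_on[OF assms(2)] by simp
next
  case (Suc k)
  have hd: "((%x. h (f x) (g x)) has_derivative (%v. h (f x) (dir g x v) + h (dir f x v) (g x))) (at x)"
    if "x : U" for x
    by (rule bounded_bilinear.FDERIV[OF assms(2) dir_works dir_works]) (use Suc.prems that in auto)
  have d: "dir (%x. h (f x) (g x)) x = (%v. h (f x) (dir g x v) + h (dir f x v) (g x))" if "x : U" for x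
    by (rule dir_eqI) (rule hd[OF that])
  have "Ck_on k U (%x. h (f x) (dir g x v) + h (dir f x v) (g x))" for v
    using Suc.prems by (intro Ck_on_add[OF assms(1)] Suc.IH) (auto intro: Ck_on_SucD)
  then have "Ck_on k U (%x. dir (%x. h (f x) (g x)) x v)" for v
    by (subst Ck_on_cong[OF assms(1), of _ "%x. h (f x) (dir g x v) + h (dir f x v) (g x)"]) (auto simp: d)
  then show ?case using hd by (auto simp: differentiable_def)
qed

lemmas Ck_on_mult = Ck_on_bilinear[OF _ bounded_bilinear_mult]
lemmas Ck_on_scaleR = Ck_on_bilinear[OF _ bounded_bilinear_scaleR]
lemmas Ck_on_inner = Ck_on_bilinear[OF _ bounded_bilinear_inner]

lemma Ck_on_linear_compose:
  assumes "open U" "bounded_linear h" "Ck_on k U f"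
  shows "Ck_on k U (%x. h (f x))"
  using assms(3)
proof (induction k arbitrary: f)
  case 0
  then show ?case using linear_continuous_on_compose[OF _ assms(2)[THEN bounded_linear.linear]] by simp
next
  case (Suc k)
  have hd: "((%x. h (f x)) has_derivative (%v. h (dir f x v))) (at x)" if "x : U" for x
    using bounded_linear.has_derivative[OF assms(2) dir_works] Suc.prems that by auto
  have "Ck_on k U (%x. dir (%x. h (f x)) x v)" for v
    using Suc.prems Suc.IH[of "%x. dir f x v"]
    by (subst Ck_on_cong[OF assms(1), of _ "%x. h (dir f x v)"]) (auto simp: dir_eqI[OF hd])
  then show ?case using hd by (auto simp: differentiable_def)
qed

lemma Ck_on_minus:
  assumes "open U" "Ck_on k U f" shows "Ck_on k U (%x. - f x)"
  by (rule Ck_on_linear_compose[OF assms(1) bounded_linear_minus[OF bounded_linear_ident] assms(2)])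

lemma Ck_on_diff:
  assumes "open U" "Ck_on k U f" "Ck_on k U g"
  shows "Ck_on k U (%x. f x - g x)"
  using Ck_on_add[OF assms(1,2) Ck_on_minus[OF assms(1,3)]] by simp

lemma Ck_on_cmult:
  assumes "open U" "Ck_on k U f" shows "Ck_on k U (%x. c * f x :: real)"
  using Ck_on_mult[OF assms(1) Ck_on_const assms(2)] .

lemma Ck_on_prod:
  fixes f :: "'i => 'e::euclidean_space => real"
  assumes "open U" "!!i. i : I ==> Ck_on k U (f i)"
  shows "Ck_on k U (%x. PROD i:I. f i x)"
proof (cases "finite I")
  case True
  then show ?thesis using assms(2) by (induction I) (auto intro: Ck_on_mult[OF assms(1)])
qed simp

lemma Ck_on_componentwise:
  fixes f :: "'e::euclidean_space => 'f::euclidean_space"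
  assumes "open U" "!!b. b : Basis ==> Ck_on k U (%x. f x \<bullet> b)"
  shows "Ck_on k U f"
proof -
  have "Ck_on k U (%x. SUM b:Basis. (f x \<bullet> b) *\<^sub>R b)"
    by (intro Ck_on_sum Ck_on_scaleR assms Ck_on_const)
  then show ?thesis by (simp add: euclidean_representation)
qed

lemma Ck_on_Pair:
  assumes "open U" "Ck_on k U f" "Ck_on k U g"
  shows "Ck_on k U (%x. (f x, g x))"
proof -
  have "bounded_linear (%x. (x, 0))" "bounded_linear (%x. (0, x))"
    by (auto intro!: bounded_linear_Pair bounded_linear_ident bounded_linear_zero)
  from Ck_on_linear_compose[OF assms(1) this(1) assms(2)] Ck_on_linear_compose[OF assms(1) this(2) assms(3)]
  have "Ck_on k U (%x. (f x, 0) + (0, g x))"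
    by (intro Ck_on_add assms(1))
  then show ?thesis by simp
qed

lemma linear_basis_sum:
  assumes "linear h" shows "h (v::'e::euclidean_space) = (SUM b:Basis. (v \<bullet> b) *\<^sub>R h b)"
  by (metis (no_types, lifting) assms euclidean_representation linear_scale linear_sum sum.cong)

lemma dir_linear: "f differentiable (at x) ==> linear (dir f x)"
  by (simp add: linear_frechet_derivative)

lemma dir_compose:
  assumes "g differentiable (at x)" "f differentiable (at (g x))"
  shows "dir (%x. f (g x)) x = (%v. dir f (g x) (dir g x v))"
  using frechet_derivative_compose[OF assms] by (simp add: o_def)

text \<open>Expanding the inner derivative in the standard basis replaces the moving direction of
  \<open>dir f\<close> by fixed ones, to which the induction hypothesis applies.\<close>

lemma Ck_on_compose:
  assumes "open U" "Ck_on k U g" "Ck_on k V f" "g ` U \<subseteq> V"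
  shows "Ck_on k U (%x. f (g x))"
  using assms(2-4)
proof (induction k arbitrary: f)
  case 0
  then show ?case by (auto intro: continuous_on_compose2)
next
  case (Suc k)
  have fd: "f differentiable (at (g x))" and gd: "g differentiable (at x)" if "x : U" for x
    using Suc.prems that by auto
  have hd: "((%x. f (g x)) has_derivative (%v. dir f (g x) (dir g x v))) (at x)" if "x : U" for x
    using diff_chain_at[OF dir_works dir_works, OF gd fd] that by (simp add: o_def)
  have e: "dir (%x. f (g x)) x v = (SUM b:Basis. (dir g x v \<bullet> b) *\<^sub>R dir f (g x) b)" if "x : U" for x v
    using dir_eqI[OF hd[OF that]] linear_basis_sum[OF dir_linear[OF fd[OF that]]] by metis
  have "Ck_on k U (%x. SUM b:Basis. (dir g x v \<bullet> b) *\<^sub>R dir f (g x) b)" for v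
    using Suc.prems by (intro Ck_on_sum Ck_on_scaleR Ck_on_inner Suc.IH Ck_on_const assms(1))
      (auto intro: Ck_on_SucD)
  then have "Ck_on k U (%x. dir (%x. f (g x)) x v)" for v
    by (subst Ck_on_cong[OF assms(1)]) (rule e)
  then show ?case using hd by (auto simp: differentiable_def)
qed

lemma dir_real: "(f has_real_derivative d) (at x) ==> dir f x v = d * v"
  using dir_eqI[of f "(*) d" x] by (simp add: has_field_derivative_def)

text \<open>The derivative of the inverse is a polynomial in the inverse, so each order gives the
  next.\<close>

lemma Ck_on_inverse_real: "Ck_on k (- {0::real}) inverse"
proof (induction k)
  case 0
  show ?case by (auto intro: continuous_intros)
next
  case (Suc k)
  have "dir inverse x v = - (inverse x * inverse x) * v" if "x : - {0::real}" for x v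
    using that by (intro dir_real) (auto intro!: derivative_eq_intros simp: power2_eq_square)
  moreover have "Ck_on k (- {0}) (%x::real. - (inverse x * inverse x) * v)" for v
    by (intro Ck_on_mult Ck_on_minus Suc Ck_on_const) auto
  ultimately have "Ck_on k (- {0::real}) (%x. dir inverse x v)" for v
    using Ck_on_cong[of "- {0::real}" "%x. dir inverse x v"] by (smt (verit) open_Compl closed_singleton)
  moreover have "inverse differentiable (at x)" if "x ~= 0" for x :: real
    using that by simp
  ultimately show ?case by simp
qed

lemma Ck_on_inverse:
  fixes f :: "'e::euclidean_space => real"
  assumes "open U" "Ck_on k U f" "!!x. x : U ==> f x ~= 0"
  shows "Ck_on k U (%x. inverse (f x))"
  by (rule Ck_on_compose[OF assms(1,2) Ck_on_inverse_real]) (use assms(3) in auto)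

lemma Ck_on_divide:
  fixes f g :: "'e::euclidean_space => real"
  assumes "open U" "Ck_on k U f" "Ck_on k U g" "!!x. x : U ==> g x ~= 0"
  shows "Ck_on k U (%x. f x / g x)"
  unfolding divide_inverse by (intro Ck_on_mult Ck_on_inverse assms)

lemma Ck_on_ln_real: "Ck_on k {0<..} (ln :: real => real)"
proof (cases k)
  case 0
  then show ?thesis by (auto intro: continuous_intros)
next
  case (Suc j)
  have "dir ln x v = inverse x * v" if "x : {0<..}" for x v :: real
    using that by (intro dir_real) (auto intro!: derivative_eq_intros simp: divide_inverse)
  moreover have "Ck_on j {0<..} (%x::real. inverse x * v)" for v
    by (intro Ck_on_mult Ck_on_const Ck_on_subset[OF Ck_on_inverse_real]) auto
  ultimately have "Ck_on j {0<..} (%x. dir ln x (v::real))" for v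
    using Ck_on_cong[of "{0<..}" "%x. dir ln x v"] by simp
  moreover have "ln differentiable (at x)" if "x > 0" for x :: real
    using that by (metis DERIV_ln[OF that] differentiable_def has_field_derivative_def)
  ultimately show ?thesis using Suc by simp
qed

lemma Ck_on_ln:
  fixes f :: "'e::euclidean_space => real"
  assumes "open U" "Ck_on k U f" "!!x. x : U ==> f x > 0"
  shows "Ck_on k U (%x. ln (f x))"
  by (rule Ck_on_compose[OF assms(1,2) Ck_on_ln_real]) (use assms(3) in auto)

lemma Ck_on_exp_real: "Ck_on k U (exp :: real => real)"
proof -
  have d: "dir exp x v = exp x * v" for x v :: real
    by (intro dir_real) (auto intro!: derivative_eq_intros)
  have e: "exp differentiable (at x)" for x :: real
    by (metis DERIV_exp differentiable_def has_field_derivative_def)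
  have "Ck_on k UNIV (exp::real=>real)"
  proof (induction k)
    case (Suc k)
    then have "Ck_on k UNIV (%x::real. exp x * v)" for v by (intro Ck_on_mult Ck_on_const) auto
    then show ?case by (auto simp: d e)
  qed (simp add: continuous_on_exp)
  then show ?thesis by (rule Ck_on_subset) simp
qed

lemma Ck_on_exp:
  fixes f :: "'e::euclidean_space => real"
  assumes "open U" "Ck_on k U f"
  shows "Ck_on k U (%x. exp (f x))"
  by (rule Ck_on_compose[OF assms(1,2) Ck_on_exp_real[of _ UNIV]]) auto

lemma Ck_on_det:
  fixes M :: "'e::euclidean_space => real ^ 'm::finite ^ 'm"
  assumes "open U" "!!i j. Ck_on k U (%x. M x $ i $ j)"
  shows "Ck_on k U (%x. det (M x))"
  unfolding det_def by (intro Ck_on_sum Ck_on_cmult Ck_on_prod assms)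

section \<open>Symmetry of second derivatives\<close>

lemma second_difference_mean_value:
  fixes f :: "'e::euclidean_space => real"
  assumes U: "!!s t. 0 <= s ==> s <= h ==> 0 <= t ==> t <= h ==> x + s *\<^sub>R u + t *\<^sub>R v : U"
    and f: "Ck_on 2 U f" and h: "0 < h"
  obtains s t where "0 < s" "s < h" "0 < t" "t < h"
    "f (x + h *\<^sub>R u + h *\<^sub>R v) - f (x + h *\<^sub>R u) - f (x + h *\<^sub>R v) + f x
       = h * h * dir (%y. dir f y u) (x + s *\<^sub>R u + t *\<^sub>R v) v"
proof -
  have fd: "f differentiable (at y)" and fd2: "(%y. dir f y u) differentiable (at y)" if "y : U" for y
    using f that by (auto simp: numeral_2_eq_2)
  \<comment> \<open>The second difference is \<open>\<phi> h - \<phi> 0\<close>. The mean value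
    theorem is applied to \<open>\<phi>\<close> and then, in direction \<open>v\<close>, to the
    derivative along \<open>u\<close>.\<close>
  define \<phi> where "\<phi> s = f (x + s *\<^sub>R u + h *\<^sub>R v) - f (x + s *\<^sub>R u)" for s
  have line: "((%s. g (y + s *\<^sub>R w)) has_real_derivative dir g (y + s *\<^sub>R w) w) (at s)"
    if "g differentiable (at (y + s *\<^sub>R w))" for g :: "'e => real" and y w s
  proof -
    have "((%s. y + s *\<^sub>R w) has_derivative (%r. r *\<^sub>R w)) (at s)"
      by (auto intro!: derivative_eq_intros)
    from diff_chain_at[OF this dir_works[OF that]]
    have "((%s. g (y + s *\<^sub>R w)) has_derivative (%r. dir g (y + s *\<^sub>R w) (r *\<^sub>R w))) (at s)"
      by (simp add: o_def)
    then show ?thesis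
      by (simp add: has_field_derivative_def linear_scale[OF dir_linear[OF that]] mult.commute[of _ "dir g _ w"])
  qed
  have in1: "x + s *\<^sub>R u : U" "x + s *\<^sub>R u + h *\<^sub>R v : U" if "0 <= s" "s <= h" for s
    using U[of s 0] U[of s h] that h by auto
  have "(\<phi> has_real_derivative
      dir f (x + s *\<^sub>R u + h *\<^sub>R v) u - dir f (x + s *\<^sub>R u) u) (at s)" if "0 <= s" "s <= h" for s
  proof -
    have e: "x + s *\<^sub>R u + h *\<^sub>R v = (x + h *\<^sub>R v) + s *\<^sub>R u" for s by simp
    show ?thesis unfolding \<phi>_def e
      using fd[OF in1(1)[OF that]] fd[OF in1(2)[OF that]] unfolding e
      by (intro DERIV_diff line)
  qed
  from MVT2[OF h this] obtain s where s: "0 < s" "s < h"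
    "\<phi> h - \<phi> 0 = (h - 0) * (dir f (x + s *\<^sub>R u + h *\<^sub>R v) u - dir f (x + s *\<^sub>R u) u)" by auto
  have "((%t. dir f (x + s *\<^sub>R u + t *\<^sub>R v) u) has_real_derivative
      dir (%y. dir f y u) (x + s *\<^sub>R u + t *\<^sub>R v) v) (at t)" if "0 <= t" "t <= h" for t
    using fd2[OF U[of s t]] that s by (intro line) auto
  from MVT2[OF h this] obtain t where t: "0 < t" "t < h"
    "dir f (x + s *\<^sub>R u + h *\<^sub>R v) u - dir f (x + s *\<^sub>R u) u
      = h * dir (%y. dir f y u) (x + s *\<^sub>R u + t *\<^sub>R v) v" by auto
  show thesis
    by (rule that[OF s(1,2) t(1,2)]) (use s(3) t(3) in \<open>simp add: \<phi>_def\<close>)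
qed

text \<open>Exchanging \<open>u\<close> and \<open>v\<close> leaves the second difference unchanged.
  So the two mixed derivatives take a common value at two points arbitrarily close to
  \<open>x\<close>, and continuity finishes.\<close>

lemma dir_dir_commute_real:
  fixes f :: "'e::euclidean_space => real"
  assumes U: "open U" "x : U" and f: "Ck_on 2 U f"
  shows "dir (%y. dir f y u) x v = dir (%y. dir f y v) x u"
proof (rule ccontr)
  define A where "A y = dir (%y. dir f y u) y v" for y
  define B where "B y = dir (%y. dir f y v) y u" for y
  assume "~ ?thesis"
  then have e: "\<bar>A x - B x\<bar> / 2 > 0" (is "?e > 0") by (simp add: A_def B_def)
  have "continuous_on U A" "continuous_on U B"
    using f by (auto simp: numeral_2_eq_2 A_def B_def)
  then have "isCont A x" "isCont B x"
    using U by (auto simp: continuous_on_eq_continuous_at)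
  then have "(A \<longlongrightarrow> A x) (nhds x)" "(B \<longlongrightarrow> B x) (nhds x)"
    unfolding isCont_def tendsto_at_iff_tendsto_nhds by auto
  from tendstoD[OF this(1) e] tendstoD[OF this(2) e]
  have "\<forall>\<^sub>F y in nhds x. dist (A y) (A x) < ?e" "\<forall>\<^sub>F y in nhds x. dist (B y) (B x) < ?e" .
  moreover have "\<forall>\<^sub>F y in nhds x. y : U" using U by (auto simp: eventually_nhds)
  ultimately have "\<forall>\<^sub>F y in nhds x. dist (A y) (A x) < ?e & dist (B y) (B x) < ?e & y : U"
    by eventually_elim auto
  then obtain r where r: "r > 0"
    "!!y. dist y x < r ==> dist (A y) (A x) < ?e & dist (B y) (B x) < ?e & y : U"
    unfolding eventually_nhds_metric by blast
  \<comment> \<open>Small enough for the parallelogram spanned by \<open>h u\<close> and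
    \<open>h v\<close> to stay within distance \<open>r\<close>; the summand 1 avoids a zero
    denominator.\<close>
  define h where "h = r / (norm u + norm v + 1)"
  have h: "h > 0" using r by (auto simp: h_def intro!: divide_pos_pos add_nonneg_pos)
  have n: "dist (x + s *\<^sub>R u + t *\<^sub>R v) x < r" if "0 <= s" "s <= h" "0 <= t" "t <= h" for s t
  proof -
    have "dist (x + s *\<^sub>R u + t *\<^sub>R v) x = norm (s *\<^sub>R u + t *\<^sub>R v)" by (simp add: dist_norm)
    also have "... <= s * norm u + t * norm v" using norm_triangle_ineq[of "s *\<^sub>R u" "t *\<^sub>R v"] that by simp
    also have "... <= h * norm u + h * norm v" using that by (intro add_mono mult_right_mono) auto
    also have "... < h * (norm u + norm v + 1)" using h by (simp add: algebra_simps)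
    also have "... = r"
      using norm_ge_zero[of u] norm_ge_zero[of v] by (smt (verit) h_def nonzero_eq_divide_eq)
    finally show ?thesis .
  qed
  have n'': "x + s *\<^sub>R u + t *\<^sub>R v : U" if "0 <= s" "s <= h" "0 <= t" "t <= h" for s t
    using n[of s t] r(2) that by simp
  obtain s t where st: "0 < s" "s < h" "0 < t" "t < h" and 1:
    "f (x + h *\<^sub>R u + h *\<^sub>R v) - f (x + h *\<^sub>R u) - f (x + h *\<^sub>R v) + f x = h * h * A (x + s *\<^sub>R u + t *\<^sub>R v)"
    using second_difference_mean_value[OF n'' f h] unfolding A_def by blast
  have n': "x + s *\<^sub>R v + t *\<^sub>R u : U" if "0 <= s" "s <= h" "0 <= t" "t <= h" for s t
    using n''[of t s] that by (simp add: add.commute add.left_commute)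
  obtain s' t' where st': "0 < s'" "s' < h" "0 < t'" "t' < h" and 2:
    "f (x + h *\<^sub>R v + h *\<^sub>R u) - f (x + h *\<^sub>R v) - f (x + h *\<^sub>R u) + f x = h * h * B (x + s' *\<^sub>R v + t' *\<^sub>R u)"
    using second_difference_mean_value[OF n' f h] unfolding B_def by blast
  have sw: "x + h *\<^sub>R v + h *\<^sub>R u = x + h *\<^sub>R u + h *\<^sub>R v" by simp
  have "h * h * A (x + s *\<^sub>R u + t *\<^sub>R v) = h * h * B (x + s' *\<^sub>R v + t' *\<^sub>R u)"
    using 1 2[unfolded sw] by linarith
  then have "A (x + s *\<^sub>R u + t *\<^sub>R v) = B (x + t' *\<^sub>R u + s' *\<^sub>R v)"
    using h by (simp add: add.commute add.left_commute)
  moreover have "dist (A (x + s *\<^sub>R u + t *\<^sub>R v)) (A x) < ?e" "dist (B (x + t' *\<^sub>R u + s' *\<^sub>R v)) (B x) < ?e"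
    using r(2)[OF n[of s t]] r(2)[OF n[of t' s']] st st' by auto
  ultimately show False unfolding dist_real_def by (simp add: abs_if split: if_splits)
qed

lemma dir_inner:
  assumes "f differentiable (at x)"
  shows "dir (%y. f y \<bullet> b) x v = dir f x v \<bullet> b"
  using dir_eqI[OF has_derivative_inner_left[OF dir_works[OF assms], of b]] by metis

lemma dir_dir_commute:
  fixes f :: "'e::euclidean_space => 'f::euclidean_space"
  assumes U: "open U" "x : U" and f: "Ck_on 2 U f"
  shows "dir (%y. dir f y u) x v = dir (%y. dir f y v) x u"
proof (rule euclidean_eqI)
  fix b :: 'f
  have C: "Ck_on 2 U (%y. f y \<bullet> b)" by (intro Ck_on_inner f U Ck_on_const)
  have e: "dir (%y. dir (%z. f z \<bullet> b) y u) x v = dir (%y. dir f y u) x v \<bullet> b" for u v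
  proof -
    have "dir (%z. f z \<bullet> b) y u = dir f y u \<bullet> b" if "y : U" for y
      using f that by (intro dir_inner) (auto simp: numeral_2_eq_2)
    then have "dir (%y. dir (%z. f z \<bullet> b) y u) x = dir (%y. dir f y u \<bullet> b) x"
      by (intro dir_cong[OF U])
    then show ?thesis using dir_inner[of "%y. dir f y u" x b v] f U by (auto simp: numeral_2_eq_2)
  qed
  show "dir (%y. dir f y u) x v \<bullet> b = dir (%y. dir f y v) x u \<bullet> b"
    using dir_dir_commute_real[OF U C, of u v] unfolding e .
qed

section \<open>Smooth cutoff functions\<close>

definition flat_exp :: "nat => real => real" where
  "flat_exp n x = (if x > 0 then (1 / x) ^ n * exp (- 1 / x) else 0)"

lemma flat_exp_tendsto: "(flat_exp n \<longlongrightarrow> 0) (at 0)"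
proof -
  have "((%x. (1 / x) ^ n / exp (1 / x :: real)) \<longlongrightarrow> 0) (at_right 0)"
    using filterlim_compose[OF tendsto_power_div_exp_0[of n] filterlim_inverse_at_top_right]
    by (simp add: field_simps)
  then have r: "(flat_exp n \<longlongrightarrow> 0) (at_right 0)"
    by (rule Lim_transform_eventually)
      (auto simp: flat_exp_def eventually_at_filter exp_minus field_simps)
  have "(flat_exp n \<longlongrightarrow> 0) (at_left 0)"
    by (rule tendsto_eventually) (auto simp: flat_exp_def eventually_at_filter)
  with r show ?thesis by (simp add: filterlim_at_split)
qed

text \<open>The span of the family is closed under differentiation, so a single induction over all
  \<open>n\<close> makes every member smooth.\<close>

lemma flat_exp_derivative:
  "(flat_exp n has_real_derivative flat_exp (n + 2) x - real n * flat_exp (n + 1) x) (at x)"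
proof -
  consider "x > 0" | "x < 0" | "x = 0" by linarith
  then show ?thesis
  proof cases
    case 1
    have "((%x. (1 / x) ^ n * exp (- 1 / x)) has_real_derivative flat_exp (n + 2) x - real n * flat_exp (n + 1) x) (at x)"
    proof -
      have p: "((%x. (1 / x) ^ n) has_real_derivative - (real n * (1 / x) ^ (n + 1))) (at x)"
      proof (cases n)
        case (Suc m)
        show ?thesis unfolding Suc
          using DERIV_power_Suc[OF DERIV_inverse[of x UNIV], of m] 1 by (simp add: inverse_eq_divide algebra_simps)
      qed simp
      have e: "((%x. exp (- 1 / x)) has_real_derivative (1 / x) ^ 2 * exp (- 1 / x)) (at x)"
        using 1 by (auto intro!: derivative_eq_intros simp: field_simps power2_eq_square)
      show ?thesis
        using DERIV_mult[OF p e] 1 by (simp add: flat_exp_def power_add power2_eq_square algebra_simps)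
    qed
    then show ?thesis
      by (rule has_field_derivative_transform_within_open[of _ _ _ "{0<..}"]) (use 1 in \<open>auto simp: flat_exp_def\<close>)
  next
    case 2
    have "((%x. 0) has_real_derivative flat_exp (n + 2) x - real n * flat_exp (n + 1) x) (at x)"
      using 2 by (simp add: flat_exp_def)
    then show ?thesis
      by (rule has_field_derivative_transform_within_open[of _ _ _ "{..<0}"]) (use 2 in \<open>auto simp: flat_exp_def\<close>)
  next
    case 3
    \<comment> \<open>At the origin the difference quotient of member \<open>n\<close> is member
      \<open>Suc n\<close>, whose limit is already known.\<close>
    have "((%h. (flat_exp n (0 + h) - flat_exp n 0) / h) \<longlongrightarrow> 0) (at 0)"
      by (rule Lim_transform_eventually[OF flat_exp_tendsto[of "Suc n"]])
        (auto simp: flat_exp_def eventually_at_filter)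
    then show ?thesis using 3 by (simp add: DERIV_def flat_exp_def)
  qed
qed

lemma Ck_on_flat_exp: "Ck_on k UNIV (flat_exp n)"
proof (induction k arbitrary: n)
  case 0
  show ?case using flat_exp_derivative[of n] by (auto intro!: continuous_at_imp_continuous_on DERIV_isCont)
next
  case (Suc k)
  have "flat_exp n differentiable (at x)" for x
    using flat_exp_derivative[of n x] by (auto simp: differentiable_def has_field_derivative_def)
  moreover have "Ck_on k UNIV (%x. (flat_exp (n + 2) x - real n * flat_exp (n + 1) x) * v)" for v
    by (intro Ck_on_mult Ck_on_diff Ck_on_const Suc) auto
  ultimately show ?case by (simp add: dir_real[OF flat_exp_derivative])
qed

text \<open>The quotient falls from 1 to 0 between 1 and 2. Its denominator is positive because
  \<open>2 - r\<close> or \<open>r - 1\<close> is.\<close>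

definition smooth_step :: "real => real" where
  "smooth_step r = flat_exp 0 (2 - r) / (flat_exp 0 (2 - r) + flat_exp 0 (r - 1))"

lemma flat_exp_nonneg: "flat_exp 0 x >= 0" and flat_exp_pos: "x > 0 ==> flat_exp 0 x > 0"
  by (auto simp: flat_exp_def)

lemma smooth_step_denom: "flat_exp 0 (2 - r) + flat_exp 0 (r - 1) > 0"
proof (cases "r < 2")
  case True
  then show ?thesis using flat_exp_nonneg flat_exp_pos by (intro add_pos_nonneg) auto
next
  case False
  then show ?thesis using flat_exp_nonneg flat_exp_pos by (intro add_nonneg_pos) auto
qed

lemma smooth_step_1: "r <= 1 ==> smooth_step r = 1"
  using smooth_step_denom[of r] by (auto simp: smooth_step_def flat_exp_def)

lemma smooth_step_0: "r >= 2 ==> smooth_step r = 0"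
  by (auto simp: smooth_step_def flat_exp_def)

lemma smooth_step_range: "0 <= smooth_step r" "smooth_step r <= 1"
  using smooth_step_denom[of r] flat_exp_nonneg[of "2 - r"] flat_exp_nonneg[of "r - 1"]
  by (auto simp: smooth_step_def)

lemma Ck_on_smooth_step: "Ck_on k UNIV smooth_step"
proof -
  have "Ck_on k UNIV (%r. flat_exp 0 (2 - r))" "Ck_on k UNIV (%r. flat_exp 0 (r - 1))"
    by (intro Ck_on_compose[OF _ _ Ck_on_flat_exp] Ck_on_diff Ck_on_const
        Ck_on_bounded_linear bounded_linear_ident; simp)+
  moreover have "flat_exp 0 (2 - r) + flat_exp 0 (r - 1) ~= 0" for r
    using smooth_step_denom[of r] by simp
  ultimately show ?thesis unfolding smooth_step_def[abs_def]
    by (intro Ck_on_divide Ck_on_add) auto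
qed

section \<open>Positive definite forms and their determinants\<close>

type_synonym 'e bilin = "'e => 'e => real"

definition posdef :: "('e::euclidean_space) bilin => bool" where
  "posdef g \<longleftrightarrow> (ALL u. linear (g u)) & (ALL u v. g u v = g v u) & (ALL u. u ~= 0 --> g u u > 0)"

definition gframe :: "('e::euclidean_space) bilin => ('e => 'e) => bool" where
  "gframe g F \<longleftrightarrow> (ALL a:Basis. ALL b:Basis. g (F a) (F b) = (if a = b then 1 else 0))"

lemma posdefD:
  assumes "posdef g"
  shows "linear (g u)" "linear (%u. g u v)" "g u v = g v u" "u ~= 0 ==> g u u > 0" "g u u >= 0"
    "g u u = 0 \<longleftrightarrow> u = 0"
proof -
  show l: "linear (g u)" for u using assms by (simp add: posdef_def)
  show s: "g u v = g v u" for u v using assms unfolding posdef_def by blast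
  have "(%u. g u v) = g v" using s by auto
  then show "linear (%u. g u v)" using l by simp
  show p: "u ~= 0 ==> g u u > 0" using assms by (simp add: posdef_def)
  have z: "g 0 0 = 0" using linear_0[OF l] .
  show "g u u >= 0" using p z by (cases "u = 0") (auto intro: less_imp_le)
  show "g u u = 0 \<longleftrightarrow> u = 0" using p z by (cases "u = 0") auto
qed

lemma posdef_simps:
  assumes "posdef g"
  shows "g (u + u') v = g u v + g u' v" "g v (u + u') = g v u + g v u'"
    "g (u - u') v = g u v - g u' v" "g v (u - u') = g v u - g v u'"
    "g (c *\<^sub>R u) v = c * g u v" "g v (c *\<^sub>R u) = c * g v u"
    "g (- u) v = - g u v" "g v (- u) = - g v u" "g 0 v = 0" "g v 0 = 0"
  using linear_add[OF posdefD(1)[OF assms]] linear_add[OF posdefD(2)[OF assms]]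
    linear_diff[OF posdefD(1)[OF assms]] linear_diff[OF posdefD(2)[OF assms]]
    linear_scale[OF posdefD(1)[OF assms]] linear_scale[OF posdefD(2)[OF assms]]
    linear_neg[OF posdefD(1)[OF assms]] linear_neg[OF posdefD(2)[OF assms]]
    linear_0[OF posdefD(1)[OF assms]] linear_0[OF posdefD(2)[OF assms]]
  by auto

lemma posdef_sum:
  assumes "posdef g"
  shows "g (SUM a:A. f a) v = (SUM a:A. g (f a) v)" "g v (SUM a:A. f a) = (SUM a:A. g v (f a))"
  using linear_sum[OF posdefD(1)[OF assms]] linear_sum[OF posdefD(2)[OF assms]] by auto

text \<open>Gram-Schmidt, one index of \<open>Basis\<close> at a time.\<close>

lemma gframe_exists:
  assumes g: "posdef (g :: 'e::euclidean_space bilin)"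
  obtains F where "gframe g F"
proof -
  have "EX F. ALL a:S. ALL b:S. g (F a) (F b) = (if a = b then 1 else 0)" if "S \<subseteq> Basis" for S :: "'e set"
    using finite_subset[OF that finite_Basis] that
  proof (induction S rule: finite_induct)
    case (insert c S)
    then obtain F where F: "!!a b. a : S ==> b : S ==> g (F a) (F b) = (if a = b then 1 else 0)" by auto
    have "card S < DIM('e)" using insert by (metis insert_subset psubsetI psubset_card_mono finite_Basis)
    then have "dim (F ` S) < DIM('e)"
      using dim_le_card'[of "F ` S"] card_image_le[of S F] insert(1) by (meson finite_imageI le_less_trans)
    then obtain w where w: "w ~: span (F ` S)" by (metis UNIV_I dim_UNIV dim_span less_irrefl subsetI top.extremum_uniqueI)
    define z where "z = w - (SUM a:S. g w (F a) *\<^sub>R F a)"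
    have "(SUM a:S. g w (F a) *\<^sub>R F a) : span (F ` S)"
      by (intro span_sum span_scale span_base) auto
    then have z0: "z ~= 0" using w by (auto simp: z_def)
    have zF: "g z (F b) = 0" if "b : S" for b
    proof -
      have "g z (F b) = g w (F b) - (SUM a:S. g w (F a) * g (F a) (F b))"
        by (simp add: z_def posdef_simps[OF g] posdef_sum[OF g])
      also have "(SUM a:S. g w (F a) * g (F a) (F b)) = (SUM a:S. if a = b then g w (F b) else 0)"
        by (intro sum.cong) (use F that in auto)
      also have "... = g w (F b)" using that insert(1) by simp
      finally show ?thesis by simp
    qed
    have zz: "g z z > 0" using posdefD(4)[OF g z0] .
    define G where "G = F(c := (1 / sqrt (g z z)) *\<^sub>R z)"
    have "g (G c) (G c) = 1" using zz by (simp add: G_def posdef_simps[OF g] power2_eq_square[symmetric])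
    moreover have "g (G c) (G b) = 0" "g (G b) (G c) = 0" if "b : S" for b
      using that insert(2) zF posdefD(3)[OF g, of z "F b"] by (auto simp: G_def posdef_simps[OF g])
    moreover have "g (G a) (G b) = (if a = b then 1 else 0)" if "a : S" "b : S" for a b
      using that insert(2) F by (auto simp: G_def)
    ultimately show ?case using insert(2) by (intro exI[of _ G]) auto
  qed simp
  then show thesis using that by (auto simp: gframe_def)
qed

text \<open>The linear map sending \<open>Basis\<close> to the frame is injective by orthonormality,
  hence onto by dimension, and pairing with the frame recovers the coefficients.\<close>

lemma gframe_expand:
  assumes g: "posdef (g :: 'e::euclidean_space bilin)" and F: "gframe g F"
  shows "(SUM a:Basis. g u (F a) *\<^sub>R F a) = u"
proof -
  define f where "f v = (SUM a:Basis. (v \<bullet> a) *\<^sub>R F a)" for v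
  have lf: "linear f" by (rule linearI)
      (auto simp: f_def inner_add_left scaleR_add_left sum.distrib scaleR_sum_right)
  have gf: "g (f v) (F b) = v \<bullet> b" if "b : Basis" for v b
  proof -
    have "g (f v) (F b) = (SUM a:Basis. (v \<bullet> a) * g (F a) (F b))"
      by (simp add: f_def posdef_simps[OF g] posdef_sum[OF g])
    also have "... = (SUM a:Basis. if a = b then v \<bullet> b else 0)"
      by (intro sum.cong) (use F that in \<open>auto simp: gframe_def\<close>)
    finally show ?thesis using that by simp
  qed
  have "inj f"
  proof (subst linear_injective_0[OF lf], intro allI impI)
    fix v assume "f v = 0"
    then have "v \<bullet> b = 0" if "b : Basis" for b
      using gf[OF that, of v] by (simp add: posdef_simps[OF g])
    then show "v = 0" using euclidean_eqI[of v 0] by simp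
  qed
  then have "surj f" using linear_injective_imp_surjective[OF lf] by auto
  then obtain v where v: "u = f v" by auto
  show ?thesis unfolding v using gf by (simp add: f_def)
qed

lemma gframe_parseval:
  assumes g: "posdef (g :: 'e::euclidean_space bilin)" and F: "gframe g F"
  shows "g u v = (SUM a:Basis. g u (F a) * g v (F a))"
proof -
  have "g u v = g u (SUM a:Basis. g v (F a) *\<^sub>R F a)" by (simp add: gframe_expand[OF assms])
  then show ?thesis by (simp add: posdef_simps[OF g] posdef_sum[OF g] mult.commute)
qed

text \<open>The trace of an endomorphism does not depend on the metric. This connects orthonormal
  frames with the coordinate traces in \<open>ricci_curv\<close> and in the divergence.\<close>

lemma gframe_trace:
  assumes g: "posdef (g :: 'e::euclidean_space bilin)" and F: "gframe g F" and R: "linear R"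
  shows "(SUM a:Basis. g (R (F a)) (F a)) = (SUM b:Basis. R b \<bullet> b)"
proof -
  have "(SUM a:Basis. g (R (F a)) (F a)) = (SUM a:Basis. SUM b:Basis. (F a \<bullet> b) * g (R b) (F a))"
    by (subst linear_basis_sum[OF R]) (simp add: posdef_simps[OF g] posdef_sum[OF g])
  also have "... = (SUM b:Basis. (SUM a:Basis. g (R b) (F a) *\<^sub>R F a) \<bullet> b)"
    by (subst sum.swap) (simp add: inner_sum_left mult.commute)
  also have "... = (SUM b:Basis. R b \<bullet> b)" by (simp add: gframe_expand[OF g F])
  finally show ?thesis .
qed

text \<open>The inverse metric as a map from covectors to vectors. The description operator is the
  one used by \<open>christoffel\<close>, which thereby becomes an instance.\<close>

definition raise :: "('e::euclidean_space) bilin => ('e => real) => 'e" where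
  "raise g l = (THE z. ALL w. g z w = l w)"

lemma raise_unique:
  assumes g: "posdef g" and "!!w. g z w = l w"
  shows "raise g l = z"
  unfolding raise_def
proof (rule the_equality)
  fix y assume "ALL w. g y w = l w"
  then have "g (y - z) (y - z) = 0" using assms by (simp add: posdef_simps[OF g])
  then show "y = z" using posdefD(6)[OF g, of "y - z"] by simp
qed (use assms in auto)

text \<open>The Riesz representative is written down in an orthonormal frame.\<close>

lemma raise_works:
  assumes g: "posdef (g :: 'e::euclidean_space bilin)" and l: "linear l"
  shows "g (raise g l) w = l w"
proof -
  obtain F where F: "gframe g F" using gframe_exists[OF g] .
  define z where "z = (SUM a:Basis. l (F a) *\<^sub>R F a)"
  have "g z w = l w" for w
  proof -
    have "l w = l (SUM a:Basis. g w (F a) *\<^sub>R F a)" by (simp add: gframe_expand[OF g F])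
    also have "... = g z w"
      using posdefD(3)[OF g] by (simp add: z_def linear_sum[OF l] linear_scale[OF l] posdef_simps[OF g] posdef_sum[OF g] mult.commute)
    finally show ?thesis by simp
  qed
  then show ?thesis using raise_unique[OF g] by metis
qed

lemma raise_linear:
  assumes g: "posdef (g :: 'e::euclidean_space bilin)" and l: "!!w. linear (%u. b u w)" "!!u. linear (b u)"
  shows "linear (%u. raise g (b u))"
proof (rule linearI)
  show "raise g (b (u + v)) = raise g (b u) + raise g (b v)" for u v
    by (rule raise_unique[OF g]) (simp add: posdef_simps[OF g] raise_works[OF g l(2)] linear_add[OF l(1)])
  show "raise g (b (c *\<^sub>R u)) = c *\<^sub>R raise g (b u)" for c u
    by (rule raise_unique[OF g]) (simp add: posdef_simps[OF g] raise_works[OF g l(2)] linear_scale[OF l(1)])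
qed

lemma gframe_isometry:
  assumes "gframe g F" "!!u v. g (J u) (J v) = g u v"
  shows "gframe g (%a. J (F a))"
  using assms by (auto simp: gframe_def)

text \<open>With \<open>p\<close> and \<open>q\<close> the transition matrices between two frames, both sides are
  \<open>2 N - |p|\<^sup>2 - |q|\<^sup>2\<close>, where \<open>N = tr (p q)\<close> is the dimension.\<close>

lemma trace_difference:
  assumes g: "posdef (g :: 'e::euclidean_space bilin)" and F: "gframe g F"
    and h: "posdef h" and G: "gframe h G"
  shows "(SUM a:Basis. g (F a) (F a) - h (F a) (F a)) - (SUM a:Basis. g (G a) (G a) - h (G a) (G a))
    = - (SUM a:Basis. SUM b:Basis. (g (F a) (G b) - h (F a) (G b))\<^sup>2)"
proof -
  define p where "p a b = g (F a) (G b)" for a b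
  define q where "q a b = h (F a) (G b)" for a b
  have gF: "(SUM a:Basis. g (F a) (F a)) = real DIM('e)" using F by (simp add: gframe_def)
  have hG: "(SUM a:Basis. h (G a) (G a)) = real DIM('e)" using G by (simp add: gframe_def)
  have gG: "(SUM b:Basis. g (G b) (G b)) = (SUM a:Basis. SUM b:Basis. (p a b)\<^sup>2)"
    using gframe_parseval[OF g F, of "G _" "G _"] posdefD(3)[OF g]
    by (subst sum.swap) (simp add: p_def power2_eq_square)
  have hF: "(SUM a:Basis. h (F a) (F a)) = (SUM a:Basis. SUM b:Basis. (q a b)\<^sup>2)"
    using gframe_parseval[OF h G, of "F _" "F _"] by (simp add: q_def power2_eq_square)
  have "(SUM a:Basis. SUM b:Basis. q a b * p a b) = (SUM a:Basis. g (F a) (SUM b:Basis. q a b *\<^sub>R G b))"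
    by (simp add: p_def posdef_simps[OF g] posdef_sum[OF g])
  also have "... = real DIM('e)"
    using gF by (simp add: q_def gframe_expand[OF h G])
  finally have pq: "(SUM a:Basis. SUM b:Basis. q a b * p a b) = real DIM('e)" .
  have "(SUM a:Basis. SUM b:Basis. (p a b - q a b)\<^sup>2) =
     (SUM a:Basis. SUM b:Basis. (p a b)\<^sup>2) + (SUM a:Basis. SUM b:Basis. (q a b)\<^sup>2)
       - 2 * (SUM a:Basis. SUM b:Basis. q a b * p a b)"
    by (simp add: power2_diff sum.distrib sum_subtractf sum_distrib_left algebra_simps)
  then show ?thesis
    unfolding p_def[symmetric] q_def[symmetric] using gF hG gG hF pq by (simp add: sum_subtractf)
qed

text \<open>A bilinear form is determined by its values on pairs taken from two bases; the first
  entry is expanded in \<open>F\<close> and the second in \<open>G\<close>.\<close>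

lemma posdef_eq_of_frames:
  assumes g: "posdef (g :: 'e::euclidean_space bilin)" and F: "gframe g F"
    and h: "posdef h" and G: "gframe h G"
    and z: "(SUM a:Basis. SUM b:Basis. (g (F a) (G b) - h (F a) (G b))\<^sup>2) = 0"
  shows "g u v = h u v"
proof -
  have e: "g (F a) (G b) = h (F a) (G b)" if "a : Basis" "b : Basis" for a b
  proof -
    have "(SUM b:Basis. (g (F a) (G b) - h (F a) (G b))\<^sup>2) = 0"
      using z that by (subst (asm) sum_nonneg_eq_0_iff) (auto intro: sum_nonneg)
    then show ?thesis using that by (subst (asm) sum_nonneg_eq_0_iff) auto
  qed
  have ex: "k u v = (SUM a:Basis. SUM b:Basis. g u (F a) * h v (G b) * k (F a) (G b))" if k: "posdef k" for k
  proof -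
    have "k u v = k (SUM a:Basis. g u (F a) *\<^sub>R F a) (SUM b:Basis. h v (G b) *\<^sub>R G b)"
      by (simp add: gframe_expand[OF g F] gframe_expand[OF h G])
    also have "... = (SUM a:Basis. g u (F a) * k (F a) (SUM b:Basis. h v (G b) *\<^sub>R G b))"
      by (simp only: posdef_simps(5)[OF k] posdef_sum(1)[OF k])
    finally show ?thesis
      by (simp add: posdef_simps(6)[OF k] posdef_sum(2)[OF k] sum_distrib_left mult.assoc)
  qed
  show ?thesis unfolding ex[OF g] ex[OF h] using e by (intro sum.cong) auto
qed

text \<open>With \<open>z\<close> the raised vector and \<open>s\<close> its
  \<open>h\<close>-length, \<open>c * s^2 <= g z z = l z <= B * s\<close>.\<close>

lemma raise_bound:
  assumes g: "posdef g" and h: "posdef h" and c: "c > 0" "!!u. c * h u u <= g u u"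
    and l: "linear l" "!!u. \<bar>l u\<bar> <= B * sqrt (h u u)" and B: "B >= 0"
  shows "sqrt (h (raise g l) (raise g l)) <= B / c"
proof (cases "raise g l = 0")
  case True
  then show ?thesis using c B by (simp add: posdef_simps[OF h])
next
  case False
  define z where "z = raise g l"
  define s where "s = sqrt (h z z)"
  have s: "s > 0" "s * s = h z z" using posdefD(4)[OF h False] by (auto simp: s_def z_def)
  have "c * (s * s) <= g z z" using c(2)[of z] s by simp
  also have "... = l z" by (simp add: z_def raise_works[OF g l(1)])
  also have "... <= B * s" using l(2)[of z] by (simp add: s_def)
  finally have "c * s <= B" using s(1) by (simp add: mult.assoc[symmetric])
  then show ?thesis using c(1) by (simp add: s_def z_def field_simps)
qed

text \<open>So the difference of the two pairings is as small as that of the two metrics.\<close>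

lemma raise_difference:
  assumes g: "posdef g" and h: "posdef h" and l: "linear l" "linear m"
  shows "l (raise g m) - l (raise h m) = - (g (raise g m) (raise h l) - h (raise g m) (raise h l))"
  using raise_works[OF g l(2), of "raise h l"] raise_works[OF h l(1), of "raise g m"]
    raise_works[OF h l(2), of "raise h l"] raise_works[OF h l(1), of "raise h m"]
    posdefD(3)[OF h, of "raise h l" "raise g m"] posdefD(3)[OF h, of "raise h l" "raise h m"] by linarith

text \<open>Since \<open>J\<close> is an isometry with square -1, raising \<open>m \<circ> J\<close>
  gives \<open>- J (raise g m)\<close>, and duality makes the pairing skew in \<open>l\<close> and
  \<open>m\<close>. This is what exchanges the roles of cutoff and primitive in the flux.\<close>

lemma raise_J:
  assumes g: "posdef g" and J: "linear J" "!!u v. g (J u) (J v) = g u v" "!!u. J (J u) = - u"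
    and l: "linear l" "linear m"
  shows "l (raise g (%u. m (J u))) = - m (raise g (%u. l (J u)))"
proof -
  have lJ: "linear (%u. l (J u))" using linear_compose[OF J(1) l(1)] by (simp add: o_def)
  have "g (- J (raise g m)) w = m (J w)" for w
  proof -
    have "g (- J (raise g m)) w = g (J (- J (raise g m))) (J w)" by (simp add: J(2))
    also have "J (- J (raise g m)) = raise g m" by (simp add: linear_neg[OF J(1)] J(3))
    finally show ?thesis by (simp add: raise_works[OF g l(2)])
  qed
  then have "raise g (%u. m (J u)) = - J (raise g m)" by (intro raise_unique[OF g])
  then have "l (raise g (%u. m (J u))) = - l (J (raise g m))" by (simp add: linear_neg[OF l(1)])
  also have "l (J (raise g m)) = g (raise g (%u. l (J u))) (raise g m)" by (simp add: raise_works[OF g lJ])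
  also have "... = m (raise g (%u. l (J u)))" using raise_works[OF g l(2)] posdefD(3)[OF g] by metis
  finally show ?thesis .
qed

text \<open>The index map carries vectors to a finite type, where \<open>det\<close> lives. It is
  also applied to enumerated frames, not just to enumerations of the standard basis.\<close>

definition gmat :: "('m::finite => 'e::euclidean_space) => 'e bilin => real ^ 'm ^ 'm" where
  "gmat \<iota> g = (\<chi> i j. g (\<iota> i) (\<iota> j))"

definition lmat :: "('m::finite => 'e::euclidean_space) => ('m => 'f::euclidean_space) => ('e => 'f) => real ^ 'm ^ 'm" where
  "lmat \<iota> \<iota>' f = (\<chi> i j. f (\<iota> j) \<bullet> \<iota>' i)"

lemma basis_reindex:
  assumes "bij_betw \<iota> (UNIV :: 'm::finite set) Basis"
  shows "(SUM b:Basis. f b) = (SUM i:UNIV. f (\<iota> i))"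
  using sum.reindex_bij_betw[OF assms, of f] by simp

lemma gmat_pullback:
  assumes \<iota>': "bij_betw (\<iota>' :: 'm::finite => 'f::euclidean_space) UNIV Basis"
    and g: "!!u. linear (g u)" "!!v. linear (%u. g u v)"
  shows "gmat \<iota> (%u v. g (f u) (f v)) = transpose (lmat \<iota> \<iota>' f) ** gmat \<iota>' g ** lmat \<iota> \<iota>' f"
proof -
  have ex: "x = (SUM k:UNIV. (x \<bullet> \<iota>' k) *\<^sub>R \<iota>' k)" for x
    using basis_reindex[OF \<iota>', of "%b. (x \<bullet> b) *\<^sub>R b"] by (simp add: euclidean_representation)
  have gx: "g x y = (SUM k:UNIV. (SUM l:UNIV. (x \<bullet> \<iota>' l) * g (\<iota>' l) (\<iota>' k)) * (y \<bullet> \<iota>' k))" for x y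
  proof -
    have "g x y = g (SUM l:UNIV. (x \<bullet> \<iota>' l) *\<^sub>R \<iota>' l) (SUM k:UNIV. (y \<bullet> \<iota>' k) *\<^sub>R \<iota>' k)"
      using ex by simp
    also have "... = (SUM k:UNIV. (y \<bullet> \<iota>' k) * (SUM l:UNIV. (x \<bullet> \<iota>' l) * g (\<iota>' l) (\<iota>' k)))"
      by (simp add: linear_sum[OF g(1)] linear_sum[OF g(2)] linear_scale[OF g(1)] linear_scale[OF g(2)])
    finally show ?thesis by (simp add: mult.commute)
  qed
  show ?thesis
    by (simp add: vec_eq_iff gmat_def lmat_def matrix_matrix_mult_def transpose_def gx[of "f _" "f _"])
qed

lemma det_gmat_pullback:
  assumes "bij_betw (\<iota>' :: 'm::finite => 'f::euclidean_space) UNIV Basis"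
    and "!!u. linear (g u)" "!!v. linear (%u. g u v)"
  shows "det (gmat \<iota> (%u v. g (f u) (f v))) = (det (lmat \<iota> \<iota>' f))\<^sup>2 * det (gmat \<iota>' g)"
  by (subst gmat_pullback[OF assms]) (simp add: det_mul power2_eq_square mult.assoc mult.left_commute)

lemma gmat_frame:
  assumes \<iota>: "bij_betw (\<iota> :: 'm::finite => 'e::euclidean_space) UNIV Basis" and F: "gframe g F"
  shows "gmat (%i. F (\<iota> i)) g = mat 1"
proof -
  have "\<iota> i : Basis" "\<iota> i = \<iota> j \<longleftrightarrow> i = j" for i j
    using \<iota> by (auto simp: bij_betw_def inj_def)
  then show ?thesis using F by (auto simp: gmat_def gframe_def mat_def vec_eq_iff)
qed

text \<open>The factor \<open>k\<close> is the squared determinant of the change of basis, hence the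
  same for every form. The Gram matrix of \<open>g\<close> in its own frame is the identity, which
  fixes the value of \<open>k\<close>.\<close>

lemma det_gmat_frame_change:
  assumes \<iota>: "bij_betw (\<iota> :: 'm::finite => 'e::euclidean_space) UNIV Basis" and g: "posdef g" and F: "gframe g F"
  obtains k :: real where "k > 0" "k * det (gmat \<iota> g) = 1"
    "!!h. posdef h ==> det (gmat (%i. F (\<iota> i)) h) = k * det (gmat \<iota> h)"
proof -
  let ?f = "%v. SUM b:Basis. (v \<bullet> b) *\<^sub>R F b"
  define d where "d = det (lmat \<iota> \<iota> ?f)"
  have "?f (\<iota> i) = F (\<iota> i)" for i
  proof -
    have i: "\<iota> i : Basis" using \<iota> by (auto simp: bij_betw_def)
    then have "?f (\<iota> i) = (SUM b:Basis. (if b = \<iota> i then F b else 0))"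
      by (intro sum.cong) (auto simp: inner_Basis)
    then show ?thesis using i by simp
  qed
  then have e: "gmat (%i. F (\<iota> i)) h = gmat \<iota> (%u v. h (?f u) (?f v))" for h
    by (simp only: gmat_def)
  have d: "det (gmat (%i. F (\<iota> i)) h) = d\<^sup>2 * det (gmat \<iota> h)" if "posdef h" for h
    unfolding e d_def by (rule det_gmat_pullback[OF \<iota> posdefD(1,2)[OF that]])
  have 1: "d\<^sup>2 * det (gmat \<iota> g) = 1" using d[OF g] unfolding gmat_frame[OF \<iota> F] det_I by (rule sym)
  then have "d\<^sup>2 > 0" by (metis mult_zero_left zero_less_power2 zero_neq_one power_zero_numeral)
  then show thesis using 1 d by (rule that)
qed

lemma det_gmat_pos:
  assumes \<iota>: "bij_betw (\<iota> :: 'm::finite => 'e::euclidean_space) UNIV Basis" and g: "posdef g"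
  shows "det (gmat \<iota> g) > 0"
proof -
  obtain F where F: "gframe g F" using gframe_exists[OF g] .
  obtain k :: real where "k > 0" "k * det (gmat \<iota> g) = 1" using det_gmat_frame_change[OF \<iota> g F] by blast
  then show ?thesis using zero_less_mult_pos[of k "det (gmat \<iota> g)"] by simp
qed

text \<open>This turns a quotient of two coordinate densities into one determinant, which is close
  to 1 when the metrics are close.\<close>

lemma det_gmat_ratio:
  assumes \<iota>: "bij_betw (\<iota> :: 'm::finite => 'e::euclidean_space) UNIV Basis" and g: "posdef g" and F: "gframe g F"
    and h: "posdef h"
  shows "det (gmat \<iota> h) / det (gmat \<iota> g) = det (gmat (%i. F (\<iota> i)) h)"
proof -
  obtain k :: real where "k * det (gmat \<iota> g) = 1" "det (gmat (%i. F (\<iota> i)) h) = k * det (gmat \<iota> h)"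
    using det_gmat_frame_change[OF \<iota> g F] h by metis
  then show ?thesis using det_gmat_pos[OF \<iota> g] by (simp add: field_simps)
qed

text \<open>Leibniz expansion: one term per permutation, each a product of \<open>CARD('m)\<close>
  entries.\<close>

lemma det_bound:
  fixes A :: "real ^ 'm::finite ^ 'm"
  assumes "!!i j. \<bar>A $ i $ j\<bar> <= B"
  shows "\<bar>det A\<bar> <= fact CARD('m) * B ^ CARD('m)"
proof -
  have "\<bar>det A\<bar> <= (SUM p | p permutes (UNIV::'m set). \<bar>of_int (sign p) * (PROD i:UNIV. A $ i $ p i)\<bar>)"
    unfolding det_def by (rule sum_abs)
  also have "... <= (SUM p | p permutes (UNIV::'m set). B ^ CARD('m))"
  proof (rule sum_mono)
    fix p :: "'m => 'm"
    have "\<bar>of_int (sign p) * (PROD i:UNIV. A $ i $ p i)\<bar> = (PROD i:UNIV. \<bar>A $ i $ p i\<bar>)"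
      by (simp add: abs_mult sign_def abs_prod)
    also have "... <= (PROD i:(UNIV::'m set). B)" by (intro prod_mono) (auto simp: assms)
    finally show "\<bar>of_int (sign p) * (PROD i:UNIV. A $ i $ p i)\<bar> <= B ^ CARD('m)" by simp
  qed
  also have "... = fact CARD('m) * B ^ CARD('m)" by (simp add: card_permutations)
  finally show ?thesis .
qed

lemma det_near_identity:
  assumes "e > 0"
  obtains d where "d > 0" "!!A :: real ^ 'm::finite ^ 'm. (!!i j. \<bar>A $ i $ j - mat 1 $ i $ j\<bar> < d) ==> \<bar>det A - 1\<bar> < e"
proof -
  have "continuous_on UNIV (det :: real ^ 'm ^ 'm => real)"
    unfolding det_def by (intro continuous_intros)
  then have "isCont (det :: real ^ 'm ^ 'm => real) (mat 1)"
    by (simp add: continuous_on_eq_continuous_at)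
  then obtain r where r: "r > 0" "!!A :: real ^ 'm ^ 'm. dist A (mat 1) < r ==> \<bar>det A - 1\<bar> < e"
    using assms unfolding continuous_at_eps_delta by (metis det_I dist_real_def)
  \<comment> \<open>The norm of a matrix is at most the sum of the absolute values of its
    \<open>CARD('m) * CARD('m)\<close> entries; the added 1 keeps the final inequality
    strict.\<close>
  define d where "d = r / (real CARD('m) * real CARD('m) + 1)"
  have d: "d > 0" using r by (auto simp: d_def intro!: divide_pos_pos add_nonneg_pos)
  show thesis
  proof (rule that[OF d])
    fix A :: "real ^ 'm ^ 'm" assume A: "!!i j. \<bar>A $ i $ j - mat 1 $ i $ j\<bar> < d"
    have "norm (A - mat 1) <= (SUM i:UNIV. norm ((A - mat 1) $ i))"
      unfolding norm_vec_def by (rule L2_set_le_sum) simp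
    also have "... <= (SUM i:UNIV. SUM j:UNIV. \<bar>(A - mat 1) $ i $ j\<bar>)"
      by (intro sum_mono norm_le_l1_cart)
    also have "... <= (SUM i:(UNIV::'m set). SUM j:(UNIV::'m set). d)"
      using A by (intro sum_mono) (auto simp: less_imp_le)
    also have "... = d * (real CARD('m) * real CARD('m))" by simp
    also have "... < d * (real CARD('m) * real CARD('m) + 1)" using d by simp
    also have "... = r" unfolding d_def using add_nonneg_pos[of "real CARD('m) * real CARD('m)" 1] by simp
    finally show "\<bar>det A - 1\<bar> < e" using r(2) by (simp add: dist_norm)
  qed
qed

text \<open>Only the identity permutation contributes to the derivative of the determinant at the identity:
  the other products have at least two vanishing factors.\<close>

lemma has_derivative_det_at_identity:
  fixes M :: "'e::euclidean_space => real ^ 'm::finite ^ 'm"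
  assumes M: "!!i j. ((%x. M x $ i $ j) has_derivative (%v. M' v $ i $ j)) (at x)" and 1: "M x = mat 1"
  shows "((%x. det (M x)) has_derivative (%v. SUM i:UNIV. M' v $ i $ i)) (at x)"
proof -
  have "((%x. det (M x)) has_derivative
     (%v. SUM p | p permutes UNIV. of_int (sign p) *
        (SUM i:UNIV. M' v $ i $ p i * (PROD j:UNIV - {i}. M x $ j $ p j)))) (at x)"
    unfolding det_def by (intro has_derivative_sum has_derivative_mult_right has_derivative_prod M)
  moreover have "(SUM p | p permutes UNIV. of_int (sign p) *
        (SUM i:UNIV. M' v $ i $ p i * (PROD j:UNIV - {i}. M x $ j $ p j))) = (SUM i:UNIV. M' v $ i $ i)" for v
  proof -
    have "of_int (sign p) * (SUM i:UNIV. M' v $ i $ p i * (PROD j:UNIV - {i}. M x $ j $ p j)) = (0::real)"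
      if p: "p permutes UNIV" "p ~= id" for p :: "'m => 'm"
    proof -
      obtain k where k: "p k ~= k" using p(2) by (auto simp: fun_eq_iff)
      have pk: "p (p k) ~= p k" using k permutes_inj[OF p(1)] by (auto simp: inj_def)
      have Z: "(PROD j:UNIV - {i}. M x $ j $ p j) = 0" for i
      proof -
        have "EX j. j ~= i & p j ~= j" using k pk by metis
        then obtain j where "j ~= i" "p j ~= j" by blast
        then show ?thesis by (intro prod_zero) (auto simp: 1 mat_def intro!: bexI[of _ j])
      qed
      show ?thesis by (simp only: Z mult_zero_right sum.neutral_const)
    qed
    then have "(SUM p | p permutes UNIV. of_int (sign p) *
        (SUM i:UNIV. M' v $ i $ p i * (PROD j:UNIV - {i}. M x $ j $ p j))) =
      (SUM p:{id}. of_int (sign p) * (SUM i:UNIV. M' v $ i $ p i * (PROD j:UNIV - {i}. M x $ j $ p j)))"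
      by (intro sum.mono_neutral_right) (auto simp: finite_permutations permutes_id)
    also have "... = (SUM i:UNIV. M' v $ i $ i)" by (simp add: 1 mat_def)
    finally show ?thesis .
  qed
  ultimately show ?thesis by simp
qed

text \<open>Jacobi's formula. In a frame that is orthonormal at \<open>x\<close> the Gram matrix is
  the identity there, and changing to this frame shifts the logarithm by the constant
  \<open>ln k\<close>.\<close>

lemma has_derivative_ln_det_gmat:
  fixes g :: "'x::euclidean_space => 'e::euclidean_space bilin"
  assumes \<iota>: "bij_betw (\<iota> :: 'm::finite => 'e) UNIV Basis"
    and U: "open U" "x : U" and g: "!!y. y : U ==> posdef (g y)"
    and F: "gframe (g x) F" and d: "!!u v. (%y. g y u v) differentiable (at x)"
  shows "((%y. ln (det (gmat \<iota> (g y)))) has_derivative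
     (%w. SUM a:Basis. dir (%y. g y (F a) (F a)) x w)) (at x)"
proof -
  obtain k :: real where k: "k > 0"
    "!!h. posdef h ==> det (gmat (%i. F (\<iota> i)) h) = k * det (gmat \<iota> h)"
    using det_gmat_frame_change[OF \<iota> g[OF U(2)] F] by metis
  have 1: "gmat (%i. F (\<iota> i)) (g x) = mat 1" by (rule gmat_frame[OF \<iota> F])
  have "((%y. det (gmat (%i. F (\<iota> i)) (g y))) has_derivative
     (%v. SUM i:UNIV. (\<chi> i j. dir (%y. g y (F (\<iota> i)) (F (\<iota> j))) x v) $ i $ i)) (at x)"
    by (rule has_derivative_det_at_identity[of "%y. gmat (%i. F (\<iota> i)) (g y)"
          "%v. \<chi> i j. dir (%y. g y (F (\<iota> i)) (F (\<iota> j))) x v" x])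
      (use 1 in \<open>simp_all add: gmat_def dir_works[OF d]\<close>)
  then have "((%y. det (gmat (%i. F (\<iota> i)) (g y))) has_derivative
     (%v. SUM a:Basis. dir (%y. g y (F a) (F a)) x v)) (at x)"
    by (simp add: basis_reindex[OF \<iota>])
  then have "((%y. ln (det (gmat (%i. F (\<iota> i)) (g y))) - ln k) has_derivative
     (%v. SUM a:Basis. dir (%y. g y (F a) (F a)) x v)) (at x)"
    by (auto intro!: derivative_eq_intros simp: 1)
  then show ?thesis
  proof (rule has_derivative_transform_within_open[OF _ U])
    fix y assume "y : U"
    then show "ln (det (gmat (%i. F (\<iota> i)) (g y))) - ln k = ln (det (gmat \<iota> (g y)))"
      using k(2)[OF g[of y]] det_gmat_pos[OF \<iota> g[of y]] k(1) by (simp add: ln_mult_pos)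
  qed
qed

text \<open>By Cramer's rule.\<close>

lemma Ck_on_raise:
  fixes g :: "'x::euclidean_space => 'e::euclidean_space bilin"
  assumes \<iota>: "bij_betw (\<iota> :: 'm::finite => 'e) UNIV Basis" and U: "open U"
    and g: "!!y. y : U ==> posdef (g y)" "!!u v. Ck_on k U (%y. g y u v)"
    and l: "!!y. y : U ==> linear (l y)" "!!v. Ck_on k U (%y. l y v)"
  shows "Ck_on k U (%y. raise (g y) (l y))"
proof (rule Ck_on_componentwise[OF U])
  fix b :: 'e assume "b : Basis"
  then obtain i where i: "b = \<iota> i" using \<iota> by (metis bij_betw_imp_surj_on imageE)
  define N where "N y = (\<chi> i' j. if j = i then l y (\<iota> i') else gmat \<iota> (g y) $ i' $ j)" for y
  have "raise (g y) (l y) \<bullet> b = det (N y) / det (gmat \<iota> (g y))" if y: "y : U" for y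
  proof -
    define z where "z = raise (g y) (l y)"
    define Z where "Z = (\<chi> j. z \<bullet> \<iota> j)"
    have z: "z = (SUM j:UNIV. (z \<bullet> \<iota> j) *\<^sub>R \<iota> j)"
      using basis_reindex[OF \<iota>, of "%b. (z \<bullet> b) *\<^sub>R b"] by (simp add: euclidean_representation)
    have "(gmat \<iota> (g y) *v Z) $ i' = l y (\<iota> i')" for i'
    proof -
      have "l y (\<iota> i') = g y z (\<iota> i')" by (simp add: z_def raise_works[OF g(1)[OF y] l(1)[OF y]])
      also have "... = (SUM j:UNIV. (z \<bullet> \<iota> j) * g y (\<iota> j) (\<iota> i'))"
        by (subst z) (simp only: posdef_simps[OF g(1)[OF y]] posdef_sum[OF g(1)[OF y]])
      finally show ?thesis
        using posdefD(3)[OF g(1)[OF y], of "\<iota> i'"] by (simp add: gmat_def Z_def matrix_vector_mult_def mult.commute)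
    qed
    then have "gmat \<iota> (g y) *v Z = (\<chi> i'. l y (\<iota> i'))" by (simp add: vec_eq_iff)
    then have "Z = (\<chi> k. det (\<chi> i' j. if j = k then (\<chi> i'. l y (\<iota> i')) $ i' else gmat \<iota> (g y) $ i' $ j) / det (gmat \<iota> (g y)))"
      using cramer[of "gmat \<iota> (g y)" Z] det_gmat_pos[OF \<iota> g(1)[OF y]] by simp
    then have "Z $ i = det (N y) / det (gmat \<iota> (g y))" by (simp add: N_def cong: if_cong)
    then show ?thesis by (simp add: Z_def z_def i)
  qed
  moreover have "Ck_on k U (%y. det (N y) / det (gmat \<iota> (g y)))"
  proof (intro Ck_on_divide Ck_on_det U)
    show "Ck_on k U (%x. N x $ i' $ j)" for i' j
      using l(2) g(2) by (cases "j = i") (auto simp: N_def gmat_def)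
    show "Ck_on k U (%x. gmat \<iota> (g x) $ i' $ j)" for i' j
      using g(2) by (simp add: gmat_def)
    show "det (gmat \<iota> (g x)) ~= 0" if "x : U" for x using det_gmat_pos[OF \<iota> g(1)[OF that]] by simp
  qed
  ultimately show "Ck_on k U (%y. raise (g y) (l y) \<bullet> b)"
    by (subst Ck_on_cong[OF U]) auto
qed

section \<open>Kaehler geometry in a chart\<close>

lemma linear_dir_parameter:
  fixes h :: "'x::euclidean_space => 'e::real_vector => real"
  assumes U: "open U" "x : U" and l: "!!y. y : U ==> linear (h y)"
    and d: "!!v. (%y. h y v) differentiable (at x)"
  shows "linear (%v. dir (%y. h y v) x z)"
proof (rule linearI)
  show "dir (%y. h y (u + v)) x z = dir (%y. h y u) x z + dir (%y. h y v) x z" for u v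
  proof -
    have "dir (%y. h y (u + v)) x = dir (%y. h y u + h y v) x"
      by (rule dir_cong[OF U]) (rule linear_add[OF l])
    also have "... = (%z. dir (%y. h y u) x z + dir (%y. h y v) x z)"
      by (intro dir_eqI has_derivative_add dir_works d)
    finally show ?thesis by simp
  qed
  show "dir (%y. h y (c *\<^sub>R v)) x z = c *\<^sub>R dir (%y. h y v) x z" for c v
  proof -
    have "dir (%y. h y (c *\<^sub>R v)) x = dir (%y. c *\<^sub>R h y v) x"
      by (rule dir_cong[OF U]) (rule linear_scale[OF l])
    also have "... = (%z. c *\<^sub>R dir (%y. h y v) x z)"
      by (intro dir_eqI has_derivative_scaleR_right dir_works d)
    finally show ?thesis by simp
  qed
qed

lemma dir_uminus_cong:
  fixes f h :: "'e::euclidean_space => 'f::euclidean_space"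
  assumes "open U" "x : U" "!!y. y : U ==> f y = - h y" "h differentiable (at x)"
  shows "dir f x v = - dir h x v"
proof -
  have "dir f x = dir (%y. - h y) x" by (rule dir_cong[OF assms(1-3)])
  also have "... = (%v. - dir h x v)" by (intro dir_eqI has_derivative_minus dir_works assms(4))
  finally show ?thesis by simp
qed

abbreviation mulI :: "complex ^ 'n => complex ^ 'n" where
  "mulI u \<equiv> \<i> *s u"

lemma mulI_mulI: "mulI (mulI u) = - u"
  by (simp add: vec_eq_iff)

lemma linear_mulI: "linear mulI"
  by (rule linearI) (simp_all add: vec_eq_iff algebra_simps scaleR_conv_of_real)

text \<open>Everything about a Kaehler form that is visible in one chart. Two forms get interpreted
  on the same range, so nothing here refers to an atlas.\<close>

locale kaehler_chart =
  fixes U :: "(complex ^ 'n) set" and \<omega> :: "(complex ^ 'n) local_tensor"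
    and \<iota> :: "'m::finite => complex ^ 'n"
  assumes \<iota>: "bij_betw \<iota> UNIV Basis"
    and open_U: "open U"
    and smooth: "Ck_on k U (%x. \<omega> x [u, v])"
    and bilinear: "x : U ==> linear (%u. \<omega> x [u, v])" "x : U ==> linear (%v. \<omega> x [u, v])"
    and skew: "x : U ==> \<omega> x [u, v] = - \<omega> x [v, u]"
    and invariant: "x : U ==> \<omega> x [mulI u, mulI v] = \<omega> x [u, v]"
    and positive: "x : U ==> u ~= 0 ==> \<omega> x [u, mulI u] > 0"
    and closed: "x : U ==> dir (%y. \<omega> y [v, w]) x u - dir (%y. \<omega> y [u, w]) x v
                    + dir (%y. \<omega> y [u, v]) x w = 0"
begin

definition g :: "complex ^ 'n => (complex ^ 'n) bilin" where
  "g x u v = \<omega> x [u, mulI v]"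

text \<open>The metric in the list form that \<open>christoffel\<close> and
  \<open>ricci_curv\<close> take.\<close>

definition gt :: "(complex ^ 'n) local_tensor" where
  "gt = (%x vs. if length vs = 2 then \<omega> x [vs ! 0, mulI (vs ! 1)] else 0)"

lemma gt_eq: "gt x [u, v] = g x u v"
  by (simp add: gt_def g_def)

lemma g_alt: assumes x: "x : U" shows "g x u v = - \<omega> x [mulI u, v]"
proof -
  have "\<omega> x [mulI u, mulI (mulI v)] = - \<omega> x [mulI u, v]"
    unfolding mulI_mulI by (rule linear_neg[OF bilinear(2)[OF x]])
  then show ?thesis using invariant[OF x, of u "mulI v"] by (simp only: g_def)
qed

lemma omega_g: assumes x: "x : U" shows "\<omega> x [u, v] = - g x u (mulI v)"
  unfolding g_def mulI_mulI by (simp add: linear_neg[OF bilinear(2)[OF x]])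

lemma posdef_g: assumes "x : U" shows "posdef (g x)"
  unfolding posdef_def
proof (intro conjI allI impI)
  show "linear (g x u)" for u
    using linear_compose[OF linear_mulI bilinear(2)[OF assms, of u]] by (simp add: o_def g_def[abs_def])
  show "g x u v = g x v u" for u v
    using skew[OF assms, of "mulI u" v] g_alt[OF assms, of u v] by (simp add: g_def)
  show "u ~= 0 ==> g x u u > 0" for u using positive[OF assms] by (simp add: g_def)
qed

lemma g_mulI: "x : U ==> g x (mulI u) (mulI v) = g x u v"
  unfolding g_def by (rule invariant)

lemma smooth_g: "Ck_on k U (%x. g x u v)"
  unfolding g_def by (rule smooth)

lemma diff_g: "x : U ==> (%y. g y u v) differentiable (at x)"
  using Ck_on_imp_differentiable[OF smooth_g[of 1]] by auto

lemma diff_omega: "x : U ==> (%y. \<omega> y [u, v]) differentiable (at x)"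
  using Ck_on_imp_differentiable[OF smooth[of 1]] by auto

section \<open>The Levi-Civita connection and its compatibility with the complex structure\<close>

definition dg :: "complex ^ 'n => complex ^ 'n => complex ^ 'n => complex ^ 'n => real" where
  "dg x z u v = dir (%y. g y u v) x z"

lemma dg_sym: "x : U ==> dg x z u v = dg x z v u"
  unfolding dg_def using dir_cong[OF open_U, of x "%y. g y u v" "%y. g y v u"] posdefD(3)[OF posdef_g] by simp

lemma linear_dg:
  assumes "x : U"
  shows "linear (dg x z u)" "linear (%u. dg x z u v)" "linear (%z. dg x z u v)"
proof -
  show "linear (dg x z u)" unfolding dg_def[abs_def]
    by (rule linear_dir_parameter[OF open_U assms, where h = "%y v. g y u v"]) (auto intro: posdefD posdef_g diff_g assms)
  show "linear (%u. dg x z u v)" unfolding dg_def[abs_def]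
    by (rule linear_dir_parameter[OF open_U assms, where h = "%y u. g y u v"]) (auto intro: posdefD posdef_g diff_g assms)
  show "linear (%z. dg x z u v)" unfolding dg_def[abs_def]
    using dir_linear[OF diff_g[OF assms]] by simp
qed

definition koszul :: "complex ^ 'n => complex ^ 'n => complex ^ 'n => complex ^ 'n => real" where
  "koszul x u v w = (dg x u v w + dg x v u w - dg x w u v) / 2"

definition \<Gamma> :: "complex ^ 'n => complex ^ 'n => complex ^ 'n => complex ^ 'n" where
  "\<Gamma> x u v = raise (g x) (koszul x u v)"

lemma christoffel_eq: "christoffel gt x u v = \<Gamma> x u v"
proof -
  have "(2 * g x z w = dg x u v w + dg x v u w - dg x w u v) \<longleftrightarrow> (g x z w = koszul x u v w)" for z w
    by (auto simp: koszul_def)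
  then show ?thesis
    unfolding christoffel_def \<Gamma>_def raise_def gt_eq dg_def[symmetric] by simp
qed

lemma linear_koszul:
  assumes "x : U"
  shows "linear (koszul x u v)" "linear (%v. koszul x u v w)"
proof -
  note l = linear_dg[OF assms]
  have 1: "linear (%w. (1/2) *\<^sub>R (dg x u v w + dg x v u w - dg x w u v))"
    by (intro linear_compose_scale_right linear_compose_add linear_compose_sub l)
  then show "linear (koszul x u v)" by (simp add: koszul_def[abs_def])
  have "linear (%v. (1/2) *\<^sub>R (dg x u v w + dg x v u w - dg x w u v))"
    by (intro linear_compose_scale_right linear_compose_add linear_compose_sub l)
  then show "linear (%v. koszul x u v w)" by (simp add: koszul_def[abs_def])
qed

lemma g_Gamma: "x : U ==> g x (\<Gamma> x u v) w = koszul x u v w"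
  unfolding \<Gamma>_def by (rule raise_works[OF posdef_g linear_koszul(1)])

lemma Gamma_sym: "x : U ==> \<Gamma> x u v = \<Gamma> x v u"
  unfolding \<Gamma>_def koszul_def using dg_sym[of x _ u v] by (auto intro!: arg_cong[of _ _ "raise (g x)"])

lemma Gamma_linear: assumes "x : U" shows "linear (\<Gamma> x u)" "linear (%u. \<Gamma> x u v)"
proof -
  show 1: "linear (\<Gamma> x u)" for u
    using raise_linear[OF posdef_g[OF assms], of "koszul x u"] linear_koszul[OF assms]
    by (simp add: \<Gamma>_def[abs_def])
  show "linear (%u. \<Gamma> x u v)" using 1[of v] Gamma_sym[OF assms, of _ v] by simp
qed

lemma metric_compatible: "x : U ==> dg x u v w = g x (\<Gamma> x u v) w + g x v (\<Gamma> x u w)"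
  using posdefD(3)[OF posdef_g, of x v "\<Gamma> x u w"] dg_sym[of x _ v w] dg_sym[of x _ v u] dg_sym[of x _ w u]
  by (simp add: g_Gamma koszul_def field_simps)

lemma dg_omega: "x : U ==> dg x z u (mulI v) = - dir (%y. \<omega> y [u, v]) x z"
  unfolding dg_def by (rule dir_uminus_cong[OF open_U]) (auto simp: omega_g diff_omega)

lemma dg_omega': "x : U ==> dg x z u v = dir (%y. \<omega> y [u, mulI v]) x z"
  by (simp add: dg_def g_def)

lemma dg_mulI_skew: "x : U ==> dg x z (mulI u) v = - dg x z u (mulI v)"
proof -
  assume x: "x : U"
  have "dg x z (mulI u) v = dir (%y. \<omega> y [u, v]) x z" unfolding dg_def
    by (rule fun_cong[OF dir_cong[OF open_U x]]) (simp add: g_def invariant)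
  then show ?thesis using dg_omega[OF x] by simp
qed

lemma dir_omega_invariant:
  "x : U ==> dir (%y. \<omega> y [mulI u, mulI v]) x z = dir (%y. \<omega> y [u, v]) x z"
  by (rule fun_cong[OF dir_cong[OF open_U]]) (simp_all add: invariant)

text \<open>Real arithmetic for the next lemma: \<open>a\<close>, \<open>b\<close>, \<open>c\<close>
  stand for derivatives of the form, primes for arguments rotated by \<open>mulI\<close>, and the
  other letters for derivatives of the metric.\<close>

lemma koszul_arithmetic:
  fixes a :: real
  assumes "a - b + c = 0" "a' - b' + c' = 0" "a' = a" "d = - c" "e = - b" "f = b'" "h = c'" "k = - l"
  shows "- ((l + e - h) / 2) = (k + f - d) / 2"
  using assms by (simp add: field_simps)

text \<open>The complex structure is parallel. Closedness for \<open>u, v, w\<close> and for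
  \<open>u, mulI v, mulI w\<close> have the same derivative along \<open>u\<close> by invariance;
  eliminating it leaves the Koszul identity for the rotated vector.\<close>

lemma Gamma_mulI: assumes x: "x : U" shows "\<Gamma> x u (mulI v) = mulI (\<Gamma> x u v)"
  unfolding \<Gamma>_def[of x u "mulI v"]
proof (rule raise_unique[OF posdef_g[OF x]])
  fix w
  have "g x (mulI (\<Gamma> x u v)) w = - g x (\<Gamma> x u v) (mulI w)"
    using g_mulI[OF x, of "mulI (\<Gamma> x u v)" w] by (simp add: mulI_mulI posdef_simps[OF posdef_g[OF x]])
  also have "... = koszul x u (mulI v) w"
    unfolding g_Gamma[OF x] koszul_def
    by (rule koszul_arithmetic[OF closed[OF x, of v w u] closed[OF x, of "mulI v" "mulI w" u]
          dir_omega_invariant[OF x] dg_omega[OF x] dg_omega[OF x] dg_omega'[OF x] dg_omega'[OF x]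
          dg_mulI_skew[OF x]])
  finally show "g x (mulI (\<Gamma> x u v)) w = koszul x u (mulI v) w" .
qed

lemma Gamma_mulI': "x : U ==> \<Gamma> x (mulI u) v = mulI (\<Gamma> x u v)"
  using Gamma_mulI Gamma_sym by metis

lemma smooth_Gamma: "Ck_on k U (%x. \<Gamma> x u v)"
proof -
  have "Ck_on k U (%x. (1/2) * (dg x u v w + dg x v u w - dg x w u v))" for w
    unfolding dg_def by (intro Ck_on_cmult Ck_on_add Ck_on_diff open_U Ck_on_dir smooth_g)
  then have "Ck_on k U (%x. koszul x u v w)" for w by (simp add: koszul_def)
  then show ?thesis unfolding \<Gamma>_def
    by (intro Ck_on_raise[OF \<iota> open_U] posdef_g smooth_g linear_koszul)
qed

lemma diff_Gamma: "x : U ==> (%y. \<Gamma> y u v) differentiable (at x)"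
  using Ck_on_imp_differentiable[OF smooth_Gamma[of 1]] by auto

text \<open>Half of the logarithmic derivative of the Gram determinant, and at the same time the
  trace by which the connection enters the Ricci curvature and the divergence.\<close>

definition \<kappa> :: "complex ^ 'n => complex ^ 'n => real" where
  "\<kappa> x w = (SUM b:Basis. \<Gamma> x b w \<bullet> b)"

definition lndet :: "complex ^ 'n => real" where
  "lndet x = ln (det (gmat \<iota> (g x)))"

text \<open>In an orthonormal frame the first and last Koszul terms cancel by symmetry, and the
  middle one is Jacobi's formula.\<close>

lemma lndet_derivative: assumes x: "x : U" shows "dir lndet x w = 2 * \<kappa> x w"
proof -
  obtain F where F: "gframe (g x) F" using gframe_exists[OF posdef_g[OF x]] .
  have "dir lndet x = (%w. SUM a:Basis. dg x w (F a) (F a))"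
    unfolding lndet_def[abs_def] dg_def
    by (rule dir_eqI, rule has_derivative_ln_det_gmat[OF \<iota> open_U x posdef_g F diff_g[OF x]])
  moreover have "\<kappa> x w = (SUM a:Basis. g x (\<Gamma> x (F a) w) (F a))"
    unfolding \<kappa>_def using gframe_trace[OF posdef_g[OF x] F Gamma_linear(2)[OF x]] by simp
  moreover have "g x (\<Gamma> x (F a) w) (F a) = dg x w (F a) (F a) / 2" for a
    using dg_sym[OF x] by (simp add: g_Gamma[OF x] koszul_def)
  ultimately show ?thesis by (simp add: sum_divide_distrib[symmetric])
qed

lemma smooth_lndet: "Ck_on k U lndet"
  unfolding lndet_def[abs_def]
  by (intro Ck_on_ln Ck_on_det open_U det_gmat_pos[OF \<iota>] posdef_g) (auto simp: gmat_def smooth_g)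

text \<open>As \<open>\<Gamma>\<close> is complex bilinear, rotating both arguments by
  \<open>mulI\<close> reverses the sign of every curvature term except those where
  \<open>\<Gamma> y b w\<close> is differentiated along \<open>v\<close>. In the sum their trace is
  what survives.\<close>

lemma ricci_sum:
  assumes x: "x : U"
  shows "ricci_curv gt x v w + ricci_curv gt x (mulI v) (mulI w) =
    - (dir (%y. \<kappa> y w) x v + dir (%y. \<kappa> y (mulI w)) x (mulI v))"
proof -
  note lin = Gamma_linear[OF x]
  have neg: "\<Gamma> y (mulI v) (mulI w) = - \<Gamma> y v w" if "y : U" for y
    using that by (simp add: Gamma_mulI Gamma_mulI' mulI_mulI)
  have 1: "dir (%y. \<Gamma> y (mulI v) (mulI w)) x b = - dir (%y. \<Gamma> y v w) x b" for b
    by (rule dir_uminus_cong[OF open_U x neg diff_Gamma[OF x]])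
  have 2: "\<Gamma> x b (\<Gamma> x (mulI v) (mulI w)) = - \<Gamma> x b (\<Gamma> x v w)" for b
    by (simp add: neg[OF x] linear_neg[OF lin(1)])
  have 4: "\<Gamma> x (mulI v) (\<Gamma> x b (mulI w)) = - \<Gamma> x v (\<Gamma> x b w)" for b
    by (simp add: Gamma_mulI[OF x] Gamma_mulI'[OF x] mulI_mulI)
  have k: "dir (%y. \<kappa> y w) x v = (SUM b:Basis. dir (%y. \<Gamma> y b w) x v \<bullet> b)" for v w
  proof -
    have "dir (%y. \<kappa> y w) x = (%v. SUM b:Basis. dir (%y. \<Gamma> y b w) x v \<bullet> b)"
      unfolding \<kappa>_def by (intro dir_eqI has_derivative_sum has_derivative_inner_left dir_works diff_Gamma x)
    then show ?thesis by simp
  qed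
  have "ricci_curv gt x v w + ricci_curv gt x (mulI v) (mulI w) =
    (SUM b:Basis. - (dir (%y. \<Gamma> y b w) x v \<bullet> b) - dir (%y. \<Gamma> y b (mulI w)) x (mulI v) \<bullet> b)"
    unfolding ricci_curv_def riemann_curv_def christoffel_eq sum.distrib[symmetric]
    by (intro sum.cong refl) (simp add: 1 2 4 inner_diff_left inner_add_left)
  then show ?thesis unfolding k by (simp add: sum_subtractf sum_negf)
qed

text \<open>The left-hand side is the real form of the complex Hessian of \<open>lndet\<close>; it
  is -2 times the Ricci sum just computed.\<close>

lemma pluriharmonic_lndet:
  assumes x: "x : U" and ric: "!!v w. ricci_curv gt x v w = 0"
  shows "dir (%y. dir lndet y w) x v + dir (%y. dir lndet y (mulI w)) x (mulI v) = 0"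
proof -
  have "dir (%y. dir lndet y w) x v = 2 * dir (%y. \<kappa> y w) x v" for v w
  proof -
    have "((%y. \<kappa> y w) has_derivative (%v. SUM b:Basis. dir (%y. \<Gamma> y b w) x v \<bullet> b)) (at x)"
      unfolding \<kappa>_def by (intro has_derivative_sum has_derivative_inner_left dir_works diff_Gamma x)
    then have "(%y. \<kappa> y w) differentiable (at x)" by (rule differentiableI)
    have "dir (%y. dir lndet y w) x = dir (%y. 2 * \<kappa> y w) x"
      by (rule dir_cong[OF open_U x lndet_derivative])
    also have "... = (%v. 2 * dir (%y. \<kappa> y w) x v)"
      by (intro dir_eqI has_derivative_mult_right dir_works) fact
    finally show ?thesis by simp
  qed
  then show ?thesis using ricci_sum[OF x, of v w] ric by simp
qed

section \<open>Divergence of the vector field dual to a rotated 1-form\<close>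

definition vfield :: "(complex ^ 'n => complex ^ 'n => real) => complex ^ 'n => complex ^ 'n" where
  "vfield \<beta> x = raise (g x) (%w. \<beta> x (mulI w))"

lemma Ck_on_vfield:
  assumes "!!x. x : U ==> linear (\<beta> x)" "!!v. Ck_on k U (%x. \<beta> x v)"
  shows "Ck_on k U (vfield \<beta>)"
  unfolding vfield_def[abs_def]
  using linear_compose[OF linear_mulI assms(1)] assms(2)
  by (intro Ck_on_raise[OF \<iota> open_U] posdef_g smooth_g) (auto simp: o_def)

text \<open>The left-hand side is the trace of the covariant derivative of \<open>V\<close>. Because
  \<open>mulI\<close> is parallel, that derivative is dual to the covariant derivative of
  \<open>\<beta>\<close> composed with \<open>mulI\<close>. Averaging the trace over the frame and
  over its rotation antisymmetrises it, and a torsion-free connection then leaves the exterior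
  derivative.\<close>

lemma divergence_vfield:
  assumes x: "x : U" and \<beta>: "!!x. x : U ==> linear (\<beta> x)" "!!v. Ck_on 1 U (%x. \<beta> x v)"
    and F: "gframe (g x) F"
  shows "(SUM b:Basis. dir (vfield \<beta>) x b \<bullet> b) + \<kappa> x (vfield \<beta> x) =
    (SUM a:Basis. dir (%y. \<beta> y (mulI (F a))) x (F a) - dir (%y. \<beta> y (F a)) x (mulI (F a))) / 2"
proof -
  define V where "V = vfield \<beta>"
  have gV: "g y (V y) w = \<beta> y (mulI w)" if "y : U" for y w
    unfolding V_def vfield_def
    using raise_works[OF posdef_g[OF that]] linear_compose[OF linear_mulI \<beta>(1)[OF that]] by (simp add: o_def)
  have dV: "V differentiable (at x)" unfolding V_def
    by (rule Ck_on_imp_differentiable[OF Ck_on_vfield[OF \<beta>] _ x]) auto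
  have d\<beta>: "(%y. \<beta> y v) differentiable (at x)" for v
    by (rule Ck_on_imp_differentiable[OF \<beta>(2) _ x]) auto
  note p = posdef_g[OF x]
  \<comment> \<open>\<open>R\<close> is the covariant derivative of the vector field, and
    \<open>B\<close> that of the 1-form.\<close>
  define R where "R u = dir V x u + \<Gamma> x u (V x)" for u
  define B where "B u w = dir (%y. \<beta> y w) x u - \<beta> x (\<Gamma> x u w)" for u w
  have lR: "linear R" unfolding R_def by (intro linear_compose_add dir_linear dV Gamma_linear x)
  have lB: "linear (B u)" for u
    unfolding B_def[abs_def]
    using linear_compose[OF Gamma_linear(1)[OF x, of u] \<beta>(1)[OF x]]
    by (intro linear_compose_sub linear_dir_parameter[OF open_U x \<beta>(1) d\<beta>]) (auto simp: o_def)
  have gR: "g x (R u) w = B u (mulI w)" for u w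
  proof -
    \<comment> \<open>Both the metric and \<open>V\<close> vary with \<open>y\<close>; writing
      \<open>V\<close> in coordinates separates the two contributions.\<close>
    have "((%y. SUM b:Basis. (V y \<bullet> b) * g y b w) has_derivative
        (%u. SUM b:Basis. (V x \<bullet> b) * dg x u b w + (dir V x u \<bullet> b) * g x b w)) (at x)"
      unfolding dg_def
      by (intro has_derivative_sum has_derivative_mult has_derivative_inner_left dir_works dV diff_g x)
    moreover have "(SUM b:Basis. (V y \<bullet> b) * g y b w) = \<beta> y (mulI w)" if "y : U" for y
      using linear_basis_sum[OF posdefD(2)[OF posdef_g[OF that], of w], of "V y"] gV[OF that, of w] by simp
    ultimately have "((%y. \<beta> y (mulI w)) has_derivative
        (%u. SUM b:Basis. (V x \<bullet> b) * dg x u b w + (dir V x u \<bullet> b) * g x b w)) (at x)"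
      by (auto intro: has_derivative_transform_within_open[OF _ open_U x])
    then have "dir (%y. \<beta> y (mulI w)) x u = (SUM b:Basis. (V x \<bullet> b) * dg x u b w + (dir V x u \<bullet> b) * g x b w)"
      by (rule fun_cong[OF dir_eqI])
    also have "... = dg x u (V x) w + g x (dir V x u) w"
      using linear_basis_sum[OF linear_dg(2)[OF x, of u w], of "V x"]
        linear_basis_sum[OF posdefD(2)[OF p, of w], of "dir V x u"] by (simp add: sum.distrib)
    also have "dg x u (V x) w = g x (\<Gamma> x u (V x)) w + g x (V x) (\<Gamma> x u w)" by (rule metric_compatible[OF x])
    also have "g x (V x) (\<Gamma> x u w) = \<beta> x (\<Gamma> x u (mulI w))" by (simp add: gV[OF x] Gamma_mulI[OF x])
    finally show ?thesis by (simp add: R_def B_def posdef_simps[OF p])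
  qed
  have F': "gframe (g x) (%a. mulI (F a))" by (rule gframe_isometry[where J = mulI, OF F g_mulI[OF x]])
  have "(SUM b:Basis. R b \<bullet> b) = (SUM a:Basis. B (F a) (mulI (F a)))"
    using gframe_trace[OF p F lR] by (simp add: gR)
  moreover have "(SUM b:Basis. R b \<bullet> b) = - (SUM a:Basis. B (mulI (F a)) (F a))"
    using gframe_trace[OF p F' lR] by (simp add: gR mulI_mulI linear_neg[OF lB] sum_negf)
  ultimately have "2 * (SUM b:Basis. R b \<bullet> b) = (SUM a:Basis. B (F a) (mulI (F a)) - B (mulI (F a)) (F a))"
    by (simp add: sum_subtractf)
  also have "... = (SUM a:Basis. dir (%y. \<beta> y (mulI (F a))) x (F a) - dir (%y. \<beta> y (F a)) x (mulI (F a)))"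
    by (simp add: B_def Gamma_sym[OF x, of "mulI _"])
  finally show ?thesis by (simp add: R_def V_def \<kappa>_def inner_add_left sum.distrib)
qed

end

section \<open>Integration of compactly supported functions\<close>

lemma integral_eq_UNIV:
  fixes f :: "'e::euclidean_space => 'f::banach"
  assumes "!!x. x ~: S ==> f x = 0"
  shows "integral S f = integral UNIV f"
proof -
  have "(%x. if x : S then f x else 0) = f" using assms by auto
  then show ?thesis using integral_restrict_UNIV[of S f] by simp
qed

lemma absolutely_integrable_compact_support:
  fixes f :: "'e::euclidean_space => real"
  assumes f: "continuous_on UNIV f" and C: "compact C" "!!x. x ~: C ==> f x = 0" and S: "C \<subseteq> S"
  shows "f absolutely_integrable_on S"
proof -
  obtain a where a: "C \<subseteq> cbox (- a) a"
    using bounded_subset_cbox_symmetric[OF compact_imp_bounded[OF C(1)]] by blast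
  have 1: "f absolutely_integrable_on (cbox (- a) a)"
    by (rule absolutely_integrable_continuous) (rule continuous_on_subset[OF f], simp)
  have e: "(%x. if x : cbox (- a) a then f x else 0) = (%x. if x : S then f x else 0)"
    using C(2) a S by fastforce
  show ?thesis
    using 1 absolutely_integrable_restrict_UNIV[of "cbox (- a) a" f] absolutely_integrable_restrict_UNIV[of S f]
    unfolding e by blast
qed

lemma integrable_compact_support:
  fixes f :: "'e::euclidean_space => real"
  assumes "continuous_on UNIV f" and "compact C" "!!x. x ~: C ==> f x = 0"
  shows "f integrable_on UNIV"
  using absolutely_integrable_compact_support[OF assms, of UNIV] set_lebesgue_integral_eq_integral(1) by blast

lemma continuous_on_zero_extension:
  fixes f :: "'a::topological_space => 'b::real_normed_vector"
  assumes "open U" "closed C" "C \<subseteq> U" "continuous_on U f" "!!x. x ~: C ==> f x = 0"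
  shows "continuous_on UNIV f"
proof -
  have "continuous_on (- C) f" 
    by (rule continuous_on_eq[OF continuous_on_const[of _ 0]]) (simp add: assms(5))
  then have "continuous_on (U Un - C) f"
    using assms by (intro continuous_on_open_Un) auto
  moreover have "U Un - C = UNIV" using assms(3) by auto
  ultimately show ?thesis by simp
qed

text \<open>By translation invariance the integral of \<open>F (y + t v)\<close> does not depend on
  small \<open>t\<close>, and its derivative at \<open>t = 0\<close> is the integral in
  question.\<close>

lemma integral_dir_compact_support:
  fixes F :: "'e::euclidean_space => real"
  assumes F: "Ck_on 1 UNIV F" and C: "compact C" "!!x. x ~: C ==> F x = 0"
  shows "integral UNIV (%y. dir F y v) = 0"
proof -
  have dF: "F differentiable (at y)" for y using F by simp
  have cF: "continuous_on UNIV (%y. dir F y v)" using F by simp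
  have d0: "dir F y v = 0" if "y ~: C" for y
  proof -
    have "dir F y = dir (%_. 0) y"
      by (rule dir_cong[of "- C"]) (use that C compact_imp_closed[OF C(1)] in auto)
    then show ?thesis by (simp add: frechet_derivative_const)
  qed
  obtain R where R: "C \<subseteq> ball (0::'e) R" "R > 0"
    using bounded_subset_ballD[OF compact_imp_bounded[OF C(1)]] by blast
  \<comment> \<open>The box contains every translate of the support by \<open>t v\<close> with
    \<open>|t| <= 1\<close>, so one can differentiate under an integral over a fixed box.\<close>
  obtain a where a: "ball (0::'e) (R + norm v) \<subseteq> cbox (- a) a"
    using bounded_subset_cbox_symmetric[OF bounded_ball] by blast
  define g where "g t = integral (cbox (- a) a) (%y. F (y + t *\<^sub>R v))" for t :: real
  have g: "g t = integral UNIV F" if t: "t : {-1..1}" for t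
  proof -
    have "C \<subseteq> cbox (- a + t *\<^sub>R v) (a + t *\<^sub>R v)"
    proof
      fix x assume "x : C"
      then have "norm x < R" using R by auto
      moreover have "norm (t *\<^sub>R v) <= norm v" using t by (simp add: mult_left_le_one_le abs_le_iff)
      ultimately have "norm (x - t *\<^sub>R v) < R + norm v" using norm_triangle_ineq4[of x "t *\<^sub>R v"] by linarith
      then have "x - t *\<^sub>R v : ball 0 (R + norm v)" by simp
      then have "x - t *\<^sub>R v : cbox (- a) a" using a by blast
      then show "x : cbox (- a + t *\<^sub>R v) (a + t *\<^sub>R v)"
        by (auto simp: mem_box inner_diff_left inner_add_left)
    qed
    then have "integral (cbox (- a + t *\<^sub>R v) (a + t *\<^sub>R v)) F = integral UNIV F"
      by (intro integral_eq_UNIV) (use C in auto)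
    then show ?thesis
      using integral_shift_cbox[of "- a + t *\<^sub>R v" "t *\<^sub>R v" "a + t *\<^sub>R v" F] by (simp add: g_def)
  qed
  have "(g has_vector_derivative integral (cbox (- a) a) (%y. dir F (y + 0 *\<^sub>R v) v)) (at 0 within {-1..1})"
    unfolding g_def
  proof (rule leibniz_rule_vector_derivative)
    show "((%t. F (y + t *\<^sub>R v)) has_vector_derivative dir F (y + t *\<^sub>R v) v) (at t within {-1..1})"
      for t :: real and y
    proof -
      have "((%s. y + s *\<^sub>R v) has_derivative (%r. r *\<^sub>R v)) (at t)"
        by (auto intro!: derivative_eq_intros)
      from diff_chain_at[OF this dir_works[OF dF]]
      have "((%s. F (y + s *\<^sub>R v)) has_derivative (%r. dir F (y + t *\<^sub>R v) (r *\<^sub>R v))) (at t)"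
        by (simp add: o_def)
      then show ?thesis
        by (simp add: has_vector_derivative_def linear_scale[OF dir_linear[OF dF]] has_derivative_at_withinI)
    qed
    have "continuous_on UNIV F" using F Ck_on_imp_continuous by blast
    then show "(%y. F (y + t *\<^sub>R v)) integrable_on cbox (- a) a" for t
      by (intro integrable_continuous continuous_on_compose2[of UNIV F _ "%y. y + t *\<^sub>R v"])
        (auto intro!: continuous_intros)
    show "continuous_on ({-1..1} \<times> cbox (- a) a) (%(t, y). dir F (y + t *\<^sub>R v) v)"
      unfolding split_beta
      by (rule continuous_on_compose2[OF cF, where f = "%p. snd p + fst p *\<^sub>R v"]) (auto intro!: continuous_intros)
  qed auto
  moreover have "(g has_vector_derivative 0) (at 0 within {-1..1})"
    by (rule has_vector_derivative_transform[of _ _ _ "%_. integral UNIV F"])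
      (simp_all only: g has_vector_derivative_const, simp)
  moreover have "at 0 within {-1..1} = at (0::real)" by (rule at_within_Icc_at) auto
  ultimately have "integral (cbox (- a) a) (%y. dir F (y + 0 *\<^sub>R v) v) = 0"
    using vector_derivative_unique_at[of g _ 0 0] by simp
  then have "integral (cbox (- a) a) (%y. dir F y v) = 0" by simp
  moreover have "integral (cbox (- a) a) (%y. dir F y v) = integral UNIV (%y. dir F y v)"
  proof (rule integral_eq_UNIV, rule d0)
    fix x assume "x ~: cbox (- a) a"
    moreover have "ball (0::'e) R \<subseteq> ball 0 (R + norm v)" by (rule subset_ball) simp
    then have "C \<subseteq> cbox (- a) a" using R(1) a by (meson subset_trans)
    ultimately show "x ~: C" by auto
  qed
  ultimately show ?thesis by simp
qed

text \<open>Continuity is demanded on the whole space, so the extension by zero outside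
  \<open>W\<close> is part of the notion.\<close>

definition csupp :: "('x::topological_space => real) => 'x set => bool" where
  "csupp f W \<longleftrightarrow> continuous_on UNIV f & (EX C. compact C & C \<subseteq> W & (ALL p. p ~: C --> f p = 0))"

lemma csupp_mult: "csupp f W ==> continuous_on UNIV h ==> csupp (%p. f p * h p) W"
  unfolding csupp_def by (auto intro!: continuous_intros)

lemma csupp_mult': "csupp f W ==> continuous_on UNIV h ==> csupp (%p. h p * f p) W"
  using csupp_mult by (simp add: mult.commute)

lemma csupp_Int:
  fixes f h :: "'x::t2_space => real"
  assumes "csupp f V" "csupp h W" shows "csupp (%p. f p * h p) (V Int W)"
proof -
  obtain C D where "compact C" "C \<subseteq> V" "!!p. p ~: C ==> f p = 0" "compact D" "D \<subseteq> W" "!!p. p ~: D ==> h p = 0"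
    using assms unfolding csupp_def by auto
  then show ?thesis using assms unfolding csupp_def
    by (intro conjI exI[of _ "C Int D"]) (auto intro!: continuous_intros compact_Int)
qed

lemma csupp_subset: "csupp f V ==> V \<subseteq> W ==> csupp f W"
  unfolding csupp_def by blast

lemma csupp_add:
  assumes "csupp f W" "csupp h W" shows "csupp (%p. f p + h p) W"
proof -
  obtain C D where "compact C" "C \<subseteq> W" "!!p. p ~: C ==> f p = 0" "compact D" "D \<subseteq> W" "!!p. p ~: D ==> h p = 0"
    using assms unfolding csupp_def by auto
  then show ?thesis using assms unfolding csupp_def
    by (intro conjI exI[of _ "C Un D"]) (auto intro!: continuous_intros)
qed

lemma csupp_zero: "csupp (%p. 0) W"
  unfolding csupp_def by (auto intro!: exI[of _ "{}"])

lemma csupp_sum: "(!!i. i : A ==> csupp (f i) W) ==> csupp (%p. SUM i:A. f i p) W"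
  by (induction A rule: infinite_finite_induct) (auto intro: csupp_add csupp_zero)

text \<open>A weighted chart consists of its domain, coordinate map, inverse, and a density in coordinates.\<close>

type_synonym ('x, 'm) wchart = "'x set \<times> ('x => real ^ 'm) \<times> (real ^ 'm => 'x) \<times> (real ^ 'm => real)"

definition wdom :: "('x, 'm) wchart => 'x set" where "wdom q = fst q"
definition wcoord :: "('x, 'm) wchart => 'x => real ^ 'm" where "wcoord q = fst (snd q)"
definition wpoint :: "('x, 'm) wchart => real ^ 'm => 'x" where "wpoint q = fst (snd (snd q))"
definition wdens :: "('x, 'm) wchart => real ^ 'm => real" where "wdens q = snd (snd (snd q))"

definition wvalid :: "('x::topological_space, 'm::finite) wchart => bool" where
  "wvalid q \<longleftrightarrow> open (wdom q) & open (wcoord q ` wdom q) &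
     homeomorphism (wdom q) (wcoord q ` wdom q) (wcoord q) (wpoint q) &
     continuous_on (wcoord q ` wdom q) (wdens q) & (ALL y:wcoord q ` wdom q. wdens q y > 0)"

definition wfun :: "('x, 'm::finite) wchart => ('x => real) => real ^ 'm => real" where
  "wfun q f y = (if y : wcoord q ` wdom q then f (wpoint q y) * wdens q y else 0)"

definition wint :: "('x, 'm::finite) wchart => ('x => real) => real" where
  "wint q f = integral UNIV (wfun q f)"

lemma wfun_csupp:
  fixes q :: "('x::t2_space, 'm::finite) wchart"
  assumes q: "wvalid q" and f: "csupp f (wdom q)"
  shows "continuous_on UNIV (wfun q f)"
    "EX C. compact C & C \<subseteq> wcoord q ` wdom q & (ALL y. y ~: C --> wfun q f y = 0)"
proof -
  note h = q[unfolded wvalid_def]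
  then have hom: "homeomorphism (wdom q) (wcoord q ` wdom q) (wcoord q) (wpoint q)" by auto
  obtain C where C: "compact C" "C \<subseteq> wdom q" "!!p. p ~: C ==> f p = 0" and cf: "continuous_on UNIV f"
    using f unfolding csupp_def by auto
  have K: "compact (wcoord q ` C)"
    using hom C by (auto intro!: compact_continuous_image intro: continuous_on_subset simp: homeomorphism_def)
  have z: "wfun q f y = 0" if "y ~: wcoord q ` C" for y
  proof (cases "y : wcoord q ` wdom q")
    case True
    then have "wcoord q (wpoint q y) = y" using hom by (metis homeomorphism_apply2)
    then have "wpoint q y ~: C" using that by force
    then show ?thesis using C by (simp add: wfun_def)
  qed (simp add: wfun_def)
  show "EX C. compact C & C \<subseteq> wcoord q ` wdom q & (ALL y. y ~: C --> wfun q f y = 0)"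
    using K z C(2) by (intro exI[of _ "wcoord q ` C"]) auto
  have "continuous_on (wcoord q ` wdom q) (%y. f (wpoint q y) * wdens q y)"
    using h hom by (intro continuous_intros continuous_on_compose2[OF cf]) (auto simp: homeomorphism_def)
  then have cw: "continuous_on (wcoord q ` wdom q) (wfun q f)"
    by (subst continuous_on_cong[OF refl, of _ _ "%y. f (wpoint q y) * wdens q y"]) (auto simp: wfun_def)
  show "continuous_on UNIV (wfun q f)"
    by (rule continuous_on_zero_extension[OF _ compact_imp_closed[OF K] _ cw z]) (use h C in auto)
qed

lemma wfun_integrable:
  fixes q :: "('x::t2_space, 'm::finite) wchart"
  assumes "wvalid q" and "csupp f (wdom q)"
  shows "wfun q f integrable_on UNIV"
  using wfun_csupp[OF assms] integrable_compact_support by metis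

lemma wint_add:
  fixes q :: "('x::t2_space, 'm::finite) wchart"
  assumes "wvalid q" "csupp f (wdom q)" "csupp h (wdom q)"
  shows "wint q (%p. f p + h p) = wint q f + wint q h"
proof -
  have "wfun q (%p. f p + h p) = (%y. wfun q f y + wfun q h y)" by (auto simp: wfun_def algebra_simps)
  then show ?thesis unfolding wint_def
    using integral_add[OF wfun_integrable[OF assms(1,2)] wfun_integrable[OF assms(1,3)]] by simp
qed

lemma wfun_zero: "wfun q (%p. 0) = (%y. 0)"
  by (auto simp: wfun_def)

lemma wint_cmult:
  fixes q :: "('x::t2_space, 'm::finite) wchart"
  shows "wint q (%p. c * f p) = c * wint q f"
proof -
  have "wfun q (%p. c * f p) = (%y. c * wfun q f y)" by (auto simp: wfun_def algebra_simps)
  then show ?thesis unfolding wint_def by simp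
qed

lemma wint_mono:
  fixes q :: "('x::t2_space, 'm::finite) wchart"
  assumes "wvalid q" "csupp f (wdom q)" "csupp h (wdom q)" "!!p. f p <= h p"
  shows "wint q f <= wint q h"
  unfolding wint_def
proof (rule integral_le)
  show "wfun q f y <= wfun q h y" for y
    using assms(1,4) by (auto simp: wfun_def wvalid_def intro!: mult_right_mono intro: less_imp_le)
qed (auto intro: wfun_integrable[OF assms(1)] assms)

text \<open>A continuous nonnegative function with vanishing integral over a box is zero on
  it.\<close>

lemma wint_pos:
  fixes q :: "('x::t2_space, 'm::finite) wchart"
  assumes q: "wvalid q" and f: "csupp f (wdom q)" "!!p. f p >= 0" and p: "f p > 0"
  shows "wint q f > 0"
proof -
  note h = q[unfolded wvalid_def]
  have pd: "p : wdom q" using f(1) p unfolding csupp_def by force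
  have n: "wfun q f y >= 0" for y using h f(2)
    by (auto simp: wfun_def intro!: mult_nonneg_nonneg intro: less_imp_le)
  have "wpoint q (wcoord q p) = p" using h pd by (metis homeomorphism_apply1)
  then have pos: "wfun q f (wcoord q p) > 0" using pd p h by (auto simp: wfun_def)
  obtain C where C: "compact C" "!!y. y ~: C ==> wfun q f y = 0" using wfun_csupp(2)[OF q f(1)] by auto
  obtain a where a: "insert (wcoord q p) C \<subseteq> box (- a) a"
    using bounded_subset_box_symmetric[of "insert (wcoord q p) C"] compact_imp_bounded[OF C(1)] by auto
  have "integral (cbox (- a) a) (wfun q f) = wint q f" unfolding wint_def
    by (rule integral_eq_UNIV) (use C a box_subset_cbox in blast)
  moreover have "integral (cbox (- a) a) (wfun q f) ~= 0"
  proof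
    assume "integral (cbox (- a) a) (wfun q f) = 0"
    moreover have c: "continuous_on (cbox (- a) a) (wfun q f)"
      by (rule continuous_on_subset[OF wfun_csupp(1)[OF q f(1)]]) auto
    moreover have "(wfun q f has_integral integral (cbox (- a) a) (wfun q f)) (cbox (- a) a)"
      by (rule integrable_integral[OF integrable_continuous[OF c]])
    ultimately have "(wfun q f has_integral 0) (cbox (- a) a)" by simp
    moreover have b: "wcoord q p : box (- a) a" using a by blast
    moreover have "wcoord q p : cbox (- a) a" using b box_subset_cbox by blast
    ultimately have "wfun q f (wcoord q p) = 0"
      using has_integral_0_cbox_imp_0[OF c] n by (metis empty_iff)
    then show False using pos by simp
  qed
  moreover have "integral (cbox (- a) a) (wfun q f) >= 0"
    using n by (intro integral_nonneg integrable_continuous continuous_on_subset[OF wfun_csupp(1)[OF q f(1)]]) auto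
  ultimately show ?thesis by simp
qed

text \<open>Compatibility is expressed through integrals rather than Jacobians, so that it can be
  used uniformly for charts of the atlas and for charts coming from the cylinder.\<close>

definition wcompat :: "('x::topological_space, 'm::finite) wchart => ('x, 'm) wchart => bool" where
  "wcompat q r \<longleftrightarrow> (ALL f. csupp f (wdom q Int wdom r) --> wint q f = wint r f)"

lemma wcompatI:
  fixes q r :: "('x::t2_space, 'm::{finite,wellorder}) wchart"
  assumes q: "wvalid q" and r: "wvalid r"
    and T: "!!y. y : wcoord q ` (wdom q Int wdom r) ==>
        ((%y. wcoord r (wpoint q y)) has_derivative T' y) (at y)"
      "!!y. y : wcoord q ` (wdom q Int wdom r) ==>
        wdens q y = \<bar>det (matrix (T' y))\<bar> * wdens r (wcoord r (wpoint q y))"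
  shows "wcompat q r"
  unfolding wcompat_def
proof (intro allI impI)
  fix f :: "'x => real" assume f: "csupp f (wdom q Int wdom r)"
  then obtain C where C: "compact C" "C \<subseteq> wdom q Int wdom r" "!!p. p ~: C ==> f p = 0" unfolding csupp_def by auto
  define S where "S = wcoord q ` (wdom q Int wdom r)"
  define T where "T y = wcoord r (wpoint q y)" for y
  have hq: "homeomorphism (wdom q) (wcoord q ` wdom q) (wcoord q) (wpoint q)"
    and hr: "homeomorphism (wdom r) (wcoord r ` wdom r) (wcoord r) (wpoint r)"
    using q r by (auto simp: wvalid_def)
  have hT: "(T has_derivative T' y) (at y)" if "y : S" for y
    using T(1)[of y] that by (simp add: T_def[abs_def] S_def)
  have "openin (top_of_set (wcoord q ` wdom q)) (wcoord q ` (wdom q Int wdom r))"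
    by (rule homeomorphism_imp_open_map[OF hq]) (use r in \<open>auto simp: wvalid_def openin_open\<close>)
  then have S: "open S" unfolding S_def using q openin_open_trans by (auto simp: wvalid_def)
  have pq: "wpoint q (wcoord q p) = p" if "p : wdom q" for p using hq that by (rule homeomorphism_apply1)
  have pr: "wpoint r (wcoord r p) = p" if "p : wdom r" for p using hr that by (rule homeomorphism_apply1)
  have TS: "T ` S = wcoord r ` (wdom q Int wdom r)" using pq by (force simp: T_def S_def)
  have inj: "inj_on T S" using pq pr by (auto simp: T_def S_def inj_on_def) (metis pr)
  have fr: "csupp f (wdom r)" "csupp f (wdom q)" using f by (auto elim: csupp_subset)
  obtain C' where C': "compact C'" "C' \<subseteq> wcoord r ` wdom r" "!!y. y ~: C' ==> wfun r f y = 0"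
    using wfun_csupp(2)[OF r fr(1)] by auto
  have z: "wfun r f y = 0" if "y ~: T ` S" for y
  proof (cases "y : wcoord r ` wdom r")
    case True
    then obtain p where p: "p : wdom r" "y = wcoord r p" by auto
    then have "p ~: wdom q" using that unfolding TS by auto
    then have "f p = 0" using C by blast
    then show ?thesis using p pr by (simp add: wfun_def)
  qed (simp add: wfun_def)
  have zq: "wfun q f y = 0" if "y ~: S" for y
  proof (cases "y : wcoord q ` wdom q")
    case True
    then obtain p where p: "p : wdom q" "y = wcoord q p" by auto
    then have "p ~: wdom r" using that unfolding S_def by auto
    then have "f p = 0" using C by blast
    then show ?thesis using p pq by (simp add: wfun_def)
  qed (simp add: wfun_def)
  have "wfun r f absolutely_integrable_on UNIV"
    by (rule absolutely_integrable_compact_support[OF wfun_csupp(1)[OF r fr(1)] C'(1,3)]) auto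
  moreover have "(%y. if y : T ` S then wfun r f y else 0) = wfun r f" using z by auto
  ultimately have ai: "wfun r f absolutely_integrable_on T ` S"
    using absolutely_integrable_restrict_UNIV[of "T ` S" "wfun r f"] by simp
  \<comment> \<open>The change of variables formula is applied to vector-valued functions, with the
    real case embedded as one-dimensional vectors.\<close>
  have "(%y. vec (wfun r f y) :: real ^ 1) absolutely_integrable_on T ` S"
    using ai by (subst absolutely_integrable_on_1_iff) simp
  then have "integral (T ` S) (%y. vec (wfun r f y) :: real ^ 1) =
      integral S (%x. \<bar>det (matrix (T' x))\<bar> *\<^sub>R (vec (wfun r f (T x)) :: real ^ 1))"
    using S hT inj by (intro integral_change_of_variables) (auto intro: has_derivative_at_withinI)
  then have "integral (T ` S) (wfun r f) = integral S (%x. \<bar>det (matrix (T' x))\<bar> * wfun r f (T x))"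
    by (simp add: integral_on_1_eq vec_eq_iff)
  also have "... = integral S (wfun q f)"
  proof (rule integral_cong)
    fix y assume "y : S"
    then obtain p where p: "p : wdom q" "p : wdom r" "y = wcoord q p" by (auto simp: S_def)
    then show "\<bar>det (matrix (T' y))\<bar> * wfun r f (T y) = wfun q f y"
      using T(2)[of y] pq pr by (auto simp: wfun_def T_def)
  qed
  also have "... = wint q f" unfolding wint_def by (rule integral_eq_UNIV[OF zq])
  also have "integral (T ` S) (wfun r f) = wint r f" unfolding wint_def by (rule integral_eq_UNIV[OF z])
  finally show "wint q f = wint r f" by simp
qed

text \<open>A partition of unity without division: \<open>\<Sum>\<^sub>j b\<^sub>j \<Prod>\<^sub>i\<^sub><\<^sub>j (1 - b\<^sub>i) = 1 - \<Prod>\<^sub>j (1 - b\<^sub>j)\<close>.\<close>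

definition unity_part :: "(nat => 'x => real) => nat => 'x => real" where
  "unity_part b j p = b j p * (PROD i<j. 1 - b i p)"

lemma sum_unity_part: "(SUM j<n. unity_part b j p) = 1 - (PROD j<n. 1 - b j p)"
  by (induction n) (simp_all add: unity_part_def algebra_simps)

lemma sum_unity_part_eq_1:
  assumes "j < n" "b j p = 1" shows "(SUM j<n. unity_part b j p) = 1"
proof -
  have "(PROD j<n. 1 - b j p) = 0" using assms by (intro prod_zero) auto
  then show ?thesis by (simp add: sum_unity_part)
qed

text \<open>The parameter \<open>a\<close> carries whatever a use attaches to a bump: a chart, a
  compact support, a local primitive, a bound. The weights sum to 1 on a whole neighbourhood of
  \<open>C\<close>, so the differential of the sum vanishes there.\<close>

lemma bump_cover:
  assumes C: "compact (C :: 'x::topological_space set)"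
    and b: "!!p. p : C ==> EX b a N. P b a & open N & p : N & (ALL x:N. b x = (1::real))"
  obtains n b a N where "!!j. j < n ==> P (b j) (a j)" "open N" "C \<subseteq> N"
    "!!p. p : N ==> (SUM j<(n::nat). unity_part b j p) = 1"
proof -
  obtain b' a' N' where b': "!!p. p : C ==> P (b' p) (a' p) & open (N' p) & p : N' p & (ALL x:N' p. b' p x = 1)"
    using b by metis
  obtain D where D: "D \<subseteq> C" "finite D" "C \<subseteq> (UN c:D. N' c)"
    using compactE_image[OF C, of C N'] b' by blast
  obtain e where e: "bij_betw e {..<card D} D"
    using ex_bij_betw_nat_finite[OF D(2)] by (auto simp: atLeast0LessThan)
  show thesis
  proof (rule that[of "card D" "%j. b' (e j)" "%j. a' (e j)" "UN c:D. N' c"])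
    have eD: "e j : C" if "j < card D" for j using e D(1) that by (auto simp: bij_betw_def)
    show "P (b' (e j)) (a' (e j))" if "j < card D" for j using b' eD[OF that] by auto
    show "open (UN c:D. N' c)" using b' D(1) by auto
    show "C \<subseteq> (UN c:D. N' c)" by fact
    fix p assume "p : (UN c:D. N' c)"
    then obtain c where c: "c : D" "p : N' c" by auto
    then obtain j where "j < card D" "e j = c"
      using e by (metis bij_betw_imp_surj_on imageE lessThan_iff)
    then show "(SUM j<card D. unity_part (%j. b' (e j)) j p) = 1"
      using c b' D(1) by (intro sum_unity_part_eq_1[of j]) auto
  qed
qed

lemma continuous_unity_part:
  assumes "!!i. i <= j ==> continuous_on UNIV (b i)"
  shows "continuous_on UNIV (unity_part b j)"
  unfolding unity_part_def[abs_def] using assms by (intro continuous_intros) auto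

lemma csupp_unity_part:
  assumes "!!i. i < j ==> continuous_on UNIV (b i)" "csupp (b j) W"
  shows "csupp (unity_part b j) W"
  unfolding unity_part_def[abs_def] using assms by (intro csupp_mult continuous_intros) auto

lemma unity_part_range:
  assumes "!!i. i <= j ==> 0 <= b i p & b i p <= 1"
  shows "0 <= unity_part b j p & unity_part b j p <= 1"
proof -
  have "0 <= (PROD i<j. 1 - b i p)" "(PROD i<j. 1 - b i p) <= 1"
    using assms by (auto intro!: prod_nonneg prod_le_1)
  then show ?thesis using assms[of j] by (simp add: unity_part_def mult_le_one)
qed

section \<open>The global integral\<close>

locale weighted_atlas =
  fixes Q :: "('x::t2_space, 'm::{finite,wellorder}) wchart set"
  assumes valid: "q : Q ==> wvalid q"
    and compat: "q : Q ==> r : Q ==> wcompat q r"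
    and bump: "EX b q N. (q : Q & csupp b (wdom q) & (ALL x. 0 <= b x & b x <= 1)) & open N & (p::'x) : N & (ALL x:N. b x = 1)"
begin

text \<open>The weights have to add up to 1 only where \<open>f\<close> is nonzero, so finitely many
  suffice for compact support.\<close>

definition partition :: "nat => (nat => ('x, 'm) wchart) => (nat => 'x => real) => ('x => real) => bool" where
  "partition n q \<rho> f \<longleftrightarrow> (ALL j<n. q j : Q & csupp (\<rho> j) (wdom (q j)) & (ALL p. 0 <= \<rho> j p)) &
    (ALL p. f p ~= 0 --> (SUM j<n. \<rho> j p) = 1)"

definition wsum :: "nat => (nat => ('x, 'm) wchart) => (nat => 'x => real) => ('x => real) => real" where
  "wsum n q \<rho> f = (SUM j<n. wint (q j) (%p. \<rho> j p * f p))"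

text \<open>The value comes from an arbitrary partition; independence of the choice is
  \<open>I_eq\<close>.\<close>

definition I :: "('x => real) => real" where
  "I f = (SOME s. EX n q \<rho>. partition n q \<rho> f & s = wsum n q \<rho> f)"

lemma partition_exists:
  assumes "compact C"
  shows "EX n q \<rho>. ALL f. (ALL p. p ~: C --> f p = 0) --> partition n q \<rho> f"
proof -
  define P where "P b q \<longleftrightarrow> q : Q & csupp b (wdom q) & (ALL x. 0 <= b x & b x <= 1)" for b q
  have "EX b a N. P b a & open N & p : N & (ALL x:N. b x = 1)" for p using bump[of p] by (simp only: P_def)
  then obtain n b q N where *: "!!j. j < n ==> P (b j) (q j)" "C \<subseteq> N"
    "!!p. p : N ==> (SUM j<(n::nat). unity_part b j p) = 1"
    using bump_cover[OF assms, of P] by metis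
  have "partition n q (unity_part b) f" if "ALL p. p ~: C --> f p = 0" for f
    unfolding partition_def
  proof (intro conjI allI impI)
    fix j assume j: "j < n"
    show "q j : Q" using *(1)[OF j] by (simp add: P_def)
    show "csupp (unity_part b j) (wdom (q j))"
      using *(1) j by (intro csupp_unity_part) (auto simp: P_def csupp_def)
    show "0 <= unity_part b j p" for p
      using *(1) j by (intro unity_part_range[THEN conjunct1]) (simp add: P_def)
  qed (use *(2,3) that in blast)
  then show ?thesis by blast
qed

lemma wint_sum:
  fixes q :: "('x, 'm) wchart"
  assumes "wvalid q" "!!j. j : A ==> csupp (f j) (wdom q)"
  shows "wint q (%p. SUM j:A. f j p) = (SUM j:A. wint q (f j))"
  using assms(2)
proof (induction A rule: infinite_finite_induct)
  case (insert x A)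
  then show ?case by (simp add: wint_add[OF assms(1)] csupp_sum)
qed (simp_all add: wint_def wfun_zero)

text \<open>Insert both partitions and exchange the finite sums; each product is supported in the
  intersection of two charts, where compatibility applies. The charts \<open>r j\<close> may lie
  outside \<open>Q\<close>, and compact support is asked of \<open>\<sigma> j p * f p\<close> rather
  than of \<open>\<sigma> j\<close>.\<close>

lemma wsum_eq:
  assumes P: "partition n q \<rho> f"
    and r: "!!j. j < m ==> wvalid (r j)" "!!j a. j < m ==> a : Q ==> wcompat a (r j)"
      "!!j. j < m ==> csupp (%p. \<sigma> j p * f p) (wdom (r j))" "!!p. f p ~= 0 ==> (SUM j<(m::nat). \<sigma> j p) = 1"
  shows "wsum n q \<rho> f = (SUM j<m. wint (r j) (%p. \<sigma> j p * f p))"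
proof -
  have q: "!!j. j < n ==> q j : Q" "!!j. j < n ==> csupp (\<rho> j) (wdom (q j))"
    "!!p. f p ~= 0 ==> (SUM j<n. \<rho> j p) = 1" using P by (auto simp: partition_def)
  have fs: "f p = (SUM j<m. \<sigma> j p) * f p" "f p = (SUM j<n. \<rho> j p) * f p" for p
    using r(4)[of p] q(3)[of p] by (cases "f p = 0"; simp)+
  have cs: "csupp (%p. \<rho> i p * (\<sigma> j p * f p)) (wdom (q i) Int wdom (r j))" if "i < n" "j < m" for i j
    using csupp_Int[OF q(2)[OF that(1)] r(3)[OF that(2)]] .
  have cs': "csupp (%p. \<rho> i p * (\<sigma> j p * f p)) (wdom (q i))"
    "csupp (%p. \<rho> i p * (\<sigma> j p * f p)) (wdom (r j))" if "i < n" "j < m" for i j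
    using cs[OF that] by (auto elim: csupp_subset)
  have "wsum n q \<rho> f = (SUM i<n. wint (q i) (%p. SUM j<m. \<rho> i p * (\<sigma> j p * f p)))"
    unfolding wsum_def
    by (intro sum.cong refl arg_cong[of _ _ "wint _"] ext, subst fs(1))
      (simp add: sum_distrib_left sum_distrib_right mult.assoc)
  also have "... = (SUM i<n. SUM j<m. wint (q i) (%p. \<rho> i p * (\<sigma> j p * f p)))"
    using q(1) valid cs' by (intro sum.cong refl wint_sum) auto
  also have "... = (SUM i<n. SUM j<m. wint (r j) (%p. \<rho> i p * (\<sigma> j p * f p)))"
    using r(2) q(1) cs unfolding wcompat_def by (intro sum.cong refl) auto
  also have "... = (SUM j<m. wint (r j) (%p. SUM i<n. \<rho> i p * (\<sigma> j p * f p)))"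
    using r(1) cs' by (subst sum.swap) (auto intro!: sum.cong wint_sum[symmetric])
  also have "... = (SUM j<m. wint (r j) (%p. \<sigma> j p * f p))"
    by (intro sum.cong refl arg_cong[of _ _ "wint _"] ext, subst (2) fs(2))
      (simp add: sum_distrib_left sum_distrib_right mult_ac)
  finally show ?thesis .
qed

lemma I_eq:
  assumes P: "partition n q \<rho> f" and f: "continuous_on UNIV f" shows "I f = wsum n q \<rho> f"
  unfolding I_def
proof (rule some_equality)
  show "EX n' q' \<rho>'. partition n' q' \<rho>' f & wsum n q \<rho> f = wsum n' q' \<rho>' f" using P by blast
  fix s assume "EX n' q' \<rho>'. partition n' q' \<rho>' f & s = wsum n' q' \<rho>' f"
  then obtain n' q' \<rho>' where *: "partition n' q' \<rho>' f" "s = wsum n' q' \<rho>' f" by auto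
  have "wsum n q \<rho> f = (SUM j<n'. wint (q' j) (%p. \<rho>' j p * f p))"
    by (rule wsum_eq[OF P]) (use * f valid compat in \<open>auto simp: partition_def intro: csupp_mult\<close>)
  then show "s = wsum n q \<rho> f" using * by (simp add: wsum_def)
qed

text \<open>Additivity and monotonicity are read off from one partition adapted to both
  supports.\<close>

lemma common_partition:
  assumes "csupp f UNIV" "csupp h UNIV"
  shows "EX n q \<rho>. partition n q \<rho> f & partition n q \<rho> h & partition n q \<rho> (%p. f p + h p) &
    (ALL j<n. wvalid (q j) & csupp (%p. \<rho> j p * f p) (wdom (q j)) & csupp (%p. \<rho> j p * h p) (wdom (q j)))"
proof -
  obtain C D where C: "compact C" "!!p. p ~: C ==> f p = 0" "compact D" "!!p. p ~: D ==> h p = 0"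
    using assms unfolding csupp_def by auto
  obtain n q \<rho> where "ALL f. (ALL p. p ~: C Un D --> f p = 0) --> partition n q \<rho> f"
    using partition_exists[OF compact_Un[OF C(1,3)]] by blast
  then have "partition n q \<rho> f" "partition n q \<rho> h" "partition n q \<rho> (%p. f p + h p)" using C by simp_all
  moreover have "continuous_on UNIV f" "continuous_on UNIV h" using assms by (auto simp: csupp_def)
  ultimately show ?thesis
    by (intro exI[of _ n] exI[of _ q] exI[of _ \<rho>] conjI) (auto simp: partition_def intro: valid csupp_mult)
qed

lemma I_eq_sum:
  assumes f: "csupp f UNIV"
    and r: "!!j. j < m ==> wvalid (r j)" "!!j a. j < m ==> a : Q ==> wcompat a (r j)"
      "!!j. j < m ==> csupp (%p. \<sigma> j p * f p) (wdom (r j))" "!!p. f p ~= 0 ==> (SUM j<(m::nat). \<sigma> j p) = 1"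
  shows "I f = (SUM j<m. wint (r j) (%p. \<sigma> j p * f p))"
proof -
  obtain n q \<rho> where P: "partition n q \<rho> f" using common_partition[OF f f] by blast
  show ?thesis using I_eq[OF P] wsum_eq[OF P r] f by (simp add: csupp_def)
qed

lemma I_eq_wint:
  assumes f: "csupp f (wdom q)" and q: "q : Q" shows "I f = wint q f"
  using I_eq_sum[of f "Suc 0" "%j. q" "%j p. 1"] csupp_subset[OF f] f valid compat q by simp

lemma I_add:
  assumes "csupp f UNIV" "csupp h UNIV"
  shows "I (%p. f p + h p) = I f + I h"
proof -
  obtain n q \<rho> where P: "partition n q \<rho> f" "partition n q \<rho> h" "partition n q \<rho> (%p. f p + h p)"
    "ALL j<n. wvalid (q j) & csupp (%p. \<rho> j p * f p) (wdom (q j)) & csupp (%p. \<rho> j p * h p) (wdom (q j))"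
    using common_partition[OF assms] by blast
  have c: "continuous_on UNIV f" "continuous_on UNIV h" using assms by (auto simp: csupp_def)
  show ?thesis
    unfolding I_eq[OF P(1) c(1)] I_eq[OF P(2) c(2)] I_eq[OF P(3) continuous_on_add[OF c]] wsum_def
    using P(4-) by (simp add: distrib_left wint_add sum.distrib)
qed

lemma I_mono:
  assumes "csupp f UNIV" "csupp h UNIV" "!!p. f p <= h p" shows "I f <= I h"
proof -
  obtain n q \<rho> where P: "partition n q \<rho> f" "partition n q \<rho> h"
    "ALL j<n. wvalid (q j) & csupp (%p. \<rho> j p * f p) (wdom (q j)) & csupp (%p. \<rho> j p * h p) (wdom (q j))"
    using common_partition[OF assms(1,2)] by blast
  have c: "continuous_on UNIV f" "continuous_on UNIV h" using assms by (auto simp: csupp_def)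
  show ?thesis unfolding I_eq[OF P(1) c(1)] I_eq[OF P(2) c(2)] wsum_def
    using P assms(3) by (intro sum_mono wint_mono) (auto simp: partition_def intro: mult_left_mono)
qed

lemma I_cmult:
  assumes "csupp f UNIV" shows "I (%p. c * f p) = c * I f"
proof -
  obtain n q \<rho> where P: "partition n q \<rho> f" using common_partition[OF assms assms] by blast
  then have P': "partition n q \<rho> (%p. c * f p)" by (auto simp: partition_def)
  have cf: "continuous_on UNIV f" using assms by (auto simp: csupp_def)
  show ?thesis
    unfolding I_eq[OF P cf] I_eq[OF P' continuous_on_mult_left[OF cf]] wsum_def
    by (simp add: mult.left_commute[of _ c] sum_distrib_left wint_cmult)
qed

lemma I_zero: "I (%p. 0) = 0"
  using I_cmult[OF csupp_zero, of 0] by simp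

lemma I_sum: "(!!i. i : A ==> csupp (f i) UNIV) ==> I (%p. SUM i:A. f i p) = (SUM i:A. I (f i))"
  by (induction A rule: infinite_finite_induct) (auto simp: I_zero I_add csupp_sum)

end

section \<open>Smooth manifolds\<close>

lemma homeomorphism_open_image:
  assumes "homeomorphism S T f g" "open S" "open T" "open V" "V \<subseteq> S"
  shows "open (f ` V)"
proof -
  have "openin (top_of_set T) (f ` V)"
    by (rule homeomorphism_imp_open_map[OF assms(1)]) (use assms in \<open>simp add: openin_open_eq\<close>)
  then show ?thesis using assms(3) openin_open_trans by blast
qed

locale smooth_manifold =
  fixes A :: "('x::{t2_space,second_countable_topology}, 'e::euclidean_space) chart set"
  assumes atlas: "smooth_atlas A"
begin

lemma chart:
  assumes "c : A"
  shows "open (dom_of c)" "open (range_of c)" "homeomorphism (dom_of c) (range_of c) (coord c) (point c)"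
  using atlas assms by (auto simp: smooth_atlas_def)

lemma point_coord: "c : A ==> p : dom_of c ==> point c (coord c p) = p"
  using chart(3) by (rule homeomorphism_apply1)

lemma coord_point: "c : A ==> x : range_of c ==> coord c (point c x) = x"
  using chart(3) by (rule homeomorphism_apply2)

lemma point_in: "c : A ==> x : range_of c ==> point c x : dom_of c"
  using chart(3)[of c] by (auto simp: homeomorphism_def)

lemma coord_in: "p : dom_of c ==> coord c p : range_of c"
  by (auto simp: range_of_def)

lemma cover: obtains c where "c : A" "p : dom_of c"
  using atlas unfolding smooth_atlas_def by blast

lemma cont_coord: "c : A ==> continuous_on (dom_of c) (coord c)"
  and cont_point: "c : A ==> continuous_on (range_of c) (point c)"
  using chart(3) by (auto simp: homeomorphism_def)

lemma open_coord_image: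
  assumes c: "c : A" and V: "open V" shows "open (coord c ` (dom_of c Int V))"
  by (rule homeomorphism_open_image[OF chart(3)[OF c] chart(1)[OF c] chart(2)[OF c]])
    (simp_all add: chart(1)[OF c] V open_Int)

lemma open_point_image:
  assumes c: "c : A" and V: "open V" "V \<subseteq> range_of c" shows "open (point c ` V)"
  by (rule homeomorphism_open_image[OF homeomorphism_symD[OF chart(3)[OF c]] chart(2)[OF c] chart(1)[OF c] V])

lemma coord_image_eq:
  assumes c: "c : A" shows "coord c ` (dom_of c Int V) = range_of c Int point c -` V"
proof (intro equalityI subsetI)
  fix x assume "x : coord c ` (dom_of c Int V)"
  then obtain p where "p : dom_of c" "p : V" "x = coord c p" by auto
  then show "x : range_of c Int point c -` V" by (simp add: point_coord[OF c] coord_in)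
next
  fix x assume x: "x : range_of c Int point c -` V"
  then have "coord c (point c x) = x" "point c x : dom_of c Int V"
    using coord_point[OF c] point_in[OF c] by auto
  then show "x : coord c ` (dom_of c Int V)" by (metis imageI)
qed

lemma open_overlap: "c : A ==> d : A ==> open (overlap c d)"
  unfolding overlap_def by (rule open_coord_image) (auto intro: chart(1))

lemma overlap_iff: "c : A ==> x : overlap c d \<longleftrightarrow> x : range_of c & point c x : dom_of d"
  unfolding overlap_def by (simp add: coord_image_eq)

lemma overlapI: "p : dom_of c ==> p : dom_of d ==> coord c p : overlap c d"
  by (auto simp: overlap_def)

lemma transition_apply: "transition c d x = coord d (point c x)"
  by (simp add: transition_def)

lemma transition_coord: "c : A ==> p : dom_of c ==> transition c d (coord c p) = coord d p"
  by (simp add: transition_apply point_coord)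

lemma transition_in: "c : A ==> d : A ==> x : overlap c d ==> transition c d x : overlap d c"
  by (auto simp: overlap_def transition_coord)

lemma transition_inverse: "c : A ==> d : A ==> x : overlap c d ==> transition d c (transition c d x) = x"
  by (auto simp: overlap_def transition_coord)

lemma point_transition: "c : A ==> d : A ==> x : overlap c d ==> point d (transition c d x) = point c x"
  by (auto simp: overlap_def transition_coord point_coord)

lemma Ck_transition: "c : A ==> d : A ==> Ck_on k (overlap c d) (transition c d)"
  using atlas by (auto simp: smooth_atlas_def smooth_fun_on_def)

lemma diff_transition: "c : A ==> d : A ==> x : overlap c d ==> transition c d differentiable (at x)"
  using Ck_on_imp_differentiable[OF Ck_transition[of c d 1]] by simp

lemma dir_transition_inverse:
  assumes c: "c : A" "d : A" "x : overlap c d"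
  shows "dir (transition d c) (transition c d x) (dir (transition c d) x v) = v"
proof -
  have "dir (%y. transition d c (transition c d y)) x = dir (%y. y) x"
    by (rule dir_cong[OF open_overlap[OF c(1,2)] c(3)]) (rule transition_inverse[OF c(1,2)])
  moreover have "dir (%y. y) x = (%v. v)" by (rule dir_eqI) (rule has_derivative_ident)
  moreover have "dir (%y. transition d c (transition c d y)) x =
      (%v. dir (transition d c) (transition c d x) (dir (transition c d) x v))"
    by (rule dir_compose[of "transition c d" x "transition d c", OF diff_transition[OF c]
          diff_transition[OF c(2,1) transition_in[OF c]]])
  ultimately show ?thesis by (simp add: fun_eq_iff)
qed

lemma linear_transition: "c : A ==> d : A ==> x : overlap c d ==> linear (dir (transition c d) x)"
  by (intro dir_linear diff_transition)

lemma dir_scalar_transition: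
  fixes f :: "'x => 'f::euclidean_space"
  assumes c: "c : A" "d : A" "x : overlap c d" and f: "(f o point d) differentiable (at (transition c d x))"
  shows "dir (f o point c) x v = dir (f o point d) (transition c d x) (dir (transition c d) x v)"
    "(f o point c) differentiable (at x)"
proof -
  have e: "(f o point c) y = (f o point d) (transition c d y)" if "y : overlap c d" for y
    using point_transition[OF c(1,2) that] by simp
  have "dir (f o point c) x = dir (%y. (f o point d) (transition c d y)) x"
    by (rule dir_cong[OF open_overlap[OF c(1,2)] c(3) e])
  also have "... = (%v. dir (f o point d) (transition c d x) (dir (transition c d) x v))"
    by (rule dir_compose[of "transition c d" x "f o point d", OF diff_transition[OF c] f])
  finally show "dir (f o point c) x v = dir (f o point d) (transition c d x) (dir (transition c d) x v)" by simp
  have "(%y. (f o point d) (transition c d y)) differentiable (at x)"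
    using differentiable_chain_at[OF diff_transition[OF c] f] by (simp add: o_def)
  then show "(f o point c) differentiable (at x)"
    using differentiable_cong_open[OF open_overlap[OF c(1,2)] c(3), of "f o point c"
        "%y. (f o point d) (transition c d y)"] e by blast
qed

lemma smooth_scalarD: "smooth_scalar A f ==> c : A ==> Ck_on k (range_of c) (f o point c)"
  by (simp add: smooth_scalar_def smooth_fun_on_def)

lemma smooth_scalar_diff: "smooth_scalar A f ==> c : A ==> x : range_of c ==> (f o point c) differentiable (at x)"
  using Ck_on_imp_differentiable[OF smooth_scalarD[of f c 1]] by simp

lemma smooth_scalarI: "(!!c k. c : A ==> Ck_on k (range_of c) (%x. f (point c x))) ==> smooth_scalar A f"
  by (simp add: smooth_scalar_def smooth_fun_on_def o_def)

lemma smooth_scalarD': "smooth_scalar A f ==> c : A ==> Ck_on k (range_of c) (%x. f (point c x))"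
  using smooth_scalarD[of f c k] by (simp add: o_def)

lemma continuous_from_charts:
  fixes f :: "'x => 'f::topological_space"
  assumes "!!c. c : A ==> continuous_on (range_of c) (%x. f (point c x))"
  shows "continuous_on UNIV f"
proof -
  have "continuous_on (UN c:A. dom_of c) f"
  proof (rule continuous_on_open_UN)
    show "open (dom_of c)" if "c : A" for c using chart(1)[OF that] .
    show "continuous_on (dom_of c) f" if c: "c : A" for c
    proof -
      have "continuous_on (dom_of c) (%p. f (point c (coord c p)))"
        by (rule continuous_on_compose2[OF assms[OF c] cont_coord[OF c]]) (auto simp: range_of_def)
      then show ?thesis by (subst continuous_on_cong[OF refl, of _ _ "%p. f (point c (coord c p))"])
          (auto simp: point_coord[OF c])
    qed
  qed
  then show ?thesis using atlas by (simp add: smooth_atlas_def)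
qed

lemma smooth_scalar_continuous: "smooth_scalar A f ==> continuous_on UNIV f"
  by (rule continuous_from_charts) (use Ck_on_imp_continuous smooth_scalarD' in blast)

lemma smooth_scalar_const: "smooth_scalar A (%p. a)"
  by (rule smooth_scalarI) simp

lemma smooth_scalar_mult: "smooth_scalar A f ==> smooth_scalar A h ==> smooth_scalar A (%p. f p * h p)"
  by (rule smooth_scalarI, rule Ck_on_mult) (auto intro: chart(2) smooth_scalarD')

lemma smooth_scalar_add: "smooth_scalar A f ==> smooth_scalar A h ==> smooth_scalar A (%p. f p + h p)"
  by (rule smooth_scalarI, rule Ck_on_add) (auto intro: chart(2) smooth_scalarD')

lemma smooth_scalar_diff': "smooth_scalar A f ==> smooth_scalar A h ==> smooth_scalar A (%p. f p - h p)"
  by (rule smooth_scalarI, rule Ck_on_diff) (auto intro: chart(2) smooth_scalarD')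

lemma smooth_scalar_prod: "(!!i. i : I ==> smooth_scalar A (f i)) ==> smooth_scalar A (%p. PROD i:I. f i p)"
  by (rule smooth_scalarI, rule Ck_on_prod) (auto intro: chart(2) smooth_scalarD')

lemma smooth_scalar_compose:
  assumes "smooth_scalar A f" "!!k. Ck_on k UNIV (h :: real => real)"
  shows "smooth_scalar A (%p. h (f p))"
  by (rule smooth_scalarI, rule Ck_on_compose[OF _ smooth_scalarD'[OF assms(1)] assms(2)]) (auto intro: chart(2))

lemma smooth_unity_part:
  assumes "!!i. i <= j ==> smooth_scalar A (b i)"
  shows "smooth_scalar A (unity_part b j)"
  unfolding unity_part_def[abs_def] using assms
  by (intro smooth_scalar_mult smooth_scalar_prod smooth_scalar_diff' smooth_scalar_const) auto

text \<open>In the chart this is a smooth step of the squared distance from the centre; the square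
  avoids the singularity of the norm.\<close>

lemma bump_function:
  assumes p: "p : dom_of c" "c : A" and N: "open N" "p : N"
  obtains b C M where "smooth_scalar A b" "!!q. 0 <= b q & b q <= 1" "open M" "p : M" "!!q. q : M ==> b q = 1"
    "compact C" "C \<subseteq> dom_of c Int N" "!!q. q ~: C ==> b q = 0"
proof -
  define x0 where "x0 = coord c p"
  have x0: "x0 : coord c ` (dom_of c Int N)"
    unfolding x0_def by (rule imageI) (simp add: p N)
  obtain R where R: "R > 0" "cball x0 R \<subseteq> coord c ` (dom_of c Int N)"
    using open_contains_cball[THEN iffD1, OF open_coord_image[OF p(2) N(1)]] x0 by blast
  define r where "r = R / 2"
  have r: "r > 0" "cball x0 (2 * r) \<subseteq> coord c ` (dom_of c Int N)" using R by (auto simp: r_def)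
  then have r': "cball x0 (2 * r) \<subseteq> range_of c" by (auto simp: range_of_def)
  define \<phi> where "\<phi> x = smooth_step (((x - x0) \<bullet> (x - x0)) / r\<^sup>2)" for x
  define b where "b q = (if q : dom_of c then \<phi> (coord c q) else 0)" for q
  define C where "C = point c ` cball x0 (2 * r)"
  have C: "compact C" unfolding C_def
    by (intro compact_continuous_image continuous_on_subset[OF cont_point[OF p(2)]] compact_cball r')
  have CN: "C \<subseteq> dom_of c Int N" using r(2) point_coord[OF p(2)] by (force simp: C_def)
  \<comment> \<open>Outside the doubled ball the argument of the step exceeds 4, well beyond the
    point 2 from which on it vanishes.\<close>
  have ss: "\<phi> x = 0" if "2 * r < dist x0 x" for x
  proof -
    have "2 * r\<^sup>2 <= (2 * r)\<^sup>2" using r(1) by (simp add: power_mult_distrib)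
    also have "... <= (norm (x - x0))\<^sup>2"
      using that r(1) by (intro power_mono) (auto simp: dist_norm norm_minus_commute)
    finally show ?thesis unfolding \<phi>_def dot_square_norm using r(1) by (intro smooth_step_0) (simp add: field_simps)
  qed
  have b0: "b q = 0" if "q ~: C" for q
  proof (cases "q : dom_of c")
    case True
    then have "coord c q ~: cball x0 (2 * r)" using that point_coord[OF p(2) True] by (force simp: C_def)
    then show ?thesis using ss by (simp add: b_def)
  qed (simp add: b_def)
  have s\<phi>: "Ck_on k UNIV \<phi>" for k
    unfolding \<phi>_def[abs_def]
    by (intro Ck_on_compose[OF _ _ Ck_on_smooth_step] Ck_on_divide Ck_on_inner Ck_on_diff Ck_on_const
        Ck_on_bounded_linear bounded_linear_ident) (use r in auto)
  show thesis
  proof (rule that[of b "point c ` ball x0 r" C])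
    show "smooth_scalar A b"
    proof (rule smooth_scalarI, rule Ck_on_local)
      fix d k x assume d: "d : A" "x : range_of d"
      \<comment> \<open>In another chart the bump is locally either \<open>\<phi>\<close> after a
        transition map or, away from the compact set \<open>C\<close>, identically zero.\<close>
      show "EX V. open V & x : V & Ck_on k V (%x. b (point d x))"
      proof (cases "point d x : dom_of c")
        case True
        have "Ck_on k (overlap d c) (%y. \<phi> (transition d c y))"
          by (rule Ck_on_compose[OF open_overlap[OF d(1) p(2)] Ck_transition[OF d(1) p(2)] s\<phi>]) simp
        moreover have "\<phi> (transition d c y) = b (point d y)" if "y : overlap d c" for y
          using that overlap_iff[OF d(1), of y c] by (simp add: b_def transition_apply)
        ultimately have "Ck_on k (overlap d c) (%x. b (point d x))"
          using Ck_on_cong[OF open_overlap[OF d(1) p(2)], of "%y. \<phi> (transition d c y)" "%x. b (point d x)" k] by simp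
        then show ?thesis
          using True d overlap_iff[OF d(1), of x c] open_overlap[OF d(1) p(2)] by blast
      next
        case False
        define V where "V = range_of d Int point d -` (- C)"
        have "open V" unfolding V_def coord_image_eq[OF d(1), symmetric]
          using open_coord_image[OF d(1), of "- C"] compact_imp_closed[OF C] by (simp add: open_Compl)
        moreover have "Ck_on k V (%x. b (point d x))"
          using Ck_on_cong[OF `open V`, of "%x. 0" "%x. b (point d x)" k] b0 by (auto simp: V_def)
        moreover have "x : V" using d(2) CN False by (auto simp: V_def)
        ultimately show ?thesis by blast
      qed
    qed
    show "open (point c ` ball x0 r)" using r(1) r' by (intro open_point_image p) auto
    show "p : point c ` ball x0 r" using imageI[of "coord c p" "ball x0 r" "point c"] r(1)
      by (simp add: point_coord[OF p(2,1)] x0_def)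
    show "0 <= b q & b q <= 1" for q using smooth_step_range by (simp add: b_def \<phi>_def)
    fix q assume "q : point c ` ball x0 r"
    then obtain x where x: "x : ball x0 r" "q = point c x" by auto
    then have xr: "x : range_of c" using r(1) r' by auto
    have "(norm (x - x0))\<^sup>2 <= r\<^sup>2" using x r(1) by (intro power_mono) (auto simp: dist_norm norm_minus_commute)
    then have "\<phi> x = 1" unfolding \<phi>_def dot_square_norm using r(1) by (intro smooth_step_1) (simp add: field_simps)
    then show "b q = 1" using x(2) xr point_in[OF p(2)] coord_point[OF p(2)] by (simp add: b_def)
  qed (use C CN b0 in auto)
qed

lemma tensor_transition:
  "tensor_field A k T ==> c : A ==> d : A ==> x : overlap c d ==> length vs = k ==>
    T c x vs = T d (transition c d x) (map (dir (transition c d) x) vs)"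
  unfolding tensor_field_def by blast

lemma tensor_smooth: "tensor_field A k T ==> c : A ==> length vs = k ==> Ck_on j (range_of c) (%x. T c x vs)"
  unfolding tensor_field_def smooth_fun_on_def by blast

lemma tensor1_linear:
  assumes "tensor_field A 1 T" "c : A" "x : range_of c" shows "linear (%v. T c x [v])"
proof -
  have "linear (%v. T c x ([0][0 := v]))" using assms unfolding tensor_field_def
    by (metis One_nat_def length_Cons list.size(3) zero_less_one)
  then show ?thesis by simp
qed

lemma tensor2_linear:
  assumes "tensor_field A 2 T" "c : A" "x : range_of c"
  shows "linear (%u. T c x [u, v])" "linear (%v. T c x [u, v])"
proof -
  have l: "linear (%w. T c x (vs[i := w]))" if "length vs = 2" "i < 2" for vs i
    using assms that unfolding tensor_field_def by blast
  show "linear (%u. T c x [u, v])" using l[of "[0, v]" 0] by simp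
  show "linear (%v. T c x [u, v])" using l[of "[u, 0]" 1] by simp
qed

lemma ext_deriv_1:
  "c : A ==> x : range_of c ==>
    ext_deriv A 1 \<eta> c x [u, v] = dir (%y. \<eta> c y [v]) x u - dir (%y. \<eta> c y [u]) x v"
  by (simp add: ext_deriv_def)

lemma ext_deriv_2:
  "c : A ==> x : range_of c ==>
    ext_deriv A 2 \<eta> c x [u, v, w] = dir (%y. \<eta> c y [v, w]) x u - dir (%y. \<eta> c y [u, w]) x v
      + dir (%y. \<eta> c y [u, v]) x w"
  by (simp add: ext_deriv_def numeral_2_eq_2)

text \<open>Polarisation of the vanishing on equal arguments.\<close>

lemma form2_skew:
  assumes "diff_form A 2 \<alpha>" "c : A" "x : range_of c" shows "\<alpha> c x [u, v] = - \<alpha> c x [v, u]"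
proof -
  have z: "\<alpha> c x [w, w] = 0" for w
    using assms(1)[unfolded diff_form_def, THEN conjunct2, rule_format, of "[w, w]" 0 1 c x] by simp
  note l = tensor2_linear[OF _ assms(2,3), of \<alpha>]
  have t: "tensor_field A 2 \<alpha>" using assms(1) by (simp add: diff_form_def)
  have "\<alpha> c x [u + v, u + v] = \<alpha> c x [u, u] + \<alpha> c x [u, v] + (\<alpha> c x [v, u] + \<alpha> c x [v, v])"
    using linear_add[OF l(1)[OF t], of u v "u + v"] linear_add[OF l(2)[OF t, of u], of u v]
      linear_add[OF l(2)[OF t, of v], of u v] by simp
  then show ?thesis using z by simp
qed

end

text \<open>Integrals and determinants are taken in \<open>real ^ 'm\<close>; an enumeration of the
  basis identifies any Euclidean space of that dimension with it.\<close>

definition emb :: "('m::finite => 'e::euclidean_space) => real ^ 'm => 'e" where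
  "emb \<iota> y = (SUM i:UNIV. (y $ i) *\<^sub>R \<iota> i)"

definition unemb :: "('m::finite => 'e::euclidean_space) => 'e => real ^ 'm" where
  "unemb \<iota> v = (\<chi> i. v \<bullet> \<iota> i)"

lemma emb_unemb:
  assumes "bij_betw (\<iota> :: 'm::finite => 'e::euclidean_space) UNIV Basis"
  shows "emb \<iota> (unemb \<iota> v) = v" "unemb \<iota> (emb \<iota> y) = y" "emb \<iota> (axis i 1) = \<iota> i"
proof -
  have B: "\<iota> i : Basis" "\<iota> i = \<iota> j \<longleftrightarrow> i = j" for i j using assms by (auto simp: bij_betw_def inj_def)
  show "emb \<iota> (unemb \<iota> v) = v"
    using basis_reindex[OF assms, of "%b. (v \<bullet> b) *\<^sub>R b"] by (simp add: emb_def unemb_def euclidean_representation)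
  have "(SUM j:UNIV. (y $ j) *\<^sub>R \<iota> j) \<bullet> \<iota> i = (SUM j:UNIV. if j = i then y $ i else 0)" for i
    unfolding inner_sum_left by (intro sum.cong refl) (use B in \<open>auto simp: inner_Basis\<close>)
  then show "unemb \<iota> (emb \<iota> y) = y" by (simp add: emb_def unemb_def vec_eq_iff)
  have "emb \<iota> (axis i 1) = (SUM j:UNIV. if j = i then \<iota> i else 0)"
    unfolding emb_def by (intro sum.cong refl) (auto simp: axis_def)
  then show "emb \<iota> (axis i 1) = \<iota> i" by simp
qed

lemma linear_emb: "linear (emb \<iota>)"
  by (rule linearI) (simp_all add: emb_def algebra_simps sum.distrib scaleR_sum_right)

lemma linear_unemb: "linear (unemb \<iota>)"
  by (rule linearI) (simp_all add: unemb_def vec_eq_iff inner_add_left)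

lemmas bounded_linear_emb = linear_emb[THEN linear_conv_bounded_linear[THEN iffD1]]
lemmas bounded_linear_unemb = linear_unemb[THEN linear_conv_bounded_linear[THEN iffD1]]

lemma emb_homeomorphism:
  assumes "bij_betw (\<iota> :: 'm::finite => 'e::euclidean_space) UNIV Basis"
  shows "homeomorphism S (unemb \<iota> ` S) (unemb \<iota>) (emb \<iota>)"
  by (rule homeomorphismI)
    (auto simp: emb_unemb[OF assms] intro!: linear_continuous_on bounded_linear_emb bounded_linear_unemb)

lemma unemb_image:
  assumes "bij_betw (\<iota> :: 'm::finite => 'e::euclidean_space) UNIV Basis"
  shows "unemb \<iota> ` S = emb \<iota> -` S"
proof (intro equalityI subsetI)
  fix y assume "y : emb \<iota> -` S"
  then have "y = unemb \<iota> (emb \<iota> y)" "emb \<iota> y : S" by (simp_all add: emb_unemb[OF assms])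
  then show "y : unemb \<iota> ` S" by (metis imageI)
qed (auto simp: emb_unemb[OF assms])

lemma open_unemb_image:
  assumes "bij_betw (\<iota> :: 'm::finite => 'e::euclidean_space) UNIV Basis" "open S"
  shows "open (unemb \<iota> ` S)"
  unfolding unemb_image[OF assms(1)]
  by (intro open_vimage assms(2) linear_continuous_on bounded_linear_emb)

text \<open>The Riemannian density of \<open>h\<close>. The inverse \<open>\<psi>\<close> is passed
  separately because charts pushed forward from the cylinder have an inverse that is not given as
  \<open>point c\<close>.\<close>

definition metric_wchart ::
  "('m::finite => 'e::euclidean_space) => ('x, 'e) chart => ('e => 'x) => ('e => 'e bilin) => ('x, 'm) wchart" where
  "metric_wchart \<iota> c \<psi> h = (dom_of c, %p. unemb \<iota> (coord c p), %y. \<psi> (emb \<iota> y),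
     %y. sqrt (det (gmat \<iota> (h (emb \<iota> y)))))"

lemma metric_wchart_simps:
  "wdom (metric_wchart \<iota> c \<psi> h) = dom_of c" "wcoord (metric_wchart \<iota> c \<psi> h) p = unemb \<iota> (coord c p)"
  "wpoint (metric_wchart \<iota> c \<psi> h) y = \<psi> (emb \<iota> y)"
  "wdens (metric_wchart \<iota> c \<psi> h) y = sqrt (det (gmat \<iota> (h (emb \<iota> y))))"
  "wcoord (metric_wchart \<iota> c \<psi> h) ` S = unemb \<iota> ` coord c ` S"
  by (auto simp: metric_wchart_def wdom_def wcoord_def wpoint_def wdens_def)

lemma wvalid_metric_wchart:
  assumes \<iota>: "bij_betw (\<iota> :: 'm::finite => 'e::euclidean_space) UNIV Basis"
    and c: "open (dom_of c)" "open (range_of c)" "homeomorphism (dom_of c) (range_of c) (coord c) \<psi>"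
    and h: "!!x. x : range_of c ==> posdef (h x)" "!!u v. continuous_on (range_of c) (%x. h x u v)"
  shows "wvalid (metric_wchart \<iota> c \<psi> h)"
proof -
  define q where "q = metric_wchart \<iota> c \<psi> h"
  have im: "wcoord q ` wdom q = unemb \<iota> ` range_of c" by (simp add: q_def metric_wchart_simps range_of_def image_image)
  have w: "wcoord q = unemb \<iota> o coord c" "wpoint q = \<psi> o emb \<iota>"
    by (auto simp: q_def metric_wchart_simps)
  have e: "emb \<iota> y : range_of c" if "y : unemb \<iota> ` range_of c" for y using that by (auto simp: emb_unemb[OF \<iota>])
  have "homeomorphism (wdom q) (unemb \<iota> ` range_of c) (wcoord q) (wpoint q)" unfolding w
    using homeomorphism_compose[OF c(3) emb_homeomorphism[OF \<iota>]] by (simp add: q_def metric_wchart_simps)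
  moreover have "continuous_on (unemb \<iota> ` range_of c) (wdens q)"
  proof -
    have "continuous_on (unemb \<iota> ` range_of c) (%y. h (emb \<iota> y) u v)" for u v
      by (rule continuous_on_compose2[OF h(2) linear_continuous_on[OF bounded_linear_emb]]) (use e in auto)
    then show ?thesis unfolding q_def metric_wchart_simps(4)[abs_def] det_def gmat_def
      by (auto intro!: continuous_intros simp: metric_wchart_simps)
  qed
  ultimately show ?thesis
    unfolding wvalid_def q_def[symmetric] im using c(1) open_unemb_image[OF \<iota> c(2)] det_gmat_pos[OF \<iota> h(1)] e
    by (auto simp: q_def metric_wchart_simps)
qed

lemma matrix_emb:
  assumes \<iota>: "bij_betw (\<iota> :: 'm::finite => 'e::euclidean_space) UNIV Basis"
  shows "matrix (%y. unemb \<iota>' (f (emb \<iota> y))) = lmat \<iota> \<iota>' f"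
  by (simp add: matrix_def lmat_def vec_eq_iff emb_unemb[OF \<iota>] unemb_def)

text \<open>As \<open>h\<close> is the pullback of \<open>h'\<close>, the Gram determinants differ
  by the squared Jacobian, whose root is the factor in the change of variables.\<close>

lemma wcompat_metric_wchart:
  assumes \<iota>: "bij_betw (\<iota> :: 'm::{finite,wellorder} => 'e::euclidean_space) UNIV Basis"
    and \<iota>': "bij_betw (\<iota>' :: 'm => 'f::euclidean_space) UNIV Basis"
    and valid: "wvalid (metric_wchart \<iota> c \<psi> h)" "wvalid (metric_wchart \<iota>' d \<psi>' h' :: ('x::t2_space, 'm) wchart)"
    and T: "!!x. x : coord c ` (dom_of c Int dom_of d) ==> ((%x. coord d (\<psi> x)) has_derivative T' x) (at x)"
      "!!x u v. x : coord c ` (dom_of c Int dom_of d) ==> h x u v = h' (coord d (\<psi> x)) (T' x u) (T' x v)"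
    and h': "!!x. x : coord c ` (dom_of c Int dom_of d) ==> posdef (h' (coord d (\<psi> x)))"
  shows "wcompat (metric_wchart \<iota> c \<psi> h) (metric_wchart \<iota>' d \<psi>' h')"
proof (rule wcompatI[OF valid, where T' = "%y z. unemb \<iota>' (T' (emb \<iota> y) (emb \<iota> z))"], unfold metric_wchart_simps)
  fix y assume "y : unemb \<iota> ` coord c ` (dom_of c Int dom_of d)"
  then have x: "emb \<iota> y : coord c ` (dom_of c Int dom_of d)" by (auto simp: emb_unemb[OF \<iota>])
  have "((%y. coord d (\<psi> (emb \<iota> y))) has_derivative (%z. T' (emb \<iota> y) (emb \<iota> z))) (at y)"
    using diff_chain_at[OF bounded_linear_imp_has_derivative[OF bounded_linear_emb] T(1)[OF x]] by (simp add: o_def)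
  from bounded_linear.has_derivative[OF bounded_linear_unemb this]
  show "((%y. unemb \<iota>' (coord d (\<psi> (emb \<iota> y)))) has_derivative (%z. unemb \<iota>' (T' (emb \<iota> y) (emb \<iota> z)))) (at y)" .
  have "h (emb \<iota> y) = (%u v. h' (coord d (\<psi> (emb \<iota> y))) (T' (emb \<iota> y) u) (T' (emb \<iota> y) v))"
    using T(2)[OF x] by (intro ext)
  then have "det (gmat \<iota> (h (emb \<iota> y))) = (det (lmat \<iota> \<iota>' (T' (emb \<iota> y))))\<^sup>2 * det (gmat \<iota>' (h' (coord d (\<psi> (emb \<iota> y)))))"
    using det_gmat_pullback[OF \<iota>' posdefD(1,2)[OF h'[OF x]], of \<iota> "T' (emb \<iota> y)"] by simp
  then show "sqrt (det (gmat \<iota> (h (emb \<iota> y)))) = \<bar>det (matrix (%z. unemb \<iota>' (T' (emb \<iota> y) (emb \<iota> z))))\<bar> *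
      sqrt (det (gmat \<iota>' (h' (emb \<iota>' (unemb \<iota>' (coord d (\<psi> (emb \<iota> y))))))))"
    by (simp add: real_sqrt_mult matrix_emb[OF \<iota>] emb_unemb[OF \<iota>'])
qed

section \<open>The ratio of the volume forms\<close>

lemma vector_smult_Re_Im: "z *s u = Re z *\<^sub>R u + Im z *\<^sub>R mulI u" for u :: "complex ^ 'n"
  by (simp add: vec_eq_iff complex_eq_iff)

lemma norm_vector_smult: "norm (z *s u) = cmod z * norm u" for u :: "complex ^ 'n"
proof -
  have "L2_set (%i. cmod z * cmod (u $ i)) UNIV = cmod z * L2_set (%i. cmod (u $ i)) UNIV"
    by (simp add: L2_set_right_distrib)
  then show ?thesis by (simp add: norm_vec_def norm_mult)
qed

text \<open>On a complex line a pluriharmonic function is the real part of a holomorphic function \<open>P\<close>,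
  and the maximum modulus principle applies to \<open>exp P\<close>.\<close>

lemma pluriharmonic_maximum:
  fixes f :: "complex ^ 'n => real"
  assumes f: "Ck_on 2 (ball x0 r) f"
    and ph: "!!x v w. x : ball x0 r ==>
      dir (%y. dir f y w) x v + dir (%y. dir f y (mulI w)) x (mulI v) = 0"
    and max: "!!x. x : ball x0 r ==> f x <= f x0" and x: "x : ball x0 r"
  shows "f x = f x0"
proof (cases "x = x0")
  case False
  define u where "u = x - x0"
  have u: "norm u > 0" "norm u < r" using False x by (auto simp: u_def dist_norm norm_minus_commute)
  \<comment> \<open>The complex line through \<open>x0\<close> and \<open>x\<close> meets the ball
    in a disc. Parametrised with \<open>x\<close> at 1, its radius exceeds 1.\<close>
  define R where "R = r / norm u"
  have R: "R > 1" using u by (simp add: R_def)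
  define S where "S = ball (0::complex) R"
  have S: "open S" "convex S" "connected S" "0 : S" "1 : S" using R by (auto simp: S_def)
  define l where "l z = x0 + z *s u" for z
  have lS: "l z : ball x0 r" if "z : S" for z
    using that u by (simp add: l_def S_def dist_norm norm_vector_smult R_def field_simps)
  have dl: "(l has_derivative (%w. w *s u)) (at z)" for z
  proof -
    have "bounded_linear (%w::complex. w *s u)"
      unfolding linear_conv_bounded_linear[symmetric]
      by (rule linearI) (simp_all add: vec_eq_iff algebra_simps)
    from has_derivative_add[OF has_derivative_const bounded_linear_imp_has_derivative[OF this]]
    show ?thesis unfolding l_def[abs_def] by simp
  qed
  have fd: "f differentiable (at y)" "(%y. dir f y v) differentiable (at y)" if "y : ball x0 r" for y v
    using f that by (auto simp: numeral_2_eq_2)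
  \<comment> \<open>The prospective derivative of \<open>P\<close>. Its Cauchy-Riemann equations are
    pluriharmonicity and the symmetry of second derivatives.\<close>
  define G where "G z = Complex (dir f (l z) u) (- dir f (l z) (mulI u))" for z
  have dG: "(G has_field_derivative Complex (dir (%y. dir f y u) (l z) u) (- dir (%y. dir f y (mulI u)) (l z) u)) (at z)"
    if z: "z : S" for z
  proof -
    define A where "A v w = dir (%y. dir f y v) (l z) w" for v w
    have lA: "linear (A v)" for v unfolding A_def[abs_def] using dir_linear[OF fd(2)[OF lS[OF z]]] by simp
    have Aw: "A v (w *s u) = Re w * A v u + Im w * A v (mulI u)" for v w
      by (subst vector_smult_Re_Im) (simp add: linear_add[OF lA] linear_scale[OF lA])
    have d: "((%z. dir f (l z) v) has_derivative (%w. A v (w *s u))) (at z)" for v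
      using diff_chain_at[OF dl dir_works[OF fd(2)[OF lS[OF z]]]] by (simp add: o_def A_def)
    have s: "A u (mulI u) = A (mulI u) u"
      unfolding A_def by (rule dir_dir_commute[OF open_ball lS[OF z] f])
    have t: "A (mulI u) (mulI u) = - A u u" using ph[OF lS[OF z], of u u] by (simp add: A_def)
    have "((%z. Complex (dir f (l z) u) (- dir f (l z) (mulI u))) has_derivative
        (%w. Complex (A u (w *s u)) (- A (mulI u) (w *s u)))) (at z)"
      unfolding Complex_eq
      by (intro has_derivative_add has_derivative_mult_right has_derivative_of_real has_derivative_minus d)
    moreover have "Complex (A u (w *s u)) (- A (mulI u) (w *s u)) = Complex (A u u) (- A (mulI u) u) * w" for w
      unfolding Aw[of u w] Aw[of "mulI u" w] s t by (simp add: complex_eq_iff algebra_simps)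
    ultimately show ?thesis by (simp add: has_field_derivative_def G_def[abs_def] A_def)
  qed
  then have "G holomorphic_on S" using S(1) holomorphic_on_open by blast
  then obtain P where P: "!!z. z : S ==> (P has_field_derivative G z) (at z within S)"
    using holomorphic_convex_primitive'[OF S(2,1)] by blast
  have P': "(P has_field_derivative G z) (at z)" if "z : S" for z
    using P[OF that] at_within_open[OF that S(1)] by simp
  have "((%z. f (l z) - Re (P z)) has_derivative (%w. 0)) (at z within S)" if z: "z : S" for z
  proof -
    have 1: "((%z. f (l z)) has_derivative (%w. dir f (l z) (w *s u))) (at z)"
      using diff_chain_at[OF dl dir_works[OF fd(1)[OF lS[OF z]]]] by (simp add: o_def)
    have 2: "((%z. Re (P z)) has_derivative (%w. Re (G z * w))) (at z)"
      by (intro bounded_linear.has_derivative[OF bounded_linear_Re])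
        (use P'[OF z] in \<open>simp add: has_field_derivative_def\<close>)
    have "dir f (l z) (w *s u) = Re (G z * w)" for w
      unfolding G_def using dir_linear[OF fd(1)[OF lS[OF z]]]
      by (subst vector_smult_Re_Im) (simp add: linear_add linear_scale mult.commute)
    then show ?thesis using has_derivative_diff[OF 1 2] by (simp add: has_derivative_at_withinI)
  qed
  then obtain k where k: "!!z. z : S ==> f (l z) - Re (P z) = k"
    using has_derivative_zero_constant[OF S(2), of "%z. f (l z) - Re (P z)"] by blast
  define E where "E z = exp (P z)" for z
  have E: "cmod (E z) = exp (f (l z) - k)" if "z : S" for z using k[OF that] by (simp add: E_def algebra_simps)
  have "E holomorphic_on S" unfolding E_def
    using P' by (intro holomorphic_intros) (auto simp: holomorphic_on_open[OF S(1)])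
  moreover have "cmod (E z) <= cmod (E 0)" if "z : S" for z
    using max[OF lS[OF that]] E[OF that] E[OF S(4)] by (simp add: l_def)
  ultimately have "E constant_on S"
    using maximum_modulus_principle[OF _ S(1,3) S(1) _ S(4)] by blast
  then have "E 1 = E 0" using S by (auto simp: constant_on_def)
  then have "f (l 1) = f (l 0)" using E[OF S(4)] E[OF S(5)] by simp
  then show ?thesis by (simp add: l_def u_def)
qed simp

context smooth_manifold
begin

text \<open>Glues chart representatives into one function; the chosen chart is irrelevant once they
  agree on overlaps.\<close>

definition scalar_fun :: "(('x, 'e) chart => 'e => 'f) => 'x => 'f" where
  "scalar_fun s p = s (SOME c. c : A & p : dom_of c) (coord (SOME c. c : A & p : dom_of c) p)"

lemma scalar_fun_eq:
  assumes "!!c d x. c : A ==> d : A ==> x : overlap c d ==> s c x = s d (transition c d x)"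
    and c: "c : A" "p : dom_of c"
  shows "scalar_fun s p = s c (coord c p)"
proof -
  define d where "d = (SOME c. c : A & p : dom_of c)"
  have d: "d : A" "p : dom_of d"
    using someI[of "%c. c : A & p : dom_of c" c] c by (auto simp: d_def)
  have "s d (coord d p) = s c (transition d c (coord d p))"
    by (rule assms(1)[OF d(1) c(1) overlapI[OF d(2) c(2)]])
  then show ?thesis unfolding scalar_fun_def d_def[symmetric] by (simp add: transition_coord[OF d])
qed

lemma scalar_fun_point:
  assumes "!!c d x. c : A ==> d : A ==> x : overlap c d ==> s c x = s d (transition c d x)"
    and c: "c : A" "x : range_of c"
  shows "scalar_fun s (point c x) = s c x"
  using scalar_fun_eq[OF assms(1) c(1) point_in[OF c]] coord_point[OF c] by simp

text \<open>Coordinate balls are connected, so the manifold is locally connected.\<close>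

lemma open_connected_component: "open (connected_component_set UNIV (p::'x))"
proof (subst open_subopen, intro ballI)
  fix q assume q: "q : connected_component_set UNIV p"
  obtain c where c: "c : A" "q : dom_of c" using cover .
  obtain r where r: "r > 0" "ball (coord c q) r \<subseteq> range_of c"
    using chart(2)[OF c(1)] coord_in[OF c(2)] open_contains_ball by blast
  define V where "V = point c ` ball (coord c q) r"
  have "connected V" unfolding V_def
    by (intro connected_continuous_image continuous_on_subset[OF cont_point[OF c(1)]] connected_ball r)
  moreover have qV: "q : V" unfolding V_def
    using imageI[of "coord c q" "ball (coord c q) r" "point c"] r(1) by (simp add: point_coord[OF c])
  ultimately have "V \<subseteq> connected_component_set UNIV q" by (intro connected_component_maximal) auto
  moreover have "connected_component_set UNIV q = connected_component_set UNIV p"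
    using q by (simp add: connected_component_eq)
  moreover have "open V" unfolding V_def by (intro open_point_image c r open_ball)
  ultimately show "EX T. open T & q : T & T \<subseteq> connected_component_set UNIV p" using qV by blast
qed

text \<open>A positive value makes the supremum over the component a maximum attained on a compact
  set, and the maximum points form an open and closed subset. The component may be compact, so the
  conclusion is constancy rather than vanishing.\<close>

lemma vanishing_at_infinity_maximum:
  fixes F :: "'x => real"
  assumes F: "continuous_on UNIV F"
    and inf: "!!e. e > 0 ==> EX L. compact L & (ALL p. p ~: L --> \<bar>F p\<bar> < e)"
    and max: "!!N q. open N ==> q : N ==> (!!p. p : N ==> F p <= F q) ==>
      EX M. open M & q : M & (ALL p:M. F p = F q)"
    and q: "F q > 0" "q : connected_component_set UNIV p"
  shows "F p = F q"
proof -
  define C where "C = connected_component_set UNIV p"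
  have C: "open C" "closed C" "connected C" "p : C" "q : C"
    using open_connected_component[of p] closed_connected_component[of UNIV p] q(2)
    by (auto simp: C_def)
  obtain L where L: "compact L" "!!p. p ~: L ==> \<bar>F p\<bar> < F q" using inf[OF q(1)] by blast
  define K where "K = L Int C"
  have K: "compact K" unfolding K_def using L(1) C(2) by (rule compact_Int_closed)
  have "q : K" using L(2)[of q] C(5) q(1) by (auto simp: K_def)
  then obtain z where z: "z : K" "!!y. y : K ==> F y <= F z"
    using continuous_attains_sup[OF K _ continuous_on_subset[OF F]] by blast
  have zC: "F y <= F z" if "y : C" for y
  proof (cases "y : L")
    case True
    then show ?thesis using z(2) that by (simp add: K_def)
  next
    case False
    then have "F y < F q" using L(2) by fastforce
    also have "... <= F z" using z(2) `q : K` by simp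
    finally show ?thesis by simp
  qed
  have op: "open (C Int {y. F y = F z})"
  proof (subst open_subopen, intro ballI)
    fix y assume y: "y : C Int {y. F y = F z}"
    then have yC: "y : C" and yz: "F y = F z" by simp_all
    have "EX M. open M & y : M & (ALL p:M. F p = F y)"
      by (rule max[OF C(1) yC]) (simp add: yz zC)
    then obtain M where M: "open M" "y : M" "!!p. p : M ==> F p = F z" unfolding yz by blast
    have "M Int C \<subseteq> C Int {y. F y = F z}" using M(3) by blast
    then show "EX T. open T & y : T & T \<subseteq> C Int {y. F y = F z}"
      using open_Int[OF M(1) C(1)] M(2) yC by blast
  qed
  have op2: "open {y. F y ~= F z}" by (rule open_Collect_neq[OF F continuous_on_const])
  have e: "C Int {y. F y ~= F z} = {}"
  proof (rule ccontr)
    assume "~ ?thesis"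
    then have "{y. F y ~= F z} Int C ~= {}" by (simp add: Int_commute)
    moreover have "z : (C Int {y. F y = F z}) Int C" using z(1) by (simp add: K_def)
    then have "(C Int {y. F y = F z}) Int C ~= {}" by blast
    moreover have "(C Int {y. F y = F z}) Int {y. F y ~= F z} Int C = {}" by auto
    moreover have "C \<subseteq> (C Int {y. F y = F z}) Un {y. F y ~= F z}" by auto
    ultimately show False using connectedD[OF C(3) op op2] by blast
  qed
  have "F y = F z" if "y : C" for y
  proof (rule ccontr)
    assume "F y ~= F z"
    then have "y : C Int {y. F y ~= F z}" using that by simp
    then show False unfolding e by simp
  qed
  then show ?thesis using C(4,5) by simp
qed

end

definition kmet :: "('x, complex ^ 'n) tensor => ('x, complex ^ 'n) chart => complex ^ 'n => (complex ^ 'n) bilin" where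
  "kmet \<omega> c x u v = \<omega> c x [u, mulI v]"

text \<open>Naturality of index raising; it makes \<open>wfield\<close> compatible with changes of
  charts.\<close>

lemma raise_pullback:
  assumes h: "posdef h" and g: "posdef g" "!!u v. g u v = h (L u) (L v)" and L: "surj L" and n: "linear n"
    and m: "!!w. m w = n (L w)" "linear m"
  shows "L (raise g m) = raise h n"
proof (rule raise_unique[OF h, symmetric])
  fix w
  obtain w' where w: "w = L w'" using L by auto
  have "h (L (raise g m)) (L w') = m w'" by (metis g(2) raise_works[OF g(1) m(2)])
  then show "h (L (raise g m)) w = n w" by (simp add: w m)
qed

section \<open>Two Kaehler forms on one complex manifold\<close>

locale kaehler_pair = smooth_manifold A
  for A :: "('x::{t2_space,second_countable_topology}, complex ^ 'n) chart set" +
  fixes \<omega> \<omega>' :: "('x, complex ^ 'n) tensor" and \<iota> :: "'m::{finite,wellorder} => complex ^ 'n"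
  assumes holo: "c : A ==> d : A ==> x : overlap c d ==>
      dir (transition c d) x (mulI v) = mulI (dir (transition c d) x v)"
    and kaehler: "kaehler_form A \<omega>" "kaehler_form A \<omega>'"
    and \<iota>: "bij_betw \<iota> UNIV Basis"
begin

lemma kaehler_chart:
  assumes k: "kaehler_form A \<alpha>" and c: "c : A"
  shows "kaehler_chart (range_of c) (\<alpha> c) \<iota>"
proof -
  have df: "diff_form A 2 \<alpha>" and ed: "ext_deriv A 2 \<alpha> = zero_tensor"
    using k by (auto simp: kaehler_form_def closed_form_def)
  then have t: "tensor_field A 2 \<alpha>" by (simp add: diff_form_def)
  have 1: "Ck_on k (range_of c) (%x. \<alpha> c x [u, v])" for k u v using tensor_smooth[OF t c] by simp
  note 2 = tensor2_linear[OF t c] and 3 = form2_skew[OF df c]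
  have 4: "\<alpha> c x [mulI u, mulI v] = \<alpha> c x [u, v]" if "x : range_of c" for x u v
    using k c that by (auto simp: kaehler_form_def)
  have 5: "\<alpha> c x [u, mulI u] > 0" if "x : range_of c" "u ~= 0" for x u
    using k c that by (auto simp: kaehler_form_def)
  have 6: "dir (%y. \<alpha> c y [v, w]) x u - dir (%y. \<alpha> c y [u, w]) x v + dir (%y. \<alpha> c y [u, v]) x w = 0"
    if "x : range_of c" for x u v w
    using ext_deriv_2[OF c that, of \<alpha> u v w] by (simp add: ed zero_tensor_def)
  show ?thesis
    by (rule kaehler_chart.intro) (fact \<iota> chart(2)[OF c] 1 2 3 4 5 6)+
qed

lemma kaehler_chart_g: "kaehler_form A \<alpha> ==> c : A ==> kaehler_chart.g (\<alpha> c) = kmet \<alpha> c"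
  using kaehler_chart.g_def[OF kaehler_chart] by (auto simp: fun_eq_iff kmet_def)

lemma kaehler_chart_gt: "kaehler_form A \<alpha> ==> c : A ==> kaehler_chart.gt (\<alpha> c) = kaehler_metric_of \<alpha> c"
  using kaehler_chart.gt_def[OF kaehler_chart] by (simp add: kaehler_metric_of_def)

lemma posdef_kmet: "kaehler_form A \<alpha> ==> c : A ==> x : range_of c ==> posdef (kmet \<alpha> c x)"
  using kaehler_chart.posdef_g[OF kaehler_chart] kaehler_chart_g by metis

lemma kmet_mulI: "kaehler_form A \<alpha> ==> c : A ==> x : range_of c ==> kmet \<alpha> c x (mulI u) (mulI v) = kmet \<alpha> c x u v"
  using kaehler_chart.g_mulI[OF kaehler_chart] kaehler_chart_g by metis

lemma smooth_kmet: "kaehler_form A \<alpha> ==> c : A ==> Ck_on k (range_of c) (%x. kmet \<alpha> c x u v)"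
  using kaehler_chart.smooth_g[OF kaehler_chart] kaehler_chart_g by metis

lemma overlap_range: "c : A ==> x : overlap c d ==> x : range_of c"
  by (simp add: overlap_iff)

lemma transition_range: "c : A ==> d : A ==> x : overlap c d ==> transition c d x : range_of d"
  using transition_in overlap_range by blast

lemma kmet_transition:
  assumes k: "kaehler_form A \<alpha>" and c: "c : A" "d : A" "x : overlap c d"
  shows "kmet \<alpha> c x u v = kmet \<alpha> d (transition c d x) (dir (transition c d) x u) (dir (transition c d) x v)"
proof -
  have t: "tensor_field A 2 \<alpha>" using k by (auto simp: kaehler_form_def closed_form_def diff_form_def)
  show ?thesis using tensor_transition[OF t c, of "[u, mulI v]"] holo[OF c] by (simp add: kmet_def)
qed

definition lnvol :: "('x, complex ^ 'n) tensor => ('x, complex ^ 'n) chart => complex ^ 'n => real" where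
  "lnvol \<alpha> c x = ln (det (gmat \<iota> (kmet \<alpha> c x)))"

lemma kaehler_chart_lndet: "kaehler_form A \<alpha> ==> c : A ==> kaehler_chart.lndet (\<alpha> c) \<iota> = lnvol \<alpha> c"
  using kaehler_chart.lndet_def[OF kaehler_chart] kaehler_chart_g by (auto simp: fun_eq_iff lnvol_def)

lemma smooth_lnvol: "kaehler_form A \<alpha> ==> c : A ==> Ck_on k (range_of c) (lnvol \<alpha> c)"
  using kaehler_chart.smooth_lndet[OF kaehler_chart] kaehler_chart_lndet by metis

definition lnratio :: "('x, complex ^ 'n) chart => complex ^ 'n => real" where
  "lnratio c x = lnvol \<omega>' c x - lnvol \<omega> c x"

text \<open>The Jacobian term does not depend on \<open>\<alpha>\<close>, so it cancels in
  \<open>lnratio\<close>.\<close>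

lemma lnvol_transition:
  assumes k: "kaehler_form A \<alpha>" and c: "c : A" "d : A" "x : overlap c d"
  shows "lnvol \<alpha> c x = ln ((det (lmat \<iota> \<iota> (dir (transition c d) x)))\<^sup>2) + lnvol \<alpha> d (transition c d x)"
proof -
  have p: "posdef (kmet \<alpha> d (transition c d x))" "posdef (kmet \<alpha> c x)"
    using posdef_kmet[OF k] c overlap_range transition_range by auto
  have "kmet \<alpha> c x = (%u v. kmet \<alpha> d (transition c d x) (dir (transition c d) x u) (dir (transition c d) x v))"
    using kmet_transition[OF k c] by (intro ext)
  then have e: "det (gmat \<iota> (kmet \<alpha> c x)) =
      (det (lmat \<iota> \<iota> (dir (transition c d) x)))\<^sup>2 * det (gmat \<iota> (kmet \<alpha> d (transition c d x)))"
    using det_gmat_pullback[OF \<iota> posdefD(1,2)[OF p(1)], of \<iota> "dir (transition c d) x"] by simp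
  have "det (gmat \<iota> (kmet \<alpha> c x)) > 0" "det (gmat \<iota> (kmet \<alpha> d (transition c d x))) > 0"
    using det_gmat_pos[OF \<iota>] p by auto
  then have "(det (lmat \<iota> \<iota> (dir (transition c d) x)))\<^sup>2 > 0" unfolding e by (simp add: zero_less_mult_iff)
  then show ?thesis unfolding lnvol_def e using `det (gmat \<iota> (kmet \<alpha> d (transition c d x))) > 0`
    by (simp add: ln_mult_pos)
qed

lemma lnratio_transition: "c : A ==> d : A ==> x : overlap c d ==> lnratio c x = lnratio d (transition c d x)"
  using lnvol_transition[OF kaehler(1)] lnvol_transition[OF kaehler(2)] by (simp add: lnratio_def)

definition volratio :: "'x => real" where "volratio = scalar_fun lnratio"

lemma volratio_point: "c : A ==> x : range_of c ==> volratio (point c x) = lnratio c x"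
  unfolding volratio_def by (rule scalar_fun_point[OF lnratio_transition])

lemma smooth_lnratio: "c : A ==> Ck_on k (range_of c) (lnratio c)"
  unfolding lnratio_def[abs_def] by (intro Ck_on_diff chart smooth_lnvol kaehler)

lemma lnratio_pluriharmonic:
  assumes ric: "ricci_flat A (kaehler_metric_of \<omega>)" "ricci_flat A (kaehler_metric_of \<omega>')"
    and c: "c : A" "x : range_of c"
  shows "dir (%y. dir (lnratio c) y w) x v + dir (%y. dir (lnratio c) y (mulI w)) x (mulI v) = 0"
proof -
  have ph: "dir (%y. dir (lnvol \<alpha> c) y w) x v + dir (%y. dir (lnvol \<alpha> c) y (mulI w)) x (mulI v) = 0"
    if k: "kaehler_form A \<alpha>" and r: "ricci_flat A (kaehler_metric_of \<alpha>)" for \<alpha>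
    using kaehler_chart.pluriharmonic_lndet[OF kaehler_chart[OF k c(1)] c(2), of w v] r c
    unfolding kaehler_chart_gt[OF k c(1)] kaehler_chart_lndet[OF k c(1)] ricci_flat_def by blast
  have d: "lnvol \<alpha> c differentiable (at y)" "(%y. dir (lnvol \<alpha> c) y v) differentiable (at y)"
    if "kaehler_form A \<alpha>" "y : range_of c" for \<alpha> y v
    using smooth_lnvol[OF that(1) c(1), of 2] that(2) by (auto simp: numeral_2_eq_2)
  have "dir (%y. dir (lnratio c) y w) x v = dir (%y. dir (lnvol \<omega>' c) y w) x v - dir (%y. dir (lnvol \<omega> c) y w) x v" for w v
  proof -
    have "dir (lnratio c) y = (%w. dir (lnvol \<omega>' c) y w - dir (lnvol \<omega> c) y w)" if "y : range_of c" for y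
      unfolding lnratio_def[abs_def] by (intro dir_eqI has_derivative_diff dir_works d kaehler that)
    then have "dir (%y. dir (lnratio c) y w) x = dir (%y. dir (lnvol \<omega>' c) y w - dir (lnvol \<omega> c) y w) x"
      by (intro dir_cong[OF chart(2)[OF c(1)] c(2)]) simp
    also have "... = (%v. dir (%y. dir (lnvol \<omega>' c) y w) x v - dir (%y. dir (lnvol \<omega> c) y w) x v)"
      by (intro dir_eqI has_derivative_diff dir_works d kaehler c)
    finally show ?thesis by simp
  qed
  then show ?thesis using ph[OF kaehler(1) ric(1)] ph[OF kaehler(2) ric(2)] by simp
qed

text \<open>The factor \<open>s\<close> turns minima into maxima, so that one statement covers both
  signs of the ratio.\<close>

lemma local_maximum_volratio:
  assumes ric: "ricci_flat A (kaehler_metric_of \<omega>)" "ricci_flat A (kaehler_metric_of \<omega>')"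
    and N: "open N" "q : N" and max: "!!p. p : N ==> s * volratio p <= s * volratio q"
  shows "EX M. open M & q : M & (ALL p:M. s * volratio p = s * volratio q)"
proof -
  obtain c where c: "c : A" "q : dom_of c" using cover .
  have qN: "coord c q : coord c ` (dom_of c Int N)" using c N by simp
  obtain r where r: "r > 0" "ball (coord c q) r \<subseteq> coord c ` (dom_of c Int N)"
    using open_contains_ball[THEN iffD1, OF open_coord_image[OF c(1) N(1)]] qN by blast
  have br: "ball (coord c q) r \<subseteq> range_of c" using r(2) by (auto simp: range_of_def)
  define f where "f x = s * lnratio c x" for x
  have fv: "f x = s * volratio (point c x)" if "x : ball (coord c q) r" for x
    using volratio_point[OF c(1)] that br by (auto simp: f_def)
  have sm: "Ck_on k (ball (coord c q) r) f" for k unfolding f_def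
    by (intro Ck_on_cmult open_ball Ck_on_subset[OF smooth_lnratio[OF c(1)] br])
  have d: "lnratio c differentiable (at y)" "(%y. dir (lnratio c) y v) differentiable (at y)" if "y : range_of c" for y v
    using smooth_lnratio[OF c(1), of 2] that by (auto simp: numeral_2_eq_2)
  have ff: "dir (%y. dir f y w) x v = s * dir (%y. dir (lnratio c) y w) x v" if "x : ball (coord c q) r" for x v w
  proof -
    have "dir f y = (%w. s * dir (lnratio c) y w)" if "y : ball (coord c q) r" for y
      unfolding f_def[abs_def] using d(1) that br by (intro dir_eqI has_derivative_mult_right dir_works) auto
    then have "dir (%y. dir f y w) x = dir (%y. s * dir (lnratio c) y w) x"
      by (intro dir_cong[OF open_ball that]) simp
    also have "... = (%v. s * dir (%y. dir (lnratio c) y w) x v)"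
      using d(2) that br by (intro dir_eqI has_derivative_mult_right dir_works) auto
    finally show ?thesis by simp
  qed
  have const: "f x = f (coord c q)" if "x : ball (coord c q) r" for x
  proof (rule pluriharmonic_maximum[OF sm _ _ that])
    fix x assume x: "x : ball (coord c q) r"
    then have "x : range_of c" using br by blast
    from lnratio_pluriharmonic[OF ric c(1) this]
    show "dir (%y. dir f y w) x v + dir (%y. dir f y (mulI w)) x (mulI v) = 0" for v w
      unfolding ff[OF x] distrib_left[symmetric] by simp
    have "point c x : N" using x r(2) coord_image_eq[OF c(1), of N] by auto
    then show "f x <= f (coord c q)" using max[of "point c x"] fv[OF x] fv[of "coord c q"] r(1)
      by (simp add: point_coord[OF c])
  qed
  have e: "s * volratio (point c x) = s * volratio q" if "x : ball (coord c q) r" for x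
  proof -
    have "s * volratio (point c x) = f x" using fv[OF that] by simp
    also have "f x = f (coord c q)" by (rule const[OF that])
    also have "... = s * volratio q" using fv[of "coord c q"] r(1) by (simp add: point_coord[OF c])
    finally show ?thesis .
  qed
  show ?thesis
  proof (intro exI[of _ "point c ` ball (coord c q) r"] conjI)
    show "open (point c ` ball (coord c q) r)" by (rule open_point_image[OF c(1) open_ball br])
    show "q : point c ` ball (coord c q) r"
      using imageI[of "coord c q" "ball (coord c q) r" "point c"] r(1) by (simp add: point_coord[OF c])
  qed (use e in auto)
qed

text \<open>The maximum principle makes the ratio constant on every component where it is somewhere
  nonzero, and on the others it is zero. Equality of the derivatives is the form in which the
  divergence formula uses this.\<close>

theorem volratio_locally_constant:
  assumes ric: "ricci_flat A (kaehler_metric_of \<omega>)" "ricci_flat A (kaehler_metric_of \<omega>')"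
    and inf: "!!e. e > 0 ==> EX L. compact L & (ALL p. p ~: L --> \<bar>volratio p\<bar> < e)"
    and c: "c : A" "x : range_of c"
  shows "dir (lnvol \<omega>' c) x v = dir (lnvol \<omega> c) x v"
proof -
  define p where "p = point c x"
  define C where "C = connected_component_set UNIV p"
  have cont: "continuous_on UNIV volratio"
    by (rule continuous_from_charts)
      (subst continuous_on_cong[OF refl volratio_point], auto intro: Ck_on_imp_continuous smooth_lnratio)
  have *: "volratio a = volratio b" if b: "b : connected_component_set UNIV a" "volratio b ~= 0" for a b
  proof -
    \<comment> \<open>The sign makes the value at \<open>b\<close> positive, as the maximum
      principle demands.\<close>
    define s where "s = sgn (volratio b)"
    have s: "\<bar>s\<bar> = 1" "s * volratio b > 0" using b(2) by (auto simp: s_def sgn_if)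
    have "s * volratio a = s * volratio b"
    proof (rule vanishing_at_infinity_maximum[where F = "%p. s * volratio p", OF _ _ _ s(2) b(1)])
      show "continuous_on UNIV (%p. s * volratio p)" by (intro continuous_intros cont)
      show "EX L. compact L & (ALL p. p ~: L --> \<bar>s * volratio p\<bar> < e)" if "e > 0" for e
        using inf[OF that] s(1) by (simp add: abs_mult)
    qed (use local_maximum_volratio[OF ric] s(1) in auto)
    then show ?thesis using s(1) by auto
  qed
  \<comment> \<open>If one of the two values is nonzero, the preceding fact applies with that point
    as \<open>b\<close>.\<close>
  have "volratio q = volratio p" if q: "q : C" for q
    using *[of q p] *[of p q] q by (metis C_def connected_component_sym mem_Collect_eq)
  then have const: "lnratio c y = volratio p" if "y : range_of c" "point c y : C" for y
    using volratio_point[OF c(1) that(1)] that(2) by simp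
  define V where "V = range_of c Int point c -` C"
  have V: "open V" unfolding V_def coord_image_eq[OF c(1), symmetric] C_def
    by (intro open_coord_image c open_connected_component)
  have xV: "x : V" using c(2) by (simp add: V_def C_def p_def)
  have d: "lnvol \<alpha> c differentiable (at x)" if "kaehler_form A \<alpha>" for \<alpha>
    using smooth_lnvol[OF that c(1), of 1] c(2) by auto
  have "dir (lnratio c) x = dir (%y. volratio p) x"
    by (rule dir_cong[OF V xV]) (simp add: V_def const)
  then have "dir (lnratio c) x v = 0" by (simp add: frechet_derivative_const)
  moreover have "dir (lnratio c) x = (%v. dir (lnvol \<omega>' c) x v - dir (lnvol \<omega> c) x v)"
    unfolding lnratio_def[abs_def] by (intro dir_eqI has_derivative_diff dir_works d kaehler)
  ultimately show ?thesis by simp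
qed

end

section \<open>Divergence and flux\<close>

context smooth_manifold
begin

text \<open>One derivative is what is available for the function that corrects \<open>\<eta>\<close>
  on the end.\<close>

definition C1_scalar :: "('x => real) => bool" where
  "C1_scalar f \<longleftrightarrow> (ALL c:A. Ck_on 1 (range_of c) (f o point c))"

lemma C1_scalar_diff: "C1_scalar f ==> c : A ==> x : range_of c ==> (f o point c) differentiable (at x)"
  by (simp add: C1_scalar_def)

lemma smooth_imp_C1: "smooth_scalar A f ==> C1_scalar f"
  unfolding C1_scalar_def using smooth_scalarD by blast

lemma C1_scalarD: "C1_scalar f ==> c : A ==> Ck_on 1 (range_of c) (%x. f (point c x))"
  unfolding C1_scalar_def o_def by blast

lemma C1_scalar_mult: "C1_scalar f ==> C1_scalar h ==> C1_scalar (%p. f p * h p)"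
  unfolding C1_scalar_def o_def by (intro ballI Ck_on_mult chart(2)) blast+

lemma C1_scalar_continuous: "C1_scalar f ==> continuous_on UNIV f"
  by (rule continuous_from_charts, rule Ck_on_imp_continuous, rule C1_scalarD)

definition dsc :: "('x => real) => ('x, 'e) chart => 'e => 'e => real" where
  "dsc f c x v = dir (f o point c) x v"

text \<open>A 1-form without any regularity, so that differentials of merely C^1 functions are
  included.\<close>

definition covec :: "(('x, 'e) chart => 'e => 'e => real) => bool" where
  "covec \<beta> \<longleftrightarrow> (ALL c:A. ALL x:range_of c. linear (\<beta> c x)) &
     (ALL c:A. ALL d:A. ALL x:overlap c d. ALL v. \<beta> c x v = \<beta> d (transition c d x) (dir (transition c d) x v))"

lemma covec_dsc: assumes "C1_scalar f" shows "covec (dsc f)"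
  unfolding covec_def
proof (intro conjI ballI allI)
  show "linear (dsc f c x)" if "c : A" "x : range_of c" for c x
    unfolding dsc_def[abs_def] using dir_linear[OF C1_scalar_diff[OF assms that]] by simp
  fix c d x v assume c: "c : A" "d : A" "x : overlap c d"
  have "(f o point d) differentiable (at (transition c d x))"
    using C1_scalar_diff[OF assms c(2)] transition_in[OF c] overlap_iff[OF c(2)] by blast
  from dir_scalar_transition(1)[OF c this]
  show "dsc f c x v = dsc f d (transition c d x) (dir (transition c d) x v)" by (simp add: dsc_def)
qed

lemma dsc_zero:
  assumes C: "closed C" "!!p. p ~: C ==> f p = k" and c: "c : A" "x : range_of c" "point c x ~: C"
  shows "dsc f c x v = 0"
proof -
  have V: "open (coord c ` (dom_of c Int - C))" using C(1) by (intro open_coord_image c) auto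
  have "x : coord c ` (dom_of c Int - C)" unfolding coord_image_eq[OF c(1)] using c by simp
  then have "dir (f o point c) x = dir (%_. k) x"
    by (rule dir_cong[OF V]) (use C(2) in \<open>auto simp: coord_image_eq[OF c(1)]\<close>)
  then show ?thesis by (simp add: dsc_def frechet_derivative_const)
qed

lemma dsc_sum:
  fixes f :: "nat => 'x => real"
  assumes N: "open N" "!!p. p : N ==> h p = (SUM j<n. f j p)" and f: "!!j. j < n ==> C1_scalar (f j)"
    and c: "c : A" "x : range_of c" "point c x : N"
  shows "dsc h c x v = (SUM j<n. dsc (f j) c x v)"
proof -
  have V: "open (coord c ` (dom_of c Int N))" by (intro open_coord_image c N)
  have "x : coord c ` (dom_of c Int N)" unfolding coord_image_eq[OF c(1)] using c by simp
  then have "dir (h o point c) x = dir (%y. SUM j<n. (f j o point c) y) x"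
    by (rule dir_cong[OF V]) (use N(2) in \<open>auto simp: coord_image_eq[OF c(1)]\<close>)
  also have "... = (%v. SUM j<n. dir (f j o point c) x v)"
    by (intro dir_eqI has_derivative_sum dir_works C1_scalar_diff f c) auto
  finally show ?thesis by (simp add: dsc_def)
qed

end

section \<open>The vector field \<open>W\<close> of a 1-form and its divergence\<close>

locale exact_kaehler_pair = kaehler_pair A \<omega> \<omega>' \<iota>
  for A :: "('x::{t2_space,second_countable_topology}, complex ^ 'n) chart set"
    and \<omega> \<omega>' :: "('x, complex ^ 'n) tensor" and \<iota> :: "'m::{finite,wellorder} => complex ^ 'n" +
  fixes \<eta> :: "('x, complex ^ 'n) tensor"
  assumes form_eta: "diff_form A 1 \<eta>" and d_eta: "diff_tensor \<omega> \<omega>' = ext_deriv A 1 \<eta>"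
    and same_volume: "c : A ==> x : range_of c ==> dir (lnvol \<omega>' c) x v = dir (lnvol \<omega> c) x v"
begin

definition wq :: "('x, complex ^ 'n) chart => ('x, 'm) wchart" where
  "wq c = metric_wchart \<iota> c (point c) (kmet \<omega> c)"

lemma wvalid_wq: "c : A ==> wvalid (wq c)"
  unfolding wq_def
  by (intro wvalid_metric_wchart \<iota> chart posdef_kmet kaehler(1) Ck_on_imp_continuous[OF smooth_kmet[OF kaehler(1), of _ 0]])

lemma wdom_wq: "wdom (wq c) = dom_of c"
  by (simp add: wq_def metric_wchart_simps)

lemma wcompat_wq: assumes c: "c : A" "d : A" shows "wcompat (wq c) (wq d)"
  unfolding wq_def
proof (rule wcompat_metric_wchart[OF \<iota> \<iota>, where T' = "%x. dir (transition c d) x"])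
  show "wvalid (metric_wchart \<iota> c (point c) (kmet \<omega> c))" "wvalid (metric_wchart \<iota> d (point d) (kmet \<omega> d))"
    using wvalid_wq c by (auto simp: wq_def)
  fix x assume "x : coord c ` (dom_of c Int dom_of d)"
  then have x: "x : overlap c d" by (simp add: overlap_def)
  show "((%x. coord d (point c x)) has_derivative dir (transition c d) x) (at x)"
    using dir_works[OF diff_transition[OF c x]] by (simp add: transition_def o_def)
  show "kmet \<omega> c x u v = kmet \<omega> d (coord d (point c x)) (dir (transition c d) x u) (dir (transition c d) x v)" for u v
    using kmet_transition[OF kaehler(1) c x] by (simp add: transition_apply)
  show "posdef (kmet \<omega> d (coord d (point c x)))"
    using posdef_kmet[OF kaehler(1) c(2) transition_range[OF c x]] by (simp add: transition_apply)
qed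

sublocale weighted_atlas "wq ` A"
proof
  show "wvalid q" if "q : wq ` A" for q using that wvalid_wq by auto
  show "wcompat q r" if "q : wq ` A" "r : wq ` A" for q r using that wcompat_wq by auto
  fix p
  obtain c where c: "c : A" "p : dom_of c" using cover .
  obtain b C M where b: "smooth_scalar A b" "open M" "p : M" "!!q. q : M ==> b q = 1"
    "compact C" "C \<subseteq> dom_of c Int UNIV" "!!q. q ~: C ==> b q = 0" and br: "!!q. 0 <= b q & b q <= 1"
    using bump_function[OF c(2,1) open_UNIV UNIV_I] by metis
  have "csupp b (wdom (wq c))" unfolding csupp_def wdom_wq
    using b(5-7) smooth_scalar_continuous[OF b(1)] by auto
  then show "EX b q N. (q : wq ` A & csupp b (wdom q) & (ALL x. 0 <= b x & b x <= 1)) & open N & p : N & (ALL x:N. b x = 1)"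
    using b br c by (intro exI[of _ b] exI[of _ "wq c"] exI[of _ M]) auto
qed

text \<open>The vector field \<open>W = g\<^sup>-\<^sup>1(\<beta> J) - g'\<^sup>-\<^sup>1(\<beta> J)\<close> of a \<open>1\<close>-form \<open>\<beta>\<close>.\<close>

definition wfield :: "(('x, complex ^ 'n) chart => complex ^ 'n => complex ^ 'n => real) =>
    ('x, complex ^ 'n) chart => complex ^ 'n => complex ^ 'n" where
  "wfield \<beta> c x = raise (kmet \<omega> c x) (%w. \<beta> c x (mulI w)) - raise (kmet \<omega>' c x) (%w. \<beta> c x (mulI w))"

text \<open>The integrand of the flux; \<open>PF\<close> is its chart-free version.\<close>

definition pairing :: "('x => real) => (('x, complex ^ 'n) chart => complex ^ 'n => complex ^ 'n => real) =>
    ('x, complex ^ 'n) chart => complex ^ 'n => real" where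
  "pairing f \<beta> c x = dsc f c x (wfield \<beta> c x)"

definition PF :: "('x => real) => (('x, complex ^ 'n) chart => complex ^ 'n => complex ^ 'n => real) => 'x => real" where
  "PF f \<beta> = scalar_fun (pairing f \<beta>)"

lemma wfield_transition:
  assumes \<beta>: "covec \<beta>" and c: "c : A" "d : A" "x : overlap c d"
  shows "dir (transition c d) x (wfield \<beta> c x) = wfield \<beta> d (transition c d x)"
proof -
  note l = linear_transition[OF c]
  have cx: "x : range_of c" and dx: "transition c d x : range_of d"
    using overlap_range transition_range c by auto
  have s: "surj (dir (transition c d) x)"
  proof (rule surjI)
    show "dir (transition c d) x (dir (transition d c) (transition c d x) w) = w" for w
      using dir_transition_inverse[OF c(2,1) transition_in[OF c], of w] by (simp add: transition_inverse[OF c])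
  qed
  have lc: "linear (%w. \<beta> c x (mulI w))" and ld: "linear (%w. \<beta> d (transition c d x) (mulI w))"
  proof -
    have "linear (\<beta> c x)" "linear (\<beta> d (transition c d x))" using \<beta> c cx dx unfolding covec_def by blast+
    from this[THEN linear_compose[OF linear_mulI]]
    show "linear (%w. \<beta> c x (mulI w))" "linear (%w. \<beta> d (transition c d x) (mulI w))"
      by (simp_all add: o_def)
  qed
  have "dir (transition c d) x (raise (kmet \<alpha> c x) (%w. \<beta> c x (mulI w))) =
      raise (kmet \<alpha> d (transition c d x)) (%w. \<beta> d (transition c d x) (mulI w))" if k: "kaehler_form A \<alpha>" for \<alpha>
  proof (rule raise_pullback[OF posdef_kmet[OF k c(2) dx] posdef_kmet[OF k c(1) cx] _ s ld _ lc])
    show "kmet \<alpha> c x u v = kmet \<alpha> d (transition c d x) (dir (transition c d) x u) (dir (transition c d) x v)" for u v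
      by (rule kmet_transition[OF k c])
    show "\<beta> c x (mulI w) = \<beta> d (transition c d x) (mulI (dir (transition c d) x w))" for w
      using \<beta> c unfolding holo[OF c, symmetric] covec_def by blast
  qed
  from this[OF kaehler(1)] this[OF kaehler(2)]
  show ?thesis unfolding wfield_def linear_diff[OF l] by simp
qed

lemma pairing_transition:
  assumes f: "C1_scalar f" and \<beta>: "covec \<beta>" and c: "c : A" "d : A" "x : overlap c d"
  shows "pairing f \<beta> c x = pairing f \<beta> d (transition c d x)"
  using covec_dsc[OF f] c unfolding pairing_def wfield_transition[OF \<beta> c, symmetric] covec_def by blast

lemma PF_point:
  assumes "C1_scalar f" "covec \<beta>" "c : A" "x : range_of c"
  shows "PF f \<beta> (point c x) = pairing f \<beta> c x"
  unfolding PF_def by (rule scalar_fun_point[OF pairing_transition[OF assms(1,2)] assms(3,4)])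

lemma PF_coord:
  assumes "C1_scalar f" "covec \<beta>" "c : A" "p : dom_of c"
  shows "PF f \<beta> p = pairing f \<beta> c (coord c p)"
  using PF_point[OF assms(1-3) coord_in[OF assms(4)]] point_coord[OF assms(3,4)] by simp

definition C1_covec :: "(('x, complex ^ 'n) chart => complex ^ 'n => complex ^ 'n => real) => bool" where
  "C1_covec \<beta> \<longleftrightarrow> covec \<beta> & (ALL c:A. ALL v. Ck_on 1 (range_of c) (%x. \<beta> c x v))"

lemma C1_covec_dsc: "smooth_scalar A f ==> C1_covec (dsc f)"
  unfolding C1_covec_def
proof (intro conjI ballI allI)
  assume f: "smooth_scalar A f"
  show "covec (dsc f)" by (rule covec_dsc[OF smooth_imp_C1[OF f]])
  show "Ck_on 1 (range_of c) (%x. dsc f c x v)" if "c : A" for c v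
    unfolding dsc_def using smooth_scalarD[OF f that, of "Suc 1"] by (rule Ck_on_dir)
qed

definition etac :: "('x, complex ^ 'n) chart => complex ^ 'n => complex ^ 'n => real" where
  "etac c x v = \<eta> c x [v]"

lemma C1_covec_eta: "C1_covec etac"
  unfolding C1_covec_def covec_def etac_def[abs_def]
proof (intro conjI ballI allI)
  have t: "tensor_field A 1 \<eta>" using form_eta by (simp add: diff_form_def)
  show "linear (%v. \<eta> c x [v])" if "c : A" "x : range_of c" for c x by (rule tensor1_linear[OF t that])
  show "Ck_on 1 (range_of c) (%x. \<eta> c x [v])" if "c : A" for c v by (rule tensor_smooth[OF t that]) simp
  show "\<eta> c x [v] = \<eta> d (transition c d x) [dir (transition c d) x v]"
    if "c : A" "d : A" "x : overlap c d" for c d x v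
    using tensor_transition[OF t that, of "[v]"] by simp
qed

lemma smooth_wfield:
  assumes \<beta>: "C1_covec \<beta>" and c: "c : A"
  shows "Ck_on 1 (range_of c) (wfield \<beta> c)"
proof -
  have l: "linear (%w. \<beta> c x (mulI w))" if "x : range_of c" for x
    using linear_compose[OF linear_mulI] \<beta> c that by (auto simp: C1_covec_def covec_def o_def)
  have s: "Ck_on 1 (range_of c) (%x. \<beta> c x v)" for v using \<beta> c by (auto simp: C1_covec_def)
  show ?thesis unfolding wfield_def[abs_def]
    by (intro Ck_on_diff Ck_on_raise[OF \<iota>] chart(2)[OF c] l s posdef_kmet smooth_kmet kaehler c)
qed

text \<open>Divergence with respect to the Riemannian density of \<open>\<omega>\<close>, whose
  logarithm is half of \<open>lnvol \<omega> c\<close>.\<close>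

definition wdiv :: "(('x, complex ^ 'n) chart => complex ^ 'n => complex ^ 'n => real) =>
    ('x, complex ^ 'n) chart => complex ^ 'n => real" where
  "wdiv \<beta> c x = (SUM b:Basis. dir (wfield \<beta> c) x b \<bullet> b) + dir (lnvol \<omega> c) x (wfield \<beta> c x) / 2"

lemma continuous_wdiv:
  assumes \<beta>: "C1_covec \<beta>" and c: "c : A"
  shows "continuous_on (range_of c) (wdiv \<beta> c)"
proof -
  have w: "Ck_on 1 (range_of c) (wfield \<beta> c)" by (rule smooth_wfield[OF assms])
  then have "continuous_on (range_of c) (%x. dir (wfield \<beta> c) x b)" for b by simp
  moreover have "continuous_on (range_of c) (wfield \<beta> c)" using w Ck_on_imp_continuous by blast
  moreover have s: "Ck_on 1 (range_of c) (lnvol \<omega> c)" by (rule smooth_lnvol[OF kaehler(1) c])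
  then have "continuous_on (range_of c) (%x. dir (lnvol \<omega> c) x b)" for b by simp
  moreover have lb: "dir (lnvol \<omega> c) x (wfield \<beta> c x) = (SUM b:Basis. (wfield \<beta> c x \<bullet> b) * dir (lnvol \<omega> c) x b)"
    if "x : range_of c" for x
    using linear_basis_sum[OF dir_linear[of "lnvol \<omega> c" x], of "wfield \<beta> c x"] s that by simp
  ultimately have "continuous_on (range_of c) (%x. (SUM b:Basis. dir (wfield \<beta> c) x b \<bullet> b) +
      (SUM b:Basis. (wfield \<beta> c x \<bullet> b) * dir (lnvol \<omega> c) x b) / 2)"
    by (intro continuous_intros) auto
  then show ?thesis
    by (rule continuous_on_eq) (simp add: wdiv_def lb)
qed

text \<open>By \<open>same_volume\<close> the trace \<open>\<kappa>\<close> is the same for both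
  metrics, so the single divergence \<open>wdiv\<close> splits into the Riemannian divergences of
  the two halves of \<open>W\<close>, each for its own metric.\<close>

lemma wdiv_eq:
  assumes \<beta>: "C1_covec \<beta>" and c: "c : A" "x : range_of c"
    and F: "gframe (kmet \<omega> c x) F" "gframe (kmet \<omega>' c x) F'"
  defines "e \<equiv> %u v. dir (%y. \<beta> c y v) x u - dir (%y. \<beta> c y u) x v"
  shows "wdiv \<beta> c x = (SUM a:Basis. e (F a) (mulI (F a))) / 2 - (SUM a:Basis. e (F' a) (mulI (F' a))) / 2"
proof -
  interpret K: kaehler_chart "range_of c" "\<omega> c" \<iota> by (rule kaehler_chart[OF kaehler(1) c(1)])
  interpret K': kaehler_chart "range_of c" "\<omega>' c" \<iota> by (rule kaehler_chart[OF kaehler(2) c(1)])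
  have g: "K.g = kmet \<omega> c" "K'.g = kmet \<omega>' c" using kaehler_chart_g kaehler c by auto
  have l: "linear (\<beta> c y)" if "y : range_of c" for y using \<beta> c that by (auto simp: C1_covec_def covec_def)
  have s: "Ck_on 1 (range_of c) (%x. \<beta> c x v)" for v using \<beta> c by (auto simp: C1_covec_def)
  have w: "wfield \<beta> c = (%x. K.vfield (\<beta> c) x - K'.vfield (\<beta> c) x)"
    by (simp add: fun_eq_iff wfield_def K.vfield_def K'.vfield_def g)
  have dv: "K.vfield (\<beta> c) differentiable (at x)" "K'.vfield (\<beta> c) differentiable (at x)"
    using K.Ck_on_vfield[OF l s] K'.Ck_on_vfield[OF l s] c(2) by auto
  have "dir (wfield \<beta> c) x = (%b. dir (K.vfield (\<beta> c)) x b - dir (K'.vfield (\<beta> c)) x b)"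
    unfolding w by (intro dir_eqI has_derivative_diff dir_works dv)
  then have 1: "(SUM b:Basis. dir (wfield \<beta> c) x b \<bullet> b) =
      (SUM b:Basis. dir (K.vfield (\<beta> c)) x b \<bullet> b) - (SUM b:Basis. dir (K'.vfield (\<beta> c)) x b \<bullet> b)"
    by (simp add: inner_diff_left sum_subtractf)
  have k: "2 * K.\<kappa> x v = dir (lnvol \<omega> c) x v" "2 * K'.\<kappa> x v = dir (lnvol \<omega> c) x v" for v
    using K.lndet_derivative[OF c(2)] K'.lndet_derivative[OF c(2)] same_volume[OF c]
    by (auto simp: kaehler_chart_lndet[OF kaehler(1) c(1)] kaehler_chart_lndet[OF kaehler(2) c(1)])
  have s': "lnvol \<omega> c differentiable (at x)" using smooth_lnvol[OF kaehler(1) c(1), of 1] c(2) by auto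
  have 2: "dir (lnvol \<omega> c) x (wfield \<beta> c x) / 2 = K.\<kappa> x (K.vfield (\<beta> c) x) - K'.\<kappa> x (K'.vfield (\<beta> c) x)"
    using k(1)[of "K.vfield (\<beta> c) x"] k(2)[of "K'.vfield (\<beta> c) x"]
    by (simp add: w linear_diff[OF dir_linear[OF s']] field_simps)
  show ?thesis
    using K.divergence_vfield[OF c(2) l s F(1)[folded g]] K'.divergence_vfield[OF c(2) l s F(2)[folded g]]
    unfolding wdiv_def 1 2 e_def by linarith
qed

text \<open>\<open>h\<close> represents the divergence of \<open>f W\<close>; multiplied by the
  density it becomes the flat divergence of a compactly supported field.\<close>

lemma integration_by_parts:
  assumes c: "c : A" and f: "C1_scalar f" "csupp f (dom_of c)" and \<beta>: "C1_covec \<beta>"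
    and h: "!!x. x : range_of c ==> h (point c x) = pairing f \<beta> c x + f (point c x) * wdiv \<beta> c x"
  shows "wint (wq c) h = 0"
proof -
  obtain C where C: "compact C" "C \<subseteq> dom_of c" "!!p. p ~: C ==> f p = 0" using f(2) unfolding csupp_def by auto
  define C' where "C' = coord c ` C"
  have C': "compact C'" "C' \<subseteq> range_of c" unfolding C'_def range_of_def
    using C by (auto intro!: compact_continuous_image continuous_on_subset[OF cont_coord[OF c]])
  have fz: "f (point c x) = 0" if "x : range_of c" "x ~: C'" for x
  proof -
    have "point c x ~: C" using that coord_point[OF c that(1)] by (metis C'_def imageI)
    then show ?thesis by (rule C(3))
  qed
  define W where "W = wfield \<beta> c"
  \<comment> \<open>The Riemannian density, written as an exponential so as to be differentiated
    through \<open>lnvol\<close>.\<close>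
  define D where "D x = exp (1/2 * lnvol \<omega> c x)" for x
  \<comment> \<open>The compact support of \<open>f\<close> inside the chart keeps the extension by
    zero C^1.\<close>
  define Y where "Y x = (if x : range_of c then (D x * f (point c x)) *\<^sub>R W x else 0)" for x
  note o = chart(2)[OF c]
  have sW: "Ck_on 1 (range_of c) W" unfolding W_def by (rule smooth_wfield[OF \<beta> c])
  have sD: "Ck_on 1 (range_of c) D" unfolding D_def by (intro Ck_on_exp Ck_on_cmult o smooth_lnvol kaehler c)
  have sf: "Ck_on 1 (range_of c) (%x. f (point c x))" using f(1) c by (simp add: C1_scalar_def o_def)
  have "Ck_on 1 (range_of c) (%x. (D x * f (point c x)) *\<^sub>R W x)"
    by (intro Ck_on_scaleR Ck_on_mult o sW sD sf)
  then have sY: "Ck_on 1 (range_of c) Y"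
    by (subst Ck_on_cong[OF o, of Y "%x. (D x * f (point c x)) *\<^sub>R W x"]) (simp add: Y_def)
  have Yz: "Y x = 0" if "x ~: C'" for x using fz that by (simp add: Y_def)
  have oC: "open (- C')" using compact_imp_closed[OF C'(1)] by auto
  have sYU: "Ck_on 1 UNIV Y"
  proof (rule Ck_on_local)
    fix x :: "complex ^ 'n"
    show "EX V. open V & x : V & Ck_on 1 V Y"
    proof (cases "x : range_of c")
      case False
      have "Ck_on 1 (- C') Y" using Ck_on_cong[OF oC, of Y "%_. 0" 1] Yz by simp
      then show ?thesis using False C'(2) oC by blast
    qed (use sY o in blast)
  qed
  have dY: "Y differentiable (at x)" for x using sYU by simp
  have dYz: "dir Y x = (%v. 0)" if "x ~: C'" for x
    using dir_cong[OF oC, of x Y "%_. 0"] that Yz by (simp add: frechet_derivative_const)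
  have div: "(SUM b:Basis. dir Y x b \<bullet> b) = D x * h (point c x)" if x: "x : range_of c" for x
  proof -
    have dW: "W differentiable (at x)" and dD: "D differentiable (at x)"
      and df: "(%x. f (point c x)) differentiable (at x)" and dl: "lnvol \<omega> c differentiable (at x)"
      using sW sD sf smooth_lnvol[OF kaehler(1) c, of 1] x by auto
    have D': "dir D x v = D x * dir (lnvol \<omega> c) x v / 2" for v
    proof -
      have "(D has_derivative (%v. exp (1/2 * lnvol \<omega> c x) * (1/2 * dir (lnvol \<omega> c) x v))) (at x)"
        unfolding D_def[abs_def]
        by (rule has_derivative_eq_rhs[OF has_derivative_exp[OF has_derivative_mult_right[OF dir_works[OF dl]]]])
          (simp add: fun_eq_iff)
      from dir_eqI[OF this] show ?thesis by (simp add: D_def)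
    qed
    have "dir Y x = dir (%x. (D x * f (point c x)) *\<^sub>R W x) x"
      by (rule dir_cong[OF o x]) (simp add: Y_def)
    also have "... = (%v. (D x * f (point c x)) *\<^sub>R dir W x v +
        (D x * dir (%x. f (point c x)) x v + dir D x v * f (point c x)) *\<^sub>R W x)"
      by (intro dir_eqI has_derivative_scaleR has_derivative_mult dir_works dW dD df)
    finally have e: "dir Y x v = (D x * f (point c x)) *\<^sub>R dir W x v +
        (D x * dir (%x. f (point c x)) x v + dir D x v * f (point c x)) *\<^sub>R W x" for v by simp
    have s1: "(SUM b:Basis. (W x \<bullet> b) * dir (%x. f (point c x)) x b) = dsc f c x (W x)"
      using linear_basis_sum[OF dir_linear[OF df], of "W x"] by (simp add: dsc_def o_def)
    have s2: "(SUM b:Basis. (W x \<bullet> b) * dir (lnvol \<omega> c) x b) = dir (lnvol \<omega> c) x (W x)"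
      using linear_basis_sum[OF dir_linear[OF dl], of "W x"] by simp
    have "(SUM b:Basis. dir Y x b \<bullet> b) = (SUM b:Basis. D x * (f (point c x) * (dir W x b \<bullet> b) +
        ((W x \<bullet> b) * dir (%x. f (point c x)) x b + f (point c x) * ((W x \<bullet> b) * dir (lnvol \<omega> c) x b) / 2)))"
      by (intro sum.cong refl) (simp add: e D' inner_add_left algebra_simps)
    also have "... = D x * (f (point c x) * (SUM b:Basis. dir W x b \<bullet> b) +
        (dsc f c x (W x) + f (point c x) * dir (lnvol \<omega> c) x (W x) / 2))"
      unfolding s1[symmetric] s2[symmetric]
      by (simp add: sum.distrib sum_distrib_left sum_divide_distrib algebra_simps)
    also have "... = D x * h (point c x)"
      unfolding h[OF x] pairing_def wdiv_def W_def by (simp add: algebra_simps)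
    finally show ?thesis .
  qed
  define G where "G i y = Y (emb \<iota> y) \<bullet> \<iota> i" for i y
  have sG: "Ck_on 1 UNIV (G i)" for i unfolding G_def[abs_def]
    by (intro Ck_on_inner Ck_on_const open_UNIV
        Ck_on_compose[OF open_UNIV Ck_on_bounded_linear[OF bounded_linear_emb] sYU]) auto
  have K: "compact (unemb \<iota> ` C')"
    by (intro compact_continuous_image linear_continuous_on bounded_linear_unemb C')
  have em: "emb \<iota> y ~: C'" if "y ~: unemb \<iota> ` C'" for y
    using that by (metis emb_unemb(2)[OF \<iota>] imageI)
  have Gz: "G i y = 0" if "y ~: unemb \<iota> ` C'" for i y using Yz[OF em[OF that]] by (simp add: G_def)
  have dG: "dir (G i) y v = dir Y (emb \<iota> y) (emb \<iota> v) \<bullet> \<iota> i" for i y v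
  proof -
    have "((%y. Y (emb \<iota> y)) has_derivative (%v. dir Y (emb \<iota> y) (emb \<iota> v))) (at y)"
      using diff_chain_at[OF bounded_linear_imp_has_derivative[OF bounded_linear_emb] dir_works[OF dY]]
      by (simp add: o_def)
    from dir_eqI[OF has_derivative_inner_left[OF this]] show ?thesis unfolding G_def[abs_def] by simp
  qed
  have I0: "integral UNIV (%y. dir (G i) y v) = 0" for i v
    by (rule integral_dir_compact_support[OF sG K Gz])
  have int: "(%y. dir (G i) y v) integrable_on UNIV" for i v
  proof (rule integrable_compact_support[OF _ K])
    show "continuous_on UNIV (%y. dir (G i) y v)" using sG[of i] by simp
    show "dir (G i) y v = 0" if "y ~: unemb \<iota> ` C'" for y
      using dYz[OF em[OF that]] by (simp add: dG)
  qed
  have "wfun (wq c) h y = (SUM i:UNIV. dir (G i) y (axis i 1))" for y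
  proof -
    have s: "(SUM i:UNIV. dir (G i) y (axis i 1)) = (SUM b:Basis. dir Y (emb \<iota> y) b \<bullet> b)"
      by (simp add: dG emb_unemb[OF \<iota>] basis_reindex[OF \<iota>])
    have i: "y : wcoord (wq c) ` wdom (wq c) \<longleftrightarrow> emb \<iota> y : range_of c"
      unfolding wq_def metric_wchart_simps using unemb_image[OF \<iota>, of "range_of c"]
      by (auto simp: range_of_def)
    show ?thesis
    proof (cases "emb \<iota> y : range_of c")
      case True
      have "det (gmat \<iota> (kmet \<omega> c (emb \<iota> y))) > 0"
        by (rule det_gmat_pos[OF \<iota> posdef_kmet[OF kaehler(1) c True]])
      then have "sqrt (det (gmat \<iota> (kmet \<omega> c (emb \<iota> y)))) = D (emb \<iota> y)"
        unfolding D_def lnvol_def by (metis less_le powr_def powr_half_sqrt)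
      then show ?thesis unfolding s div[OF True] wfun_def i
        using True by (simp add: wq_def metric_wchart_simps)
    next
      case False
      then have "emb \<iota> y ~: C'" using C'(2) by blast
      then show ?thesis unfolding s wfun_def i using False dYz by simp
    qed
  qed
  then have "wint (wq c) h = integral UNIV (%y. SUM i:UNIV. dir (G i) y (axis i 1))"
    unfolding wint_def by (metis ext)
  also have "... = (SUM i:UNIV. integral UNIV (%y. dir (G i) y (axis i 1)))"
    using int by (intro integral_sum) auto
  finally show ?thesis by (simp add: I0)
qed

end

context exact_kaehler_pair
begin

lemma csupp_PF:
  assumes f: "C1_scalar f" and \<beta>: "C1_covec \<beta>" and W: "compact C" "C \<subseteq> W" "!!p. p ~: C ==> f p = 0"
  shows "csupp (PF f \<beta>) W"
proof -
  have cv: "covec \<beta>" using \<beta> by (simp add: C1_covec_def)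
  have "continuous_on (range_of c) (%x. PF f \<beta> (point c x))" if c: "c : A" for c
  proof -
    have s: "Ck_on 1 (range_of c) (f o point c)" using f c by (simp add: C1_scalar_def)
    have "continuous_on (range_of c) (wfield \<beta> c)"
      by (rule Ck_on_imp_continuous[OF smooth_wfield[OF \<beta> c]])
    moreover have "continuous_on (range_of c) (%x. dir (f o point c) x b)" for b using s by simp
    ultimately have "continuous_on (range_of c) (%x. SUM b:Basis. (wfield \<beta> c x \<bullet> b) * dir (f o point c) x b)"
      by (intro continuous_intros)
    moreover have "(SUM b:Basis. (wfield \<beta> c x \<bullet> b) * dir (f o point c) x b) = PF f \<beta> (point c x)"
      if x: "x : range_of c" for x
      using linear_basis_sum[OF dir_linear[OF C1_scalar_diff[OF f c x]], of "wfield \<beta> c x"]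
      by (simp add: PF_point[OF f cv c x] pairing_def dsc_def)
    ultimately show ?thesis by (rule continuous_on_eq)
  qed
  then have "continuous_on UNIV (PF f \<beta>)" by (rule continuous_from_charts)
  moreover have "PF f \<beta> p = 0" if "p ~: C" for p
  proof -
    obtain c where c: "c : A" "p : dom_of c" using cover .
    have "point c (coord c p) ~: C" unfolding point_coord[OF c] by (rule that)
    from dsc_zero[OF compact_imp_closed[OF W(1)] W(3) c(1) coord_in[OF c(2)] this]
    show ?thesis unfolding PF_coord[OF f cv c] pairing_def by simp
  qed
  ultimately show ?thesis using W unfolding csupp_def by blast
qed

text \<open>In contrast to \<open>partition\<close> the weights are smooth, because the divergence
  theorem differentiates them.\<close>

lemma smooth_partition:
  assumes "compact C"
  shows "EX n \<rho> c D N. (ALL j<(n::nat). smooth_scalar A (\<rho> j) & c j : A & compact (D j) & D j \<subseteq> dom_of (c j) &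
      (ALL p. p ~: D j --> \<rho> j p = 0)) & open N & C \<subseteq> N & (ALL p:N. (SUM j<n. \<rho> j p) = 1)"
proof -
  define P where "P b cD \<longleftrightarrow> smooth_scalar A b & fst cD : A & compact (snd cD) & snd cD \<subseteq> dom_of (fst cD) &
      (ALL p. p ~: snd cD --> b p = 0)" for b :: "'x => real" and cD :: "('x, complex ^ 'n) chart \<times> 'x set"
  have bump: "EX b cD M. P b cD & open M & p : M & (ALL x:M. b x = 1)" if "p : C" for p
  proof -
    obtain c where c: "c : A" "p : dom_of c" using cover .
    obtain b D M where b: "smooth_scalar A b" "open M" "p : M" "!!q. q : M ==> b q = 1"
      "compact D" "D \<subseteq> dom_of c Int UNIV" "!!q. q ~: D ==> b q = 0"
      using bump_function[OF c(2,1) open_UNIV UNIV_I] by metis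
    then have "P b (c, D)" using c by (auto simp: P_def)
    then show ?thesis using b(2-4) by blast
  qed
  show ?thesis
  proof (rule bump_cover[OF assms bump])
    fix n b cD N
    assume *: "!!j. j < n ==> P (b j) (cD j)" "open N" "C \<subseteq> N"
      "!!p. p : N ==> (SUM j<(n::nat). unity_part b j p) = 1"
    have "smooth_scalar A (unity_part b j)" if "j < n" for j
      using *(1) that by (intro smooth_unity_part) (auto simp: P_def)
    moreover have "unity_part b j p = 0" if "j < n" "p ~: snd (cD j)" for j p
      using *(1) that by (simp add: unity_part_def P_def)
    ultimately show ?thesis using *
      by (intro exI[of _ n] exI[of _ "unity_part b"] exI[of _ "%j. fst (cD j)"] exI[of _ "%j. snd (cD j)"] exI[of _ N])
        (auto simp: P_def)
  qed
qed

definition qdefect :: "('x, complex ^ 'n) chart => complex ^ 'n => real" where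
  "qdefect c x = - wdiv etac c x"

lemma kmet_difference:
  assumes c: "c : A" "x : range_of c"
  shows "kmet \<omega> c x u v - kmet \<omega>' c x u v = dir (%y. etac c y (mulI v)) x u - dir (%y. etac c y u) x (mulI v)"
proof -
  have "\<omega> c x [u, mulI v] - \<omega>' c x [u, mulI v] = ext_deriv A 1 \<eta> c x [u, mulI v]"
    using d_eta by (metis diff_tensor_def)
  then show ?thesis unfolding ext_deriv_1[OF c] kmet_def etac_def by simp
qed

lemma frames:
  assumes c: "c : A" "x : range_of c"
  obtains F F' where "gframe (kmet \<omega> c x) F" "gframe (kmet \<omega>' c x) F'"
  using gframe_exists[OF posdef_kmet[OF kaehler(1) c]] gframe_exists[OF posdef_kmet[OF kaehler(2) c]] by metis

text \<open>Since \<open>d\<eta>\<close> is the difference of the forms, \<open>wdiv_eq\<close>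
  yields the traces of the difference of the metrics in the two frames, and
  \<open>trace_difference\<close> evaluates them as a sum of squares.\<close>

lemma qdefect_eq:
  assumes c: "c : A" "x : range_of c" and F: "gframe (kmet \<omega> c x) F" "gframe (kmet \<omega>' c x) F'"
  shows "qdefect c x = (SUM a:Basis. SUM b:Basis. (kmet \<omega> c x (F a) (F' b) - kmet \<omega>' c x (F a) (F' b))\<^sup>2) / 2"
proof -
  have "wdiv etac c x = ((SUM a:Basis. kmet \<omega> c x (F a) (F a) - kmet \<omega>' c x (F a) (F a)) -
      (SUM a:Basis. kmet \<omega> c x (F' a) (F' a) - kmet \<omega>' c x (F' a) (F' a))) / 2"
    unfolding wdiv_eq[OF C1_covec_eta c F] kmet_difference[OF c] by (simp add: diff_divide_distrib)
  then show ?thesis unfolding qdefect_def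
    using trace_difference[OF posdef_kmet[OF kaehler(1) c] F(1) posdef_kmet[OF kaehler(2) c] F(2)] by simp
qed

lemma qdefect_nonneg: assumes c: "c : A" "x : range_of c" shows "qdefect c x >= 0"
proof -
  obtain F F' where F: "gframe (kmet \<omega> c x) F" "gframe (kmet \<omega>' c x) F'" using frames[OF c] .
  show ?thesis unfolding qdefect_eq[OF c F] by (simp add: sum_nonneg)
qed

lemma qdefect_zero:
  assumes c: "c : A" "x : range_of c" and z: "qdefect c x = 0"
  shows "\<omega> c x [u, v] = \<omega>' c x [u, v]"
proof -
  obtain F F' where F: "gframe (kmet \<omega> c x) F" "gframe (kmet \<omega>' c x) F'" using frames[OF c] .
  \<comment> \<open>The form is recovered from the metric, \<open>\<omega>(u, v)\<close> being the
    metric of \<open>u\<close> and \<open>- mulI v\<close>.\<close>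
  have "kmet \<omega> c x u (- mulI v) = kmet \<omega>' c x u (- mulI v)"
    using posdef_eq_of_frames[OF posdef_kmet[OF kaehler(1) c] F(1) posdef_kmet[OF kaehler(2) c] F(2)]
      z qdefect_eq[OF c F] by simp
  moreover have "mulI (- mulI v) = v" by (simp add: vec_eq_iff)
  ultimately show ?thesis by (simp add: kmet_def)
qed

text \<open>Frames are transported by the transition map, after which both sums of squares have the
  same entries.\<close>

lemma qdefect_transition:
  assumes c: "c : A" "d : A" "x : overlap c d"
  shows "qdefect c x = qdefect d (transition c d x)"
proof -
  have cx: "x : range_of c" and dx: "transition c d x : range_of d"
    using overlap_range transition_range c by auto
  obtain F F' where F: "gframe (kmet \<omega> c x) F" "gframe (kmet \<omega>' c x) F'"
    using frames[OF c(1) cx] .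
  define G where "G a = dir (transition c d) x (F a)" for a
  define G' where "G' a = dir (transition c d) x (F' a)" for a
  have k: "kmet \<omega> d (transition c d x) (dir (transition c d) x u) (dir (transition c d) x v) = kmet \<omega> c x u v"
    "kmet \<omega>' d (transition c d x) (dir (transition c d) x u) (dir (transition c d) x v) = kmet \<omega>' c x u v" for u v
    using kmet_transition[OF kaehler(1) c] kmet_transition[OF kaehler(2) c] by auto
  have G: "gframe (kmet \<omega> d (transition c d x)) G" "gframe (kmet \<omega>' d (transition c d x)) G'"
    using F unfolding gframe_def G_def G'_def k by auto
  show ?thesis unfolding qdefect_eq[OF c(1) cx F] qdefect_eq[OF c(2) dx G] G_def G'_def k ..
qed

definition Q :: "'x => real" where "Q = scalar_fun qdefect"

lemma Q_point: "c : A ==> x : range_of c ==> Q (point c x) = qdefect c x"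
  unfolding Q_def by (rule scalar_fun_point[OF qdefect_transition])

lemma Q_coord: "c : A ==> p : dom_of c ==> Q p = qdefect c (coord c p)"
  unfolding Q_def by (rule scalar_fun_eq[OF qdefect_transition])

lemma Q_nonneg: "Q p >= 0"
proof -
  obtain c where "c : A" "p : dom_of c" using cover .
  then show ?thesis using Q_coord qdefect_nonneg coord_in by metis
qed

lemma continuous_Q: "continuous_on UNIV Q"
proof (rule continuous_from_charts)
  fix c assume c: "c : A"
  have "continuous_on (range_of c) (qdefect c)"
    unfolding qdefect_def[abs_def] by (intro continuous_intros continuous_wdiv[OF C1_covec_eta c])
  then show "continuous_on (range_of c) (%x. Q (point c x))"
    by (rule continuous_on_eq) (simp add: Q_point[OF c])
qed

lemma PF_sum:
  fixes f :: "nat => 'x => real"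
  assumes N: "open N" "!!p. p : N ==> h p = (SUM j<n. f j p)" and f: "!!j. j < n ==> C1_scalar (f j)"
    and h: "C1_scalar h" and \<beta>: "covec \<beta>" and p: "p : N"
  shows "PF h \<beta> p = (SUM j<n. PF (f j) \<beta> p)"
proof -
  obtain c where c: "c : A" "p : dom_of c" using cover .
  have "PF (f j) \<beta> p = pairing (f j) \<beta> c (coord c p)" if "j < n" for j by (rule PF_coord[OF f[OF that] \<beta> c])
  moreover have "pairing h \<beta> c (coord c p) = (SUM j<n. pairing (f j) \<beta> c (coord c p))"
    unfolding pairing_def
    by (rule dsc_sum[OF N f c(1) coord_in[OF c(2)]]) (simp_all add: point_coord[OF c] p)
  ultimately show ?thesis by (simp add: PF_coord[OF h \<beta> c])
qed

text \<open>The global divergence theorem. The partition multiplies \<open>\<zeta>\<close> before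
  differentiation, so each piece lives in one chart and the derivatives of the weights recombine by
  linearity.\<close>

lemma I_PF:
  assumes \<zeta>: "C1_scalar \<zeta>" "csupp \<zeta> UNIV" and \<beta>: "C1_covec \<beta>" and q: "continuous_on UNIV q"
    and div: "!!c x. c : A ==> x : range_of c ==> wdiv \<beta> c x = - q (point c x)"
  shows "I (PF \<zeta> \<beta>) = I (%p. \<zeta> p * q p)"
proof -
  have cv: "covec \<beta>" using \<beta> by (simp add: C1_covec_def)
  obtain C where C: "compact C" "!!p. p ~: C ==> \<zeta> p = 0" using \<zeta>(2) unfolding csupp_def by auto
  obtain n \<rho> c D N where P: "ALL j<(n::nat). smooth_scalar A (\<rho> j) & c j : A & compact (D j) & D j \<subseteq> dom_of (c j) &
      (ALL p. p ~: D j --> \<rho> j p = 0)" "C \<subseteq> N" "ALL p:N. (SUM j<n. \<rho> j p) = 1"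
    using smooth_partition[OF C(1)] by blast
  define f where "f j p = \<rho> j p * \<zeta> p" for j p
  have f: "C1_scalar (f j)" if "j < n" for j
    unfolding f_def using P(1) that by (intro C1_scalar_mult smooth_imp_C1 \<zeta>(1)) auto
  have fD: "compact (D j)" "D j \<subseteq> dom_of (c j)" "!!p. p ~: D j ==> f j p = 0" "c j : A" if "j < n" for j
    using P(1) that by (auto simp: f_def)
  have s: "\<zeta> p = (SUM j<n. f j p)" for p
  proof (cases "p : C")
    case True
    then have "(SUM j<n. \<rho> j p) = 1" using P(2,3) by blast
    then show ?thesis unfolding f_def sum_distrib_right[symmetric] by simp
  qed (simp add: f_def C(2))
  have cf: "csupp (f j) (dom_of (c j))" if "j < n" for j
    unfolding csupp_def using C1_scalar_continuous[OF f[OF that]] fD[OF that] by blast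
  have c1: "csupp (PF (f j) \<beta>) (dom_of (c j))" if "j < n" for j
    by (rule csupp_PF[OF f[OF that] \<beta> fD(1-3)[OF that]])
  have c2: "csupp (%p. f j p * q p) (dom_of (c j))" if "j < n" for j
    by (rule csupp_mult[OF cf[OF that] q])
  have e: "I (PF (f j) \<beta>) = I (%p. f j p * q p)" if j: "j < n" for j
  proof -
    have c3: "csupp (%p. (-1) * (f j p * q p)) (dom_of (c j))"
      by (rule csupp_mult'[OF c2[OF j]]) (intro continuous_intros)
    have "I (%p. PF (f j) \<beta> p + (-1) * (f j p * q p)) = wint (wq (c j)) (%p. PF (f j) \<beta> p + (-1) * (f j p * q p))"
      using csupp_add[OF c1[OF j] c3] fD(4)[OF j] by (intro I_eq_wint) (auto simp: wdom_wq)
    also have "... = 0"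
      by (rule integration_by_parts[OF fD(4)[OF j] f[OF j] cf[OF j] \<beta>])
        (simp add: PF_point[OF f[OF j] cv fD(4)[OF j]] div[OF fD(4)[OF j]])
    finally have "I (%p. PF (f j) \<beta> p + (-1) * (f j p * q p)) = 0" .
    then show ?thesis
      using I_add[OF csupp_subset[OF c1[OF j]] csupp_subset[OF c3]] I_cmult[OF csupp_subset[OF c2[OF j]], of "-1"] by simp
  qed
  have "PF \<zeta> \<beta> = (%p. SUM j<n. PF (f j) \<beta> p)"
    using PF_sum[OF open_UNIV s f \<zeta>(1) cv] by auto
  then have "I (PF \<zeta> \<beta>) = (SUM j<n. I (PF (f j) \<beta>))"
    using I_sum[of "{..<n}" "%j. PF (f j) \<beta>"] csupp_subset[OF c1] by simp
  also have "... = (SUM j<n. I (%p. f j p * q p))" using e by simp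
  also have "... = I (%p. SUM j<n. f j p * q p)"
    using I_sum[of "{..<n}" "%j p. f j p * q p"] csupp_subset[OF c2] by simp
  also have "(%p. SUM j<n. f j p * q p) = (%p. \<zeta> p * q p)"
    using s by (auto simp: sum_distrib_right)
  finally show ?thesis .
qed

text \<open>The form \<open>d\<zeta>\<close> is closed, by symmetry of second derivatives.\<close>

lemma wdiv_exact:
  assumes \<zeta>: "smooth_scalar A \<zeta>" and c: "c : A" "x : range_of c"
  shows "wdiv (dsc \<zeta>) c x = 0"
proof -
  obtain F F' where F: "gframe (kmet \<omega> c x) F" "gframe (kmet \<omega>' c x) F'" using frames[OF c] .
  have "dir (%y. dsc \<zeta> c y v) x u = dir (%y. dsc \<zeta> c y u) x v" for u v
    unfolding dsc_def by (rule dir_dir_commute[OF chart(2)[OF c(1)] c(2) smooth_scalarD[OF \<zeta> c(1)]])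
  then show ?thesis unfolding wdiv_eq[OF C1_covec_dsc[OF \<zeta>] c F] by simp
qed

text \<open>The vector field of \<open>d\<zeta>\<close> vanishes off the support of
  \<open>\<zeta>\<close>, so \<open>h\<close> may be multiplied by a compactly supported function
  without changing the pairing. The divergence theorem then applies, since this field is C^1 and
  divergence free.\<close>

lemma I_PF_exact:
  assumes \<zeta>: "smooth_scalar A \<zeta>" "compact C" "!!p. p ~: C ==> \<zeta> p = 0" and h: "C1_scalar h"
  shows "I (PF h (dsc \<zeta>)) = 0" "csupp (PF h (dsc \<zeta>)) UNIV"
proof -
  have \<beta>: "C1_covec (dsc \<zeta>)" by (rule C1_covec_dsc[OF \<zeta>(1)])
  then have cv: "covec (dsc \<zeta>)" by (simp add: C1_covec_def)
  obtain n \<rho> c D N where P: "ALL j<(n::nat). smooth_scalar A (\<rho> j) & c j : A & compact (D j) & D j \<subseteq> dom_of (c j) &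
      (ALL p. p ~: D j --> \<rho> j p = 0)" "open N" "C \<subseteq> N" "ALL p:N. (SUM j<n. \<rho> j p) = 1"
    using smooth_partition[OF \<zeta>(2)] by blast
  \<comment> \<open>\<open>\<psi>\<close> is 1 on a neighbourhood of the support of
    \<open>\<zeta>\<close> and vanishes outside the compact set \<open>K\<close>.\<close>
  define \<psi> K where "\<psi> p = (SUM j<n. \<rho> j p)" and "K = (UN j<n. D j)" for p
  have "smooth_scalar A (%p. SUM j<m. \<rho> j p)" if "m <= n" for m
    using that P(1) by (induction m) (auto intro: smooth_scalar_add smooth_scalar_const)
  then have \<psi>: "smooth_scalar A \<psi>" unfolding \<psi>_def[abs_def] by blast
  have K: "compact K" "!!p. p ~: K ==> \<psi> p * h p = 0"
    using P(1) by (auto simp: K_def \<psi>_def intro!: compact_UN)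
  have g: "C1_scalar (%p. \<psi> p * h p)" by (intro C1_scalar_mult smooth_imp_C1 \<psi> h)
  have z: "PF k (dsc \<zeta>) p = 0" if "p ~: C" "C1_scalar k" for k p
  proof -
    obtain c where c: "c : A" "p : dom_of c" using cover .
    have x: "coord c p : range_of c" by (rule coord_in[OF c(2)])
    have "point c (coord c p) ~: C" unfolding point_coord[OF c] by (rule that(1))
    then have "dsc \<zeta> c (coord c p) v = 0" for v
      using dsc_zero[where f = \<zeta> and k = 0, OF compact_imp_closed[OF \<zeta>(2)] \<zeta>(3) c(1) x] by blast
    then have "wfield (dsc \<zeta>) c (coord c p) = 0"
      using raise_unique[OF posdef_kmet[OF kaehler(1) c(1) x], of 0 "%_. 0"]
        raise_unique[OF posdef_kmet[OF kaehler(2) c(1) x], of 0 "%_. 0"]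
        posdef_simps(9)[OF posdef_kmet[OF kaehler(1) c(1) x]] posdef_simps(9)[OF posdef_kmet[OF kaehler(2) c(1) x]]
      by (simp add: wfield_def)
    then show ?thesis
      using linear_0[OF dir_linear[OF C1_scalar_diff[OF that(2) c(1) x]]]
      by (simp add: PF_coord[OF that(2) cv c] pairing_def dsc_def)
  qed
  have "PF h (dsc \<zeta>) p = PF (%p. \<psi> p * h p) (dsc \<zeta>) p" for p
  proof (cases "p : N")
    case True
    have "h q = (SUM j<1::nat. \<psi> q * h q)" if "q : N" for q using P(4) that by (simp add: \<psi>_def)
    from PF_sum[OF P(2) this g h cv True] show ?thesis by simp
  next
    case False
    then have "p ~: C" using P(3) by blast
    then show ?thesis using z h g by simp
  qed
  then have eq: "PF h (dsc \<zeta>) = PF (%p. \<psi> p * h p) (dsc \<zeta>)" by auto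
  show "csupp (PF h (dsc \<zeta>)) UNIV" unfolding eq by (rule csupp_PF[OF g \<beta> K(1) subset_UNIV K(2)])
  have "csupp (%p. \<psi> p * h p) UNIV" unfolding csupp_def using C1_scalar_continuous[OF g] K by blast
  from I_PF[OF g this \<beta>, of "%_. 0"] show "I (PF h (dsc \<zeta>)) = 0"
    unfolding eq by (simp add: wdiv_exact[OF \<zeta>(1)] I_zero)
qed

text \<open>Replacing \<open>\<eta>\<close> by \<open>\<eta> - dh\<close> does not change the flux, since \<open>d\<zeta>(W\<^sub>d\<^sub>h) = - dh(W\<^sub>d\<^sub>\<zeta>)\<close>
  and \<open>W\<^sub>d\<^sub>\<zeta>\<close> is divergence free.\<close>

theorem flux_identity:
  assumes \<zeta>: "smooth_scalar A \<zeta>" "compact C" "!!p. p ~: C ==> \<zeta> p = 0" and h: "C1_scalar h"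
  defines "P \<equiv> PF \<zeta> (%c x v. etac c x v - dsc h c x v)"
  shows "I (%p. \<zeta> p * Q p) = I P" "csupp P UNIV"
proof -
  have C1: "C1_scalar \<zeta>" by (rule smooth_imp_C1[OF \<zeta>(1)])
  have cv: "covec etac" "covec (dsc h)" "covec (dsc \<zeta>)"
    using C1_covec_eta covec_dsc h C1 by (auto simp: C1_covec_def)
  have cvd: "covec (%c x v. etac c x v - dsc h c x v)"
    using cv(1,2) unfolding covec_def by (auto intro: linear_compose_sub)
  have "P p = PF \<zeta> etac p + PF h (dsc \<zeta>) p" for p
  proof -
    obtain c where c: "c : A" "p : dom_of c" using cover .
    define x where "x = coord c p"
    have x: "x : range_of c" unfolding x_def by (rule coord_in[OF c(2)])
    note g = posdef_kmet[OF kaehler(1) c(1) x] and g' = posdef_kmet[OF kaehler(2) c(1) x]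
    have l: "linear (etac c x)" "linear (dsc h c x)" "linear (dsc \<zeta> c x)"
      using cv c(1) x by (auto simp: covec_def)
    have lJ: "linear (%w. etac c x (mulI w))" "linear (%w. dsc h c x (mulI w))"
      using l[THEN linear_compose[OF linear_mulI]] by (simp_all add: o_def)
    have r: "raise k (%w. etac c x (mulI w) - dsc h c x (mulI w)) =
        raise k (%w. etac c x (mulI w)) - raise k (%w. dsc h c x (mulI w))" if k: "posdef k" for k
      by (rule raise_unique[OF k]) (simp add: posdef_simps[OF k] raise_works[OF k lJ(1)] raise_works[OF k lJ(2)])
    have J: "dsc \<zeta> c x (raise k (%w. dsc h c x (mulI w))) = - dsc h c x (raise k (%w. dsc \<zeta> c x (mulI w)))"
      if "posdef k" "!!u v. k (mulI u) (mulI v) = k u v" for k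
      by (rule raise_J[OF that(1) linear_mulI that(2) mulI_mulI l(3,2)])
    have "pairing \<zeta> (%c x v. etac c x v - dsc h c x v) c x = pairing \<zeta> etac c x + pairing h (dsc \<zeta>) c x"
      unfolding pairing_def wfield_def r[OF g] r[OF g'] linear_diff[OF l(3)] linear_diff[OF l(2)]
        J[OF g kmet_mulI[OF kaehler(1) c(1) x]] J[OF g' kmet_mulI[OF kaehler(2) c(1) x]] by simp
    then show ?thesis
      by (simp add: P_def PF_coord[OF C1 cvd c] PF_coord[OF C1 cv(1) c] PF_coord[OF h cv(3) c] x_def)
  qed
  then have P: "P = (%p. PF \<zeta> etac p + PF h (dsc \<zeta>) p)" by auto
  have c1: "csupp (PF \<zeta> etac) UNIV" by (rule csupp_PF[OF C1 C1_covec_eta \<zeta>(2) _ \<zeta>(3)]) auto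
  note c2 = I_PF_exact[OF \<zeta> h]
  show "csupp P UNIV" unfolding P by (rule csupp_add[OF c1 c2(2)])
  have "csupp \<zeta> UNIV" unfolding csupp_def using C1_scalar_continuous[OF C1] \<zeta>(2,3) by blast
  from I_PF[OF C1 this C1_covec_eta continuous_Q] have "I (PF \<zeta> etac) = I (%p. \<zeta> p * Q p)"
    by (simp add: Q_point qdefect_def)
  moreover have "I P = I (PF \<zeta> etac) + I (PF h (dsc \<zeta>))" unfolding P by (rule I_add[OF c1 c2(2)])
  ultimately show "I (%p. \<zeta> p * Q p) = I P" using c2(1) by simp
qed

end

section \<open>Primitives on the end\<close>

text \<open>Differentiation under the integral for derivatives given as plain functions; the passage
  to bounded linear functions stays inside the proof.\<close>

lemma leibniz_has_derivative:
  fixes f :: "'x::euclidean_space => real => real"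
  assumes U: "open U" "convex U" "z : U"
    and f: "!!z s. z : U ==> s : {0..1} ==> ((%z. f z s) has_derivative G z s) (at z)"
      "!!z. z : U ==> continuous_on {0..1} (f z)"
    and G: "!!w. continuous_on (U \<times> {0..1}) (%(z, s). G z s w)"
  shows "((%z. integral {0..1} (f z)) has_derivative (%w. integral {0..1} (%s. G z s w))) (at z)"
proof -
  define B where "B z s = Blinfun (G z s)" for z s
  have B: "blinfun_apply (B z s) = G z s" if "z : U" "s : {0..1}" for z s
    unfolding B_def using f(1)[OF that] by (intro bounded_linear_Blinfun_apply has_derivative_bounded_linear)
  have cB: "continuous_on (U \<times> cbox 0 1) (%(z, s). B z s)"
  proof (rule continuous_on_blinfun_componentwise)
    show "continuous_on (U \<times> cbox 0 1) (%x. blinfun_apply (case x of (z, s) => B z s) w)" for w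
      by (rule continuous_on_eq[OF G[of w, folded cbox_interval]]) (auto simp: B cbox_interval)
  qed
  have "((%z. integral (cbox 0 1) (f z)) has_derivative integral (cbox 0 1) (B z)) (at z within U)"
  proof (rule leibniz_rule[OF _ _ cB U(3,2)])
    show "((%x. f x t) has_derivative blinfun_apply (B x t)) (at x within U)" if "x : U" "t : cbox 0 1" for x t
      using f(1)[of x t] that B[of x t] by (simp add: cbox_interval has_derivative_at_withinI)
    show "f x integrable_on cbox 0 1" if "x : U" for x
      using f(2)[OF that] by (intro integrable_continuous) (simp add: cbox_interval)
  qed
  moreover have "blinfun_apply (integral (cbox 0 1) (B z)) w = integral {0..1} (%s. G z s w)" for w
  proof -
    have "B z integrable_on cbox 0 1"
      by (intro integrable_continuous continuous_on_compose2[OF cB, where f = "%s. (z, s)", simplified])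
        (use U in \<open>auto intro!: continuous_intros\<close>)
    then have "blinfun_apply (integral (cbox 0 1) (B z)) w = integral (cbox 0 1) (%s. blinfun_apply (B z s) w)"
      by (rule blinfun_apply_integral)
    also have "... = integral (cbox 0 1) (%s. G z s w)"
      by (rule integral_cong) (simp add: B U cbox_interval)
    finally show ?thesis by (simp add: cbox_interval)
  qed
  ultimately show ?thesis
    using at_within_open[OF U(3,1)] by (simp add: cbox_interval has_derivative_eq_rhs fun_eq_iff)
qed

definition ext1 :: "('v::euclidean_space => 'v => real) => 'v => 'v => 'v => real" where
  "ext1 \<theta> z u v = dir (%y. \<theta> y v) z u - dir (%y. \<theta> y u) z v"

text \<open>The line integral of \<open>\<theta>\<close> along the path \<open>(T0, x0) \<leadsto> (t, x0) \<leadsto> (t, x)\<close>, and the defect of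
  being a primitive, which only involves \<open>d\<theta>\<close> on the second segment.\<close>

definition prim :: "(real * 'e::euclidean_space => real * 'e => real) => real => 'e => real * 'e => real" where
  "prim \<theta> T0 x0 z = integral {T0..fst z} (%s. \<theta> (s, x0) (1, 0)) +
     integral {0..1} (%s. \<theta> (fst z, x0 + s *\<^sub>R (snd z - x0)) (0, snd z - x0))"

definition prim_err :: "(real * 'e::euclidean_space => real * 'e => real) => 'e => real * 'e => real * 'e => real" where
  "prim_err \<theta> x0 z w = integral {0..1} (%s.
     ext1 \<theta> (fst z, x0 + s *\<^sub>R (snd z - x0)) (fst w, s *\<^sub>R snd w) (0, snd z - x0))"

context
  fixes \<theta> :: "real * 'e::euclidean_space => real * 'e => real" and x0 :: 'e and r T0 :: real
  assumes lin: "!!t x. x : ball x0 r ==> linear (\<theta> (t, x))"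
    and C1: "!!w. Ck_on 1 (UNIV \<times> ball x0 r) (%z. \<theta> z w)" and r: "r > 0"
begin

lemma theta_diff: "x : ball x0 r ==> (%z. \<theta> z w) differentiable (at (t, x))"
  by (rule Ck_on_imp_differentiable[OF C1]) auto

lemma theta_cont: "continuous_on (UNIV \<times> ball x0 r) (%z. \<theta> z w)"
  by (rule Ck_on_imp_continuous[OF C1])

lemma dtheta_cont: "continuous_on (UNIV \<times> ball x0 r) (%z. dir (%y. \<theta> y v) z w)"
proof -
  have "ALL w. continuous_on (UNIV \<times> ball x0 r) (%z. dir (%y. \<theta> y v) z w)" using C1[of v] by simp
  then show ?thesis by blast
qed

lemma theta_sum: "x : ball x0 r ==> \<theta> (t, x) w = (SUM b:Basis. (w \<bullet> b) * \<theta> (t, x) b)"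
  using linear_basis_sum[OF lin, of x t w] by simp

lemma dtheta_linear: "x : ball x0 r ==> linear (dir (%y. \<theta> y v) (t, x))"
  by (intro dir_linear theta_diff)

lemma dtheta_sum: "x : ball x0 r ==> dir (%y. \<theta> y v) (t, x) w = (SUM b:Basis. (w \<bullet> b) * dir (%y. \<theta> y v) (t, x) b)"
  using linear_basis_sum[OF dtheta_linear, of x v t w] by simp

lemma dtheta_parameter:
  assumes "x : ball x0 r"
  shows "linear (%v. dir (%y. \<theta> y v) (t, x) w)"
proof (rule linear_dir_parameter[of "UNIV \<times> ball x0 r"])
  show "open (UNIV \<times> ball x0 r)" by (intro open_Times) auto
qed (use assms in \<open>auto intro: theta_diff lin\<close>)

lemma dtheta_parameter_sum:
  "x : ball x0 r ==> dir (%y. \<theta> y v) (t, x) w = (SUM b:Basis. (v \<bullet> b) * dir (%y. \<theta> y b) (t, x) w)"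
  using linear_basis_sum[OF dtheta_parameter[of x t w], of v] by simp

lemma segment_in_ball: "x : ball x0 r ==> s : {0..1} ==> x0 + s *\<^sub>R (x - x0) : ball x0 r"
proof -
  assume a: "x : ball x0 r" "s : {0..1}"
  have "norm (s *\<^sub>R (x - x0)) <= norm (x - x0)" using a by (simp add: mult_left_le_one_le)
  then show ?thesis using a by (simp add: dist_norm norm_minus_commute)
qed

text \<open>The homotopy formula. Along the segment from \<open>x0\<close>, differentiating
  \<open>\<theta>\<close> of the velocity in direction \<open>w\<close> gives the
  \<open>s\<close>-derivative of \<open>\<theta>\<close> on the varied vector plus a value of
  \<open>d\<theta>\<close>. The former integrates to boundary terms, and the one at
  \<open>x0\<close> cancels against the derivative of the integral over the
  \<open>t\<close>-axis.\<close>

lemma prim_derivative: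
  assumes z: "z : {T0<..} \<times> ball x0 r"
  shows "(prim \<theta> T0 x0 has_derivative (%w. \<theta> z w + prim_err \<theta> x0 z w)) (at z)"
proof -
  define U where "U = {T0<..} \<times> ball x0 r"
  have U: "open U" "convex U" "z : U" unfolding U_def using z by (auto intro: open_Times convex_Times)
  define \<gamma> where "\<gamma> z s = (fst z, x0 + s *\<^sub>R (snd z - x0))" for z :: "real * 'e" and s
  define bz where "bz z = (0::real, snd z - x0)" for z :: "real * 'e"
  \<comment> \<open>\<open>dg s\<close> and \<open>db\<close> are the derivatives, with respect to
    the endpoint \<open>z\<close>, of the segment \<open>\<gamma>\<close> and of its velocity
    \<open>bz\<close>.\<close>
  define dg where "dg s w = (fst w, s *\<^sub>R snd w)" for s and w :: "real * 'e"
  define db where "db w = (0::real, snd w)" for w :: "real * 'e"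
  have \<gamma>U: "snd (\<gamma> z s) : ball x0 r" "\<gamma> z s : UNIV \<times> ball x0 r" if "z : U" "s : {0..1}" for z s
    using segment_in_ball[of "snd z" s] that by (auto simp: \<gamma>_def U_def)
  have \<gamma>im: "(%p. \<gamma> (fst p) (snd p)) ` (U \<times> {0..1}) \<subseteq> UNIV \<times> ball x0 r"
    by (rule image_subsetI, rule \<gamma>U(2)) auto
  have \<gamma>im': "\<gamma> z ` {0..1} \<subseteq> UNIV \<times> ball x0 r" if "z : U" for z
    by (rule image_subsetI, rule \<gamma>U(2)[OF that])
  have \<gamma>p: "\<gamma> z s = (fst z, snd (\<gamma> z s))" for z s by (simp add: \<gamma>_def)
  have sums: "(SUM b:Basis. (v \<bullet> b) * \<theta> (\<gamma> z s) b) = \<theta> (\<gamma> z s) v"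
    "(SUM b:Basis. (v \<bullet> b) * dir (%y. \<theta> y b) (\<gamma> z s) u) = dir (%y. \<theta> y v) (\<gamma> z s) u"
    and td: "(%y. \<theta> y v) differentiable (at (\<gamma> z s))" if "z : U" "s : {0..1}" for z s u v
    using theta_sum[OF \<gamma>U(1)[OF that], of "fst z" v] dtheta_parameter_sum[OF \<gamma>U(1)[OF that], of v "fst z" u]
      theta_diff[OF \<gamma>U(1)[OF that], of v "fst z"] \<gamma>p[of z s] by simp_all
  define f where "f z s = \<theta> (\<gamma> z s) (bz z)" for z s
  define G where "G z s w = (SUM b:Basis. (bz z \<bullet> b) * dir (%y. \<theta> y b) (\<gamma> z s) (dg s w) + (db w \<bullet> b) * \<theta> (\<gamma> z s) b)" for z s w
  have d\<gamma>: "((%z. \<gamma> z s) has_derivative dg s) (at z)" for z s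
    unfolding \<gamma>_def dg_def[abs_def] by (auto intro!: derivative_eq_intros)
  have dbz: "(bz has_derivative db) (at z)" for z
    unfolding bz_def[abs_def] db_def[abs_def] by (auto intro!: derivative_eq_intros)
  have c\<gamma>: "continuous_on X (%p. \<gamma> (fst p) (snd p))" for X
    unfolding \<gamma>_def by (intro continuous_intros)
  have cbz: "continuous_on X (%p. bz (fst p))" for X :: "((real * 'e) \<times> real) set"
    unfolding bz_def by (intro continuous_intros)
  have fe: "f z s = (SUM b:Basis. (bz z \<bullet> b) * \<theta> (\<gamma> z s) b)" if "z : U" "s : {0..1}" for z s
    unfolding f_def by (rule sums(1)[OF that, symmetric])
  have df: "((%z. f z s) has_derivative G z s) (at z)" if "z : U" "s : {0..1}" for z s
  proof (rule has_derivative_transform_within_open[OF _ U(1) that(1)])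
    have th: "((%z. \<theta> (\<gamma> z s) b) has_derivative (%w. dir (%y. \<theta> y b) (\<gamma> z s) (dg s w))) (at z)" for b
      using diff_chain_at[OF d\<gamma> dir_works[OF td[OF that]]] by (simp add: o_def)
    show "((%z. SUM b:Basis. (bz z \<bullet> b) * \<theta> (\<gamma> z s) b) has_derivative G z s) (at z)"
      unfolding G_def by (intro has_derivative_sum has_derivative_mult has_derivative_inner_left dbz th)
  qed (rule fe[OF _ that(2), symmetric])
  have cG: "continuous_on (U \<times> {0..1}) (%(z, s). G z s w)" for w
  proof -
    have t1: "continuous_on (U \<times> {0..1}) (%p. \<theta> (\<gamma> (fst p) (snd p)) b)" for b
      by (rule continuous_on_compose2[OF theta_cont c\<gamma> \<gamma>im])
    have t2: "continuous_on (U \<times> {0..1}) (%p. dir (%y. \<theta> y b) (\<gamma> (fst p) (snd p)) (dg (snd p) w))" for b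
    proof (rule continuous_on_eq)
      show "continuous_on (U \<times> {0..1}) (%p. SUM b':Basis. (dg (snd p) w \<bullet> b') * dir (%y. \<theta> y b) (\<gamma> (fst p) (snd p)) b')"
        unfolding dg_def
        by (intro continuous_intros continuous_on_compose2[OF dtheta_cont c\<gamma> \<gamma>im])
      show "(SUM b':Basis. (dg (snd p) w \<bullet> b') * dir (%y. \<theta> y b) (\<gamma> (fst p) (snd p)) b') =
          dir (%y. \<theta> y b) (\<gamma> (fst p) (snd p)) (dg (snd p) w)" if "p : U \<times> {0..1}" for p
        using dtheta_sum[OF \<gamma>U(1), of "fst p" "snd p" b "fst (fst p)" "dg (snd p) w"] \<gamma>p[of "fst p" "snd p"] that by auto
    qed
    show ?thesis unfolding split_beta G_def by (intro continuous_intros t1 t2 cbz)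
  qed
  have cf: "continuous_on {0..1} (f z)" if "z : U" for z
  proof (rule continuous_on_eq)
    show "continuous_on {0..1} (%s. SUM b:Basis. (bz z \<bullet> b) * \<theta> (\<gamma> z s) b)"
    proof (intro continuous_intros)
      have c: "continuous_on {0..1} (\<gamma> z)" unfolding \<gamma>_def by (intro continuous_intros)
      show "continuous_on {0..1} (%s. \<theta> (\<gamma> z s) b)" for b
        by (rule continuous_on_compose2[OF theta_cont c \<gamma>im'[OF that]])
    qed
  qed (simp add: fe that)
  have d2: "((%z. integral {0..1} (f z)) has_derivative (%w. integral {0..1} (%s. G z s w))) (at z)"
    by (rule leibniz_has_derivative[OF U df cf cG])
  have zU: "z : U" by (rule U(3))
  have G: "integral {0..1} (%s. G z s w) = \<theta> z w - \<theta> (fst z, x0) (fst w, 0) + prim_err \<theta> x0 z w" for w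
  proof -
    \<comment> \<open>The integrand will be \<open>k'\<close>, the derivative of \<open>k\<close> in
      \<open>s\<close>, plus a value of \<open>d\<theta>\<close>.\<close>
    define k where "k s = \<theta> (\<gamma> z s) (dg s w)" for s
    define k' where "k' s = dir (%y. \<theta> y (dg s w)) (\<gamma> z s) (bz z) + \<theta> (\<gamma> z s) (db w)" for s
    have dk: "(k has_vector_derivative k' s) (at s within {0..1})" if s: "s : {0..1}" for s
    proof -
      have dgs: "((%s. \<gamma> z s) has_derivative (%h. h *\<^sub>R bz z)) (at s)"
        unfolding \<gamma>_def bz_def by (auto intro!: derivative_eq_intros)
      have th: "((%s. \<theta> (\<gamma> z s) b) has_derivative (%h. dir (%y. \<theta> y b) (\<gamma> z s) (h *\<^sub>R bz z))) (at s)" for b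
        using diff_chain_at[OF dgs dir_works[OF td[OF zU s]]] by (simp add: o_def)
      have dd: "((%s. dg s w) has_derivative (%h. h *\<^sub>R db w)) (at s)"
        unfolding dg_def db_def by (auto intro!: derivative_eq_intros)
      have "((%s. SUM b:Basis. (dg s w \<bullet> b) * \<theta> (\<gamma> z s) b) has_derivative
          (%h. SUM b:Basis. (dg s w \<bullet> b) * dir (%y. \<theta> y b) (\<gamma> z s) (h *\<^sub>R bz z) + ((h *\<^sub>R db w) \<bullet> b) * \<theta> (\<gamma> z s) b)) (at s)"
        by (intro has_derivative_sum has_derivative_mult has_derivative_inner_left dd th)
      moreover have "(SUM b:Basis. (dg s w \<bullet> b) * dir (%y. \<theta> y b) (\<gamma> z s) (h *\<^sub>R bz z) + ((h *\<^sub>R db w) \<bullet> b) * \<theta> (\<gamma> z s) b) = h *\<^sub>R k' s" for h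
      proof -
        have a: "dir (%y. \<theta> y (dg s w)) (\<gamma> z s) (h *\<^sub>R bz z) = h * dir (%y. \<theta> y (dg s w)) (\<gamma> z s) (bz z)"
          using linear_scale[OF dtheta_linear[OF \<gamma>U(1)[OF zU s], of "dg s w" "fst z"], of h "bz z"] \<gamma>p[of z s] by simp
        have b: "\<theta> (\<gamma> z s) (h *\<^sub>R db w) = h * \<theta> (\<gamma> z s) (db w)"
          using linear_scale[OF lin[OF \<gamma>U(1)[OF zU s], of "fst z"], of h "db w"] \<gamma>p[of z s] by simp
        show ?thesis unfolding sum.distrib sums[OF zU s] a b k'_def by (simp add: algebra_simps)
      qed
      ultimately have 1: "((%s. SUM b:Basis. (dg s w \<bullet> b) * \<theta> (\<gamma> z s) b) has_derivative (%h. h *\<^sub>R k' s)) (at s within {0..1})"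
        by (simp add: has_derivative_at_withinI)
      have ke: "k s = (SUM b:Basis. (dg s w \<bullet> b) * \<theta> (\<gamma> z s) b)" if "s : {0..1}" for s
        unfolding k_def by (rule sums(1)[OF zU that, symmetric])
      show ?thesis unfolding has_vector_derivative_def
        by (rule has_derivative_transform[OF s _ 1]) (simp add: ke)
    qed
    have hi: "(k' has_integral (k 1 - k 0)) {0..1}" by (rule fundamental_theorem_of_calculus[OF _ dk]) auto
    have k01: "k 1 = \<theta> z w" "k 0 = \<theta> (fst z, x0) (fst w, 0)" by (simp_all add: k_def \<gamma>_def dg_def)
    have I1: "integral {0..1} k' = \<theta> z w - \<theta> (fst z, x0) (fst w, 0)"
      using integral_unique[OF hi] unfolding k01 .
    have I1': "k' integrable_on {0..1}" by (rule has_integral_integrable[OF hi])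
    have e: "G z s w = k' s + ext1 \<theta> (\<gamma> z s) (dg s w) (bz z)" if s: "s : {0..1}" for s
      by (simp add: G_def k'_def ext1_def sum.distrib sums[OF zU s])
    have "continuous_on {0..1} (%s. G z s w)"
    proof -
      have c: "continuous_on {0..1} (%s::real. (z, s))" by (intro continuous_intros)
      have "(%s. (z, s)) ` {0..1} \<subseteq> U \<times> {0..1}" using zU by auto
      from continuous_on_compose2[OF cG[of w] c this] show ?thesis by simp
    qed
    then have "(%s. G z s w) integrable_on {0..1}" by (rule integrable_continuous_real)
    then have "integral {0..1} (%s. G z s w) - integral {0..1} k' = integral {0..1} (%s. G z s w - k' s)"
      using I1' by (simp add: integral_diff)
    also have "... = prim_err \<theta> x0 z w" unfolding prim_err_def
      by (rule integral_cong) (use e in \<open>auto simp: \<gamma>_def dg_def bz_def\<close>)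
    finally show ?thesis using I1 by simp
  qed
  have d1: "((%z. integral {T0..fst z} (%s. \<theta> (s, x0) (1, 0))) has_derivative (%w. \<theta> (fst z, x0) (fst w, 0))) (at z)"
  proof -
    have x0: "x0 : ball x0 r" using r by simp
    have c: "continuous_on {T0..fst z + 1} (%s. \<theta> (s, x0) (1, 0))"
      by (rule continuous_on_compose2[OF theta_cont, of _ "%s. (s, x0)"]) (use x0 in \<open>auto intro!: continuous_intros\<close>)
    have tz: "T0 < fst z" using z by auto
    have "((%u. integral {T0..u} (%s. \<theta> (s, x0) (1, 0))) has_real_derivative \<theta> (fst z, x0) (1, 0)) (at (fst z) within {T0..fst z + 1})"
      by (rule integral_has_real_derivative[OF c]) (use tz in auto)
    then have "((%u. integral {T0..u} (%s. \<theta> (s, x0) (1, 0))) has_real_derivative \<theta> (fst z, x0) (1, 0)) (at (fst z))"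
      using tz by (simp add: at_within_Icc_at)
    from diff_chain_at[OF has_derivative_fst[OF has_derivative_ident] this[unfolded has_field_derivative_def]]
    have hd: "((%z. integral {T0..fst z} (%s. \<theta> (s, x0) (1, 0))) has_derivative (%w. \<theta> (fst z, x0) (1, 0) * fst w)) (at z)"
      by (simp add: o_def)
    have e: "\<theta> (fst z, x0) (1, 0) * fst w = \<theta> (fst z, x0) (fst w, 0)" for w
      using linear_scale[OF lin[OF x0, of "fst z"], of "fst w" "(1, 0)"] by simp
    show ?thesis using hd unfolding e .
  qed
  have p: "prim \<theta> T0 x0 = (%z. integral {T0..fst z} (%s. \<theta> (s, x0) (1, 0)) + integral {0..1} (f z))"
    by (simp add: prim_def[abs_def] f_def[abs_def] \<gamma>_def bz_def)
  show ?thesis unfolding p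
    by (rule has_derivative_eq_rhs[OF has_derivative_add[OF d1 d2]]) (simp add: G fun_eq_iff)
qed

text \<open>The segment has speed at most \<open>r\<close>, and the varied vector is no longer than
  \<open>w\<close>.\<close>

lemma prim_err_bound:
  assumes z: "z : {T0<..} \<times> ball x0 r" and C: "C >= 0"
    and b: "!!x u v. x : ball x0 r ==> \<bar>ext1 \<theta> (fst z, x) u v\<bar> <= C * norm u * norm v"
  shows "\<bar>prim_err \<theta> x0 z w\<bar> <= C * r * norm w"
proof -
  have zr: "norm (snd z - x0) <= r" "snd z : ball x0 r" using z by (auto simp: dist_norm norm_minus_commute)
  define g where "g s = ext1 \<theta> (fst z, x0 + s *\<^sub>R (snd z - x0)) (fst w, s *\<^sub>R snd w) (0, snd z - x0)" for s
  have "\<bar>g s\<bar> <= C * r * norm w" if s: "s : {0..1}" for s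
  proof -
    have "norm (fst w, s *\<^sub>R snd w) <= norm w"
    proof -
      have "(s * norm (snd w))\<^sup>2 <= (norm (snd w))\<^sup>2"
        using s by (intro power_mono) (auto simp: mult_left_le_one_le)
      then show ?thesis using s by (simp add: norm_Pair norm_prod_def real_sqrt_le_mono)
    qed
    then have "C * norm (fst w, s *\<^sub>R snd w) * norm (0::real, snd z - x0) <= C * norm w * r"
      using C zr(1) by (intro mult_mono) auto
    then show ?thesis using b[OF segment_in_ball[OF zr(2) s], of "(fst w, s *\<^sub>R snd w)" "(0, snd z - x0)"]
      by (simp add: g_def mult_ac)
  qed
  note gb = this
  have n: "0 <= C * r * norm w" using C r by simp
  have "norm (integral {0..1} g) <= C * r * norm w"
  proof (cases "g integrable_on {0..1}")
    case True
    then have i: "(g has_integral integral {0..1} g) (cbox 0 1)" by (simp add: cbox_interval integrable_integral)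
    from has_integral_bound[OF n i] gb show ?thesis by (simp add: cbox_interval)
  next
    case False
    then show ?thesis using n by (simp add: not_integrable_integral)
  qed
  then show ?thesis by (simp add: prim_err_def g_def[abs_def])
qed

text \<open>The error term involves first derivatives of \<open>\<theta>\<close>, which are merely
  continuous, so order one is what this construction yields.\<close>

lemma Ck_on_prim: "Ck_on 1 ({T0<..} \<times> ball x0 r) (prim \<theta> T0 x0)"
proof -
  define U where "U = {T0<..} \<times> ball x0 r"
  have d: "dir (prim \<theta> T0 x0) z = (%w. \<theta> z w + prim_err \<theta> x0 z w)" if "z : U" for z
    using prim_derivative that by (intro dir_eqI) (simp add: U_def)
  have "continuous_on U (%z. \<theta> z w + prim_err \<theta> x0 z w)" for w
  proof -
    have c1: "continuous_on U (%z. \<theta> z w)"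
      by (rule continuous_on_subset[OF theta_cont]) (auto simp: U_def)
    have cg: "continuous_on (U \<times> {0..1}) (%p::(real * 'e) \<times> real. (fst (fst p), x0 + snd p *\<^sub>R (snd (fst p) - x0)))"
      by (intro continuous_intros)
    have dc: "continuous_on (U \<times> {0..1}) (%p::(real * 'e) \<times> real. dir (%y. \<theta> y a) (fst (fst p), x0 + snd p *\<^sub>R (snd (fst p) - x0)) b)" for a b
      by (rule continuous_on_compose2[OF dtheta_cont cg]) (use segment_in_ball in \<open>auto simp: U_def\<close>)
    have "continuous_on (U \<times> {0..1}) (%(z, s). ext1 \<theta> (fst z, x0 + s *\<^sub>R (snd z - x0)) (fst w, s *\<^sub>R snd w) (0, snd z - x0))"
    proof (rule continuous_on_eq)
      let ?y = "%p::(real * 'e) \<times> real. (fst (fst p), x0 + snd p *\<^sub>R (snd (fst p) - x0))"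
      let ?w = "%p::(real * 'e) \<times> real. (fst w, snd p *\<^sub>R snd w)" and ?v = "%p::(real * 'e) \<times> real. (0::real, snd (fst p) - x0)"
      show "continuous_on (U \<times> {0..1}) (%p. SUM a:Basis. SUM b:Basis.
          ((?v p \<bullet> a) * (?w p \<bullet> b) - (?w p \<bullet> a) * (?v p \<bullet> b)) * dir (%y. \<theta> y a) (?y p) b)"
        by (intro continuous_intros dc)
      fix p :: "(real * 'e) \<times> real" assume "p : U \<times> {0..1}"
      then have y: "x0 + snd p *\<^sub>R (snd (fst p) - x0) : ball x0 r"
        using segment_in_ball[of "snd (fst p)" "snd p"] by (auto simp: U_def)
      have e: "dir (%y. \<theta> y v) (?y p) u = (SUM a:Basis. SUM b:Basis. (v \<bullet> a) * (u \<bullet> b) * dir (%y. \<theta> y a) (?y p) b)" for u v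
      proof -
        have "dir (%y. \<theta> y v) (?y p) u = (SUM a:Basis. (v \<bullet> a) * dir (%y. \<theta> y a) (?y p) u)"
          by (rule dtheta_parameter_sum[OF y])
        also have "... = (SUM a:Basis. (v \<bullet> a) * (SUM b:Basis. (u \<bullet> b) * dir (%y. \<theta> y a) (?y p) b))"
          by (intro sum.cong refl arg_cong2[where f = "(*)"] dtheta_sum[OF y])
        finally show ?thesis by (simp only: sum_distrib_left mult.assoc)
      qed
      show "(SUM a:Basis. SUM b:Basis.
          ((?v p \<bullet> a) * (?w p \<bullet> b) - (?w p \<bullet> a) * (?v p \<bullet> b)) * dir (%y. \<theta> y a) (?y p) b) =
          (case p of (z, s) => ext1 \<theta> (fst z, x0 + s *\<^sub>R (snd z - x0)) (fst w, s *\<^sub>R snd w) (0, snd z - x0))"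
        unfolding split_beta ext1_def e[of "?v p" "?w p"] e[of "?w p" "?v p"]
        by (simp only: sum_subtractf left_diff_distrib)
    qed
    then have "continuous_on U (%z. prim_err \<theta> x0 z w)"
      unfolding prim_err_def cbox_interval[symmetric] by (rule integral_continuous_on_param)
    then show ?thesis using c1 by (intro continuous_intros)
  qed
  then have "continuous_on U (%z. dir (prim \<theta> T0 x0) z w)" for w
    by (rule continuous_on_eq) (simp add: d)
  moreover have "prim \<theta> T0 x0 differentiable (at z)" if "z : U" for z
    by (rule differentiableI[OF prim_derivative]) (use that in \<open>simp add: U_def\<close>)
  ultimately show ?thesis by (simp add: U_def)
qed

end

lemma linear_family_locally_bounded:
  fixes L :: "'a::euclidean_space => 'b::euclidean_space => 'c::real_normed_vector"
  assumes U: "open U" "x0 : U" and L: "!!x. x : U ==> linear (L x)" "!!b. continuous_on U (%x. L x b)"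
  shows "EX B>=0. EX r>0. ball x0 r \<subseteq> U & (ALL x:ball x0 r. ALL v. norm (L x v) <= B * norm v)"
proof -
  obtain r where r: "r > 0" "cball x0 r \<subseteq> U" using U open_contains_cball by blast
  have "EX B. ALL x:cball x0 r. norm (L x b) <= B" for b
    using compact_imp_bounded[OF compact_continuous_image[OF continuous_on_subset[OF L(2)[of b] r(2)] compact_cball]]
    unfolding bounded_iff by auto
  then obtain B where B: "!!b x. x : cball x0 r ==> norm (L x b) <= B b" by metis
  have "norm (L x v) <= (SUM b:Basis. \<bar>B b\<bar>) * norm v" if x: "x : ball x0 r" for x v
  proof -
    have xU: "x : cball x0 r" "x : U" using x r(2) by auto
    have "norm (L x v) = norm (SUM b:Basis. (v \<bullet> b) *\<^sub>R L x b)"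
      using linear_basis_sum[OF L(1)[OF xU(2)], of v] by simp
    also have "... <= (SUM b:Basis. norm v * \<bar>B b\<bar>)"
    proof (rule sum_norm_le)
      fix b :: 'b assume "b : Basis"
      then show "norm ((v \<bullet> b) *\<^sub>R L x b) <= norm v * \<bar>B b\<bar>"
        using B[OF xU(1), of b] Basis_le_norm[of b v] by (simp add: mult_mono)
    qed
    finally show ?thesis by (simp add: sum_distrib_left mult.commute)
  qed
  then show ?thesis using r by (intro exI[of _ "SUM b:Basis. \<bar>B b\<bar>"] conjI exI[of _ r]) (auto simp: sum_nonneg)
qed

lemma has_derivative_snd_compose:
  assumes "(T has_derivative T') (at x)"
  shows "((%z. T (snd z)) has_derivative (%w. T' (snd w))) (at (t, x))"
    "((%z. (fst z, T (snd z))) has_derivative (%w. (fst w, T' (snd w)))) (at (t, x))"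
proof -
  have "(T has_derivative T') (at (snd (t, x)))" using assms by simp
  from diff_chain_at[OF has_derivative_snd[OF has_derivative_ident] this]
  show "((%z. T (snd z)) has_derivative (%w. T' (snd w))) (at (t, x))" by (simp add: o_def)
  from has_derivative_Pair[OF has_derivative_fst[OF has_derivative_ident] this]
  show "((%z. (fst z, T (snd z))) has_derivative (%w. (fst w, T' (snd w)))) (at (t, x))" by simp
qed

lemma dir_locally_bounded:
  assumes U: "open U" "x0 : U" and f: "Ck_on 1 U f"
  shows "EX B>=0. EX r>0. ball x0 r \<subseteq> U & (ALL x:ball x0 r. ALL v. norm (dir f x v) <= B * norm v)"
proof (rule linear_family_locally_bounded[OF U])
  show "linear (dir f x)" if "x : U" for x using dir_linear Ck_on_imp_differentiable[OF f _ that] by simp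
  show "continuous_on U (%x. dir f x b)" for b using f by simp
qed

abbreviation rep :: "('s, 'e) chart => (real * 's => 'b) => real * 'e => 'b" where
  "rep c F z \<equiv> F (fst z, point c (snd z))"

lemma exp_decay: "a > 0 ==> ((%t. exp (- a * t)) \<longlongrightarrow> (0 :: real)) at_top"
  by (intro filterlim_compose[OF exp_at_bot] filterlim_tendsto_neg_mult_at_bot[OF tendsto_const] filterlim_ident) simp

section \<open>Almost closed 1-forms on a cylinder and their local primitives\<close>

locale end_form = smooth_manifold A
  for A :: "('s::{t2_space,second_countable_topology}, 'e::euclidean_space) chart set" +
  fixes \<theta> :: "('s, 'e) chart => real * 'e => real * 'e => real" and T0 lam :: real
  assumes lam: "lam > 0"
    and theta_lin: "c : A ==> x : range_of c ==> linear (\<theta> c (t, x))"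
    and theta_C1: "c : A ==> Ck_on 1 (UNIV \<times> range_of c) (%z. \<theta> c z w)"
    and theta_inv: "c : A ==> d : A ==> x : overlap c d ==>
      \<theta> c (t, x) w = \<theta> d (t, transition c d x) (fst w, dir (transition c d) x (snd w))"
    and theta_decay: "c : A ==> x0 : range_of c ==> EX C. EX r>0. ALL x:ball x0 r. ALL t>T0. ALL u v.
      \<bar>ext1 (\<theta> c) (t, x) u v\<bar> <= C * exp (- lam * t) * norm u * norm v"
    and cpt: "compact (UNIV :: 's set)"
begin

text \<open>The bound is local in the cross-section and uses the norm of one chart, which makes it
  stable under sums; uniformity is recovered later by compactness.\<close>

definition decays :: "'e => (real * 'e => real * 'e => real) => bool" where
  "decays x0 \<phi> \<longleftrightarrow> (EX C>=0. EX r>0. ALL x:ball x0 r. ALL t>T0. ALL w. \<bar>\<phi> (t, x) w\<bar> <= C * exp (- lam * t) * norm w)"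

lemma decays_dominated:
  assumes "decays x0 \<phi>" "r > 0" "!!x t w. x : ball x0 r ==> t > T0 ==> \<bar>\<psi> (t, x) w\<bar> <= K * \<bar>\<phi> (t, x) w\<bar>"
  shows "decays x0 \<psi>"
proof -
  obtain C r' where C: "C >= 0" "r' > 0" "!!x t w. x : ball x0 r' ==> t > T0 ==> \<bar>\<phi> (t, x) w\<bar> <= C * exp (- lam * t) * norm w"
    using assms(1) unfolding decays_def by blast
  have "\<bar>\<psi> (t, x) w\<bar> <= (\<bar>K\<bar> * C) * exp (- lam * t) * norm w" if "x : ball x0 (min r r')" "t > T0" for x t w
  proof -
    have "\<bar>\<psi> (t, x) w\<bar> <= K * \<bar>\<phi> (t, x) w\<bar>" using assms(3) that by auto
    also have "... <= \<bar>K\<bar> * \<bar>\<phi> (t, x) w\<bar>" by (intro mult_right_mono) auto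
    also have "... <= \<bar>K\<bar> * (C * exp (- lam * t) * norm w)" using C(3)[of x t w] that by (intro mult_left_mono) auto
    finally show ?thesis by (simp add: mult_ac)
  qed
  then show ?thesis unfolding decays_def using C(1,2) assms(2)
    by (intro exI[of _ "\<bar>K\<bar> * C"] conjI exI[of _ "min r r'"]) auto
qed

lemma decays_zero: "decays x0 (%z w. 0)"
  unfolding decays_def by (intro exI[of _ 0] conjI exI[of _ 1]) auto

lemma decays_add:
  assumes "decays x0 \<phi>" "decays x0 \<psi>" shows "decays x0 (%z w. \<phi> z w + \<psi> z w)"
proof -
  obtain C r where C: "C >= 0" "r > 0" "!!x t w. x : ball x0 r ==> t > T0 ==> \<bar>\<phi> (t, x) w\<bar> <= C * exp (- lam * t) * norm w"
    using assms(1) unfolding decays_def by blast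
  obtain C' r' where C': "C' >= 0" "r' > 0" "!!x t w. x : ball x0 r' ==> t > T0 ==> \<bar>\<psi> (t, x) w\<bar> <= C' * exp (- lam * t) * norm w"
    using assms(2) unfolding decays_def by blast
  have "\<bar>\<phi> (t, x) w + \<psi> (t, x) w\<bar> <= (C + C') * exp (- lam * t) * norm w" if "x : ball x0 (min r r')" "t > T0" for x t w
    using C(3)[of x t w] C'(3)[of x t w] that by (simp add: algebra_simps)
  then show ?thesis unfolding decays_def using C(1,2) C'(1,2)
    by (intro exI[of _ "C + C'"] conjI exI[of _ "min r r'"]) auto
qed

lemma decays_sum:
  assumes "!!k. k < n ==> decays x0 (\<phi> k)" shows "decays x0 (%z w. SUM k<n::nat. \<phi> k z w)"
  using assms by (induction n) (auto intro: decays_add decays_zero)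

lemma decays_cong:
  assumes "decays x0 \<phi>" "open V" "x0 : V" "!!x t w. x : V ==> t > T0 ==> \<psi> (t, x) w = \<phi> (t, x) w"
  shows "decays x0 \<psi>"
proof -
  obtain r where "r > 0" "ball x0 r \<subseteq> V" using assms(2,3) open_contains_ball by blast
  moreover have "\<bar>\<psi> (t, x) w\<bar> <= 1 * \<bar>\<phi> (t, x) w\<bar>" if "x : ball x0 r" "t > T0" for x t w
    using assms(4)[of x t w] that calculation(2) by (metis mult_1 order_refl subsetD)
  ultimately show ?thesis using decays_dominated[OF assms(1), of r \<psi> 1] by blast
qed

lemma decays_minus: "decays x0 \<phi> ==> decays x0 (%z w. - \<phi> z w)"
  using decays_dominated[of x0 \<phi> 1 _ 1] by simp

lemma decays_diff: "decays x0 \<phi> ==> decays x0 \<psi> ==> decays x0 (%z w. \<phi> z w - \<psi> z w)"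
  using decays_add[OF _ decays_minus, of x0 \<phi> \<psi>] by simp

abbreviation C1_near :: "('s, 'e) chart => 'e => (real * 'e => real) => bool" where
  "C1_near c x0 g \<equiv> EX r>0. ball x0 r \<subseteq> range_of c & Ck_on 1 ({T0<..} \<times> ball x0 r) g"

definition almost_primitive :: "('s, 'e) chart => 'e => (real * 's => real) => bool" where
  "almost_primitive c x0 F \<longleftrightarrow> C1_near c x0 (rep c F) &
     decays x0 (%z w. \<theta> c z w - dir (rep c F) z w)"

text \<open>The homotopy primitive of one chart around \<open>s0\<close>. In another chart the error
  changes by the derivative of the transition map, which is locally bounded.\<close>

lemma local_primitive:
  "EX F U. open U & s0 : U & (ALL c:A. ALL x0:range_of c. point c x0 : U --> almost_primitive c x0 F)"
proof -
  obtain a where a: "a : A" "s0 : dom_of a" using cover .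
  define x1 where "x1 = coord a s0"
  have x1: "x1 : range_of a" using a by (simp add: x1_def coord_in)
  obtain C r1 where C: "r1 > 0" "!!x t u v. x : ball x1 r1 ==> t > T0 ==> \<bar>ext1 (\<theta> a) (t, x) u v\<bar> <= C * exp (- lam * t) * norm u * norm v"
    using theta_decay[OF a(1) x1] by blast
  obtain r2 where r2: "r2 > 0" "ball x1 r2 \<subseteq> range_of a"
    using chart(2)[OF a(1)] x1 open_contains_ball by blast
  define r where "r = min r1 r2"
  have r: "r > 0" "ball x1 r \<subseteq> ball x1 r1" "ball x1 r \<subseteq> range_of a" using C(1) r2 by (auto simp: r_def)
  have bd: "\<bar>ext1 (\<theta> a) (t, x) u v\<bar> <= \<bar>C\<bar> * exp (- lam * t) * norm u * norm v" if "x : ball x1 r" "t > T0" for x t u v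
  proof -
    have "x : ball x1 r1" using r(2) that(1) by blast
    from C(2)[OF this that(2), of u v]
    have "\<bar>ext1 (\<theta> a) (t, x) u v\<bar> <= C * (exp (- lam * t) * norm u * norm v)" by (simp only: mult.assoc)
    also have "... <= \<bar>C\<bar> * (exp (- lam * t) * norm u * norm v)" by (rule mult_right_mono) auto
    finally show ?thesis by (simp only: mult.assoc)
  qed
  have ln: "x : ball x1 r ==> linear (\<theta> a (t, x))" for t x using theta_lin[OF a(1)] r(3) by blast
  have c1: "Ck_on 1 (UNIV \<times> ball x1 r) (%z. \<theta> a z w)" for w
    by (rule Ck_on_subset[OF theta_C1[OF a(1)]]) (use r(3) in auto)
  note pr = ln c1 r(1)
  define P where "P = prim (\<theta> a) T0 x1"
  define E where "E = prim_err (\<theta> a) x1"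
  have dP: "(P has_derivative (%w. \<theta> a z w + E z w)) (at z)" if "z : {T0<..} \<times> ball x1 r" for z
    unfolding P_def E_def by (rule prim_derivative[OF pr that])
  have CP: "Ck_on 1 ({T0<..} \<times> ball x1 r) P"
    unfolding P_def by (rule Ck_on_prim[OF pr])
  have bE: "\<bar>E (t, x) w\<bar> <= (\<bar>C\<bar> * exp (- lam * t)) * r * norm w" if "x : ball x1 r" "t > T0" for t x w
    unfolding E_def
    by (rule prim_err_bound[OF pr]) (use that bd in auto)
  define F where "F p = P (fst p, coord a (snd p))" for p :: "real * 's"
  define U where "U = point a ` ball x1 r"
  have U: "open U" "s0 : U"
  proof -
    show "open U" unfolding U_def by (rule open_point_image[OF a(1) open_ball r(3)])
    show "s0 : U" using imageI[of x1 "ball x1 r" "point a"] r(1) by (simp add: U_def x1_def point_coord[OF a])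
  qed
  have "almost_primitive c x0 F" if c: "c : A" and x0: "x0 : range_of c" "point c x0 : U" for c x0
  proof -
    define T where "T = transition c a"
    have Ua: "U \<subseteq> dom_of a" using r(3) point_in[OF a(1)] by (auto simp: U_def)
    define W where "W = coord c ` (dom_of c Int U)"
    have W: "open W" "x0 : W" unfolding W_def using open_coord_image[OF c U(1)] x0 by (auto simp: coord_image_eq[OF c])
    have Wo: "W \<subseteq> overlap c a" using Ua by (auto simp: W_def overlap_def)
    have TW: "T x : ball x1 r" if "x : W" for x
    proof -
      have "point c x : U" using that by (auto simp: W_def coord_image_eq[OF c])
      then obtain y where y: "y : ball x1 r" "point c x = point a y" by (auto simp: U_def)
      have "y : range_of a" using y(1) r(3) by blast
      then show ?thesis using y coord_point[OF a(1)] by (simp add: T_def transition_apply)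
    qed
    have CT: "Ck_on 1 W T" unfolding T_def by (rule Ck_on_subset[OF Ck_transition[OF c a(1)] Wo])
    obtain B r3 where B: "B >= 0" "r3 > 0" "ball x0 r3 \<subseteq> W" "!!x v. x : ball x0 r3 ==> norm (dir T x v) <= B * norm v"
      using dir_locally_bounded[OF W CT] by blast
    have Wr: "W \<subseteq> range_of c" by (auto simp: W_def coord_image_eq[OF c])
    have rep: "rep c F = (%z. P (fst z, T (snd z)))"
      by (auto simp: F_def T_def transition_apply)
    have opn: "open ({T0<..} \<times> ball x0 r3)" by (intro open_Times) auto
    have Cg: "Ck_on 1 ({T0<..} \<times> ball x0 r3) (%z. (fst z, T (snd z)))"
      by (intro Ck_on_Pair opn Ck_on_bounded_linear bounded_linear_fst
          Ck_on_compose[OF opn Ck_on_bounded_linear[OF bounded_linear_snd] CT]) (use B(3) in auto)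
    have 1: "Ck_on 1 ({T0<..} \<times> ball x0 r3) (rep c F)" unfolding rep
      by (rule Ck_on_compose[OF opn Cg CP]) (use B(3) TW in auto)
    have dF: "dir (rep c F) (t, x) w = \<theta> c (t, x) w + E (t, T x) (fst w, dir T x (snd w))"
      if x: "x : ball x0 r3" and t: "t > T0" for t x w
    proof -
      have xW: "x : W" using x B(3) by auto
      have "(T has_derivative dir T x) (at x)" using CT xW by (intro dir_works Ck_on_imp_differentiable[of 1]) auto
      note g = has_derivative_snd_compose(2)[OF this, of t]
      have "(P has_derivative (%w. \<theta> a (t, T x) w + E (t, T x) w)) (at (t, T x))"
        by (rule dP) (use t TW[OF xW] in auto)
      from diff_chain_at[OF g, of P, unfolded fst_conv snd_conv, OF this]
      have "((%z. P (fst z, T (snd z))) has_derivative (%w. \<theta> a (t, T x) (fst w, dir T x (snd w)) + E (t, T x) (fst w, dir T x (snd w)))) (at (t, x))"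
        by (simp add: o_def)
      then have "dir (rep c F) (t, x) = (%w. \<theta> a (t, T x) (fst w, dir T x (snd w)) + E (t, T x) (fst w, dir T x (snd w)))"
        unfolding rep by (rule dir_eqI)
      moreover have "\<theta> c (t, x) w = \<theta> a (t, T x) (fst w, dir T x (snd w))"
        unfolding T_def by (rule theta_inv[OF c a(1)]) (use Wo xW in blast)
      ultimately show ?thesis by simp
    qed
    have 2: "decays x0 (%z w. \<theta> c z w - dir (rep c F) z w)"
    proof -
      have "\<bar>\<theta> c (t, x) w - dir (rep c F) (t, x) w\<bar> <= \<bar>C\<bar> * r * (1 + B) * exp (- lam * t) * norm w"
        if x: "x : ball x0 r3" and t: "T0 < t" for x t w
      proof -
      have "norm (fst w, dir T x (snd w)) <= \<bar>fst w\<bar> + norm (dir T x (snd w))"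
        using norm_Pair_le[of "fst w" "dir T x (snd w)"] by simp
      also have "... <= norm w + B * norm w"
        using B(4)[OF x, of "snd w"] norm_fst_le[of "fst w" "snd w"] mult_left_mono[OF norm_snd_le[of "snd w" "fst w"] B(1)] by simp
      finally have n: "norm (fst w, dir T x (snd w)) <= (1 + B) * norm w" by (simp add: algebra_simps)
      have "T x : ball x1 r" using TW B(3) x by blast
      from bE[OF this t, of "(fst w, dir T x (snd w))"]
      have "\<bar>E (t, T x) (fst w, dir T x (snd w))\<bar> <= \<bar>C\<bar> * exp (- lam * t) * r * norm (fst w, dir T x (snd w))" .
      also have "... <= \<bar>C\<bar> * exp (- lam * t) * r * ((1 + B) * norm w)"
        using n r(1) by (intro mult_left_mono) auto
      finally show ?thesis unfolding dF[OF x t] by (simp add: mult_ac)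
      qed
      moreover have "0 <= \<bar>C\<bar> * r * (1 + B)" using r B by simp
      ultimately show ?thesis unfolding decays_def using B(2) by blast
    qed
    show ?thesis unfolding almost_primitive_def using 1 2 B(2,3) Wr by blast
  qed
  then show ?thesis using U by blast
qed

text \<open>The differential of the difference decays exponentially, so the difference tends to a
  constant at the same rate, uniformly near \<open>x0\<close>.\<close>

lemma almost_primitive_difference:
  assumes F: "almost_primitive c x0 F" and G: "almost_primitive c x0 G"
  shows "EX m C. EX r>0. C >= 0 & (ALL x:ball x0 r. ALL t>T0. \<bar>rep c F (t, x) - rep c G (t, x) - m\<bar> <= C * exp (- lam * t))"
proof -
  have d: "decays x0 (%z w. dir (rep c F) z w - dir (rep c G) z w)"
    using decays_diff[of x0 "%z w. \<theta> c z w - dir (rep c G) z w" "%z w. \<theta> c z w - dir (rep c F) z w"] F G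
    unfolding almost_primitive_def by simp
  obtain C r1 where C: "C >= 0" "r1 > 0" "!!x t w. x : ball x0 r1 ==> t > T0 ==>
      \<bar>dir (rep c F) (t, x) w - dir (rep c G) (t, x) w\<bar> <= C * exp (- lam * t) * norm w"
    using d unfolding decays_def by blast
  obtain rF where rF: "rF > 0" "Ck_on 1 ({T0<..} \<times> ball x0 rF) (rep c F)"
    using F unfolding almost_primitive_def by blast
  obtain rG where rG: "rG > 0" "Ck_on 1 ({T0<..} \<times> ball x0 rG) (rep c G)"
    using G unfolding almost_primitive_def by blast
  define r where "r = min r1 (min rF rG)"
  have r: "r > 0" "ball x0 r \<subseteq> ball x0 r1" "ball x0 r \<subseteq> ball x0 rF" "ball x0 r \<subseteq> ball x0 rG"
    using C(2) rF(1) rG(1) by (auto simp: r_def)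
  define q where "q z = rep c F z - rep c G z" for z
  define D where "D z w = dir (rep c F) z w - dir (rep c G) z w" for z w
  have dq: "(q has_derivative D (t, x)) (at (t, x))" if "x : ball x0 r" "t > T0" for t x
    unfolding q_def D_def
    by (intro has_derivative_diff dir_works Ck_on_imp_differentiable[OF rF(2)] Ck_on_imp_differentiable[OF rG(2)])
      (use that r in auto)
  have Db: "\<bar>D (t, x) w\<bar> <= C * exp (- lam * t) * norm w" if "x : ball x0 r" "t > T0" for t x w
    unfolding D_def by (rule C(3)) (use that r in auto)
  have x0: "x0 : ball x0 r" using r(1) by simp
  \<comment> \<open>\<open>K * exp (- lam * t)\<close> is the integral of
    \<open>C * exp (- lam * s)\<close> over \<open>s >= t\<close>.\<close>
  define K where "K = C / lam"
  have K: "K >= 0" "K * lam = C" using C(1) lam by (auto simp: K_def)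
  have dt: "((%t. q (t, x0)) has_real_derivative D (t, x0) (1, 0)) (at t)" if "t > T0" for t
  proof -
    have "((%t. (t, x0)) has_derivative (%h. (h, 0))) (at t)" by (auto intro!: derivative_eq_intros)
    from diff_chain_at[OF this dq[OF x0 that]]
    have "((%t. q (t, x0)) has_derivative (%h. D (t, x0) (h, 0))) (at t)" by (simp add: o_def)
    moreover have "(%h. D (t, x0) (h, 0)) = (*) (D (t, x0) (1, 0))"
    proof
      show "D (t, x0) (h, 0) = D (t, x0) (1, 0) * h" for h
        using linear_scale[OF has_derivative_linear[OF dq[OF x0 that]], of h "(1, 0)"] by simp
    qed
    ultimately show ?thesis by (simp only: has_field_derivative_def)
  qed
  have de: "((%t. exp (- lam * t)) has_real_derivative - lam * exp (- lam * t)) (at t)" for t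
    by (auto intro!: derivative_eq_intros)
  have D1: "\<bar>D (t, x0) (1, 0)\<bar> <= C * exp (- lam * t)" if "t > T0" for t
    using Db[OF x0 that, of "(1, 0)"] by (simp add: norm_Pair)
  \<comment> \<open>Correcting by the tail integral makes \<open>u\<close> nondecreasing and
    \<open>v\<close> nonincreasing, which squeezes the limit \<open>m\<close> between them.\<close>
  define u where "u t = q (t, x0) - K * exp (- lam * t)" for t
  define v where "v t = q (t, x0) + K * exp (- lam * t)" for t
  have u: "u s <= u t" and v: "v t <= v s" if "T0 < s" "s <= t" for s t
  proof -
    show "u s <= u t"
    proof (rule DERIV_nonneg_imp_nondecreasing[OF that(2)])
      fix y assume "s <= y" "y <= t"
      then have y: "T0 < y" using that(1) by simp
      have "(u has_real_derivative D (y, x0) (1, 0) - K * (- lam * exp (- lam * y))) (at y)"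
        unfolding u_def by (intro DERIV_diff dt y DERIV_cmult de)
      moreover have "K * (- lam * exp (- lam * y)) = - (C * exp (- lam * y))" using K(2) by (metis mult.assoc mult_minus_left mult_minus_right)
      ultimately show "EX d. (u has_real_derivative d) (at y) & 0 <= d" using D1[OF y] by force
    qed
    show "v t <= v s"
    proof (rule DERIV_nonpos_imp_nonincreasing[OF that(2)])
      fix y assume "s <= y" "y <= t"
      then have y: "T0 < y" using that(1) by simp
      have "(v has_real_derivative D (y, x0) (1, 0) + K * (- lam * exp (- lam * y))) (at y)"
        unfolding v_def by (intro DERIV_add dt y DERIV_cmult de)
      moreover have "K * (- lam * exp (- lam * y)) = - (C * exp (- lam * y))" using K(2) by (metis mult.assoc mult_minus_left mult_minus_right)
      ultimately show "EX d. (v has_real_derivative d) (at y) & d <= 0" using D1[OF y] by force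
    qed
  qed
  have uv: "u s <= v t" if "T0 < s" "T0 < t" for s t
  proof -
    have "u s <= u (max s t)" using u[of s "max s t"] that by simp
    also have "... <= v (max s t)" using K(1) by (simp add: u_def v_def)
    also have "... <= v t" using v[of t "max s t"] that by simp
    finally show ?thesis .
  qed
  define m where "m = (SUP s\<in>{T0<..}. u s)"
  have bdd: "bdd_above (u ` {T0<..})" by (rule bdd_aboveI[of _ "v (T0 + 1)"]) (use uv[of _ "T0 + 1"] in auto)
  have m: "u t <= m" "m <= v t" if "t > T0" for t
  proof -
    show "u t <= m" unfolding m_def by (rule cSUP_upper[OF _ bdd]) (use that in simp)
    show "m <= v t" unfolding m_def by (rule cSUP_least) (use uv that in auto)
  qed
  have "\<bar>q (t, x) - m\<bar> <= (C * r + K) * exp (- lam * t)" if x: "x : ball x0 r" and t: "t > T0" for t x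
  proof -
    have "norm (q (t, x) - q (t, x0)) <= C * exp (- lam * t) * norm (x - x0)"
    proof (rule differentiable_bound[OF convex_ball _ _ x x0, of "%y. q (t, y)" "%y h. D (t, y) (0, h)"])
      fix y assume y: "y : ball x0 r"
      have "((%y. (t, y)) has_derivative (%h. (0, h))) (at y)" by (auto intro!: derivative_eq_intros)
      from diff_chain_at[OF this dq[OF y t]]
      show "((%y. q (t, y)) has_derivative (%h. D (t, y) (0, h))) (at y within ball x0 r)"
        by (simp add: o_def has_derivative_at_withinI)
      show "onorm (%h. D (t, y) (0, h)) <= C * exp (- lam * t)"
      proof (rule onorm_le)
        show "norm (D (t, y) (0, h)) <= C * exp (- lam * t) * norm h" for h
          using Db[OF y t, of "(0, h)"] by simp
      qed
    qed
    also have "... <= C * exp (- lam * t) * r"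
      using x C(1) by (intro mult_left_mono) (auto simp: dist_norm norm_minus_commute)
    finally have "\<bar>q (t, x) - q (t, x0)\<bar> <= C * r * exp (- lam * t)" by (simp add: mult_ac)
    moreover have "\<bar>q (t, x0) - m\<bar> <= K * exp (- lam * t)" using m[OF t] by (simp add: u_def v_def abs_le_iff)
    ultimately show ?thesis by (simp add: algebra_simps)
  qed
  then show ?thesis using r(1) C(1) K(1) unfolding q_def
    by (intro exI[of _ m] exI[of _ "C * r + K"] exI[of _ r]) (auto simp: less_imp_le)
qed

end

text \<open>The zero form is exact, so \<open>\<alpha>\<close> lies in its own class and hence in
  that of \<open>\<beta>\<close>.\<close>

lemma cohomologous_imp_exact:
  assumes \<alpha>: "closed_form A k \<alpha>" and k: "k > 0" and e: "deRham_class A k \<alpha> = deRham_class A k \<beta>"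
  shows "exact_form A k (diff_tensor \<alpha> \<beta>)"
proof -
  have "diff_form A (k - 1) (zero_tensor :: ('a, 'b) tensor)"
    by (auto simp: diff_form_def tensor_field_def zero_tensor_def smooth_fun_on_def linear_zero)
  moreover have "diff_tensor \<alpha> \<alpha> = ext_deriv A (k - 1) (zero_tensor :: ('a, 'b) tensor)"
    by (auto simp: fun_eq_iff diff_tensor_def ext_deriv_def zero_tensor_def frechet_derivative_const)
  ultimately have "exact_form A k (diff_tensor \<alpha> \<alpha>)" using k unfolding exact_form_def by auto
  then have "\<alpha> : deRham_class A k \<beta>" using \<alpha> unfolding e[symmetric] by (simp add: deRham_class_def)
  then show ?thesis by (simp add: deRham_class_def)
qed

lemma choice_below: "(!!k. k < n ==> EX m. P k m) ==> EX m. ALL k<(n::nat). P k (m k)"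
  by metis

context smooth_manifold
begin

lemma form_0_scalar:
  assumes "diff_form A 0 \<phi>"
  obtains f where "!!c x. c : A ==> x : range_of c ==> f (point c x) = \<phi> c x []" "smooth_scalar A f"
proof -
  have T: "tensor_field A 0 \<phi>" using assms by (simp add: diff_form_def)
  have e: "\<phi> c x [] = \<phi> d (transition c d x) []" if "c : A" "d : A" "x : overlap c d" for c d x
    using tensor_transition[OF T that, of "[]"] by simp
  have f: "scalar_fun (%c x. \<phi> c x []) (point c x) = \<phi> c x []" if "c : A" "x : range_of c" for c x
    by (rule scalar_fun_point[OF e that])
  have "smooth_scalar A (scalar_fun (%c x. \<phi> c x []))"
  proof (rule smooth_scalarI)
    fix c k assume c: "c : A"
    show "Ck_on k (range_of c) (%x. scalar_fun (%c x. \<phi> c x []) (point c x))"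
      using tensor_smooth[OF T c, of "[]" k] Ck_on_cong[OF chart(2)[OF c] f[OF c], where k = k] by simp
  qed
  with f show thesis by (rule that)
qed

lemma exact_1_primitive:
  assumes H1: "deRham A 1 = {deRham_class A 1 zero_tensor}" and \<alpha>: "closed_form A 1 \<alpha>"
  obtains f where "smooth_scalar A f" "!!c x v. c : A ==> x : range_of c ==> \<alpha> c x [v] = dsc f c x v"
proof -
  have "deRham_class A 1 \<alpha> = deRham_class A 1 zero_tensor" using H1 \<alpha> unfolding deRham_def by blast
  from cohomologous_imp_exact[OF \<alpha> _ this] have "exact_form A 1 (diff_tensor \<alpha> zero_tensor)" by simp
  moreover have "diff_tensor \<alpha> zero_tensor = \<alpha>" by (simp add: diff_tensor_def zero_tensor_def)
  ultimately obtain \<phi> where \<phi>: "diff_form A 0 \<phi>" "\<alpha> = ext_deriv A 0 \<phi>" unfolding exact_form_def by auto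
  obtain f where f: "!!c x. c : A ==> x : range_of c ==> f (point c x) = \<phi> c x []" "smooth_scalar A f"
    using form_0_scalar[OF \<phi>(1)] by metis
  have "\<alpha> c x [v] = dsc f c x v" if c: "c : A" "x : range_of c" for c x v
  proof -
    have "dir (f o point c) x = dir (%y. \<phi> c y []) x"
      by (rule dir_cong[OF chart(2)[OF c(1)] c(2)]) (simp add: f c(1))
    then show ?thesis by (simp add: \<phi>(2) ext_deriv_def c dsc_def)
  qed
  then show thesis using that f(2) by blast
qed

end

section \<open>Gluing the local primitives\<close>

context end_form
begin

text \<open>By the product rule this is \<open>\<rho> (\<theta> - dF)\<close>. Summed over a
  partition of unity it compares \<open>\<theta>\<close> with the differential of the glued
  function, up to the sum of the \<open>F d\<rho>\<close>.\<close>

abbreviation leibniz_defect :: "('s, 'e) chart => ('s => real) => (real * 's => real) => real * 'e => real * 'e => real" where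
  "leibniz_defect c \<rho> F \<equiv> %z w. \<rho> (point c (snd z)) * \<theta> c z w + rep c F z * dsc \<rho> c (snd z) (snd w) - dir (rep c (%p. \<rho> (snd p) * F p)) z w"

lemma decaysI:
  "C >= 0 ==> r > 0 ==> (!!x t w. x : ball x0 r ==> t > T0 ==> \<bar>\<phi> (t, x) w\<bar> <= C * exp (- lam * t) * norm w) ==>
    decays x0 \<phi>"
  unfolding decays_def by blast

text \<open>The closed sets \<open>C j\<close> inside \<open>U j\<close> ensure that at a point
  outside \<open>U j\<close> the weight vanishes in a whole neighbourhood.\<close>

lemma primitive_cover:
  "EX n F \<rho> U C.
    (ALL j<n::nat. smooth_scalar A (\<rho> j) & closed (C j) & C j \<subseteq> U j & open (U j) & (ALL p. p ~: C j --> \<rho> j p = 0)) &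
    (ALL j<n. ALL c:A. ALL x:range_of c. point c x : U j --> almost_primitive c x (F j)) &
    (ALL p. (SUM j<n. \<rho> j p) = 1)"
proof -
  define P where "P b a \<longleftrightarrow> (case a of (F, U, C) => smooth_scalar A b & closed C & C \<subseteq> U & open U & (ALL p. p ~: C --> b p = 0) &
    (ALL c:A. ALL x:range_of c. point c x : U --> almost_primitive c x F))" for b a
  have "EX b a N. P b a & open N & p : N & (ALL x:N. b x = 1)" for p
  proof -
    obtain F U where FU: "open U" "p : U" "!!c x. c : A ==> x : range_of c ==> point c x : U ==> almost_primitive c x F"
      using local_primitive[of p] by metis
    obtain c where c: "c : A" "p : dom_of c" using cover .
    obtain b C M where b: "smooth_scalar A b" "open M" "p : M" "!!q. q : M ==> b q = 1"
      "compact C" "C \<subseteq> dom_of c Int U" "!!q. q ~: C ==> b q = 0"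
      using bump_function[OF c(2,1) FU(1,2)] by metis
    have "P b (F, U, C)" unfolding P_def using b FU compact_imp_closed[OF b(5)] by auto
    then show ?thesis using b by blast
  qed
  then obtain n b a N where ba: "!!j. j < n ==> P (b j) (a j)" and N: "UNIV \<subseteq> N"
      and s: "!!p. p : N ==> (SUM j<(n::nat). unity_part b j p) = 1"
    using bump_cover[OF cpt, of P] by metis
  define F U C where "F j = fst (a j)" and "U j = fst (snd (a j))" and "C j = snd (snd (a j))" for j
  have ba: "smooth_scalar A (b j)" "closed (C j)" "C j \<subseteq> U j" "open (U j)" "!!p. p ~: C j ==> b j p = 0"
      "!!c x. c : A ==> x : range_of c ==> point c x : U j ==> almost_primitive c x (F j)" if "j < n" for j
    using ba[OF that] unfolding P_def F_def U_def C_def by (auto split: prod.splits)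
  have "smooth_scalar A (unity_part b j)" if "j < n" for j
    by (rule smooth_unity_part) (use ba(1) that in auto)
  moreover have "unity_part b j p = 0" if "j < n" "p ~: C j" for j p
    using ba(5)[OF that] by (simp add: unity_part_def)
  moreover have "(SUM j<n. unity_part b j p) = 1" for p using s N by blast
  ultimately show ?thesis
    by (intro exI[of _ n] exI[of _ F] exI[of _ "unity_part b"] exI[of _ U] exI[of _ C] conjI allI impI ballI)
      (simp_all add: ba(2-4,6))
qed

lemma point_nbhd:
  assumes "c : A" "x0 : range_of c" "open V" "point c x0 : V"
  shows "EX r>0. ball x0 r \<subseteq> range_of c & (ALL x:ball x0 r. point c x : V)"
proof -
  have "open (range_of c Int point c -` V)"
    using open_coord_image[OF assms(1,3)] by (simp add: coord_image_eq[OF assms(1)])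
  moreover have "x0 : range_of c Int point c -` V" using assms by simp
  ultimately obtain r where "r > 0" "ball x0 r \<subseteq> range_of c Int point c -` V" using open_contains_ball by blast
  then show ?thesis by blast
qed

lemma almost_primitive_mult:
  assumes \<rho>: "smooth_scalar A \<rho>" and c: "c : A" "x0 : range_of c" and F: "almost_primitive c x0 F"
  shows "C1_near c x0 (rep c (%p. \<rho> (snd p) * F p))"
    "decays x0 (leibniz_defect c \<rho> F)"
proof -
  obtain r where r: "r > 0" "ball x0 r \<subseteq> range_of c" "Ck_on 1 ({T0<..} \<times> ball x0 r) (rep c F)"
    and d: "decays x0 (%z w. \<theta> c z w - dir (rep c F) z w)"
    using F unfolding almost_primitive_def by blast
  have opn: "open ({T0<..} \<times> ball x0 r)" by (intro open_Times) auto
  have cr: "Ck_on 1 ({T0<..} \<times> ball x0 r) (%z. \<rho> (point c (snd z)))"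
    by (rule Ck_on_compose[OF opn Ck_on_bounded_linear[OF bounded_linear_snd] smooth_scalarD'[OF \<rho> c(1)]]) (use r in auto)
  show "C1_near c x0 (rep c (%p. \<rho> (snd p) * F p))"
    using Ck_on_mult[OF opn cr r(3)] r(1,2) by auto
  have "continuous_on (range_of c) (%x. \<rho> (point c x))" using Ck_on_imp_continuous[OF smooth_scalarD'[OF \<rho> c(1)]] .
  then have "isCont (%x. \<rho> (point c x)) x0" using continuous_on_eq_continuous_at[OF chart(2)[OF c(1)]] c by blast
  then obtain r' where r': "r' > 0" "!!x. dist x x0 < r' ==> dist (\<rho> (point c x)) (\<rho> (point c x0)) < 1"
    unfolding continuous_at_eps_delta by (metis zero_less_one)
  show "decays x0 (leibniz_defect c \<rho> F)"
  proof (rule decays_dominated[OF d, of "min r r'"])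
    show "0 < min r r'" using r r' by simp
    fix x t w assume x: "x : ball x0 (min r r')" and t: "T0 < t"
    have xr: "x : ball x0 r" "x : range_of c" using x r by auto
    have "((\<rho> o point c) has_derivative dir (\<rho> o point c) x) (at (snd (t, x)))"
      using dir_works[OF smooth_scalar_diff[OF \<rho> c(1) xr(2)]] by simp
    from diff_chain_at[OF has_derivative_snd[OF has_derivative_ident] this]
    have d1: "((%z. \<rho> (point c (snd z))) has_derivative (%w. dsc \<rho> c x (snd w))) (at (t, x))" by (simp add: o_def dsc_def)
    have d2: "(rep c F has_derivative dir (rep c F) (t, x)) (at (t, x))"
      by (rule dir_works[OF Ck_on_imp_differentiable[OF r(3)]]) (use xr t in auto)
    have "dir (rep c (%p. \<rho> (snd p) * F p)) (t, x) w = \<rho> (point c x) * dir (rep c F) (t, x) w + dsc \<rho> c x (snd w) * F (t, point c x)"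
      using dir_eqI[OF has_derivative_mult[OF d1 d2]] by simp
    then have e: "\<rho> (point c (snd (t, x))) * \<theta> c (t, x) w + rep c F (t, x) * dsc \<rho> c (snd (t, x)) (snd w) - dir (rep c (%p. \<rho> (snd p) * F p)) (t, x) w
       = \<rho> (point c x) * (\<theta> c (t, x) w - dir (rep c F) (t, x) w)" by (simp add: algebra_simps)
    have "\<bar>\<rho> (point c x)\<bar> <= \<bar>\<rho> (point c x0)\<bar> + 1" using r'(2)[of x] x by (simp add: dist_commute dist_real_def)
    then show "\<bar>\<rho> (point c (snd (t, x))) * \<theta> c (t, x) w + rep c F (t, x) * dsc \<rho> c (snd (t, x)) (snd w) - dir (rep c (%p. \<rho> (snd p) * F p)) (t, x) w\<bar>
        <= (\<bar>\<rho> (point c x0)\<bar> + 1) * \<bar>\<theta> c (t, x) w - dir (rep c F) (t, x) w\<bar>"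
      unfolding e abs_mult by (intro mult_right_mono) auto
  qed
qed

lemma dsc_locally_bounded:
  assumes \<rho>: "smooth_scalar A \<rho>" and c: "c : A" "x0 : range_of c"
  shows "EX B>=0. EX r>0. ball x0 r \<subseteq> range_of c & (ALL x:ball x0 r. ALL v. \<bar>dsc \<rho> c x v\<bar> <= B * norm v)"
  using dir_locally_bounded[OF chart(2)[OF c(1)] c(2) smooth_scalarD[OF \<rho> c(1), of 1]] by (simp add: dsc_def)

text \<open>A Cech-de Rham argument. Gluing the \<open>F k\<close> with weights
  \<open>\<rho> k\<close> leaves the error \<open>S\<close>, the sum of the
  \<open>F k d\<rho> k\<close>. Differences of the \<open>F k\<close> converge to constants, so
  \<open>S\<close> converges to a 1-form \<open>\<Theta>\<close> on the cross-section that is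
  locally a sum of \<open>m k d\<rho> k\<close> and thus closed. By hypothesis it is some
  \<open>d\<psi>\<close>, and subtracting \<open>\<psi>\<close> leaves an exponentially small
  error.\<close>

theorem end_primitive:
  assumes H1: "deRham A 1 = {deRham_class A 1 zero_tensor}"
  obtains f where "!!c. c : A ==> Ck_on 1 ({T0<..} \<times> range_of c) (rep c f)"
    "!!c x0. c : A ==> x0 : range_of c ==> decays x0 (%z w. \<theta> c z w - dir (rep c f) z w)"
proof -
  obtain n F \<rho> U C where
    \<rho>': "ALL j<n::nat. smooth_scalar A (\<rho> j) & closed (C j) & C j \<subseteq> U j & open (U j) & (ALL p. p ~: C j --> \<rho> j p = 0)"
    and F': "ALL j<n. ALL c:A. ALL x:range_of c. point c x : U j --> almost_primitive c x (F j)"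
    and sum1': "ALL p. (SUM j<n. \<rho> j p) = 1"
    using primitive_cover by (elim exE conjE) (rule that)
  note \<rho> = \<rho>'[rule_format] and sum1 = sum1'[rule_format]
  have F: "almost_primitive c x (F j)" if "j < n" "c : A" "x : range_of c" "point c x : U j" for j c x
    using F' that by blast
  have \<rho>s: "smooth_scalar A (\<rho> j)" if "j < n" for j using \<rho>[OF that] by simp
  let ?comb = "%m c x v. SUM k<n. m k * dsc (\<rho> k) c x v"
  have off: "EX r>0. ball x0 r \<subseteq> range_of c & (ALL x:ball x0 r. \<rho> k (point c x) = 0 & (ALL v. dsc (\<rho> k) c x v = 0))"
    if c: "c : A" "x0 : range_of c" and k: "k < n" "point c x0 ~: U k" for c x0 k
  proof -
    have "point c x0 : - C k" using \<rho>[OF k(1)] k(2) by blast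
    then obtain r where r: "r > 0" "ball x0 r \<subseteq> range_of c" "!!x. x : ball x0 r ==> point c x ~: C k"
      using point_nbhd[OF c, of "- C k"] \<rho>[OF k(1)] by (auto simp: open_Compl)
    have "dsc (\<rho> k) c x v = 0" if "x : ball x0 r" for x v
      by (rule dsc_zero[of "C k" _ 0]) (use that r \<rho>[OF k(1)] c in auto)
    then show ?thesis using r \<rho>[OF k(1)] by auto
  qed
  define S where "S c t x v = (SUM k<n. F k (t, point c x) * dsc (\<rho> k) c x v)" for c t x v
  \<comment> \<open>Because the weights add up to 1, a reference primitive \<open>F i\<close> may be
    subtracted from every \<open>F k\<close> in \<open>S\<close>.\<close>
  have S_zero: "(SUM k<n. dsc (\<rho> k) c x v) = 0" if "c : A" "x : range_of c" for c x v
  proof -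
    have "dsc (%p. 1) c x v = (SUM k<n. dsc (\<rho> k) c x v)"
    proof (rule dsc_sum[where N = UNIV])
      show "1 = (SUM j<n. \<rho> j p)" for p using sum1[of p] by (rule sym)
      show "C1_scalar (\<rho> j)" if "j < n" for j by (rule smooth_imp_C1[OF \<rho>s[OF that]])
    qed (use that in simp_all)
    moreover have "dsc (%p. 1) c x v = 0" using that by (intro dsc_zero[of "{}" _ 1]) simp_all
    ultimately show ?thesis by simp
  qed
  \<comment> \<open>The constants are limits of \<open>F k - F i\<close>, where \<open>U i\<close>
    contains the point; they are set to 0 for those \<open>k\<close> whose weight vanishes
    nearby.\<close>
  have loc: "EX m. decays x0 (%z w. S c (fst z) (snd z) (snd w) - ?comb m c (snd z) (snd w))"
    if c: "c : A" "x0 : range_of c" for c x0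
  proof -
    have "EX i<n. \<rho> i (point c x0) ~= 0"
    proof (rule ccontr)
      assume "~ (EX i<n. \<rho> i (point c x0) ~= 0)"
      then have "(SUM i<n. \<rho> i (point c x0)) = 0" by (intro sum.neutral) auto
      then show False using sum1[of "point c x0"] by (metis zero_neq_one)
    qed
    then obtain i where i: "i < n" "point c x0 : U i" using \<rho> by blast
    have "EX m. decays x0 (%z w. (rep c (F k) z - rep c (F i) z - m) * dsc (\<rho> k) c (snd z) (snd w))" if k: "k < n" for k
    proof (cases "point c x0 : U k")
      case True
      obtain m D r where D: "r > 0" "D >= 0"
        "!!x t. x : ball x0 r ==> t > T0 ==> \<bar>rep c (F k) (t, x) - rep c (F i) (t, x) - m\<bar> <= D * exp (- lam * t)"
        using almost_primitive_difference[OF F[OF k c True] F[OF i(1) c i(2)]] by blast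
      obtain B r' where B: "B >= 0" "r' > 0" "!!x v. x : ball x0 r' ==> \<bar>dsc (\<rho> k) c x v\<bar> <= B * norm v"
        using dsc_locally_bounded[OF \<rho>s[OF k] c] by blast
      have "\<bar>(rep c (F k) (t, x) - rep c (F i) (t, x) - m) * dsc (\<rho> k) c (snd (t, x)) (snd w)\<bar> <= (D * B) * exp (- lam * t) * norm w"
        if "x : ball x0 (min r r')" "t > T0" for x t w
      proof -
        have "\<bar>rep c (F k) (t, x) - rep c (F i) (t, x) - m\<bar> * \<bar>dsc (\<rho> k) c x (snd w)\<bar> <= (D * exp (- lam * t)) * (B * norm w)"
        proof (rule mult_mono)
          show "\<bar>dsc (\<rho> k) c x (snd w)\<bar> <= B * norm w"
            using B(3)[of x "snd w"] that mult_left_mono[OF norm_snd_le[of "snd w" "fst w"] B(1)] by simp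
        qed (use D that in auto)
        then show ?thesis by (simp add: abs_mult mult_ac)
      qed
      then show ?thesis using D(1,2) B(1,2) by (intro exI[of _ m] decaysI[of "D * B" "min r r'"]) auto
    next
      case False
      from off[OF c k False] obtain r where "r > 0" "ALL x:ball x0 r. ALL v. dsc (\<rho> k) c x v = 0" by blast
      then show ?thesis by (intro exI[of _ 0] decays_cong[OF decays_zero open_ball, of _ x0 r]) auto
    qed
    then have "EX m. ALL k<n. decays x0 (%z w. (rep c (F k) z - rep c (F i) z - m k) * dsc (\<rho> k) c (snd z) (snd w))"
      by (rule choice_below)
    then obtain m where m: "!!k. k < n ==> decays x0 (%z w. (rep c (F k) z - rep c (F i) z - m k) * dsc (\<rho> k) c (snd z) (snd w))"
      by (elim exE) (rule that, blast)
    have "decays x0 (%z w. S c (fst z) (snd z) (snd w) - ?comb m c (snd z) (snd w))"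
    proof (rule decays_cong[OF decays_sum[OF m] chart(2)[OF c(1)] c(2)])
      fix x t w assume x: "x : range_of c"
      have "(SUM k<n. (rep c (F k) (t, x) - rep c (F i) (t, x) - m k) * dsc (\<rho> k) c (snd (t, x)) (snd w)) =
        S c t x (snd w) - F i (t, point c x) * (SUM k<n. dsc (\<rho> k) c x (snd w)) - ?comb m c x (snd w)"
        by (simp add: S_def left_diff_distrib sum_subtractf sum_distrib_left)
      then show "S c (fst (t, x)) (snd (t, x)) (snd w) - ?comb m c (snd (t, x)) (snd w) =
         (SUM k<n. (rep c (F k) (t, x) - rep c (F i) (t, x) - m k) * dsc (\<rho> k) c (snd (t, x)) (snd w))"
        using S_zero[OF c(1) x] by simp
    qed
    then show ?thesis by blast
  qed
  \<comment> \<open>As a limit in \<open>t\<close> the form involves no choice of the constants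
    \<open>m\<close>, so its invariance under changes of charts is inherited from
    \<open>S\<close>.\<close>
  define \<Theta> where "\<Theta> c x vs = (if c : A & x : range_of c & length vs = 1 then Lim at_top (%t. S c t x (vs ! 0)) else 0)" for c x vs
  have \<Theta>: "EX m. EX r>0. ball x0 r \<subseteq> range_of c & (ALL x:ball x0 r. ALL v. \<Theta> c x [v] = ?comb m c x v) &
      decays x0 (%z w. S c (fst z) (snd z) (snd w) - \<Theta> c (snd z) [snd w])"
    if c: "c : A" "x0 : range_of c" for c x0
  proof -
    obtain m where m: "decays x0 (%z w. S c (fst z) (snd z) (snd w) - ?comb m c (snd z) (snd w))"
      using loc[OF c] by blast
    obtain D r where D: "D >= 0" "r > 0" and D': "ALL x:ball x0 r. ALL t>T0. ALL w :: real * 'e.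
        \<bar>S c t x (snd w) - ?comb m c x (snd w)\<bar> <= D * exp (- lam * t) * norm w"
      using m unfolding decays_def fst_conv snd_conv by (elim exE conjE) (rule that)
    obtain r' where r': "r' > 0" "ball x0 r' \<subseteq> range_of c" using chart(2)[OF c(1)] c(2) open_contains_ball by blast
    have lim: "\<Theta> c x [v] = ?comb m c x v" if x: "x : ball x0 (min r r')" for x v
    proof -
      have e0: "((%t. D * exp (- lam * t) * norm v) \<longlongrightarrow> D * 0 * norm v) at_top"
        by (intro tendsto_intros exp_decay[OF lam])
      have "((%t. S c t x v - ?comb m c x v) \<longlongrightarrow> 0) at_top"
      proof (rule Lim_null_comparison[OF _ e0[unfolded mult_zero_right mult_zero_left]])
        show "\<forall>\<^sub>F t in at_top. norm (S c t x v - ?comb m c x v) <= D * exp (- lam * t) * norm v"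
          using eventually_gt_at_top[of T0] by eventually_elim (use D'[rule_format, of x _ "(0, v)"] x in simp)
      qed
      then have "((%t. S c t x v) \<longlongrightarrow> ?comb m c x v) at_top" by (simp add: LIM_zero_iff)
      then have "Lim at_top (%t. S c t x v) = ?comb m c x v" by (intro tendsto_Lim) auto
      moreover have "x : range_of c" using x r' by auto
      ultimately show ?thesis using c by (simp add: \<Theta>_def)
    qed
    have "decays x0 (%z w. S c (fst z) (snd z) (snd w) - \<Theta> c (snd z) [snd w])"
      by (rule decays_cong[OF m open_ball, of _ "min r r'"]) (use lim D(2) r' in auto)
    moreover have "ball x0 (min r r') \<subseteq> range_of c" using r' by auto
    ultimately show ?thesis using lim D(2) r'(1) by (intro exI[of _ m] exI[of _ "min r r'"]) auto
  qed
  have dCk: "Ck_on j (range_of c) (%x. dsc (\<rho> k) c x v)" if "c : A" "k < n" for c j k v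
    unfolding dsc_def by (rule Ck_on_dir) (rule smooth_scalarD[OF \<rho>s[OF that(2)] that(1)])
  have len1: "EX v. vs = [v]" if "length vs = 1" for vs :: "'e list" using that by (cases vs) auto
  have "closed_form A 1 \<Theta>"
    unfolding closed_form_def diff_form_def
  proof (intro conjI)
    show "tensor_field A 1 \<Theta>"
      unfolding tensor_field_def
    proof (intro conjI ballI allI impI)
      show "\<Theta> c x vs = 0" if "~ (c : A & x : range_of c & length vs = 1)" for c x vs
        using that unfolding \<Theta>_def by (simp only: if_False)
      fix c assume c: "c : A"
      show "linear (%v. \<Theta> c x (vs[i := v]))" if x: "x : range_of c" and v: "length vs = 1" "i < 1" for x vs i
      proof -
        obtain a where a: "vs = [a]" using len1 v by blast
        obtain m r where "r > 0" "!!y v. y : ball x r ==> \<Theta> c y [v] = ?comb m c y v"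
          using \<Theta>[OF c x] by blast
        then have "\<Theta> c x [v] = ?comb m c x v" for v by simp
        moreover have "linear (%v. SUM k<n. m k * dsc (\<rho> k) c x v)"
        proof (rule linear_compose_sum, rule ballI)
          fix k assume "k : {..<n}"
          then have "linear (dsc (\<rho> k) c x)" using covec_dsc[OF smooth_imp_C1[OF \<rho>s]] c x unfolding covec_def by blast
          then show "linear (%v. m k * dsc (\<rho> k) c x v)" using linear_compose_scale_right[of "dsc (\<rho> k) c x" "m k"] by simp
        qed
        ultimately show ?thesis using a v by simp
      qed
      show "smooth_fun_on (range_of c) (%x. \<Theta> c x vs)" if v: "length vs = 1" for vs
        unfolding smooth_fun_on_def
      proof (intro allI Ck_on_local)
        fix j x assume x: "x : range_of c"
        obtain a where a: "vs = [a]" using len1 v by blast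
        obtain m r where r: "r > 0" "ball x r \<subseteq> range_of c" "!!y v. y : ball x r ==> \<Theta> c y [v] = ?comb m c y v"
          using \<Theta>[OF c x] by blast
        have "Ck_on j (range_of c) (%x. ?comb m c x a)"
          by (intro Ck_on_sum Ck_on_cmult chart(2) c dCk) auto
        from Ck_on_subset[OF this r(2)] have "Ck_on j (ball x r) (%x. \<Theta> c x vs)"
          using r(3) unfolding a
          by (subst Ck_on_cong[OF open_ball, of x r "%x. \<Theta> c x [a]" "%x. ?comb m c x a"])
        then show "EX V. open V & x : V & Ck_on j V (%x. \<Theta> c x vs)" using r(1) by (intro exI[of _ "ball x r"]) auto
      qed
      fix d x vs assume d: "d : A" and x: "x : overlap c d" and v: "length (vs :: 'e list) = 1"
      obtain a where a: "vs = [a]" using len1 v by blast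
      have "dsc (\<rho> k) c x a = dsc (\<rho> k) d (transition c d x) (dir (transition c d) x a)" if "k < n" for k
        using covec_dsc[OF smooth_imp_C1[OF \<rho>s[OF that]]] c d x unfolding covec_def by blast
      then have "S c t x a = S d t (transition c d x) (dir (transition c d) x a)" for t
        unfolding S_def by (intro sum.cong) (simp_all add: point_transition[OF c d x])
      then have e: "Lim at_top (%t. S c t x a) = Lim at_top (%t. S d t (transition c d x) (dir (transition c d) x a))" by simp
      have "x : range_of c" "transition c d x : range_of d"
        using x overlap_iff[OF c] transition_in[OF c d x] overlap_iff[OF d] by auto
      then show "\<Theta> c x vs = \<Theta> d (transition c d x) (map (dir (transition c d) x) vs)"
        using c d e by (simp add: \<Theta>_def a)
    qed
    show "ALL c x vs i j. length vs = 1 & i < j & j < 1 & vs ! i = vs ! j --> \<Theta> c x vs = 0" by simp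
    have "ext_deriv A 1 \<Theta> c x vs = 0" for c x vs
    proof (cases "c : A & x : range_of c & length vs = 2")
      case True
      then obtain u v where uv: "vs = [u, v]" by (metis One_nat_def Suc_1 length_0_conv length_Suc_conv)
      have c: "c : A" "x : range_of c" using True by auto
      obtain m r where r: "r > 0" "ball x r \<subseteq> range_of c" "!!y v. y : ball x r ==> \<Theta> c y [v] = ?comb m c y v"
        using \<Theta>[OF c] by blast
      define M where "M y = (SUM k<n. m k * (\<rho> k o point c) y)" for y
      have CM: "Ck_on 2 (ball x r) M" unfolding M_def
        by (rule Ck_on_subset[OF _ r(2)]) (intro Ck_on_sum Ck_on_cmult chart(2) c smooth_scalarD \<rho>s, auto)
      have "\<Theta> c y [w] = dir M y w" if "y : ball x r" for y w
      proof -
        have "dir M y = (%w. SUM k<n. m k * dir (\<rho> k o point c) y w)" unfolding M_def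
          by (intro dir_eqI has_derivative_sum has_derivative_mult_right dir_works smooth_scalar_diff \<rho>s c) (use that r in auto)
        then show ?thesis using r(3)[OF that] by (simp add: dsc_def)
      qed
      then have d: "dir (%y. \<Theta> c y [w]) x = dir (%y. dir M y w) x" for w
        by (intro dir_cong[OF open_ball, of x x r]) (use r(1) in auto)
      show ?thesis unfolding uv ext_deriv_1[OF c] d
        using dir_dir_commute[OF open_ball, of x x r M u v] CM r(1) by simp
    next
      case False
      then show ?thesis by (auto simp: ext_deriv_def numeral_2_eq_2)
    qed
    then show "ext_deriv A 1 \<Theta> = zero_tensor" by (simp add: fun_eq_iff zero_tensor_def)
  qed
  then obtain \<psi> where \<psi>: "smooth_scalar A \<psi>" "!!c x v. c : A ==> x : range_of c ==> \<Theta> c x [v] = dsc \<psi> c x v"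
    using exact_1_primitive[OF H1] by metis
  define f where "f p = (SUM k<n. \<rho> k (snd p) * F k p) - \<psi> (snd p)" for p
  have summand: "C1_near c x0 (rep c (%p. \<rho> k (snd p) * F k p)) &
      decays x0 (leibniz_defect c (\<rho> k) (F k))"
    if c: "c : A" "x0 : range_of c" and k: "k < n" for c x0 k
  proof (cases "point c x0 : U k")
    case True
    show ?thesis using almost_primitive_mult[OF \<rho>s[OF k] c F[OF k c True]] by blast
  next
    case False
    from off[OF c k False] obtain r where r: "r > 0" "ball x0 r \<subseteq> range_of c"
      "!!x. x : ball x0 r ==> \<rho> k (point c x) = 0" "!!x v. x : ball x0 r ==> dsc (\<rho> k) c x v = 0" by blast
    have opn: "open ({T0<..} \<times> ball x0 r)" by (intro open_Times) auto
    have z: "rep c (%p. \<rho> k (snd p) * F k p) z = 0" "\<rho> k (point c (snd z)) = 0" if "z : {T0<..} \<times> ball x0 r" for z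
      using r(3)[of "snd z"] that by auto
    have 1: "Ck_on 1 ({T0<..} \<times> ball x0 r) (rep c (%p. \<rho> k (snd p) * F k p))"
      by (subst Ck_on_cong[OF opn z(1)]) (assumption, rule Ck_on_const)
    have "dir (rep c (%p. \<rho> k (snd p) * F k p)) z = dir (%z. 0) z" if "z : {T0<..} \<times> ball x0 r" for z
      by (rule dir_cong[OF opn that z(1)])
    then have 2: "decays x0 (leibniz_defect c (\<rho> k) (F k))"
      by (intro decays_cong[OF decays_zero open_ball, of _ x0 r]) (use r(1,4) z(2) in \<open>auto simp: frechet_derivative_const\<close>)
    show ?thesis using 1 2 r by blast
  qed
  have loc: "C1_near c x0 (rep c f) & decays x0 (%z w. \<theta> c z w - dir (rep c f) z w)"
    if c: "c : A" "x0 : range_of c" for c x0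
  proof -
    define g where "g k = rep c (%p. \<rho> k (snd p) * F k p)" for k
    have "EX r. ALL k<n. r k > 0 & ball x0 (r k) \<subseteq> range_of c & Ck_on 1 ({T0<..} \<times> ball x0 (r k)) (g k)"
    proof (rule choice_below)
      show "C1_near c x0 (g k)" if "k < n" for k
        unfolding g_def using summand[OF c that] by (rule conjunct1)
    qed
    then obtain r where r: "!!k. k < n ==> r k > 0 & Ck_on 1 ({T0<..} \<times> ball x0 (r k)) (g k)" by blast
    obtain r0 where r0: "r0 > 0" "ball x0 r0 \<subseteq> range_of c" using chart(2)[OF c(1)] c(2) open_contains_ball by blast
    define R where "R = Min (insert r0 (r ` {..<n}))"
    have R: "R > 0" "R <= r0" "!!k. k < n ==> R <= r k" using r r0 by (auto simp: R_def)
    have Rr: "ball x0 R \<subseteq> range_of c" using R r0 by auto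
    have opn: "open ({T0<..} \<times> ball x0 R)" by (intro open_Times) auto
    have Cg: "Ck_on 1 ({T0<..} \<times> ball x0 R) (g k)" if "k < n" for k
      by (rule Ck_on_subset[OF conjunct2[OF r[OF that]]]) (use R(3)[OF that] in auto)
    have C\<psi>: "Ck_on 1 ({T0<..} \<times> ball x0 R) (%z. \<psi> (point c (snd z)))"
      by (rule Ck_on_compose[OF opn Ck_on_bounded_linear[OF bounded_linear_snd] smooth_scalarD'[OF \<psi>(1) c(1)]]) (use Rr in auto)
    have f: "rep c f = (%z. (SUM k<n. g k z) - \<psi> (point c (snd z)))" by (simp add: f_def g_def)
    have 1: "Ck_on 1 ({T0<..} \<times> ball x0 R) (rep c f)" unfolding f
      by (intro Ck_on_diff Ck_on_sum opn Cg C\<psi>) auto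
    have df: "dir (rep c f) (t, x) w = (SUM k<n. dir (g k) (t, x) w) - \<Theta> c x [snd w]" if x: "x : ball x0 R" and t: "t > T0" for t x w
    proof -
      have xr: "x : range_of c" using x Rr by auto
      have d1: "((%z. \<psi> (point c (snd z))) has_derivative (%w. dsc \<psi> c x (snd w))) (at (t, x))"
        using has_derivative_snd_compose(1)[OF dir_works[OF smooth_scalar_diff[OF \<psi>(1) c(1) xr]]] by (simp add: o_def dsc_def)
      have "dir (rep c f) (t, x) = (%w. (SUM k<n. dir (g k) (t, x) w) - dsc \<psi> c x (snd w))" unfolding f
        by (intro dir_eqI has_derivative_diff has_derivative_sum d1 dir_works Ck_on_imp_differentiable[OF Cg]) (use x t in auto)
      then show ?thesis by (simp add: \<psi>(2)[OF c(1) xr])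
    qed
    have d1: "decays x0 (%z w. SUM k<n. \<rho> k (point c (snd z)) * \<theta> c z w + rep c (F k) z * dsc (\<rho> k) c (snd z) (snd w) - dir (g k) z w)"
      unfolding g_def using summand[OF c] by (intro decays_sum) blast
    have d2: "decays x0 (%z w. S c (fst z) (snd z) (snd w) - \<Theta> c (snd z) [snd w])" using \<Theta>[OF c] by blast
    have "decays x0 (%z w. \<theta> c z w - dir (rep c f) z w)"
    proof (rule decays_cong[OF decays_diff[OF d1 d2] open_ball, of x0 R])
      show "x0 : ball x0 R" using R by simp
      fix x t w assume x: "x : ball x0 R" and t: "T0 < t"
      have "(SUM k<n. \<rho> k (point c x) * \<theta> c (t, x) w + F k (t, point c x) * dsc (\<rho> k) c x (snd w) - dir (g k) (t, x) w) =
        (SUM k<n. \<rho> k (point c x)) * \<theta> c (t, x) w + S c t x (snd w) - (SUM k<n. dir (g k) (t, x) w)"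
        by (simp add: S_def sum.distrib sum_subtractf sum_distrib_right)
      then show "\<theta> c (t, x) w - dir (rep c f) (t, x) w =
          (SUM k<n. \<rho> k (point c (snd (t, x))) * \<theta> c (t, x) w + rep c (F k) (t, x) * dsc (\<rho> k) c (snd (t, x)) (snd w) - dir (g k) (t, x) w) -
          (S c (fst (t, x)) (snd (t, x)) (snd w) - \<Theta> c (snd (t, x)) [snd w])"
        unfolding df[OF x t] using sum1[of "point c x"] by simp
    qed
    then show ?thesis using 1 R(1) Rr by blast
  qed
  show thesis
  proof (rule that[of f])
    fix c assume c: "c : A"
    show "Ck_on 1 ({T0<..} \<times> range_of c) (rep c f)"
    proof (rule Ck_on_local)
      fix z assume z: "z : {T0<..} \<times> range_of c"
      then obtain r where r: "r > 0" "Ck_on 1 ({T0<..} \<times> ball (snd z) r) (rep c f)" using loc[OF c, of "snd z"] by auto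
      then show "EX V. open V & z : V & Ck_on 1 V (rep c f)"
        using z by (intro exI[of _ "{T0<..} \<times> ball (snd z) r"]) (auto intro: open_Times)
    qed
  qed (use loc in blast)
qed

end

section \<open>Cylindrical ends\<close>

text \<open>Stated for arbitrary source manifolds; the cylinder enters as an instance.\<close>

locale open_embedding = Y: smooth_manifold B + X: smooth_manifold A
  for B :: "('y::{t2_space,second_countable_topology}, 'f::euclidean_space) chart set"
    and A :: "('x::{t2_space,second_countable_topology}, 'e::euclidean_space) chart set" +
  fixes \<Psi> :: "'y => 'x" and \<Phi> :: "'x => 'y" and W :: "'x set"
  assumes homeo: "homeomorphism UNIV W \<Psi> \<Phi>" and open_W: "open W"
    and smooth_fwd: "smooth_map_on B A UNIV \<Psi>" and smooth_bwd: "smooth_map_on A B W \<Phi>"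
begin

definition fwd :: "('y, 'f) chart => ('x, 'e) chart => 'f => 'e" where
  "fwd c d x = coord d (\<Psi> (point c x))"

definition bwd :: "('x, 'e) chart => ('y, 'f) chart => 'e => 'f" where
  "bwd d c y = coord c (\<Phi> (point d y))"

definition loc :: "('y, 'f) chart => ('x, 'e) chart => 'f set" where
  "loc c d = coord c ` (dom_of c Int \<Psi> -` dom_of d)"

abbreviation bloc :: "('x, 'e) chart => ('y, 'f) chart => 'e set" where
  "bloc d c \<equiv> coord d ` (dom_of d Int W Int \<Phi> -` dom_of c)"

lemma inverse [simp]: "\<Phi> (\<Psi> p) = p" "q : W ==> \<Psi> (\<Phi> q) = q" "\<Psi> p : W"
  using homeo by (auto simp: homeomorphism_def)

lemma cont_fwd: "continuous_on UNIV \<Psi>" and cont_bwd: "continuous_on W \<Phi>"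
  using homeo by (auto simp: homeomorphism_def)

lemma open_preimage: "open V ==> open (\<Psi> -` V)"
  using open_vimage[OF _ cont_fwd] .

lemma open_image: "open V ==> open (\<Psi> ` V)"
  by (rule homeomorphism_open_image[OF homeo open_UNIV open_W]) auto

lemma open_loc: "c : B ==> d : A ==> open (loc c d)"
  unfolding loc_def by (intro Y.open_coord_image open_preimage X.chart)

lemma loc_iff: "c : B ==> x : loc c d \<longleftrightarrow> x : range_of c & \<Psi> (point c x) : dom_of d"
  unfolding loc_def by (simp add: Y.coord_image_eq)

lemma loc_exists: "c : B ==> x : range_of c ==> EX d:A. x : loc c d"
  by (metis loc_iff X.cover)

lemma fwd_range: "c : B ==> x : loc c d ==> fwd c d x : range_of d"
  by (simp add: loc_iff fwd_def X.coord_in)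

lemma point_fwd: "c : B ==> d : A ==> x : loc c d ==> point d (fwd c d x) = \<Psi> (point c x)"
  by (simp add: loc_iff fwd_def X.point_coord)

lemma Ck_fwd: "c : B ==> d : A ==> Ck_on k (loc c d) (fwd c d)"
  using smooth_fwd unfolding smooth_map_on_def smooth_fun_on_def loc_def fwd_def[abs_def] o_def by auto

lemma diff_fwd: "c : B ==> d : A ==> x : loc c d ==> fwd c d differentiable (at x)"
  using Ck_on_imp_differentiable[OF Ck_fwd[of c d 1]] by simp

lemma linear_fwd: "c : B ==> d : A ==> x : loc c d ==> linear (dir (fwd c d) x)"
  by (intro dir_linear diff_fwd)

lemma bwd_fwd: "c : B ==> d : A ==> x : loc c d ==> bwd d c (fwd c d x) = x"
  by (simp add: bwd_def point_fwd loc_iff Y.coord_point)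

lemma bwd_domain:
  assumes c: "c : B" "d : A"
  shows "open (bloc d c)" (is "open ?V")
    "x : loc c d ==> fwd c d x : bloc d c"
    "y : bloc d c ==> bwd d c y : loc c d & fwd c d (bwd d c y) = y"
    "Ck_on k (bloc d c) (bwd d c)"
proof -
  have "open (W Int \<Phi> -` dom_of c)" using continuous_openin_preimage_gen[OF cont_bwd Y.chart(1)[OF c(1)]] open_W
    by (simp add: openin_open_eq)
  then show "open ?V" using X.open_coord_image[OF c(2)] by (simp add: Int_assoc)
  show "fwd c d x : ?V" if "x : loc c d"
    using that Y.point_in[OF c(1)] by (auto simp: loc_iff[OF c(1)] fwd_def)
  show "bwd d c y : loc c d & fwd c d (bwd d c y) = y" if "y : ?V"
    using that by (auto simp: loc_def bwd_def fwd_def X.point_coord[OF c(2)] Y.point_coord[OF c(1)])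
  show "Ck_on k ?V (bwd d c)"
    using smooth_bwd c unfolding smooth_map_on_def smooth_fun_on_def bwd_def[abs_def] o_def by auto
qed

lemma dir_bwd_fwd:
  assumes c: "c : B" "d : A" "x : loc c d"
  shows "dir (bwd d c) (fwd c d x) (dir (fwd c d) x v) = v"
    "dir (fwd c d) x (dir (bwd d c) (fwd c d x) w) = w"
proof -
  note bd = bwd_domain[OF c(1,2)]
  have db: "bwd d c differentiable (at (fwd c d x))"
    using Ck_on_imp_differentiable[OF bd(4)[of 1] _ bd(2)[OF c(3)]] by simp
  have "dir (%y. bwd d c (fwd c d y)) x = dir (%y. y) x"
    by (rule dir_cong[OF open_loc[OF c(1,2)] c(3)]) (rule bwd_fwd[OF c(1,2)])
  moreover have "dir (%y. y) x = (%v. v)" by (rule dir_eqI) (rule has_derivative_ident)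
  moreover have "dir (%y. bwd d c (fwd c d y)) x = (%v. dir (bwd d c) (fwd c d x) (dir (fwd c d) x v))"
    by (rule dir_compose[of "fwd c d" x "bwd d c", OF diff_fwd[OF c] db])
  ultimately show "dir (bwd d c) (fwd c d x) (dir (fwd c d) x v) = v" by (simp add: fun_eq_iff)
  have "dir (%y. fwd c d (bwd d c y)) (fwd c d x) = dir (%y. y) (fwd c d x)"
    by (rule dir_cong[OF bd(1) bd(2)[OF c(3)]]) (use bd(3) in blast)
  moreover have "dir (%y. y) (fwd c d x) = (%v. v)" by (rule dir_eqI) (rule has_derivative_ident)
  moreover have "dir (%y. fwd c d (bwd d c y)) (fwd c d x) = (%v. dir (fwd c d) x (dir (bwd d c) (fwd c d x) v))"
    using dir_compose[of "bwd d c" "fwd c d x" "fwd c d", OF db] diff_fwd[OF c] by (simp add: bwd_fwd[OF c])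
  ultimately show "dir (fwd c d) x (dir (bwd d c) (fwd c d x) w) = w" by (simp add: fun_eq_iff)
qed

lemma linear_bwd: "c : B ==> d : A ==> x : loc c d ==> linear (dir (bwd d c) (fwd c d x))"
  using Ck_on_imp_differentiable[OF bwd_domain(4)[of c d 1] _ bwd_domain(2)[of c d x]] by (intro dir_linear) simp

lemma dir_fwd_target:
  assumes c: "c : B" "d : A" "d' : A" "x : loc c d" "x : loc c d'"
  shows "fwd c d x : overlap d d'" "transition d d' (fwd c d x) = fwd c d' x"
    "dir (fwd c d') x v = dir (transition d d') (fwd c d x) (dir (fwd c d) x v)"
proof -
  have o: "fwd c d y : overlap d d'" "transition d d' (fwd c d y) = fwd c d' y" if "y : loc c d Int loc c d'" for y
  proof -
    have "\<Psi> (point c y) : dom_of d" "\<Psi> (point c y) : dom_of d'" using that c(1) by (auto simp: loc_iff)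
    then show "fwd c d y : overlap d d'" "transition d d' (fwd c d y) = fwd c d' y"
      by (simp_all add: fwd_def X.overlapI X.transition_coord[OF c(2)])
  qed
  show "fwd c d x : overlap d d'" "transition d d' (fwd c d x) = fwd c d' x" using o c by auto
  have "open (loc c d Int loc c d')" by (intro open_Int open_loc c)
  moreover have "x : loc c d Int loc c d'" using c by simp
  ultimately have "dir (fwd c d') x = dir (%y. transition d d' (fwd c d y)) x"
    by (rule dir_cong) (simp add: o)
  also have "... = (%v. dir (transition d d') (fwd c d x) (dir (fwd c d) x v))"
    by (rule dir_compose[of "fwd c d" x "transition d d'", OF diff_fwd[OF c(1,2,4)] X.diff_transition[OF c(2,3)]])
      (use o c in auto)
  finally show "dir (fwd c d') x v = dir (transition d d') (fwd c d x) (dir (fwd c d) x v)" by simp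
qed

lemma dir_fwd_source:
  assumes c: "c : B" "c' : B" "d : A" "x : loc c d" "x : overlap c c'"
  shows "transition c c' x : loc c' d" "fwd c' d (transition c c' x) = fwd c d x"
    "dir (fwd c d) x v = dir (fwd c' d) (transition c c' x) (dir (transition c c') x v)"
proof -
  have o: "transition c c' y : loc c' d" "fwd c' d (transition c c' y) = fwd c d y"
    if "y : loc c d Int overlap c c'" for y
  proof -
    have y: "y : loc c d" "y : overlap c c'" using that by auto
    have t: "transition c c' y : overlap c' c" by (rule Y.transition_in[OF c(1,2) y(2)])
    then have "transition c c' y : range_of c'" using Y.overlap_iff[OF c(2)] by blast
    then show "transition c c' y : loc c' d" "fwd c' d (transition c c' y) = fwd c d y"
      using y(1) by (simp_all add: loc_iff[OF c(1)] loc_iff[OF c(2)] fwd_def Y.point_transition[OF c(1,2) y(2)])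
  qed
  show "transition c c' x : loc c' d" "fwd c' d (transition c c' x) = fwd c d x" using o c by auto
  have "open (loc c d Int overlap c c')" by (intro open_Int open_loc Y.open_overlap c)
  moreover have "x : loc c d Int overlap c c'" using c by simp
  ultimately have "dir (fwd c d) x = dir (%y. fwd c' d (transition c c' y)) x"
    by (rule dir_cong) (simp add: o)
  also have "... = (%v. dir (fwd c' d) (transition c c' x) (dir (transition c c') x v))"
    by (rule dir_compose[of "transition c c'" x "fwd c' d", OF Y.diff_transition[OF c(1,2,5)] diff_fwd[OF c(2,3)]])
      (use o c in auto)
  finally show "dir (fwd c d) x v = dir (fwd c' d) (transition c c' x) (dir (transition c c') x v)" by simp
qed

text \<open>The chart selected inside \<open>pullback\<close> may be replaced by any chart around
  the image point.\<close>

lemma pullback_eq: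
  assumes T: "tensor_field A k T" and c: "c : B" "d : A" "x : loc c d" and v: "length vs = k"
  shows "pullback B A k \<Psi> T c x vs = T d (fwd c d x) (map (dir (fwd c d) x) vs)"
proof -
  define e where "e = (SOME d. d : A & \<Psi> (point c x) : dom_of d)"
  have x: "x : range_of c" "\<Psi> (point c x) : dom_of d" using c(3) loc_iff[OF c(1)] by auto
  have e: "e : A" "\<Psi> (point c x) : dom_of e"
    using someI[of "%d. d : A & \<Psi> (point c x) : dom_of d" d] c(2) x(2) by (auto simp: e_def)
  have xe: "x : loc c e" using x(1) e(2) loc_iff[OF c(1)] by simp
  have F: "coord e o \<Psi> o point c = fwd c e" by (simp add: fun_eq_iff fwd_def)
  have "pullback B A k \<Psi> T c x vs = T e (fwd c e x) (map (dir (fwd c e) x) vs)"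
    unfolding pullback_def e_def[symmetric] Let_def F using c(1) x(1) v by simp
  also have "... = T d (transition e d (fwd c e x)) (map (dir (transition e d) (fwd c e x)) (map (dir (fwd c e) x) vs))"
    by (rule X.tensor_transition[OF T e(1) c(2) dir_fwd_target(1)[OF c(1) e(1) c(2) xe c(3)]]) (simp add: v)
  also have "... = T d (fwd c d x) (map (dir (fwd c d) x) vs)"
    using dir_fwd_target(2,3)[OF c(1) e(1) c(2) xe c(3)] by (simp add: o_def cong: map_cong)
  finally show ?thesis .
qed

lemma pullback_mult:
  assumes "c : B" "x : range_of c"
  shows "pullback B A k \<Psi> (mult_tensor f T) c x vs = f (\<Psi> (point c x)) * pullback B A k \<Psi> T c x vs"
proof -
  define e where "e = (SOME d. d : A & \<Psi> (point c x) : dom_of d)"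
  obtain d where "d : A" "\<Psi> (point c x) : dom_of d" using X.cover .
  then have e: "e : A" "\<Psi> (point c x) : dom_of e"
    using someI[of "%d. d : A & \<Psi> (point c x) : dom_of d" d] by (auto simp: e_def)
  show ?thesis unfolding pullback_def e_def[symmetric] Let_def mult_tensor_def
    using assms X.point_coord[OF e] by simp
qed

lemma Ck_pullback_1:
  assumes T: "tensor_field A 1 T" and c: "c : B"
  shows "Ck_on k (range_of c) (%x. pullback B A 1 \<Psi> T c x [v])"
proof (rule Ck_on_local)
  fix x assume "x : range_of c"
  then obtain d where d: "d : A" "x : loc c d" using loc_exists[OF c] by blast
  note U = open_loc[OF c d(1)]
  have "Ck_on k (loc c d) (%x. SUM b:Basis. (dir (fwd c d) x v \<bullet> b) * T d (fwd c d x) [b])"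
    by (intro Ck_on_sum Ck_on_mult Ck_on_inner U Ck_on_const Ck_on_dir[OF Ck_fwd[OF c d(1)]]
        Ck_on_compose[OF U Ck_fwd[OF c d(1)] X.tensor_smooth[OF T d(1)]]) (simp_all add: image_subset_iff fwd_range[OF c])
  moreover have "pullback B A 1 \<Psi> T c x [v] = (SUM b:Basis. (dir (fwd c d) x v \<bullet> b) * T d (fwd c d x) [b])" if "x : loc c d" for x
    using pullback_eq[OF T c d(1) that, of "[v]"]
      linear_basis_sum[OF X.tensor1_linear[OF T d(1) fwd_range[OF c that]], of "dir (fwd c d) x v"] by simp
  ultimately have "Ck_on k (loc c d) (%x. pullback B A 1 \<Psi> T c x [v])"
    by (subst Ck_on_cong[OF U, of _ "%x. SUM b:Basis. (dir (fwd c d) x v \<bullet> b) * T d (fwd c d x) [b]"])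
  then show "EX V. open V & x : V & Ck_on k V (%x. pullback B A 1 \<Psi> T c x [v])" using U d(2) by blast
qed

text \<open>The pulled-back form contains the Jacobian of the embedding; its derivatives are
  symmetric and cancel under antisymmetrisation.\<close>

lemma pullback_ext_deriv:
  assumes \<eta>: "tensor_field A 1 \<eta>" and c: "c : B" "d : A" "x : loc c d"
  shows "ext1 (%y v. pullback B A 1 \<Psi> \<eta> c y [v]) x u v =
    ext_deriv A 1 \<eta> d (fwd c d x) [dir (fwd c d) x u, dir (fwd c d) x v]"
proof -
  note U = open_loc[OF c(1,2)]
  define F where "F = fwd c d"
  have FU: "F y : range_of d" if "y : loc c d" for y using fwd_range[OF c(1) that] by (simp add: F_def)
  have Tl: "linear (%v. \<eta> d y [v])" if "y : range_of d" for y using X.tensor1_linear[OF \<eta> c(2) that] .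
  have Td: "(%y. \<eta> d y [w]) differentiable (at y)" if "y : range_of d" for y w
    using Ck_on_imp_differentiable[OF X.tensor_smooth[OF \<eta> c(2), of "[w]" 1] _ that] by simp
  have e: "pullback B A 1 \<Psi> \<eta> c y [v] = (SUM b:Basis. (dir F y v \<bullet> b) * \<eta> d (F y) [b])" if "y : loc c d" for y v
    using pullback_eq[OF \<eta> c(1,2) that, of "[v]"] linear_basis_sum[OF Tl[OF FU[OF that]], of "dir F y v"] by (simp add: F_def)
  have main: "dir (%y. pullback B A 1 \<Psi> \<eta> c y [v]) x u =
    \<eta> d (F x) [dir (%y. dir F y v) x u] + dir (%y. \<eta> d y [dir F x v]) (F x) (dir F x u)" for u v
  proof -
    have C2: "Ck_on (Suc 1) (loc c d) F" using Ck_fwd[OF c(1,2)] by (simp only: F_def)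
    have d1: "((%y. dir F y v) has_derivative dir (%y. dir F y v) x) (at x)"
      by (rule dir_works[OF Ck_on_imp_differentiable[OF Ck_on_dir[OF C2] _ c(3)]]) simp
    have d2: "((%y. \<eta> d (F y) [b]) has_derivative (%u. dir (%y. \<eta> d y [b]) (F x) (dir F x u))) (at x)" for b
      using diff_chain_at[OF dir_works[OF diff_fwd[OF c]] dir_works[OF Td[OF FU[OF c(3)], of b, unfolded F_def]]]
      by (simp add: F_def o_def)
    have "dir (%y. pullback B A 1 \<Psi> \<eta> c y [v]) x = dir (%y. SUM b:Basis. (dir F y v \<bullet> b) * \<eta> d (F y) [b]) x"
      by (rule dir_cong[OF U c(3) e])
    also have "... = (%u. SUM b:Basis. (dir F x v \<bullet> b) * dir (%y. \<eta> d y [b]) (F x) (dir F x u) +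
        (dir (%y. dir F y v) x u \<bullet> b) * \<eta> d (F x) [b])"
      by (intro dir_eqI has_derivative_sum has_derivative_mult has_derivative_inner_left d1 d2)
    finally have "dir (%y. pullback B A 1 \<Psi> \<eta> c y [v]) x u =
      (SUM b:Basis. (dir F x v \<bullet> b) * dir (%y. \<eta> d y [b]) (F x) (dir F x u)) +
      (SUM b:Basis. (dir (%y. dir F y v) x u \<bullet> b) * \<eta> d (F x) [b])" by (simp add: sum.distrib)
    also have "(SUM b:Basis. (dir (%y. dir F y v) x u \<bullet> b) * \<eta> d (F x) [b]) = \<eta> d (F x) [dir (%y. dir F y v) x u]"
      using linear_basis_sum[OF Tl[OF FU[OF c(3)]], of "dir (%y. dir F y v) x u"] by simp
    also have "(SUM b:Basis. (dir F x v \<bullet> b) * dir (%y. \<eta> d y [b]) (F x) (dir F x u)) =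
        dir (%y. \<eta> d y [dir F x v]) (F x) (dir F x u)"
    proof -
      have "linear (%w. dir (%y. \<eta> d y [w]) (F x) (dir F x u))"
        by (rule linear_dir_parameter[OF X.chart(2)[OF c(2)] FU[OF c(3)]]) (simp_all add: Td Tl FU[OF c(3)])
      from linear_basis_sum[OF this, of "dir F x v"] show ?thesis by simp
    qed
    finally show ?thesis by simp
  qed
  have "dir (%y. dir F y v) x u = dir (%y. dir F y u) x v"
    using dir_dir_commute[OF U c(3), of F v u] Ck_fwd[OF c(1,2), of 2] by (simp add: F_def)
  then show ?thesis
    unfolding ext1_def main X.ext_deriv_1[OF c(2) fwd_range[OF c(1,3)]] by (simp add: F_def)
qed

text \<open>A chart of the target modelled on the source space. It need not belong to the atlas and
  serves to integrate over the end in cylinder coordinates.\<close>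

definition push_chart :: "('y, 'f) chart => ('x, 'f) chart" where
  "push_chart c = (\<Psi> ` dom_of c, %p. coord c (\<Phi> p))"

lemma push_chart_simps:
  "dom_of (push_chart c) = \<Psi> ` dom_of c" "coord (push_chart c) p = coord c (\<Phi> p)" "range_of (push_chart c) = range_of c"
  by (simp_all add: push_chart_def dom_of_def coord_def range_of_def image_image)

lemma push_chart_homeomorphism:
  assumes c: "c : B"
  shows "homeomorphism (dom_of (push_chart c)) (range_of c) (coord (push_chart c)) (%x. \<Psi> (point c x))"
proof (rule homeomorphismI)
  show "continuous_on (dom_of (push_chart c)) (coord (push_chart c))"
    unfolding push_chart_simps(2)[abs_def] push_chart_simps(1)
    by (intro continuous_on_compose2[OF Y.cont_coord[OF c] continuous_on_subset[OF cont_bwd]]) auto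
  show "continuous_on (range_of c) (%x. \<Psi> (point c x))"
    by (intro continuous_on_compose2[OF cont_fwd Y.cont_point[OF c]]) auto
qed (auto simp: push_chart_simps Y.coord_in Y.point_in[OF c] Y.point_coord[OF c] Y.coord_point[OF c])

end

text \<open>Finitely many neighbourhoods suffice, and by monotonicity the sum of the absolute values
  of their constants works everywhere.\<close>

lemma compact_uniform_bound:
  fixes P :: "real => 's::topological_space => bool"
  assumes c: "compact (UNIV :: 's set)" and l: "!!s. EX N C. open N & s : N & (ALL p:N. P C p)"
    and m: "!!C D p. P C p ==> C <= D ==> P D p"
  shows "EX C>=0. ALL p. P C p"
proof -
  have "ALL s. EX NC. open (fst NC) & s : fst NC & (ALL p:fst NC. P (snd NC) p)"
    using l by (metis fst_conv snd_conv)
  then obtain NC where NC: "!!s. open (fst (NC s)) & s : fst (NC s) & (ALL p:fst (NC s). P (snd (NC s)) p)" by metis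
  have o: "!!s. open (fst (NC s))" "UNIV \<subseteq> (UN s:UNIV. fst (NC s))" using NC by auto
  obtain D where D: "finite D" "UNIV \<subseteq> (UN s:D. fst (NC s))"
    using compactE_image[OF c o(1) o(2)] by metis
  have "P (SUM s:D. \<bar>snd (NC s)\<bar>) p" for p
  proof -
    obtain s where s: "s : D" "p : fst (NC s)" using D by blast
    have "snd (NC s) <= \<bar>snd (NC s)\<bar>" by simp
    also have "... <= (SUM s:D. \<bar>snd (NC s)\<bar>)" by (rule member_le_sum) (use s D in auto)
    finally have "snd (NC s) <= (SUM s:D. \<bar>snd (NC s)\<bar>)" .
    moreover have "P (snd (NC s)) p" using NC[of s] s(2) by blast
    ultimately show ?thesis using m by simp
  qed
  moreover have "0 <= (SUM s:D. \<bar>snd (NC s)\<bar>)" by (rule sum_nonneg) simp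
  ultimately show ?thesis by blast
qed

lemma posdef_basis_sum:
  assumes "posdef g" shows "g u v = (SUM a:Basis. SUM b:Basis. (u \<bullet> a) * (v \<bullet> b) * g a b)"
proof -
  have "g u v = (SUM a:Basis. (u \<bullet> a) * g a v)"
    using linear_basis_sum[OF posdefD(2)[OF assms], of u v] by simp
  also have "... = (SUM a:Basis. (u \<bullet> a) * (SUM b:Basis. (v \<bullet> b) * g a b))"
    using linear_basis_sum[OF posdefD(1)[OF assms], of _ v] by (intro sum.cong refl arg_cong2[where f = "(*)"]) simp
  finally show ?thesis by (simp add: sum_distrib_left mult.assoc)
qed

text \<open>Extreme values of \<open>g x u u\<close> on the compact product of a closed ball and the
  unit sphere; homogeneity does the rest.\<close>

lemma posdef_locally_comparable:
  fixes g :: "'a::euclidean_space => 'b::euclidean_space bilin"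
  assumes U: "open U" "x0 : U" and g: "!!x. x : U ==> posdef (g x)" "!!u v. continuous_on U (%x. g x u v)"
  shows "EX K>0. EX r>0. ball x0 r \<subseteq> U &
    (ALL x:ball x0 r. ALL u. norm u <= K * sqrt (g x u u) & sqrt (g x u u) <= K * norm u)"
proof -
  obtain r where r: "r > 0" "cball x0 r \<subseteq> U" using U open_contains_cball by blast
  define S where "S = cball x0 r \<times> sphere (0::'b) 1"
  have S: "compact S" unfolding S_def by (intro compact_Times compact_cball compact_sphere)
  have "continuous_on S (%p. SUM a:Basis. SUM b:Basis. (snd p \<bullet> a) * (snd p \<bullet> b) * g (fst p) a b)"
    by (intro continuous_intros continuous_on_compose2[OF g(2)]) (use r in \<open>auto simp: S_def\<close>)
  note 1 = this
  have e: "g x u u = (SUM a:Basis. SUM b:Basis. (u \<bullet> a) * (u \<bullet> b) * g x a b)" if "x : U" for x u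
    by (rule posdef_basis_sum[OF g(1)[OF that]])
  have cont: "continuous_on S (%p. g (fst p) (snd p) (snd p))"
    by (rule continuous_on_eq[OF 1 e[symmetric]]) (use r in \<open>auto simp: S_def\<close>)
  have "(x0, SOME b. b : Basis) : S" using r(1) by (simp add: S_def SOME_Basis)
  then have ne: "S ~= {}" by blast
  obtain p where p: "p : S" "!!q. q : S ==> g (fst p) (snd p) (snd p) <= g (fst q) (snd q) (snd q)"
    using continuous_attains_inf[OF S ne cont] by blast
  obtain p' where p': "p' : S" "!!q. q : S ==> g (fst q) (snd q) (snd q) <= g (fst p') (snd p') (snd p')"
    using continuous_attains_sup[OF S ne cont] by blast
  define m M where "m = g (fst p) (snd p) (snd p)" and "M = g (fst p') (snd p') (snd p')"
  have m: "m > 0" unfolding m_def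
  proof (rule posdefD(4)[OF g(1)])
    show "fst p : U" "snd p ~= 0" using p(1) r by (auto simp: S_def)
  qed
  define K where "K = max (1 / sqrt m) (sqrt M)"
  have K: "K > 0" "1 / sqrt m <= K" "sqrt M <= K" using m by (auto simp: K_def less_max_iff_disj)
  have b: "norm u <= K * sqrt (g x u u) & sqrt (g x u u) <= K * norm u" if x: "x : ball x0 r" for x u
  proof (cases "u = 0")
    case True
    have "x : U" using x r by auto
    then show ?thesis using True posdef_simps(9)[OF g(1)] by simp
  next
    case False
    have xU: "x : U" using x r by auto
    define v where "v = (1 / norm u) *\<^sub>R u"
    have u: "u = norm u *\<^sub>R v" "norm v = 1" using False by (auto simp: v_def)
    then have vS: "(x, v) : S" using x by (auto simp: S_def)
    have g': "g x u u = (norm u)\<^sup>2 * g x v v"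
      using u(1) posdef_simps(5,6)[OF g(1)[OF xU]] by (metis mult.assoc power2_eq_square)
    have sq: "sqrt (g x u u) = norm u * sqrt (g x v v)" unfolding g' by (simp add: real_sqrt_mult)
    have mM: "m <= g x v v" "g x v v <= M" using p(2)[OF vS] p'(2)[OF vS] by (simp_all add: m_def M_def)
    have "1 <= (1 / sqrt m) * sqrt (g x v v)" using m mM(1) by simp
    also have "... <= K * sqrt (g x v v)" by (rule mult_right_mono[OF K(2)]) (use m mM in simp)
    finally have "norm u * 1 <= norm u * (K * sqrt (g x v v))" by (intro mult_left_mono) auto
    moreover have "sqrt (g x v v) <= K" using K(3) mM(2) by (meson order_trans real_sqrt_le_mono)
    then have "norm u * sqrt (g x v v) <= norm u * K" by (intro mult_left_mono) auto
    ultimately show ?thesis unfolding sq by (simp add: mult_ac)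
  qed
  have "ball x0 r \<subseteq> U" using r(2) by auto
  then show ?thesis using b K(1) r(1) by blast
qed

text \<open>\<open>tensor_norm\<close> is the Hilbert-Schmidt norm in an orthonormal frame, so this
  is Cauchy-Schwarz for sums over pairs of indices.\<close>

lemma tensor_norm_2_bound:
  fixes g T :: "'e::euclidean_space local_tensor"
  assumes g: "posdef (%u v. g x [u, v])" and T: "!!v. linear (%u. T x [u, v])" "!!u. linear (%v. T x [u, v])"
  shows "\<bar>T x [u, v]\<bar> <= tensor_norm g 2 T x * sqrt (g x [u, u]) * sqrt (g x [v, v])"
proof -
  define G where "G u v = g x [u, v]" for u v
  have G: "posdef G" using g by (simp add: G_def[abs_def])
  define F where "F = (SOME F. orthonormal_frame g x F)"
  have ofr: "orthonormal_frame g x F \<longleftrightarrow> gframe G F" for F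
    by (simp add: orthonormal_frame_def gframe_def G_def)
  obtain F0 where "gframe G F0" using gframe_exists[OF G] by blast
  then have "orthonormal_frame g x F" unfolding F_def using someI[of "orthonormal_frame g x" F0] ofr by blast
  then have F: "gframe G F" by (simp add: ofr)
  have lists: "{bs :: 'e list. set bs \<subseteq> Basis & length bs = 2} = (%(a, b). [a, b]) ` (Basis \<times> Basis)"
    by (auto simp: length_Suc_conv numeral_2_eq_2 image_iff)
  have inj: "inj_on (%(a, b). [a, b :: 'e]) (Basis \<times> Basis)" by (auto simp: inj_on_def)
  have N: "tensor_norm g 2 T x = sqrt (SUM p:Basis \<times> Basis. (T x [F (fst p), F (snd p)])\<^sup>2)"
    unfolding tensor_norm_def Let_def F_def[symmetric] lists sum.reindex[OF inj] by (simp add: split_beta)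
  have "T x [u, v] = T x [SUM a:Basis. G u (F a) *\<^sub>R F a, SUM b:Basis. G v (F b) *\<^sub>R F b]"
    by (simp add: gframe_expand[OF G F])
  also have "... = (SUM a:Basis. SUM b:Basis. (G u (F a) * G v (F b)) * T x [F a, F b])"
    unfolding linear_sum[OF T(1)] linear_sum[OF T(2)] linear_scale[OF T(1)] linear_scale[OF T(2)]
    by (subst sum.swap) (simp add: sum_distrib_left mult_ac)
  also have "... = (SUM p:Basis \<times> Basis. (G u (F (fst p)) * G v (F (snd p))) * T x [F (fst p), F (snd p)])"
    by (simp add: sum.cartesian_product split_beta)
  finally have e: "(T x [u, v])\<^sup>2 <= (SUM p:Basis \<times> Basis. (G u (F (fst p)) * G v (F (snd p)))\<^sup>2) *
      (SUM p:Basis \<times> Basis. (T x [F (fst p), F (snd p)])\<^sup>2)"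
    using Cauchy_Schwarz_ineq_sum by simp
  have par: "G w w = (SUM a:Basis. (G w (F a))\<^sup>2)" for w
    using gframe_parseval[OF G F, of w w] by (simp add: power2_eq_square)
  have "(SUM p:Basis \<times> Basis. (G u (F (fst p)) * G v (F (snd p)))\<^sup>2) = G u u * G v v"
    unfolding par sum_product by (simp add: sum.cartesian_product split_beta power_mult_distrib)
  from e[unfolded this]
  have "sqrt ((T x [u, v])\<^sup>2) <= sqrt (G u u * G v v * (SUM p:Basis \<times> Basis. (T x [F (fst p), F (snd p)])\<^sup>2))"
    by (rule real_sqrt_le_mono)
  then show ?thesis unfolding N by (simp add: G_def real_sqrt_mult mult_ac)
qed

text \<open>Reads off the summand of order zero.\<close>

lemma Ck_finite_tensor_norm_bound:
  assumes "Ck_finite_on_end A gS k m a"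
  shows "EX M>=0. EX T. ALL c:cyl_atlas A. ALL x:range_of c. T <= fst x --> tensor_norm (g_cyl A gS c) m (a c) x <= M"
proof -
  obtain T where T: "Ck_norm A gS T k m a < \<infinity>" using assms by (auto simp: Ck_finite_on_end_def)
  define s where "s i = (SUP (c, x)\<in>{(c, x). c : cyl_atlas A & x : range_of c & T <= fst x}.
     ennreal (tensor_norm (g_cyl A gS c) (m + i) ((cov_deriv (g_cyl A gS c) ^^ i) (a c)) x))" for i
  have "s 0 <= (SUM i<=k. s i)" by (rule member_le_sum) auto
  also have "... < \<infinity>" using T by (simp add: Ck_norm_def s_def)
  finally have "s 0 < top" by simp
  then obtain M where M: "0 <= M" "s 0 = ennreal M" by (cases "s 0") auto
  have "tensor_norm (g_cyl A gS c) m (a c) x <= M" if "c : cyl_atlas A" "x : range_of c" "T <= fst x" for c x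
  proof -
    have "ennreal (tensor_norm (g_cyl A gS c) m (a c) x) <= s 0" unfolding s_def
      by (rule SUP_upper2[of "(c, x)"]) (use that in auto)
    then show ?thesis unfolding M(2) using M(1) by (simp add: ennreal_le_iff)
  qed
  then show ?thesis using M(1) by blast
qed

section \<open>Product charts and product metric of a cylinder\<close>

context smooth_manifold
begin

lemma cyl_chart_simps:
  "dom_of (cyl_chart c) = UNIV \<times> dom_of c" "coord (cyl_chart c) p = (fst p, coord c (snd p))"
  "range_of (cyl_chart c) = UNIV \<times> range_of c"
proof -
  show d: "dom_of (cyl_chart c) = UNIV \<times> dom_of c" and c: "coord (cyl_chart c) p = (fst p, coord c (snd p))" for p
    by (simp_all add: cyl_chart_def dom_of_def coord_def split_beta)
  show "range_of (cyl_chart c) = UNIV \<times> range_of c" unfolding range_of_def d by (force simp: c)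
qed

lemma point_cyl_chart:
  assumes c: "c : A" "x : range_of c" shows "point (cyl_chart c) (t, x) = (t, point c x)"
  unfolding point_def
proof (rule inv_into_f_eq)
  show "inj_on (coord (cyl_chart c)) (dom_of (cyl_chart c))"
    by (rule inj_on_inverseI[where g = "%p. (fst p, point c (snd p))"]) (auto simp: cyl_chart_simps point_coord[OF c(1)])
  show "(t, inv_into (dom_of c) (coord c) x) : dom_of (cyl_chart c)"
    using point_in[OF c] by (simp add: cyl_chart_simps point_def)
  show "coord (cyl_chart c) (t, inv_into (dom_of c) (coord c) x) = (t, x)"
    using coord_point[OF c] by (simp add: cyl_chart_simps point_def)
qed

lemma cyl_overlap: "overlap (cyl_chart c) (cyl_chart d) = UNIV \<times> overlap c d"
  unfolding overlap_def cyl_chart_simps by (force simp: cyl_chart_simps)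

lemma cyl_transition:
  assumes c: "c : A" "d : A" "x : overlap c d"
  shows "transition (cyl_chart c) (cyl_chart d) (t, x) = (t, transition c d x)"
  using c overlap_iff[OF c(1)] by (simp add: transition_def point_cyl_chart cyl_chart_simps)

lemma cyl_transition_Pair:
  assumes c: "c : A" "d : A"
  shows "Ck_on k (UNIV \<times> overlap c d) (transition (cyl_chart c) (cyl_chart d))"
proof -
  have o: "open (UNIV \<times> overlap c d :: (real * 'e) set)" by (intro open_Times open_UNIV open_overlap c)
  have "Ck_on k (UNIV \<times> overlap c d) (%z::real * 'e. (fst z, transition c d (snd z)))"
  proof (rule Ck_on_Pair[OF o Ck_on_bounded_linear[OF bounded_linear_fst]])
    show "Ck_on k (UNIV \<times> overlap c d) (%z::real * 'e. transition c d (snd z))"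
      by (rule Ck_on_compose[OF o Ck_on_bounded_linear[OF bounded_linear_snd] Ck_transition[OF c]]) auto
  qed
  then show ?thesis
    by (subst Ck_on_cong[OF o, of _ "%z. (fst z, transition c d (snd z))"]) (auto simp: cyl_transition[OF c])
qed

lemma dir_cyl_transition:
  assumes c: "c : A" "d : A" "x : overlap c d"
  shows "dir (transition (cyl_chart c) (cyl_chart d)) (t, x) w = (fst w, dir (transition c d) x (snd w))"
proof -
  have o: "open (UNIV \<times> overlap c d :: (real * 'e) set)" by (intro open_Times open_UNIV open_overlap c)
  have "dir (%z. (fst z, transition c d (snd z))) (t, x) = (%w. (fst w, dir (transition c d) x (snd w)))"
    by (intro dir_eqI has_derivative_snd_compose dir_works diff_transition c)
  moreover have "dir (transition (cyl_chart c) (cyl_chart d)) (t, x) = dir (%z. (fst z, transition c d (snd z))) (t, x)"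
    by (rule dir_cong[OF o]) (use c in \<open>auto simp: cyl_transition\<close>)
  ultimately show ?thesis by simp
qed

lemma smooth_cyl_atlas: "smooth_atlas (cyl_atlas A)"
  unfolding smooth_atlas_def
proof (intro conjI ballI)
  show "(UN c:cyl_atlas A. dom_of c) = UNIV"
  proof -
    have "(t, s) : (UN c:cyl_atlas A. dom_of c)" for t s
    proof -
      obtain c where "c : A" "s : dom_of c" using cover .
      then show ?thesis by (auto simp: cyl_atlas_def cyl_chart_simps)
    qed
    then show ?thesis by auto
  qed
  fix c' assume "c' : cyl_atlas A"
  then obtain c where c: "c : A" "c' = cyl_chart c" by (auto simp: cyl_atlas_def)
  show "open (dom_of c')" "open (range_of c')" unfolding c(2) cyl_chart_simps
    by (intro open_Times open_UNIV chart c)+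
  show "homeomorphism (dom_of c') (range_of c') (coord c') (point c')" unfolding c(2)
  proof (rule homeomorphismI)
    show "continuous_on (dom_of (cyl_chart c)) (coord (cyl_chart c))"
      unfolding cyl_chart_simps(2)[abs_def]
      by (intro continuous_intros continuous_on_compose2[OF cont_coord[OF c(1)]]) (auto simp: cyl_chart_simps)
    have "continuous_on (range_of (cyl_chart c)) (%z. (fst z, point c (snd z)))"
      by (intro continuous_intros continuous_on_compose2[OF cont_point[OF c(1)]]) (auto simp: cyl_chart_simps)
    then show "continuous_on (range_of (cyl_chart c)) (point (cyl_chart c))"
      by (rule continuous_on_eq) (auto simp: cyl_chart_simps point_cyl_chart[OF c(1)])
  qed (auto simp: cyl_chart_simps point_cyl_chart[OF c(1)] coord_in point_in[OF c(1)] point_coord[OF c(1)] coord_point[OF c(1)])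
  show "smooth_fun_on (overlap c' d') (transition c' d')" if "d' : cyl_atlas A" for d'
    using that c cyl_transition_Pair[OF c(1)] by (auto simp: cyl_atlas_def smooth_fun_on_def cyl_overlap)
qed

definition cyl_metric :: "('x, 'e) tensor => ('x, 'e) chart => real * 'e => (real * 'e) bilin" where
  "cyl_metric gS c z u v = fst u * fst v + gS c (snd z) [snd u, snd v]"

text \<open>Resolves the chart choice hidden in the pullback along the projection.\<close>

lemma g_cyl_eq:
  assumes gS: "tensor_field A 2 gS" and c: "c : A" "x : range_of c"
  shows "g_cyl A gS (cyl_chart c) (t, x) [u, v] = cyl_metric gS c (t, x) u v"
proof -
  define d where "d = (SOME d. d : A & snd (point (cyl_chart c) (t, x)) : dom_of d)"
  have d: "d : A" "point c x : dom_of d"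
    using someI[of "%d. d : A & snd (point (cyl_chart c) (t, x)) : dom_of d" c] c point_in[OF c]
    by (auto simp: d_def point_cyl_chart)
  then have x: "x : overlap c d" using c overlap_iff by simp
  define F where "F = coord d o snd o point (cyl_chart c)"
  have o: "open (UNIV \<times> overlap c d :: (real * 'e) set)" by (intro open_Times open_UNIV open_overlap c d)
  have Fe: "F z = transition c d (snd z)" if "z : UNIV \<times> overlap c d" for z
  proof -
    have "snd z : range_of c" using that overlap_iff[OF c(1), of "snd z" d] by auto
    then show ?thesis using point_cyl_chart[OF c(1), of "snd z" "fst z"] by (simp add: F_def transition_def)
  qed
  have "dir (%z. transition c d (snd z)) (t, x) = (%w. dir (transition c d) x (snd w))"
    by (intro dir_eqI has_derivative_snd_compose dir_works diff_transition c(1) d(1) x)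
  moreover have "dir F (t, x) = dir (%z. transition c d (snd z)) (t, x)"
    by (rule dir_cong[OF o]) (use x Fe in auto)
  ultimately have dF: "dir F (t, x) w = dir (transition c d) x (snd w)" for w by simp
  have "pullback (cyl_atlas A) A 2 snd gS (cyl_chart c) (t, x) [u, v] = gS d (F (t, x)) [dir F (t, x) u, dir F (t, x) v]"
    unfolding pullback_def d_def[symmetric] Let_def F_def using c by (simp add: cyl_chart_simps cyl_atlas_def)
  also have "... = gS c x [snd u, snd v]"
    using tensor_transition[OF gS c(1) d(1) x, of "[snd u, snd v]"] Fe[of "(t, x)"] x by (simp add: dF)
  finally show ?thesis using c by (simp add: g_cyl_def cyl_chart_simps cyl_metric_def cyl_atlas_def)
qed

lemma posdef_riemannian:
  assumes g: "riemannian_metric A g" and c: "c : A" "x : range_of c"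
  shows "posdef (%u v. g c x [u, v])"
proof -
  have "tensor_field A 2 g" using g by (simp add: riemannian_metric_def)
  from tensor2_linear[OF this c] show ?thesis using g c by (auto simp: posdef_def riemannian_metric_def)
qed

lemma posdef_cyl_metric:
  assumes g: "riemannian_metric A gS" and c: "c : A" "x : range_of c"
  shows "posdef (cyl_metric gS c (t, x))"
proof -
  note p = posdef_riemannian[OF assms]
  show ?thesis unfolding posdef_def
  proof (intro conjI allI impI)
    show "linear (cyl_metric gS c (t, x) u)" for u
      by (rule linearI) (simp_all add: cyl_metric_def posdef_simps[OF p] algebra_simps)
    show "cyl_metric gS c (t, x) u v = cyl_metric gS c (t, x) v u" for u v
      using posdefD(3)[OF p, of "snd u" "snd v"] by (simp add: cyl_metric_def mult.commute)
    show "0 < cyl_metric gS c (t, x) u u" if "u ~= 0" for u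
    proof (cases "snd u = 0")
      case True
      then have "fst u ~= 0" using that by (metis prod_eq_iff fst_zero snd_zero)
      then have "fst u * fst u > 0" by (metis not_real_square_gt_zero)
      then show ?thesis using True posdef_simps(9)[OF p] by (simp add: cyl_metric_def)
    next
      case False
      then show ?thesis using posdefD(4)[OF p False] by (simp add: cyl_metric_def add_nonneg_pos)
    qed
  qed
qed

lemma cyl_metric_transition:
  assumes g: "tensor_field A 2 gS" and c: "c : A" "d : A" "x : overlap c d"
  shows "cyl_metric gS c (t, x) u v =
    cyl_metric gS d (t, transition c d x) (fst u, dir (transition c d) x (snd u)) (fst v, dir (transition c d) x (snd v))"
  using tensor_transition[OF g c, of "[snd u, snd v]"] by (simp add: cyl_metric_def)

text \<open>The cylinder metric does not depend on \<open>t\<close>, so constants found at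
  \<open>t = 0\<close> hold for all \<open>t\<close>.\<close>

lemma cyl_metric_comparable:
  assumes g: "riemannian_metric A gS" and c: "c : A" "x0 : range_of c"
  shows "EX K>0. EX r>0. ball x0 r \<subseteq> range_of c & (ALL x:ball x0 r. ALL t u.
    norm u <= K * sqrt (cyl_metric gS c (t, x) u u) & sqrt (cyl_metric gS c (t, x) u u) <= K * norm u)"
proof -
  have T: "tensor_field A 2 gS" using g by (simp add: riemannian_metric_def)
  have t: "cyl_metric gS c (t, x) = cyl_metric gS c (0, x)" for t x by (simp add: cyl_metric_def fun_eq_iff)
  have cont: "continuous_on (range_of c) (%x. cyl_metric gS c (0, x) u v)" for u v
    using Ck_on_imp_continuous[OF tensor_smooth[OF T c(1), of "[snd u, snd v]" 0]]
    by (simp add: cyl_metric_def continuous_on_add)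
  have pos: "posdef (cyl_metric gS c (0, x))" if "x : range_of c" for x
    by (rule posdef_cyl_metric[OF g c(1) that])
  have "EX K>0. EX r>0. ball x0 r \<subseteq> range_of c & (ALL x:ball x0 r. ALL u.
    norm u <= K * sqrt (cyl_metric gS c (0, x) u u) & sqrt (cyl_metric gS c (0, x) u u) <= K * norm u)"
    by (rule posdef_locally_comparable[OF chart(2)[OF c(1)] c(2) pos cont])
  then obtain K r where Kr: "K > 0" "r > 0" "ball x0 r \<subseteq> range_of c"
    and b: "ALL x:ball x0 r. ALL u. norm u <= K * sqrt (cyl_metric gS c (0, x) u u) & sqrt (cyl_metric gS c (0, x) u u) <= K * norm u"
    by (elim exE conjE) (rule that)
  have "norm u <= K * sqrt (cyl_metric gS c (t, x) u u) & sqrt (cyl_metric gS c (t, x) u u) <= K * norm u"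
    if "x : ball x0 r" for x t u
    using b that t[of t x] by metis
  then show ?thesis using Kr by blast
qed

end

lemma linear_cmult: "linear f ==> linear (%x. a * f x :: real)"
  using linear_compose_scale_right[of f a] by simp

context end_form
begin

lemma rep_transition:
  assumes c: "c : A" "d : A" "x : overlap c d" and t: "t > T0"
    and f: "Ck_on 1 ({T0<..} \<times> range_of d) (rep d f)"
  shows "dir (rep c f) (t, x) w = dir (rep d f) (t, transition c d x) (fst w, dir (transition c d) x (snd w))"
proof -
  have o: "open ({T0<..} \<times> overlap c d)" by (intro open_Times open_greaterThan open_overlap c)
  note g = has_derivative_snd_compose(2)[OF dir_works[OF diff_transition[OF c]], of t]
  have "transition c d x : range_of d" using transition_in[OF c] overlap_iff[OF c(2)] by blast
  then have "(rep d f has_derivative dir (rep d f) (t, transition c d x)) (at (t, transition c d x))"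
    using t by (intro dir_works Ck_on_imp_differentiable[OF f]) auto
  from diff_chain_at[OF g, of "rep d f", unfolded fst_conv snd_conv, OF this]
  have "dir (%z. rep d f (fst z, transition c d (snd z))) (t, x) =
      (%w. dir (rep d f) (t, transition c d x) (fst w, dir (transition c d) x (snd w)))"
    by (intro dir_eqI) (simp add: o_def)
  moreover have "dir (rep c f) (t, x) = dir (%z. rep d f (fst z, transition c d (snd z))) (t, x)"
    by (rule dir_cong[OF o]) (use c t point_transition[OF c(1,2)] in auto)
  ultimately show ?thesis by simp
qed

text \<open>Chart norms are locally comparable with the cylinder metric, and compactness of the
  cross-section makes the constant uniform. The predicate \<open>P\<close> speaks of all charts at a
  point, to which \<open>inv\<close> carries the bound found in one chart.\<close>

lemma uniform_decay:
  assumes gS: "riemannian_metric A gS"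
    and d: "!!c x0. c : A ==> x0 : range_of c ==> decays x0 (\<phi> c)"
    and inv: "!!c d x t w. c : A ==> d : A ==> x : overlap c d ==> t > T0 ==>
      \<phi> c (t, x) w = \<phi> d (t, transition c d x) (fst w, dir (transition c d) x (snd w))"
  shows "EX C>=0. ALL c:A. ALL x:range_of c. ALL t>T0. ALL w. \<bar>\<phi> c (t, x) w\<bar> <= C * exp (- lam * t) * sqrt (cyl_metric gS c (t, x) w w)"
proof -
  define P where "P C p \<longleftrightarrow> (ALL c:A. ALL x:range_of c. point c x = p -->
    (ALL t>T0. ALL w. \<bar>\<phi> c (t, x) w\<bar> <= C * exp (- lam * t) * sqrt (cyl_metric gS c (t, x) w w)))" for C p
  have gT: "tensor_field A 2 gS" using gS by (simp add: riemannian_metric_def)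
  have "EX C>=0. ALL p. P C p"
  proof (rule compact_uniform_bound[OF cpt])
    fix s
    obtain a where a: "a : A" "s : dom_of a" using cover .
    define x0 where "x0 = coord a s"
    have x0: "x0 : range_of a" using a by (simp add: x0_def coord_in)
    obtain C r where C: "C >= 0" "r > 0" "!!x t w. x : ball x0 r ==> t > T0 ==> \<bar>\<phi> a (t, x) w\<bar> <= C * exp (- lam * t) * norm w"
      using d[OF a(1) x0] unfolding decays_def by blast
    obtain K r' where K: "K > 0" "r' > 0" "ball x0 r' \<subseteq> range_of a"
      and K': "ALL x:ball x0 r'. ALL t u. norm u <= K * sqrt (cyl_metric gS a (t, x) u u) & sqrt (cyl_metric gS a (t, x) u u) <= K * norm u"
      using cyl_metric_comparable[OF gS a(1) x0] by (elim exE conjE) (rule that)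
    define V where "V = ball x0 (min r r')"
    have V: "open V" "V \<subseteq> range_of a" "x0 : V" using C K by (auto simp: V_def)
    have "P (C * K) p" if p: "p : point a ` V" for p
      unfolding P_def
    proof (intro ballI impI allI)
      fix c x t and w :: "real * 'e" assume c: "c : A" and x: "x : range_of c" "point c x = p" and t: "T0 < t"
      obtain y where y: "y : V" "p = point a y" using p by auto
      have "p : dom_of a" using y V(2) point_in[OF a(1)] by auto
      then have xo: "x : overlap c a" using x overlap_iff[OF c] by simp
      have Tx: "transition c a x = y" using y V(2) x coord_point[OF a(1)] by (auto simp: transition_def)
      define w' where "w' = (fst w, dir (transition c a) x (snd w))"
      have "\<bar>\<phi> c (t, x) w\<bar> <= C * exp (- lam * t) * norm w'"
        unfolding inv[OF c a(1) xo t] Tx w'_def[symmetric] by (rule C(3)) (use y t in \<open>auto simp: V_def\<close>)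
      also have "... <= C * exp (- lam * t) * (K * sqrt (cyl_metric gS a (t, y) w' w'))"
        using K'[rule_format, of y w' t] y(1) C(1) by (intro mult_left_mono) (simp_all add: V_def)
      also have "cyl_metric gS a (t, y) w' w' = cyl_metric gS c (t, x) w w"
        using cyl_metric_transition[OF gT c a(1) xo, of t w w] by (simp add: w'_def Tx)
      finally show "\<bar>\<phi> c (t, x) w\<bar> <= C * K * exp (- lam * t) * sqrt (cyl_metric gS c (t, x) w w)" by (simp add: mult_ac)
    qed
    moreover have "open (point a ` V)" by (rule open_point_image[OF a(1) V(1,2)])
    moreover have "s : point a ` V" using imageI[OF V(3), of "point a"] by (simp add: x0_def point_coord[OF a])
    ultimately show "EX N C. open N & s : N & (ALL p:N. P C p)" by blast
  next
    fix C D p assume P: "P C p" and CD: "C <= D"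
    show "P D p" unfolding P_def
    proof (intro ballI impI allI)
      fix c x t and w :: "real * 'e" assume c: "c : A" and x: "x : range_of c" "point c x = p" and t: "T0 < t"
      have "\<bar>\<phi> c (t, x) w\<bar> <= C * exp (- lam * t) * sqrt (cyl_metric gS c (t, x) w w)"
        using P c x t unfolding P_def by blast
      also have "... <= D * exp (- lam * t) * sqrt (cyl_metric gS c (t, x) w w)"
        using CD posdefD(5)[OF posdef_cyl_metric[OF gS c x(1)]] by (intro mult_right_mono) auto
      finally show "\<bar>\<phi> c (t, x) w\<bar> <= D * exp (- lam * t) * sqrt (cyl_metric gS c (t, x) w w)" .
    qed
  qed
  then obtain C where C: "C >= 0" "!!p. P C p" by blast
  have "\<bar>\<phi> c (t, x) w\<bar> <= C * exp (- lam * t) * sqrt (cyl_metric gS c (t, x) w w)"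
    if "c : A" "x : range_of c" "t > T0" for c x t w
    using C(2)[of "point c x", unfolded P_def, rule_format, OF that(1,2) refl that(3)] .
  then show ?thesis using C(1) by (intro exI[of _ C]) simp
qed

end

section \<open>Estimates on the end\<close>

locale cyl_embedding = S: smooth_manifold AS + E: open_embedding "cyl_atlas AS" A \<Psi> \<Phi> W
  for AS :: "('s::{t2_space,second_countable_topology}, 'e::euclidean_space) chart set"
    and A :: "('x::{t2_space,second_countable_topology}, 'd::euclidean_space) chart set"
    and \<Psi> :: "real * 's => 'x" and \<Phi> W +
  fixes gS :: "('s, 'e) tensor"
  assumes gS: "riemannian_metric AS gS" and compact_S: "compact (UNIV :: 's set)"
begin

abbreviation F :: "('s, 'e) chart => ('x, 'd) chart => real * 'e => 'd" where
  "F c d \<equiv> E.fwd (cyl_chart c) d"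

abbreviation L :: "('s, 'e) chart => ('x, 'd) chart => real * 'e => real * 'e => 'd" where
  "L c d z \<equiv> dir (E.fwd (cyl_chart c) d) z"

abbreviation G :: "('s, 'e) chart => real * 'e => (real * 'e) bilin" where
  "G c z \<equiv> S.cyl_metric gS c z"

abbreviation N :: "('s, 'e) chart => real * 'e => real * 'e => real" where
  "N c z u \<equiv> sqrt (S.cyl_metric gS c z u u)"

abbreviation Bwd :: "('s, 'e) chart => ('x, 'd) chart => 'd => real * 'e" where
  "Bwd c d \<equiv> E.bwd d (cyl_chart c)"

abbreviation Loc :: "('s, 'e) chart => ('x, 'd) chart => (real * 'e) set" where
  "Loc c d \<equiv> E.loc (cyl_chart c) d"

abbreviation Push :: "('s, 'e) chart => ('x, real * 'e) chart" where
  "Push c \<equiv> E.push_chart (cyl_chart c)"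

abbreviation pb1 :: "('x, 'd) tensor => ('s, 'e) chart => ('x, 'd) chart => real * 'e => real * 'e => real" where
  "pb1 T c d z u \<equiv> T d (F c d z) [L c d z u]"

abbreviation pb2 :: "('x, 'd) tensor => ('s, 'e) chart => ('x, 'd) chart => real * 'e => (real * 'e) bilin" where
  "pb2 T c d z u v \<equiv> T d (F c d z) [L c d z u, L c d z v]"

definition at_end :: "('s, 'e) chart => ('x, 'd) chart => real => 'e => bool" where
  "at_end c d t x \<longleftrightarrow> c : AS & d : A & x : range_of c & (t, x) : Loc c d"

text \<open>Comparability with the cone metric, which is \<open>exp (2 * t)\<close> times the
  cylinder metric; the factor 2 absorbs the decaying error.\<close>

definition cone_like :: "(('x, 'd) chart => 'd => 'd bilin) => real => bool" where
  "cone_like g T0 \<longleftrightarrow> (ALL c d t x v. at_end c d t x --> t > T0 -->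
    exp (2 * t) / 2 * G c (t, x) v v <= g d (F c d (t, x)) (L c d (t, x) v) (L c d (t, x) v) &
    g d (F c d (t, x)) (L c d (t, x) v) (L c d (t, x) v) <= 2 * exp (2 * t) * G c (t, x) v v)"

definition decaying :: "real => real => real => ('x, 'd) tensor => bool" where
  "decaying lam M T0 T \<longleftrightarrow> (ALL c d t x u v. at_end c d t x --> t > T0 -->
    \<bar>pb2 T c d (t, x) u v\<bar> <= M * exp (- lam * t) * N c (t, x) u * N c (t, x) v)"

lemma cone_likeD:
  "cone_like g T0 ==> at_end c d t x ==> t > T0 ==>
    exp (2 * t) / 2 * G c (t, x) v v <= g d (F c d (t, x)) (L c d (t, x) v) (L c d (t, x) v) &
    g d (F c d (t, x)) (L c d (t, x) v) (L c d (t, x) v) <= 2 * exp (2 * t) * G c (t, x) v v"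
  unfolding cone_like_def by blast

lemma decayingD:
  "decaying lam M T0 T ==> at_end c d t x ==> t > T0 ==>
    \<bar>pb2 T c d (t, x) u v\<bar> <= M * exp (- lam * t) * N c (t, x) u * N c (t, x) v"
  unfolding decaying_def by blast

lemma end_mono:
  assumes "T0 <= T1"
  shows "cone_like g T0 ==> cone_like g T1" "decaying lam M T0 T ==> decaying lam M T1 T"
  using assms unfolding cone_like_def decaying_def by force+

lemma tensor_gS: "tensor_field AS 2 gS" using gS by (simp add: riemannian_metric_def)

lemma cyl_chart_in: "c : AS ==> cyl_chart c : cyl_atlas AS" by (simp add: cyl_atlas_def)

lemma at_endD:
  assumes "at_end c d t x"
  shows "c : AS" "cyl_chart c : cyl_atlas AS" "d : A" "x : range_of c" "(t, x) : Loc c d"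
    "(t, x) : range_of (cyl_chart c)" "F c d (t, x) : range_of d" "point d (F c d (t, x)) = \<Psi> (t, point c x)"
    "linear (L c d (t, x))"
proof -
  show 1: "c : AS" "cyl_chart c : cyl_atlas AS" "d : A" "x : range_of c" "(t, x) : Loc c d"
    using assms cyl_chart_in by (auto simp: at_end_def)
  show "(t, x) : range_of (cyl_chart c)" using 1 by (simp add: S.cyl_chart_simps)
  show "F c d (t, x) : range_of d" by (rule E.fwd_range[OF 1(2,5)])
  show "point d (F c d (t, x)) = \<Psi> (t, point c x)"
    using E.point_fwd[OF 1(2,3,5)] by (simp add: S.point_cyl_chart[OF 1(1,4)])
  show "linear (L c d (t, x))" by (rule E.linear_fwd[OF 1(2,3,5)])
qed

lemma at_end_exists: "c : AS ==> x : range_of c ==> EX d. at_end c d t x"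
  using E.loc_exists[of "cyl_chart c" "(t, x)"] cyl_chart_in by (auto simp: at_end_def S.cyl_chart_simps)

lemma end_point_exists: "EX c d x. at_end c d t x & \<Psi> (t, s) = point d (F c d (t, x))"
proof -
  obtain c where c: "c : AS" "s : dom_of c" using S.cover .
  obtain d where d: "at_end c d t (coord c s)" using at_end_exists[OF c(1) S.coord_in[OF c(2)]] by blast
  show ?thesis using d at_endD(8)[OF d] by (intro exI[of _ c] exI[of _ d] exI[of _ "coord c s"]) (simp add: S.point_coord[OF c])
qed

lemma posdef_G: "at_end c d t x ==> posdef (G c (t, x))"
  using S.posdef_cyl_metric[OF gS] at_endD by blast

lemma L_inverse:
  assumes "at_end c d t x"
  shows "dir (Bwd c d) (F c d (t, x)) (L c d (t, x) v) = v"
    "L c d (t, x) (dir (Bwd c d) (F c d (t, x)) w) = w"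
    "linear (dir (Bwd c d) (F c d (t, x)))"
  using E.dir_bwd_fwd[OF at_endD(2,3,5)[OF assms]] E.linear_bwd[OF at_endD(2,3,5)[OF assms]] by auto

lemma L_onto: "at_end c d t x ==> EX v. w = L c d (t, x) v"
  using L_inverse(2) by metis

text \<open>The common part of the bounds for forms and for metrics: bilinearity turns a bound on
  \<open>tensor_norm\<close> into one on pairs of vectors.\<close>

lemma pulled_bound:
  assumes b: "Ck_finite_on_end AS gS k 2 P"
    and P: "!!c d t x u v. at_end c d t x ==> P (cyl_chart c) (t, x) [u, v] = B c d t x u v"
    and l: "!!c d t x v. at_end c d t x ==> linear (%u. B c d t x u v)" "!!c d t x u. at_end c d t x ==> linear (B c d t x u)"
  shows "EX M>=0. EX T0. ALL c d t x u v. at_end c d t x & t >= T0 --> \<bar>B c d t x u v\<bar> <= M * N c (t, x) u * N c (t, x) v"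
proof -
  obtain M T0 where M: "M >= 0" "!!c x. c : cyl_atlas AS ==> x : range_of c ==> T0 <= fst x ==>
      tensor_norm (g_cyl AS gS c) 2 (P c) x <= M"
    using Ck_finite_tensor_norm_bound[OF b] by blast
  have "\<bar>B c d t x u v\<bar> <= M * N c (t, x) u * N c (t, x) v" if e: "at_end c d t x" and t: "t >= T0" for c d t x u v
  proof -
    note c = at_endD[OF e]
    have g: "(%u v. g_cyl AS gS (cyl_chart c) (t, x) [u, v]) = G c (t, x)"
      using S.g_cyl_eq[OF tensor_gS c(1,4)] by (simp add: fun_eq_iff)
    have "\<bar>P (cyl_chart c) (t, x) [u, v]\<bar> <= tensor_norm (g_cyl AS gS (cyl_chart c)) 2 (P (cyl_chart c)) (t, x) *
        sqrt (g_cyl AS gS (cyl_chart c) (t, x) [u, u]) * sqrt (g_cyl AS gS (cyl_chart c) (t, x) [v, v])"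
      by (rule tensor_norm_2_bound) (simp_all add: g posdef_G[OF e] P[OF e] l[OF e])
    also have "... <= M * N c (t, x) u * N c (t, x) v"
      unfolding S.g_cyl_eq[OF tensor_gS c(1,4)] using M(2)[OF c(2,6)] t posdefD(5)[OF posdef_G[OF e]]
      by (intro mult_right_mono) auto
    finally show ?thesis unfolding P[OF e] .
  qed
  then show ?thesis using M(1) by blast
qed

context
  fixes T :: "('x, 'd) tensor" assumes T: "tensor_field A 2 T"
begin

lemma pulled_tensor:
  assumes e: "at_end c d t x"
  shows "pullback (cyl_atlas AS) A 2 \<Psi> (mult_tensor f T) (cyl_chart c) (t, x) [u, v] =
      f (\<Psi> (t, point c x)) * pb2 T c d (t, x) u v"
    "linear (%u. f (\<Psi> (t, point c x)) * pb2 T c d (t, x) u v)"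
    "linear (%v. f (\<Psi> (t, point c x)) * pb2 T c d (t, x) u v)"
proof -
  note c = at_endD[OF e]
  show "pullback (cyl_atlas AS) A 2 \<Psi> (mult_tensor f T) (cyl_chart c) (t, x) [u, v] =
      f (\<Psi> (t, point c x)) * pb2 T c d (t, x) u v"
    using E.pullback_mult[OF c(2,6), of 2 f T] E.pullback_eq[OF T c(2,3,5), of "[u, v]"]
    by (simp add: S.point_cyl_chart[OF c(1,4)])
qed (intro linear_cmult linear_compose[OF at_endD(9)[OF e] E.X.tensor2_linear(1)[OF T at_endD(3,7)[OF e]], unfolded o_def]
    linear_compose[OF at_endD(9)[OF e] E.X.tensor2_linear(2)[OF T at_endD(3,7)[OF e]], unfolded o_def])+

lemma pulled_tensor_bound:
  assumes "Ck_finite_on_end AS gS k 2 (pullback (cyl_atlas AS) A 2 \<Psi> (mult_tensor f T))"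
  shows "EX M>=0. EX T0. ALL c d t x u v. at_end c d t x & t >= T0 -->
    \<bar>f (\<Psi> (t, point c x)) * pb2 T c d (t, x) u v\<bar> <= M * N c (t, x) u * N c (t, x) v"
  by (rule pulled_bound[OF assms]) (rule pulled_tensor; assumption)+

lemma pulled_metric_bound:
  assumes b: "Ck_finite_on_end AS gS k 2 (mult_tensor h (diff_tensor (pullback (cyl_atlas AS) A 2 \<Psi> (mult_tensor f T)) (g_cyl AS gS)))"
  shows "EX M>=0. EX T0. ALL c d t x u v. at_end c d t x & t >= T0 -->
    \<bar>h (t, point c x) * (f (\<Psi> (t, point c x)) * pb2 T c d (t, x) u v - G c (t, x) u v)\<bar>
      <= M * N c (t, x) u * N c (t, x) v"
proof (rule pulled_bound[OF b])
  fix c d t x u v assume e: "at_end c d t x"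
  show "mult_tensor h (diff_tensor (pullback (cyl_atlas AS) A 2 \<Psi> (mult_tensor f T)) (g_cyl AS gS)) (cyl_chart c) (t, x) [u, v] =
      h (t, point c x) * (f (\<Psi> (t, point c x)) * pb2 T c d (t, x) u v - G c (t, x) u v)"
    using S.g_cyl_eq[OF tensor_gS at_endD(1,4)[OF e]] S.point_cyl_chart[OF at_endD(1,4)[OF e]]
    by (simp add: mult_tensor_def[of h] diff_tensor_def pulled_tensor(1)[OF e])
qed (intro linear_cmult linear_compose_sub pulled_tensor(2,3) posdefD(1,2)[OF posdef_G]; assumption)+

end

text \<open>Pulled back to the cylinder, \<open>\<eta>\<close> has an exponentially small
  differential, so \<open>end_primitive\<close> applies, and \<open>uniform_decay\<close> restates
  the result in the cylinder metric.\<close>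

theorem primitive_on_end:
  assumes \<eta>: "tensor_field A 1 \<eta>" and lam: "lam > 0" and M: "M >= 0"
    and H1: "deRham AS 1 = {deRham_class AS 1 zero_tensor}"
    and b: "decaying lam M T0 (ext_deriv A 1 \<eta>)"
  shows "EX f. EX C>=0. (ALL c:AS. Ck_on 1 ({T0<..} \<times> range_of c) (rep c f)) &
    (ALL c d t x w. at_end c d t x & t > T0 -->
      \<bar>pb1 \<eta> c d (t, x) w - dir (rep c f) (t, x) w\<bar> <= C * exp (- lam * t) * N c (t, x) w)"
proof -
  define \<theta> where "\<theta> c z w = pullback (cyl_atlas AS) A 1 \<Psi> \<eta> (cyl_chart c) z [w]" for c z w
  have \<theta>: "\<theta> c (t, x) w = pb1 \<eta> c d (t, x) w" if "at_end c d t x" for c d t x w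
    unfolding \<theta>_def using E.pullback_eq[OF \<eta> at_endD(2,3,5)[OF that], of "[w]"] by simp
  have lin: "linear (\<theta> c (t, x))" if c: "c : AS" and x: "x : range_of c" for c t x
    proof -
      obtain d where e: "at_end c d t x" using at_end_exists[OF c x] by blast
      show ?thesis using linear_compose[OF at_endD(9)[OF e] E.X.tensor1_linear[OF \<eta> at_endD(3,7)[OF e]]]
        by (simp add: \<theta>[OF e, abs_def] o_def)
    qed
  have C1: "Ck_on 1 (UNIV \<times> range_of c) (%z. \<theta> c z w)" if c: "c : AS" for c w
      unfolding \<theta>_def S.cyl_chart_simps(3)[symmetric] by (rule E.Ck_pullback_1[OF \<eta> cyl_chart_in[OF c]])
  have inv: "\<theta> c (t, x) w = \<theta> d (t, transition c d x) (fst w, dir (transition c d) x (snd w))"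
      if c: "c : AS" and d: "d : AS" and x: "x : overlap c d" for c d x t and w :: "real * 'e"
    proof -
      have xr: "x : range_of c" "transition c d x : range_of d"
        using x S.overlap_iff[OF c] S.transition_in[OF c d x] S.overlap_iff[OF d] by auto
      obtain a where e: "at_end c a t x" using at_end_exists[OF c xr(1)] by blast
      have ox: "(t, x) : overlap (cyl_chart c) (cyl_chart d)" using x by (simp add: S.cyl_overlap)
      note s = E.dir_fwd_source[OF at_endD(2)[OF e] cyl_chart_in[OF d] at_endD(3,5)[OF e] ox]
      have e': "at_end d a t (transition c d x)"
        using s(1) d xr at_endD(3)[OF e] by (simp add: at_end_def S.cyl_transition[OF c d x])
      show ?thesis unfolding \<theta>[OF e] \<theta>[OF e'] s(3)
        using s(2) by (simp add: S.cyl_transition[OF c d x] S.dir_cyl_transition[OF c d x])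
    qed
  have dec: "EX C. EX r>0. ALL x:ball x0 r. ALL t>T0. ALL u v. \<bar>ext1 (\<theta> c) (t, x) u v\<bar> <= C * exp (- lam * t) * norm u * norm v"
      if c: "c : AS" and x0: "x0 : range_of c" for c x0
    proof -
      obtain K r where K: "K > 0" "r > 0" "ball x0 r \<subseteq> range_of c"
        and K': "ALL x:ball x0 r. ALL t u. norm u <= K * N c (t, x) u & N c (t, x) u <= K * norm u"
        using S.cyl_metric_comparable[OF gS c x0] by (elim exE conjE) (rule that)
      have "\<bar>ext1 (\<theta> c) (t, x) u v\<bar> <= (M * K * K) * exp (- lam * t) * norm u * norm v"
        if x: "x : ball x0 r" and t: "t > T0" for x t u v
      proof -
        have xr: "x : range_of c" using x K(3) by blast
        obtain d where e: "at_end c d t x" using at_end_exists[OF c xr] by blast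
        have Nn: "0 <= N c (t, x) u" for u using posdefD(5)[OF posdef_G[OF e]] by simp
        have "\<bar>ext1 (\<theta> c) (t, x) u v\<bar> <= M * exp (- lam * t) * N c (t, x) u * N c (t, x) v"
          using decayingD[OF b e t] E.pullback_ext_deriv[OF \<eta> at_endD(2,3,5)[OF e], of u v] unfolding \<theta>_def by simp
        also have "... <= M * exp (- lam * t) * (K * norm u) * (K * norm v)"
          using K'[rule_format, OF x, of u t] K'[rule_format, OF x, of v t] M K(1) Nn
          by (intro mult_mono mult_nonneg_nonneg) simp_all
        finally show ?thesis by (simp add: mult_ac)
      qed
      then show ?thesis using K(2) by blast
    qed
  interpret ef: end_form AS \<theta> T0 lam
    by (rule end_form.intro[OF S.smooth_manifold_axioms end_form_axioms.intro]) (fact lam lin C1 inv dec compact_S)+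
  show ?thesis
  proof (rule ef.end_primitive[OF H1])
  fix f assume f: "!!c. c : AS ==> Ck_on 1 ({T0<..} \<times> range_of c) (rep c f)"
    "!!c x0. c : AS ==> x0 : range_of c ==> ef.decays x0 (%z w. \<theta> c z w - dir (rep c f) z w)"
  have "EX C>=0. ALL c:AS. ALL x:range_of c. ALL t>T0. ALL w. \<bar>\<theta> c (t, x) w - dir (rep c f) (t, x) w\<bar>
      <= C * exp (- lam * t) * sqrt (S.cyl_metric gS c (t, x) w w)"
  proof (rule ef.uniform_decay[OF gS f(2)])
    fix c d x t w assume c: "c : AS" "d : AS" "x : overlap c d" and t: "T0 < t"
    show "\<theta> c (t, x) w - dir (rep c f) (t, x) w =
      \<theta> d (t, transition c d x) (fst w, dir (transition c d) x (snd w)) -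
      dir (rep d f) (t, transition c d x) (fst w, dir (transition c d) x (snd w))"
      using ef.theta_inv[OF c] ef.rep_transition[OF c t f(1)[OF c(2)]] by simp
  qed
  then obtain C where C0: "C >= 0" and C': "ALL c:AS. ALL x:range_of c. ALL t>T0. ALL w.
      \<bar>\<theta> c (t, x) w - dir (rep c f) (t, x) w\<bar> <= C * exp (- lam * t) * N c (t, x) w"
    by (elim exE conjE) (rule that)
  note C = C0 C'[rule_format]
  have "\<bar>pb1 \<eta> c d (t, x) w - dir (rep c f) (t, x) w\<bar> <= C * exp (- lam * t) * N c (t, x) w"
    if e: "at_end c d t x" and t: "t > T0" for c d t x w
    using C(2)[OF at_endD(1,4)[OF e] t, of w] unfolding \<theta>[OF e] .
  then show ?thesis using f(1) C(1) by (intro exI[of _ f] exI[of _ C]) simp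
  qed
qed

end

section \<open>Decay of the volume ratio and of the flux\<close>

lemma det_gmat_near_identity:
  assumes "e > 0"
  shows "EX \<delta>>0. ALL (\<iota> :: 'm::finite => 'e::euclidean_space) h.
    (ALL i j. \<bar>h (\<iota> i) (\<iota> j) - (if i = j then 1 else 0)\<bar> < \<delta>) --> \<bar>det (gmat \<iota> h) - 1\<bar> < e"
proof -
  obtain \<delta> where \<delta>: "\<delta> > 0" "!!B :: real ^ 'm ^ 'm. (!!i j. \<bar>B $ i $ j - mat 1 $ i $ j\<bar> < \<delta>) ==> \<bar>det B - 1\<bar> < e"
    using det_near_identity[OF assms, where 'm = 'm] by metis
  have "\<bar>det (gmat \<iota> h) - 1\<bar> < e" if "ALL i j. \<bar>h (\<iota> i) (\<iota> j) - (if i = j then 1 else 0)\<bar> < \<delta>"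
    for \<iota> :: "'m => 'e" and h
    by (rule \<delta>(2)) (use that in \<open>simp add: gmat_def mat_def\<close>)
  then show ?thesis using \<delta>(1) by blast
qed

lemma posdef_pullback:
  assumes g: "posdef g" and l: "linear l" and inj: "!!u. l u = 0 ==> u = 0"
  shows "posdef (%u v. g (l u) (l v))"
  using linear_compose[OF l posdefD(1)[OF g]] posdefD(3,4)[OF g] inj unfolding posdef_def by (fastforce simp: o_def)

locale conical_pair = kaehler_pair A \<omega> \<omega>' \<iota> + cyl_embedding AS A \<Psi> \<Phi> W gS
  for A :: "('x::{t2_space,second_countable_topology}, complex ^ 'n) chart set"
    and \<omega> \<omega>' :: "('x, complex ^ 'n) tensor" and \<iota> :: "'m::{finite,wellorder} => complex ^ 'n"
    and AS :: "('s::{t2_space,second_countable_topology}, 'e::euclidean_space) chart set"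
    and \<Psi> :: "real * 's => 'x" and \<Phi> W gS +
  fixes lam M T1 :: real
  assumes lam: "lam > 0" and M: "M >= 0"
    and comparable: "\<alpha> : {\<omega>, \<omega>'} ==> cone_like (kmet \<alpha>) T1"
    and decay: "decaying lam M T1 (diff_tensor \<omega> \<omega>')"
    and ends: "compact (- \<Psi> ` ({T<..} \<times> UNIV))"
begin

section \<open>Linear algebra in the tangent space at one point of the end\<close>

context
  fixes c d t x assumes e: "at_end c d t x"
begin

abbreviation "Fx \<equiv> F c d (t, x)"

abbreviation "Lx \<equiv> L c d (t, x)"

abbreviation "hx \<alpha> \<equiv> kmet \<alpha> d Fx"

text \<open>The cylinder metric transported to the tangent space of the complex manifold, where
  \<open>mulI\<close> acts.\<close>

definition pmet :: "(complex ^ 'n) bilin" where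
  "pmet a b = G c (t, x) (dir (Bwd c d) Fx a) (dir (Bwd c d) Fx b)"

abbreviation "pnorm a \<equiv> sqrt (pmet a a)"

lemma pmet_L: "pmet (Lx u) (Lx v) = G c (t, x) u v"
  by (simp add: pmet_def L_inverse[OF e])

lemma posdef_pmet: "posdef pmet"
  unfolding pmet_def[abs_def]
proof (rule posdef_pullback[OF posdef_G[OF e] L_inverse(3)[OF e]])
  show "u = 0" if "dir (Bwd c d) Fx u = 0" for u
    using that L_inverse(2)[OF e, of u] linear_0[OF at_endD(9)[OF e]] by simp
qed

lemma pmet_nonneg: "0 <= pmet a a"
  by (rule posdefD(5)[OF posdef_pmet])

lemma posdef_kmet_end: "\<alpha> : {\<omega>, \<omega>'} ==> posdef (hx \<alpha>)"
  using posdef_kmet[OF _ at_endD(3,7)[OF e]] kaehler by auto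

lemma pmet_comparable:
  assumes "\<alpha> : {\<omega>, \<omega>'}" "t > T1"
  shows "exp (2 * t) / 2 * pmet a a <= hx \<alpha> a a"
    "hx \<alpha> a a <= 2 * exp (2 * t) * pmet a a"
proof -
  obtain v where v: "a = Lx v" using L_onto[OF e] by blast
  show "exp (2 * t) / 2 * pmet a a <= hx \<alpha> a a"
    "hx \<alpha> a a <= 2 * exp (2 * t) * pmet a a"
    using cone_likeD[OF comparable[OF assms(1)] e assms(2), of v] by (auto simp: v pmet_L)
qed

text \<open>\<open>mulI\<close> is an isometry of \<open>kmet \<omega>\<close>; passing from the
  cylinder metric to it and back costs a factor 4, which is 2 for norms.\<close>

lemma pmet_mulI:
  assumes t: "t > T1"
  shows "pnorm (mulI a) <= 2 * pnorm a"
proof -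
  have "exp (2 * t) / 2 * pmet (mulI a) (mulI a) <= hx \<omega> (mulI a) (mulI a)"
    by (rule pmet_comparable(1)) (use t in auto)
  also have "... = hx \<omega> a a" by (rule kmet_mulI[OF kaehler(1) at_endD(3,7)[OF e]])
  also have "... <= 2 * exp (2 * t) * pmet a a" by (rule pmet_comparable(2)) (use t in auto)
  finally have "exp (2 * t) * pmet (mulI a) (mulI a) <= exp (2 * t) * (4 * pmet a a)" by simp
  then have "pmet (mulI a) (mulI a) <= 4 * pmet a a" by (simp only: mult_le_cancel_left_pos exp_gt_zero)
  then have "pnorm (mulI a) <= sqrt (4 * pmet a a)" by (rule real_sqrt_le_mono)
  then show ?thesis by (simp add: real_sqrt_mult)
qed

lemma form_difference_bound:
  assumes t: "t > T1"
  shows "\<bar>\<omega> d Fx [a, b] - \<omega>' d Fx [a, b]\<bar>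
    <= M * exp (- lam * t) * pnorm a * pnorm b"
proof -
  obtain u v where "a = Lx u" "b = Lx v" using L_onto[OF e] by blast
  then show ?thesis using decayingD[OF decay e t, of u v] by (simp add: pmet_L diff_tensor_def)
qed

lemma kmet_difference_bound:
  assumes t: "t > T1"
  shows "\<bar>hx \<omega> a b - hx \<omega>' a b\<bar>
    <= 2 * M * exp (- lam * t) * pnorm a * pnorm b"
proof -
  have "\<bar>hx \<omega> a b - hx \<omega>' a b\<bar>
      <= M * exp (- lam * t) * pnorm a * pnorm (mulI b)"
    unfolding kmet_def by (rule form_difference_bound[OF t])
  also have "... <= M * exp (- lam * t) * pnorm a * (2 * pnorm b)"
    using M pmet_nonneg[of a] by (intro mult_left_mono pmet_mulI t) simp
  finally show ?thesis by (simp add: mult_ac)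
qed

text \<open>The case \<open>c = exp (2 * t) / 2\<close> of \<open>raise_bound\<close>: raising an
  index gains \<open>exp (- 2 * t)\<close>.\<close>

lemma raise_end_bound:
  assumes t: "t > T1" and \<alpha>: "\<alpha> : {\<omega>, \<omega>'}" and l: "linear l" "!!a. \<bar>l a\<bar> <= B * pnorm a" and B: "B >= 0"
  shows "sqrt (pmet (raise (hx \<alpha>) l) (raise (hx \<alpha>) l)) <= 2 * B * exp (- 2 * t)"
proof -
  have "sqrt (pmet (raise (hx \<alpha>) l) (raise (hx \<alpha>) l)) <= B / (exp (2 * t) / 2)"
    by (rule raise_bound[OF posdef_kmet_end[OF \<alpha>] posdef_pmet _ _ l B]) (use pmet_comparable(1)[OF \<alpha> t] in auto)
  then show ?thesis by (simp add: exp_minus field_simps)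
qed

text \<open>By \<open>raise_difference\<close> this is the difference of the metrics evaluated on
  two raised covectors. The exponent collects \<open>lam\<close> from the difference and 2 from each
  raising; 16 is the product of the constants 2, 4 and 2 of the three bounds.\<close>

lemma flux_bound:
  assumes t: "t > T1" and l: "linear l" "!!v. \<bar>l (Lx v)\<bar> <= B * N c (t, x) v" "B >= 0"
    and m: "linear m" "!!v. \<bar>m (Lx v)\<bar> <= B' * N c (t, x) v" "B' >= 0"
  shows "\<bar>l (raise (hx \<omega>) (%w. m (mulI w)) - raise (hx \<omega>') (%w. m (mulI w)))\<bar>
    <= 16 * M * B * B' * exp (- (lam + 4) * t)"
proof -
  have l': "\<bar>l a\<bar> <= B * pnorm a" for a
  proof -
    obtain v where "a = Lx v" using L_onto[OF e] by blast
    then show ?thesis using l(2)[of v] by (simp add: pmet_L)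
  qed
  have m': "\<bar>m (mulI a)\<bar> <= (2 * B') * pnorm a" for a
  proof -
    obtain v where v: "mulI a = Lx v" using L_onto[OF e] by blast
    have "\<bar>m (mulI a)\<bar> <= B' * pnorm (mulI a)" unfolding v pmet_L by (rule m(2))
    also have "... <= B' * (2 * pnorm a)" by (rule mult_left_mono[OF pmet_mulI[OF t] m(3)])
    finally show ?thesis by simp
  qed
  have lm: "linear (%w. m (mulI w))" using linear_compose[OF linear_mulI m(1)] by (simp add: o_def)
  define v w where "v = raise (hx \<omega>) (%w. m (mulI w))" and "w = raise (hx \<omega>') l"
  have v: "pnorm v <= 2 * (2 * B') * exp (- 2 * t)" unfolding v_def
    by (rule raise_end_bound[OF t _ lm m']) (use m(3) in auto)
  have w: "pnorm w <= 2 * B * exp (- 2 * t)" unfolding w_def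
    by (rule raise_end_bound[OF t _ l(1) l' l(3)]) auto
  have p: "posdef (hx \<omega>)" "posdef (hx \<omega>')" using posdef_kmet_end by auto
  have "\<bar>l (raise (hx \<omega>) (%w. m (mulI w)) - raise (hx \<omega>') (%w. m (mulI w)))\<bar> =
      \<bar>hx \<omega> v w - hx \<omega>' v w\<bar>"
    unfolding linear_diff[OF l(1)] raise_difference[OF p l(1) lm] by (simp add: v_def w_def abs_minus_commute)
  also have "... <= 2 * M * exp (- lam * t) * pnorm v * pnorm w" by (rule kmet_difference_bound[OF t])
  also have "... <= 2 * M * exp (- lam * t) * (2 * (2 * B') * exp (- 2 * t)) * (2 * B * exp (- 2 * t))"
    using v w M m(3) l(3) pmet_nonneg by (intro mult_mono mult_nonneg_nonneg) auto
  also have "... = 16 * M * B * B' * (exp (- lam * t) * exp (- 2 * t) * exp (- 2 * t))" by (simp add: mult_ac)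
  also have "exp (- lam * t) * exp (- 2 * t) * exp (- 2 * t) = exp (- (lam + 4) * t)"
    by (simp add: exp_add[symmetric] algebra_simps)
  finally show ?thesis .
qed

text \<open>Unit vectors of \<open>kmet \<omega>\<close> have squared cylinder length at most
  \<open>2 * exp (- 2 * t)\<close>, and the bound on the difference of the metrics gains this
  factor.\<close>

lemma kmet_end_near:
  assumes t: "t > T1" and f: "gframe (hx \<omega>) f" and ab: "a : Basis" "b : Basis"
  shows "\<bar>hx \<omega>' (f a) (f b) - (if a = b then 1 else 0)\<bar> <= 4 * M * exp (- lam * t) * exp (- 2 * t)"
proof -
  have n: "pmet (f a) (f a) <= 2 * exp (- 2 * t)" if "a : Basis" for a
  proof -
    have "exp (2 * t) / 2 * pmet (f a) (f a) <= 1"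
      using pmet_comparable(1)[of \<omega>, OF _ t, of "f a"] f that by (auto simp: gframe_def)
    then show ?thesis by (simp add: exp_minus field_simps)
  qed
  have n2: "pnorm (f a) * pnorm (f b) <= 2 * exp (- 2 * t)"
  proof -
    have "pnorm (f a) * pnorm (f b) <= sqrt (2 * exp (- 2 * t)) * sqrt (2 * exp (- 2 * t))"
      by (rule mult_mono) (use n[OF ab(1)] n[OF ab(2)] pmet_nonneg in \<open>auto intro: real_sqrt_le_mono\<close>)
    then show ?thesis by simp
  qed
  have "\<bar>hx \<omega> (f a) (f b) - hx \<omega>' (f a) (f b)\<bar>
      <= (2 * M * exp (- lam * t)) * (pnorm (f a) * pnorm (f b))"
    using kmet_difference_bound[OF t, of "f a" "f b"] by (simp only: mult.assoc)
  also have "... <= (2 * M * exp (- lam * t)) * (2 * exp (- 2 * t))"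
    by (rule mult_left_mono[OF n2]) (use M in simp)
  finally show ?thesis using f ab by (simp add: gframe_def abs_minus_commute mult_ac)
qed

end

text \<open>The ratio of the densities is the determinant of the Gram matrix of the second metric in
  an orthonormal frame of the first, and this matrix tends to the identity along the end.\<close>

lemma volratio_vanishes_at_infinity:
  assumes "\<epsilon> > 0"
  shows "EX C. compact C & (ALL p. p ~: C --> \<bar>volratio p\<bar> < \<epsilon>)"
proof -
  have "isCont ln (1::real)" by (rule isCont_ln) simp
  then obtain r where r: "r > 0" "!!y. \<bar>y - 1\<bar> < r ==> \<bar>ln y\<bar> < \<epsilon>"
    using assms unfolding continuous_at_eps_delta by (metis dist_real_def ln_one diff_zero)
  obtain \<delta> where \<delta>: "\<delta> > 0" and \<delta>': "ALL (f :: 'm => complex ^ 'n) h.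
      (ALL i j. \<bar>h (f i) (f j) - (if i = j then 1 else 0)\<bar> < \<delta>) --> \<bar>det (gmat f h) - 1\<bar> < r"
    using det_gmat_near_identity[OF r(1), where 'm = 'm and 'e = "complex ^ 'n"] by (elim exE conjE) (rule that)
  have "((%t. 4 * M * exp (- lam * t) * exp (- 2 * t)) \<longlongrightarrow> 4 * M * 0 * 0) at_top"
    using lam by (intro tendsto_intros exp_decay) simp_all
  then have "\<forall>\<^sub>F t in at_top. 4 * M * exp (- lam * t) * exp (- 2 * t) < \<delta>"
    using \<delta> by (intro order_tendstoD(2)) auto
  then obtain T where T: "!!t. t >= T ==> 4 * M * exp (- lam * t) * exp (- 2 * t) < \<delta>"
    unfolding eventually_at_top_linorder by blast
  define T' where "T' = max T T1"
  have "\<bar>volratio p\<bar> < \<epsilon>" if "p ~: - \<Psi> ` ({T'<..} \<times> UNIV)" for p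
  proof -
    have "EX z:{T'<..} \<times> UNIV. p = \<Psi> z" using that by (simp add: image_iff)
    then obtain t s where ts: "t > T'" "p = \<Psi> (t, s)" by auto
    obtain c d x where e: "at_end c d t x" and p: "p = point d (F c d (t, x))" using end_point_exists[of t s] ts(2) by metis
    define y where "y = F c d (t, x)"
    have y: "d : A" "y : range_of d" using at_endD[OF e] by (auto simp: y_def)
    note pd = posdef_kmet[OF kaehler(1) y] posdef_kmet[OF kaehler(2) y]
    obtain f where f: "gframe (kmet \<omega> d y) f" using gframe_exists[OF pd(1)] by blast
    have b: "\<iota> i : Basis" "\<iota> i = \<iota> j \<longleftrightarrow> i = j" for i j using \<iota> by (auto simp: bij_betw_def inj_def)
    have "\<bar>det (gmat (%i. f (\<iota> i)) (kmet \<omega>' d y)) - 1\<bar> < r"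
    proof (rule \<delta>'[rule_format])
      fix i j
      have "\<bar>kmet \<omega>' d y (f (\<iota> i)) (f (\<iota> j)) - (if \<iota> i = \<iota> j then 1 else 0)\<bar> <= 4 * M * exp (- lam * t) * exp (- 2 * t)"
        unfolding y_def by (rule kmet_end_near[OF e _ _ b(1) b(1)]) (use ts f in \<open>auto simp: T'_def y_def\<close>)
      also have "... < \<delta>" using T[of t] ts(1) by (simp add: T'_def)
      finally show "\<bar>kmet \<omega>' d y (f (\<iota> i)) (f (\<iota> j)) - (if i = j then 1 else 0)\<bar> < \<delta>"
        by (simp add: b(2))
    qed
    then have "\<bar>ln (det (gmat (%i. f (\<iota> i)) (kmet \<omega>' d y)))\<bar> < \<epsilon>" by (rule r(2))
    also have "det (gmat (%i. f (\<iota> i)) (kmet \<omega>' d y)) = det (gmat \<iota> (kmet \<omega>' d y)) / det (gmat \<iota> (kmet \<omega> d y))"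
      by (rule det_gmat_ratio[OF \<iota> pd(1) f pd(2), symmetric])
    also have "ln ... = lnratio d y"
      using det_gmat_pos[OF \<iota> pd(1)] det_gmat_pos[OF \<iota> pd(2)] by (simp add: lnratio_def lnvol_def ln_div)
    finally show ?thesis by (simp add: p y_def[symmetric] volratio_point[OF y])
  qed
  then show ?thesis using ends by blast
qed

end

lemma smooth_step_derivative:
  shows "EX B>=0. ALL r. \<bar>dir smooth_step r 1\<bar> <= B"
proof -
  have z: "dir smooth_step r 1 = 0" if "r < 1 | r > 2" for r
  proof (cases "r < 1")
    case True
    have "dir smooth_step r = dir (%r. 1) r"
      by (rule dir_cong[of "{..<1}"]) (use True smooth_step_1 in auto)
    then show ?thesis by (simp add: frechet_derivative_const)
  next
    case False
    have "dir smooth_step r = dir (%r. 0) r"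
      by (rule dir_cong[of "{2<..}"]) (use that False smooth_step_0 in auto)
    then show ?thesis by (simp add: frechet_derivative_const)
  qed
  have "Ck_on (Suc 0) UNIV smooth_step" by (rule Ck_on_smooth_step)
  from Ck_on_imp_continuous[OF Ck_on_dir[OF this]]
  have "continuous_on {1..2} (%r. dir smooth_step r 1)" by (rule continuous_on_subset) simp
  from compact_imp_bounded[OF compact_continuous_image[OF this compact_Icc]]
  obtain B where B: "ALL r:{1..2}. \<bar>dir smooth_step r 1\<bar> <= B" unfolding bounded_iff by auto
  have "\<bar>dir smooth_step r 1\<bar> <= \<bar>B\<bar>" for r
  proof (cases "r : {1..2}")
    case True
    then have "\<bar>dir smooth_step r 1\<bar> <= B" using B by blast
    then show ?thesis by simp
  qed (use z[of r] in auto)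
  then show ?thesis by (intro exI[of _ "\<bar>B\<bar>"]) simp
qed

section \<open>Cutoffs along the end and the corrected 1-form\<close>

locale conical_exact = exact_kaehler_pair A \<omega> \<omega>' \<iota> \<eta> + conical_pair A \<omega> \<omega>' \<iota> AS \<Psi> \<Phi> W gS lam M T1
  for A :: "('x::{t2_space,second_countable_topology}, complex ^ 'n) chart set"
    and \<omega> \<omega>' :: "('x, complex ^ 'n) tensor" and \<iota> :: "'m::{finite,wellorder} => complex ^ 'n"
    and \<eta> :: "('x, complex ^ 'n) tensor"
    and AS :: "('s::{t2_space,second_countable_topology}, 'e::euclidean_space) chart set"
    and \<Psi> :: "real * 's => 'x" and \<Phi> W gS and lam M T1 :: real +
  fixes par :: "'x => real" and T2 C :: real and f :: "real * 's => real"
  assumes par: "smooth_scalar A par" "!!t s. t > T2 ==> par (\<Psi> (t, s)) = t" and T2: "T1 <= T2"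
    and f_C1: "c : AS ==> Ck_on 1 ({T2<..} \<times> range_of c) (rep c f)"
    and C: "C >= 0"
    and f_decay: "at_end c d t x ==> t > T2 ==>
      \<bar>pb1 \<eta> c d (t, x) w - dir (rep c f) (t, x) w\<bar>
        <= C * exp (- lam * t) * N c (t, x) w"
begin

definition tail :: "'x set" where "tail = \<Psi> ` ({T2<..} \<times> UNIV)"

lemma tailE: assumes "p : tail" obtains t s where "p = \<Psi> (t, s)" "t > T2" "par p = t"
  using assms par(2) unfolding tail_def by auto

lemma cont_par: "continuous_on UNIV par"
  by (rule smooth_scalar_continuous[OF par(1)])

text \<open>The complement of \<open>tail\<close> is compact, so \<open>par\<close> is bounded
  there; values from \<open>T3\<close> on occur only in \<open>tail\<close>, where
  \<open>par\<close> is the cylinder parameter.\<close>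

definition T3 :: real where "T3 = (SOME T. T >= T2 & (ALL p. p ~: tail --> par p < T))"

lemma T3: "T3 >= T2" "p ~: tail ==> par p < T3"
proof -
  have "compact (- tail)" unfolding tail_def by (rule ends)
  from compact_imp_bounded[OF compact_continuous_image[OF continuous_on_subset[OF cont_par] this]]
  obtain B where B: "!!p. p ~: tail ==> \<bar>par p\<bar> <= B" unfolding bounded_iff by auto
  have "par p < max T2 (B + 1)" if "p ~: tail" for p
    using B[OF that] by (simp add: less_max_iff_disj abs_le_iff)
  then have "EX T>=T2. ALL p. p ~: tail --> par p < T" by (intro exI[of _ "max T2 (B + 1)"]) auto
  then have "T3 >= T2 & (ALL p. p ~: tail --> par p < T3)" unfolding T3_def by (rule someI_ex)
  then show "T3 >= T2" "p ~: tail ==> par p < T3" by auto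
qed

text \<open>The shift places the transition of the step between \<open>par = T\<close> and
  \<open>par = T + 1\<close>.\<close>

definition cut :: "real => 'x => real" where
  "cut T p = smooth_step (par p - T + 1)"

lemma smooth_cut: "smooth_scalar A (cut T)"
proof -
  have "smooth_scalar A (%p. par p - T + 1)"
    by (rule smooth_scalar_add[OF smooth_scalar_diff'[OF par(1) smooth_scalar_const] smooth_scalar_const])
  from smooth_scalar_compose[OF this Ck_on_smooth_step] show ?thesis unfolding cut_def[abs_def] .
qed

lemma cut_range: "0 <= cut T p" "cut T p <= 1"
  using smooth_step_range by (auto simp: cut_def)

lemma cut_1: "par p <= T ==> cut T p = 1"
  by (simp add: cut_def smooth_step_1)

lemma cut_0: "par p >= T + 1 ==> cut T p = 0"
  by (simp add: cut_def smooth_step_0)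

lemma cut_support:
  assumes "T >= T3" "p ~: - \<Psi> ` ({T + 1<..} \<times> UNIV)" shows "cut T p = 0"
proof -
  have "EX z:{T + 1<..} \<times> UNIV. p = \<Psi> z" using assms(2) by (simp add: image_iff)
  then obtain t s where "t > T + 1" "p = \<Psi> (t, s)" by auto
  then show ?thesis using par(2)[of t s] T3(1) assms(1) by (intro cut_0) auto
qed

lemma dsc_cut_0:
  assumes d: "d : A" "y : range_of d" and t: "par (point d y) < T | par (point d y) > T + 1"
  shows "dsc (cut T) d y v = 0"
proof -
  have cl: "closed {p. T <= par p}" "closed {p. par p <= T + 1}"
    by (intro closed_Collect_le continuous_intros cont_par)+
  show ?thesis
  proof (cases "par (point d y) < T")
    case True
    show ?thesis by (rule dsc_zero[OF cl(1) _ d, of _ 1]) (use True cut_1 in auto)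
  next
    case False
    show ?thesis by (rule dsc_zero[OF cl(2) _ d, of _ 0]) (use False t cut_0 in auto)
  qed
qed

definition B1 :: real where "B1 = (SOME B. B >= 0 & (ALL r. \<bar>dir smooth_step r 1\<bar> <= B))"

lemma B1: "B1 >= 0" "\<bar>dir smooth_step r 1\<bar> <= B1"
proof -
  have "B1 >= 0 & (ALL r. \<bar>dir smooth_step r 1\<bar> <= B1)" unfolding B1_def
    by (rule someI_ex[OF smooth_step_derivative])
  then show "B1 >= 0" "\<bar>dir smooth_step r 1\<bar> <= B1" by auto
qed

lemma fst_le_N: assumes "at_end c d t x" shows "\<bar>fst w\<bar> <= N c (t, x) w"
proof -
  have "(fst w)\<^sup>2 <= G c (t, x) w w"
    using posdefD(5)[OF S.posdef_riemannian[OF gS at_endD(1,4)[OF assms]], of "snd w"]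
    by (simp add: S.cyl_metric_def power2_eq_square)
  from real_sqrt_le_mono[OF this] show ?thesis by simp
qed

text \<open>The function has to agree with \<open>\<phi>\<close> only beyond \<open>T\<close>; the
  chain rule then computes its differential in cylinder coordinates.\<close>

lemma dsc_end:
  assumes e: "at_end c d t x" and t: "t > T" and h: "(h o point d) differentiable (at (F c d (t, x)))"
    and eq: "!!t s. t > T ==> h (\<Psi> (t, s)) = \<phi> (t, s)"
  shows "dsc h d (F c d (t, x)) (L c d (t, x) w) = dir (rep c \<phi>) (t, x) w"
proof -
  define V where "V = Loc c d Int {T<..} \<times> UNIV"
  have "dir (%z. (h o point d) (F c d z)) (t, x) = dir (rep c \<phi>) (t, x)"
  proof (rule dir_cong[of V])
    show "open V" unfolding V_def by (intro open_Int E.open_loc at_endD[OF e] open_Times) auto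
    show "(t, x) : V" using at_endD(5)[OF e] t by (simp add: V_def)
    fix z assume z: "z : V"
    then have "z : range_of (cyl_chart c)" using E.loc_iff[OF at_endD(2)[OF e]] by (auto simp: V_def)
    then have "at_end c d (fst z) (snd z)"
      using z at_endD(1,3)[OF e] by (auto simp: V_def at_end_def S.cyl_chart_simps)
    from at_endD(8)[OF this] show "(h o point d) (F c d z) = rep c \<phi> z"
      using z eq[of "fst z"] by (auto simp: V_def)
  qed
  then show ?thesis
    using dir_compose[of "F c d" "(t, x)" "h o point d", OF E.diff_fwd[OF at_endD(2,3,5)[OF e]] h]
    by (simp add: dsc_def)
qed

text \<open>The covector \<open>dt\<close> has norm at most 1 in the cylinder metric, and the slope
  of the step is bounded by \<open>B1\<close>.\<close>

lemma dsc_cut_bound: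
  assumes e: "at_end c d t x" and t: "t > T2"
  shows "\<bar>dsc (cut T) d (F c d (t, x)) (L c d (t, x) w)\<bar> <= B1 * N c (t, x) w"
proof -
  have dst: "smooth_step differentiable (at r)" for r
    using Ck_on_imp_differentiable[OF Ck_on_smooth_step[of 1]] by simp
  have "dsc (cut T) d (F c d (t, x)) (L c d (t, x) w) = dir (rep c (%p. smooth_step (fst p - T + 1))) (t, x) w"
    by (rule dsc_end[OF e t smooth_scalar_diff[OF smooth_cut at_endD(3,7)[OF e]],
      where \<phi> = "%p. smooth_step (fst p - T + 1)"]) (simp add: cut_def par(2))
  moreover have "((%z. smooth_step (fst z - T + 1)) has_derivative (%w. dir smooth_step (t - T + 1) (fst w))) (at (t, x))"
  proof -
    have "((%z::real * 'e. fst z - T + 1) has_derivative fst) (at (t, x))" by (auto intro!: derivative_eq_intros)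
    from diff_chain_at[OF this, of smooth_step, unfolded fst_conv, OF dir_works[OF dst]] show ?thesis by (simp add: o_def)
  qed
  moreover have "dir smooth_step (t - T + 1) (fst w) = fst w * dir smooth_step (t - T + 1) 1"
    using linear_scale[OF dir_linear[OF dst], of "t - T + 1" "fst w" 1] by simp
  ultimately have "dsc (cut T) d (F c d (t, x)) (L c d (t, x) w) = fst w * dir smooth_step (t - T + 1) 1"
    by (simp add: dir_eqI)
  then have "\<bar>dsc (cut T) d (F c d (t, x)) (L c d (t, x) w)\<bar> = \<bar>fst w\<bar> * \<bar>dir smooth_step (t - T + 1) 1\<bar>"
    by (simp add: abs_mult)
  also have "... <= N c (t, x) w * B1"
    using fst_le_N[OF e, of w] B1 posdefD(5)[OF posdef_G[OF e], of w] by (intro mult_mono) auto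
  finally show ?thesis by (simp add: mult.commute)
qed

text \<open>Near a point of \<open>tail\<close> the map \<open>\<Phi>\<close> is read in cylinder
  coordinates, where \<open>f\<close> is known to be C^1.\<close>

lemma f_local:
  assumes d: "d : A" "y : range_of d" and p: "point d y : tail"
  shows "EX V. open V & y : V & V \<subseteq> range_of d & Ck_on 1 V (%y. f (\<Phi> (point d y)))"
proof -
  obtain t s where ts: "point d y = \<Psi> (t, s)" "t > T2" using tailE[OF p] by blast
  obtain c where c: "c : AS" "s : dom_of c" using S.cover .
  note cc = cyl_chart_in[OF c(1)]
  define Y where "Y = E.bloc d (cyl_chart c)"
  note bd = E.bwd_domain[OF cc d(1), folded Y_def]
  define V where "V = Y Int Bwd c d -` ({T2<..} \<times> UNIV)"
  have oV: "open V" unfolding V_def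
    by (intro continuous_open_preimage Ck_on_imp_continuous[OF bd(4)[of 0]] bd(1) open_Times) auto
  have bw: "Bwd c d y = (fst (\<Phi> (point d y)), coord c (snd (\<Phi> (point d y))))" for y
    by (simp add: E.bwd_def S.cyl_chart_simps)
  have "\<Phi> (point d y) = (t, s)" by (simp add: ts(1))
  moreover have "y : Y" unfolding Y_def
  proof (rule image_eqI)
    show "y = coord d (point d y)" by (simp add: coord_point[OF d])
    show "point d y : dom_of d Int W Int \<Phi> -` dom_of (cyl_chart c)"
      using point_in[OF d] c(2) by (simp add: ts(1) S.cyl_chart_simps)
  qed
  ultimately have yV: "y : V" using ts(2) by (simp add: V_def bw)
  have V: "point d z : dom_of d & z : range_of d & snd (\<Phi> (point d z)) : dom_of c" if "z : Y" for z
    using that by (auto simp: Y_def point_coord[OF d(1)] coord_in S.cyl_chart_simps)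
  have "Ck_on 1 V (%y. f (fst (Bwd c d y), point c (snd (Bwd c d y))))"
  proof (rule Ck_on_compose[OF oV Ck_on_subset[OF bd(4)] f_C1[OF c(1)]])
    show "V \<subseteq> Y" by (auto simp: V_def)
    show "Bwd c d ` V \<subseteq> {T2<..} \<times> range_of c"
    proof (rule image_subsetI)
      fix z assume z: "z : V"
      then have "snd (\<Phi> (point d z)) : dom_of c" using V by (auto simp: V_def)
      then show "Bwd c d z : {T2<..} \<times> range_of c" using z S.coord_in[of "snd (\<Phi> (point d z))" c] by (auto simp: V_def bw)
    qed
  qed
  moreover have "f (\<Phi> (point d z)) = f (fst (Bwd c d z), point c (snd (Bwd c d z)))" if "z : V" for z
    using V[of z] that by (simp add: V_def bw S.point_coord[OF c(1)])
  ultimately have "Ck_on 1 V (%y. f (\<Phi> (point d y)))"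
    by (subst Ck_on_cong[OF oV, of _ "%y. f (fst (Bwd c d y), point c (snd (Bwd c d y)))"])
  moreover have "V \<subseteq> range_of d" using V by (auto simp: V_def)
  ultimately show ?thesis using oV yV by blast
qed

text \<open>Extends \<open>f\<close> to the whole manifold. The factor vanishes for
  \<open>par\<close> up to \<open>T3\<close>, which hides the values of \<open>\<Phi>\<close> off
  the end, and it is 1 from \<open>T3 + 1\<close> on.\<close>

definition hfun :: "'x => real" where
  "hfun p = (1 - cut T3 p) * f (\<Phi> p)"

lemma C1_hfun: "C1_scalar hfun"
  unfolding C1_scalar_def
proof (intro ballI Ck_on_local)
  fix d y assume d: "d : A" "y : range_of d"
  show "EX V. open V & y : V & Ck_on 1 V (hfun o point d)"
  proof (cases "point d y : tail")
    case True
    obtain V where V: "open V" "y : V" "V \<subseteq> range_of d" "Ck_on 1 V (%y. f (\<Phi> (point d y)))"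
      using f_local[OF d True] by blast
    have "Ck_on 1 V (%y. (1 - cut T3 (point d y)) * f (\<Phi> (point d y)))"
      by (intro Ck_on_mult Ck_on_diff Ck_on_const V Ck_on_subset[OF smooth_scalarD'[OF smooth_cut d(1)] V(3)])
    then show ?thesis using V unfolding hfun_def o_def by blast
  next
    case False
    define V where "V = coord d ` (dom_of d Int {p. par p < T3})"
    have oV: "open V" unfolding V_def by (intro open_coord_image d open_Collect_less continuous_intros cont_par)
    have yV: "y : V" using T3(2)[OF False] d by (simp add: V_def coord_image_eq)
    have "(hfun o point d) z = 0" if "z : V" for z
      using that cut_1[of "point d z" T3] by (auto simp: V_def coord_image_eq[OF d(1)] hfun_def)
    then have "Ck_on 1 V (hfun o point d)" by (subst Ck_on_cong[OF oV, of _ "%z. 0"]) (auto simp del: Ck_on.simps)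
    then show ?thesis using oV yV by blast
  qed
qed

lemma dsc_hfun:
  assumes e: "at_end c d t x" and t: "t > T3 + 1"
  shows "dsc hfun d (F c d (t, x)) (L c d (t, x) w) = dir (rep c f) (t, x) w"
  by (rule dsc_end[OF e t C1_scalar_diff[OF C1_hfun at_endD(3,7)[OF e]]])
    (use T3(1) in \<open>simp add: hfun_def cut_0 par(2)\<close>)

abbreviation \<beta> :: "('x, complex ^ 'n) chart => complex ^ 'n => complex ^ 'n => real" where
  "\<beta> \<equiv> %c x v. etac c x v - dsc hfun c x v"

lemma covec_beta: "covec \<beta>"
proof -
  have cv: "covec etac" "covec (dsc hfun)"
    using C1_covec_eta covec_dsc[OF C1_hfun] by (auto simp: C1_covec_def)
  show ?thesis unfolding covec_def
  proof (intro conjI ballI allI)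
    show "linear (\<beta> c x)" if "c : A" "x : range_of c" for c x
      using cv that unfolding covec_def by (intro linear_compose_sub) blast+
    show "\<beta> c x v = \<beta> d (transition c d x) (dir (transition c d) x v)"
      if "c : A" "d : A" "x : overlap c d" for c d x v
    proof -
      have "etac c x v = etac d (transition c d x) (dir (transition c d) x v)"
        "dsc hfun c x v = dsc hfun d (transition c d x) (dir (transition c d) x v)"
        using cv that unfolding covec_def by blast+
      then show ?thesis by simp
    qed
  qed
qed

text \<open>The differential of the cutoff lives in the slab over \<open>{T..T + 1}\<close>, where
  \<open>\<beta>\<close> is the decaying form because \<open>T > T3 + 1\<close>. The estimate is
  \<open>flux_bound\<close> with constants \<open>B1\<close> and
  \<open>C * exp (- lam * t)\<close>.\<close>

lemma PF_cut:
  assumes T: "T > T3 + 1"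
  shows "PF (cut T) \<beta> p ~= 0 ==> p : \<Psi> ` ({T..T + 1} \<times> UNIV)"
    "\<bar>PF (cut T) \<beta> p\<bar> <= 16 * M * B1 * C * exp (- (2 * lam + 4) * T)"
proof -
  note C1 = smooth_imp_C1[OF smooth_cut]
  obtain d0 where d0: "d0 : A" "p : dom_of d0" using cover .
  have 0: "PF (cut T) \<beta> p = 0" if "par p < T | par p > T + 1"
  proof -
    have "dsc (cut T) d0 (coord d0 p) v = 0" for v
      by (rule dsc_cut_0[OF d0(1) coord_in[OF d0(2)]]) (use that in \<open>simp add: point_coord[OF d0]\<close>)
    then show ?thesis unfolding PF_coord[OF C1 covec_beta d0] pairing_def .
  qed
  have tail: "p : \<Psi> ` ({T..T + 1} \<times> UNIV)" if "~ (par p < T | par p > T + 1)"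
  proof -
    have "p : tail" using T3(2)[of p] that T by auto
    then obtain t s where "p = \<Psi> (t, s)" "t > T2" "par p = t" by (rule tailE)
    then show ?thesis using that by auto
  qed
  then show "PF (cut T) \<beta> p ~= 0 ==> p : \<Psi> ` ({T..T + 1} \<times> UNIV)" using 0 by blast
  show "\<bar>PF (cut T) \<beta> p\<bar> <= 16 * M * B1 * C * exp (- (2 * lam + 4) * T)"
  proof (cases "par p < T | par p > T + 1")
    case True
    then show ?thesis using 0 M B1(1) C by simp
  next
    case False
    obtain t s where ts: "p = \<Psi> (t, s)" "T <= t" using tail[OF False] by auto
    obtain c d x where e: "at_end c d t x" and p: "p = point d (F c d (t, x))" using end_point_exists[of t s] ts(1) by metis
    have t: "t > T1" "t > T2" "t > T3 + 1" using ts(2) T T3(1) T2 by auto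
    note l1 = covec_dsc[OF C1, unfolded covec_def, THEN conjunct1, rule_format, OF at_endD(3,7)[OF e]]
    note l2 = covec_beta[unfolded covec_def, THEN conjunct1, rule_format, OF at_endD(3,7)[OF e]]
    have b: "\<bar>\<beta> d (F c d (t, x)) (L c d (t, x) w)\<bar> <= C * exp (- lam * t) * N c (t, x) w" for w
      using f_decay[OF e t(2), of w] by (simp add: etac_def dsc_hfun[OF e t(3)])
    have "\<bar>PF (cut T) \<beta> p\<bar> = \<bar>dsc (cut T) d (F c d (t, x)) (wfield \<beta> d (F c d (t, x)))\<bar>"
      unfolding p PF_point[OF C1 covec_beta at_endD(3,7)[OF e]] pairing_def by simp
    also have "... <= 16 * M * B1 * (C * exp (- lam * t)) * exp (- (lam + 4) * t)"
      unfolding wfield_def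
      by (rule flux_bound[OF e t(1) l1 dsc_cut_bound[OF e t(2)] B1(1) l2 b]) (use C in simp)
    also have "... = 16 * M * B1 * C * exp (- (2 * lam + 4) * t)"
      by (simp add: exp_add[symmetric] mult.assoc algebra_simps)
    also have "... <= 16 * M * B1 * C * exp (- (2 * lam + 4) * T)"
      using ts(2) lam M B1(1) C by (intro mult_left_mono) (auto simp: mult_left_mono)
    finally show ?thesis .
  qed
qed

end

section \<open>Volume of the end\<close>

text \<open>Positivity on \<open>a + b\<close> and on \<open>a - b\<close>.\<close>

lemma posdef_abs_le:
  assumes g: "posdef g" shows "\<bar>g a b\<bar> <= (g a a + g b b) / 2"
  using posdefD(5)[OF g, of "a + b"] posdefD(5)[OF g, of "a - b"] posdefD(3)[OF g, of a b]
  by (simp add: posdef_simps[OF g] abs_le_iff)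

lemma integral_bound_box:
  fixes g :: "real ^ 'm::finite => real"
  assumes z: "!!y. g y ~= 0 ==> (ALL i. \<bar>y $ i - a $ i\<bar> <= R)" and b: "!!y. \<bar>g y\<bar> <= B" and R: "R >= 0" and B: "B >= 0"
  shows "\<bar>integral UNIV g\<bar> <= B * (2 * R) ^ CARD('m)"
proof -
  define X where "X = cbox (\<chi> i. a $ i - R) (\<chi> i. a $ i + R)"
  have "y : X" if "ALL i. \<bar>y $ i - a $ i\<bar> <= R" for y
    unfolding X_def mem_box_cart
  proof (intro allI conjI)
    fix i
    have "\<bar>y $ i - a $ i\<bar> <= R" using that by blast
    then show "(\<chi> i. a $ i - R) $ i <= y $ i" "y $ i <= (\<chi> i. a $ i + R) $ i" by (simp_all add: abs_le_iff)
  qed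
  then have e: "integral X g = integral UNIV g" using z by (intro integral_eq_UNIV) blast
  have ct: "measure lborel X = (2 * R) ^ CARD('m)"
  proof -
    have "a : X" unfolding X_def mem_box_cart using R by simp
    then have "X ~= {}" by blast
    then show ?thesis unfolding X_def using content_cbox_cart[of "\<chi> i. a $ i - R" "\<chi> i. a $ i + R"] by simp
  qed
  have "norm (integral X g) <= B * measure lborel X"
  proof (cases "g integrable_on X")
    case True
    then show ?thesis unfolding X_def using b by (intro has_integral_bound[OF B integrable_integral]) auto
  next
    case False
    then show ?thesis using B by (simp add: not_integrable_integral)
  qed
  then show ?thesis by (simp add: e ct)
qed

context conical_exact
begin

text \<open>The functional \<open>J\<close> is left open because the bound is proved for integrals
  in single charts over \<open>D\<close> and then for \<open>I\<close> over the whole cross-section.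
  \<open>CARD('m)\<close> is the real dimension, so the exponential is the volume growth of a
  cone.\<close>

definition end_bound :: "(('x => real) => real) => 's set => real => bool" where
  "end_bound J D V \<longleftrightarrow> V >= 0 & (ALL T g b. csupp g UNIV --> T > T1 --> (ALL p. g p ~= 0 --> p : \<Psi> ` ({T..T + 1} \<times> D)) -->
    (ALL p. \<bar>g p\<bar> <= b) --> \<bar>J g\<bar> <= V * exp (real CARD('m) * T) * b)"

lemma end_boundD:
  assumes "end_bound J D V"
  shows "V >= 0" "csupp g UNIV ==> T > T1 ==> (!!p. g p ~= 0 ==> p : \<Psi> ` ({T..T + 1} \<times> D)) ==> (!!p. \<bar>g p\<bar> <= b) ==>
    \<bar>J g\<bar> <= V * exp (real CARD('m) * T) * b"
  using assms unfolding end_bound_def by blast+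

text \<open>The metric of \<open>\<omega>\<close> in cylinder coordinates; by \<open>hend_eq\<close>
  the chosen chart does not matter.\<close>

definition hend :: "('s, 'e) chart => real * 'e => (real * 'e) bilin" where
  "hend c z u v = (let d = SOME d. at_end c d (fst z) (snd z) in kmet \<omega> d (F c d z) (L c d z u) (L c d z v))"

lemma hend_eq:
  assumes e: "at_end c d t x"
  shows "hend c (t, x) u v = kmet \<omega> d (F c d (t, x)) (L c d (t, x) u) (L c d (t, x) v)"
proof -
  define d' where "d' = (SOME d. at_end c d t x)"
  have e': "at_end c d' t x" unfolding d'_def by (rule someI[of _ d]) (rule e)
  note tr = E.dir_fwd_target[OF at_endD(2,3)[OF e'] at_endD(3)[OF e] at_endD(5)[OF e'] at_endD(5)[OF e]]
  show ?thesis
    unfolding hend_def fst_conv snd_conv d'_def[symmetric] Let_def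
      kmet_transition[OF kaehler(1) at_endD(3)[OF e'] at_endD(3)[OF e] tr(1)] tr(2) tr(3) ..
qed

lemma posdef_hend:
  assumes c: "c : AS" "x : range_of c" shows "posdef (hend c (t, x))"
proof -
  obtain d where e: "at_end c d t x" using at_end_exists[OF c] by blast
  have p: "posdef (kmet \<omega> d (F c d (t, x)))" using posdef_kmet_end[OF e] by simp
  show ?thesis unfolding hend_eq[OF e, abs_def]
  proof (rule posdef_pullback[OF p at_endD(9)[OF e]])
    show "u = 0" if "L c d (t, x) u = 0" for u
      using that L_inverse(1)[OF e, of u] linear_0[OF L_inverse(3)[OF e]] by simp
  qed
qed

lemma continuous_hend:
  assumes c: "c : AS" shows "continuous_on (range_of (cyl_chart c)) (%z. hend c z u v)"
proof -
  have "Ck_on 0 (range_of (cyl_chart c)) (%z. hend c z u v)"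
  proof (rule Ck_on_local)
    fix z assume z: "z : range_of (cyl_chart c)"
    then obtain d where d: "d : A" "z : Loc c d" using E.loc_exists[OF cyl_chart_in[OF c]] by blast
    define V where "V = Loc c d"
    have oV: "open V" unfolding V_def by (rule E.open_loc[OF cyl_chart_in[OF c] d(1)])
    have ae: "at_end c d (fst z) (snd z)" if "z : V" for z
      using that c d(1) E.loc_iff[OF cyl_chart_in[OF c]] by (auto simp: at_end_def V_def S.cyl_chart_simps)
    have "Ck_on 0 V (%z. L c d z w \<bullet> a)" for w a
      unfolding V_def by (intro Ck_on_inner Ck_on_const Ck_on_dir E.Ck_fwd E.open_loc cyl_chart_in c d(1))
    moreover have "Ck_on 0 V (%z. kmet \<omega> d (F c d z) a b)" for a b
      unfolding V_def
      by (rule Ck_on_compose[OF E.open_loc[OF cyl_chart_in[OF c] d(1)] E.Ck_fwd[OF cyl_chart_in[OF c] d(1)] smooth_kmet[OF kaehler(1) d(1)]])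
        (use E.fwd_range[OF cyl_chart_in[OF c]] in blast)
    ultimately have "Ck_on 0 V (%z. SUM a:Basis. SUM b:Basis. (L c d z u \<bullet> a) * (L c d z v \<bullet> b) * kmet \<omega> d (F c d z) a b)"
      by (intro Ck_on_sum Ck_on_mult oV)
    moreover have "hend c z u v = (SUM a:Basis. SUM b:Basis. (L c d z u \<bullet> a) * (L c d z v \<bullet> b) * kmet \<omega> d (F c d z) a b)"
      if "z : V" for z
    proof -
      have "posdef (kmet \<omega> d (F c d z))" using posdef_kmet_end[OF ae[OF that]] by simp
      from posdef_basis_sum[OF this, of "L c d z u" "L c d z v"] show ?thesis using hend_eq[OF ae[OF that], of u v] by simp
    qed
    ultimately have "Ck_on 0 V (%z. hend c z u v)"
      by (subst Ck_on_cong[OF oV, of _ "%z. SUM a:Basis. SUM b:Basis. (L c d z u \<bullet> a) * (L c d z v \<bullet> b) * kmet \<omega> d (F c d z) a b"])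
    then show "EX V. open V & z : V & Ck_on 0 V (%z. hend c z u v)" using oV d(2) unfolding V_def by blast
  qed
  then show ?thesis by simp
qed

text \<open>Values on pairs are controlled by diagonal ones, for which comparison with the cone
  metric is available.\<close>

lemma hend_bound:
  assumes c: "c : AS" "x : range_of c" and t: "t > T1"
  shows "\<bar>hend c (t, x) u v\<bar> <= exp (2 * t) * ((N c (t, x) u)\<^sup>2 + (N c (t, x) v)\<^sup>2)"
proof -
  obtain d where e: "at_end c d t x" using at_end_exists[OF c] by blast
  have h: "hend c (t, x) w w <= 2 * exp (2 * t) * (N c (t, x) w)\<^sup>2" for w
    using cone_likeD[OF comparable e t, of \<omega> w] posdefD(5)[OF posdef_G[OF e], of w] by (simp add: hend_eq[OF e])
  show ?thesis using posdef_abs_le[OF posdef_hend[OF c], of t u v] h[of u] h[of v] by (simp add: algebra_simps)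
qed

context
  fixes \<iota>' :: "'m => real * 'e" assumes \<iota>': "bij_betw \<iota>' UNIV Basis"
begin

definition wr :: "('s, 'e) chart => ('x, 'm) wchart" where
  "wr c = metric_wchart \<iota>' (Push c) (%z. \<Psi> (point (cyl_chart c) z)) (hend c)"

lemma wvalid_wr: assumes c: "c : AS" shows "wvalid (wr c)"
  unfolding wr_def
proof (rule wvalid_metric_wchart[OF \<iota>'])
  note cc = cyl_chart_in[OF c]
  show "open (dom_of (Push c))"
    unfolding E.push_chart_simps by (intro E.open_image E.Y.chart cc)
  show "open (range_of (Push c))"
    unfolding E.push_chart_simps by (intro E.Y.chart cc)
  show "homeomorphism (dom_of (Push c)) (range_of (Push c))
      (coord (Push c)) (%z. \<Psi> (point (cyl_chart c) z))"
    unfolding E.push_chart_simps(3) by (rule E.push_chart_homeomorphism[OF cc])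
  show "posdef (hend c z)" if "z : range_of (Push c)" for z
    using posdef_hend[OF c, of "snd z" "fst z"] that by (auto simp: E.push_chart_simps S.cyl_chart_simps)
  show "continuous_on (range_of (Push c)) (%z. hend c z u v)" for u v
    unfolding E.push_chart_simps by (rule continuous_hend[OF c])
qed

text \<open>\<open>hend\<close> is the pullback of \<open>kmet \<omega>\<close>, so the densities
  match under the coordinate change \<open>Bwd\<close>.\<close>

lemma wcompat_wr: assumes d: "d : A" and c: "c : AS" shows "wcompat (wq d) (wr c)"
  unfolding wq_def wr_def
proof (rule wcompat_metric_wchart[OF \<iota> \<iota>', where T' = "%y. dir (Bwd c d) y"])
  show "wvalid (metric_wchart \<iota> d (point d) (kmet \<omega> d))" using wvalid_wq[OF d] by (simp add: wq_def)
  show "wvalid (metric_wchart \<iota>' (Push c) (%z. \<Psi> (point (cyl_chart c) z)) (hend c))"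
    using wvalid_wr[OF c] by (simp add: wr_def)
  note cc = cyl_chart_in[OF c]
  note bd = E.bwd_domain[OF cc d]
  have dm: "dom_of d Int dom_of (Push c) = dom_of d Int W Int \<Phi> -` dom_of (cyl_chart c)"
  proof -
    have "p : \<Psi> ` dom_of (cyl_chart c) \<longleftrightarrow> p : W & \<Phi> p : dom_of (cyl_chart c)" for p
    proof
      assume "p : W & \<Phi> p : dom_of (cyl_chart c)"
      then show "p : \<Psi> ` dom_of (cyl_chart c)" using imageI[of "\<Phi> p" "dom_of (cyl_chart c)" \<Psi>] by simp
    qed (auto)
    then show ?thesis unfolding E.push_chart_simps by blast
  qed
  fix y assume "y : coord d ` (dom_of d Int dom_of (Push c))"
  then have y: "y : E.bloc d (cyl_chart c)" unfolding dm .
  define z where "z = Bwd c d y"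
  have z: "z : Loc c d" "F c d z = y" using bd(3)[OF y] by (auto simp: z_def)
  have zr: "z : range_of (cyl_chart c)" using z(1) E.loc_iff[OF cc] by blast
  then have e: "at_end c d (fst z) (snd z)" using c d z(1) by (auto simp: at_end_def S.cyl_chart_simps)
  have cz: "coord (Push c) (point d y) = z" by (simp add: E.push_chart_simps z_def E.bwd_def)
  have "Bwd c d differentiable (at y)"
    using Ck_on_imp_differentiable[OF bd(4)[of 1] _ y] by simp
  then show "((%y. coord (Push c) (point d y)) has_derivative dir (Bwd c d) y) (at y)"
    unfolding E.push_chart_simps(2) E.bwd_def[abs_def] by (rule dir_works)
  show "kmet \<omega> d y u v = hend c (coord (Push c) (point d y))
      (dir (Bwd c d) y u) (dir (Bwd c d) y v)" for u v
    using hend_eq[OF e] L_inverse(2)[OF e] z(2) by (simp add: cz)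
  show "posdef (hend c (coord (Push c) (point d y)))"
    using posdef_hend[OF c, of "snd z" "fst z"] zr by (auto simp: cz S.cyl_chart_simps)
qed

text \<open>The Gram matrix has entries of order \<open>exp (2 * T)\<close>, so the density grows
  like \<open>exp (CARD('m) * T)\<close>, while the slab fits into a coordinate box whose size does
  not depend on \<open>T\<close>.\<close>

lemma wint_end_bound:
  assumes c: "c : AS" and D: "compact D" "D \<subseteq> dom_of c"
    and K: "!!s t u. s : D ==> N c (t, coord c s) u <= K * norm u"
  shows "EX V. end_bound (wint (wr c)) D V"
proof -
  have "compact (coord c ` D)"
    by (rule compact_continuous_image[OF continuous_on_subset[OF S.cont_coord[OF c] D(2)] D(1)])
  then obtain R0 where R0: "!!s. s : D ==> norm (coord c s) <= R0" "R0 > 0"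
    using compact_imp_bounded bounded_pos by (metis imageI)
  define m where "m = CARD('m)"
  \<comment> \<open>The factors are the constant of the density bound, the loss from evaluating at
    \<open>T + 1\<close>, and the volume of a box of half-width \<open>R0 + 1\<close>.\<close>
  define V where "V = sqrt (fact m * (2 * K\<^sup>2) ^ m) * exp (real m) * (2 * (R0 + 1)) ^ m"
  have V: "V >= 0" using R0(2) by (simp add: V_def)
  have "\<bar>wint (wr c) g\<bar> <= V * exp (real m * T) * b"
    if T: "T > T1" and g: "!!p. g p ~= 0 ==> p : \<Psi> ` ({T..T + 1} \<times> D)" and b: "!!p. \<bar>g p\<bar> <= b" for T g b
  proof -
    \<comment> \<open>Any point shows that \<open>b\<close> is nonnegative.\<close>
    have b0: "b >= 0" using b[of undefined] by simp
    define E0 where "E0 = b * (sqrt (fact m * (2 * K\<^sup>2) ^ m) * exp (real m * (T + 1)))"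
    have E0: "E0 >= 0" using b0 by (simp add: E0_def)
    \<comment> \<open>The box is centred at \<open>T\<close> in the \<open>t\<close>-direction and
      at 0 in the others; \<open>R0 + 1\<close> covers both the coordinates on \<open>D\<close> and
      the length of the slab.\<close>
    have main: "\<bar>wfun (wr c) g y\<bar> <= E0 & (ALL i. \<bar>y $ i - (\<chi> i. T * fst (\<iota>' i)) $ i\<bar> <= R0 + 1)" if nz: "wfun (wr c) g y ~= 0" for y
    proof -
      have yr: "y : wcoord (wr c) ` wdom (wr c)" and gn: "g (wpoint (wr c) y) ~= 0"
        using nz by (auto simp: wfun_def split: if_splits)
      have "wcoord (wr c) ` wdom (wr c) = unemb \<iota>' ` range_of (Push c)"
        unfolding wr_def metric_wchart_simps range_of_def ..
      then obtain z where z: "z : range_of (cyl_chart c)" "y = unemb \<iota>' z"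
        using yr by (auto simp: E.push_chart_simps)
      have ez: "emb \<iota>' y = z" by (simp add: z(2) emb_unemb[OF \<iota>'])
      have x: "snd z : range_of c" using z(1) by (auto simp: S.cyl_chart_simps)
      have wp: "wpoint (wr c) y = \<Psi> (fst z, point c (snd z))"
        using S.point_cyl_chart[OF c x, of "fst z"] by (simp add: wr_def metric_wchart_simps ez)
      obtain t s where ts: "\<Psi> (fst z, point c (snd z)) = \<Psi> (t, s)" "s : D" "T <= t" "t <= T + 1"
        using g[OF gn] wp by auto
      have "(fst z, point c (snd z)) = (t, s)" using arg_cong[OF ts(1), of \<Phi>] by simp
      then have zt: "fst z = t" "point c (snd z) = s" by auto
      then have sx: "coord c s = snd z" using S.coord_point[OF c x] by simp
      have zz: "z = (t, snd z)" using zt by (simp add: prod_eq_iff)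
      have \<iota>B: "\<iota>' i : Basis" for i using \<iota>' by (auto simp: bij_betw_def)
      have n1: "norm (\<iota>' i) = 1" for i using \<iota>B by (rule norm_Basis)
      have t1: "t > T1" using T ts(3) by simp
      have "\<bar>gmat \<iota>' (hend c z) $ i $ j\<bar> <= 2 * K\<^sup>2 * exp (2 * (T + 1))" for i j
      proof -
        have N2: "(N c (t, snd z) (\<iota>' i))\<^sup>2 <= K\<^sup>2" for i
          using K[OF ts(2), of t "\<iota>' i"] n1[of i] posdefD(5)[OF S.posdef_cyl_metric[OF gS c x, of t], of "\<iota>' i"]
          by (intro power_mono) (auto simp: sx)
        have "\<bar>hend c (t, snd z) (\<iota>' i) (\<iota>' j)\<bar> <= exp (2 * t) * ((N c (t, snd z) (\<iota>' i))\<^sup>2 + (N c (t, snd z) (\<iota>' j))\<^sup>2)"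
          by (rule hend_bound[OF c x t1])
        also have "... <= exp (2 * (T + 1)) * (K\<^sup>2 + K\<^sup>2)"
          using N2[of i] N2[of j] ts(4) by (intro mult_mono add_mono) auto
        finally show ?thesis using zz by (simp add: gmat_def mult_ac)
      qed
      then have "\<bar>det (gmat \<iota>' (hend c z))\<bar> <= fact m * (2 * K\<^sup>2 * exp (2 * (T + 1))) ^ m"
        unfolding m_def by (rule det_bound)
      also have "... = fact m * (2 * K\<^sup>2) ^ m * (exp (real m * (T + 1)))\<^sup>2"
        by (simp add: power_mult_distrib exp_of_nat_mult[symmetric] exp_double[symmetric] algebra_simps)
      finally have "sqrt (det (gmat \<iota>' (hend c z))) <= sqrt (fact m * (2 * K\<^sup>2) ^ m * (exp (real m * (T + 1)))\<^sup>2)"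
        by (intro real_sqrt_le_mono) simp
      then have d: "sqrt (det (gmat \<iota>' (hend c z))) <= sqrt (fact m * (2 * K\<^sup>2) ^ m) * exp (real m * (T + 1))"
        by (simp add: real_sqrt_mult)
      have pz: "posdef (hend c z)" using posdef_hend[OF c x, of t] zz by simp
      have "wfun (wr c) g y = g (wpoint (wr c) y) * sqrt (det (gmat \<iota>' (hend c z)))"
        using yr by (simp add: wfun_def) (simp add: wr_def metric_wchart_simps ez)
      then have "\<bar>wfun (wr c) g y\<bar> = \<bar>g (wpoint (wr c) y)\<bar> * sqrt (det (gmat \<iota>' (hend c z)))"
        using det_gmat_pos[OF \<iota>' pz] by (simp add: abs_mult)
      also have "... <= E0" unfolding E0_def
        using b d b0 det_gmat_pos[OF \<iota>' pz] by (intro mult_mono) auto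
      finally have 1: "\<bar>wfun (wr c) g y\<bar> <= E0" .
      have "\<bar>y $ i - T * fst (\<iota>' i)\<bar> <= R0 + 1" for i
      proof -
        have "y $ i = z \<bullet> \<iota>' i" by (simp add: z(2) unemb_def)
        also have "... = t * fst (\<iota>' i) + snd z \<bullet> snd (\<iota>' i)" using zt by (simp add: inner_prod_def)
        finally have "y $ i - T * fst (\<iota>' i) = (t - T) * fst (\<iota>' i) + snd z \<bullet> snd (\<iota>' i)" by (simp add: algebra_simps)
        moreover have "\<bar>(t - T) * fst (\<iota>' i)\<bar> <= 1 * 1"
          unfolding abs_mult using ts(3,4) norm_fst_le[of "fst (\<iota>' i)" "snd (\<iota>' i)"] n1[of i] by (intro mult_mono) auto
        moreover have "\<bar>snd z \<bullet> snd (\<iota>' i)\<bar> <= R0 * 1"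
          using Cauchy_Schwarz_ineq2[of "snd z" "snd (\<iota>' i)"] R0(1)[OF ts(2)] norm_snd_le[of "snd (\<iota>' i)" "fst (\<iota>' i)"] n1[of i] R0(2)
          by (intro order_trans[OF Cauchy_Schwarz_ineq2] mult_mono) (auto simp: sx)
        ultimately show ?thesis by linarith
      qed
      then show ?thesis using 1 by simp
    qed
    have "\<bar>wint (wr c) g\<bar> <= E0 * (2 * (R0 + 1)) ^ CARD('m)" unfolding wint_def
    proof (rule integral_bound_box)
      show "ALL i. \<bar>y $ i - (\<chi> i. T * fst (\<iota>' i)) $ i\<bar> <= R0 + 1" if "wfun (wr c) g y ~= 0" for y
        using main[OF that] by blast
      show "\<bar>wfun (wr c) g y\<bar> <= E0" for y using main[of y] E0 by (cases "wfun (wr c) g y = 0") auto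
    qed (use R0(2) E0 in auto)
    also have "... = V * exp (real m * T) * b"
    proof -
      have "exp (real m * (T + 1)) = exp (real m) * exp (real m * T)" by (simp add: exp_add[symmetric] algebra_simps)
      then show ?thesis unfolding E0_def V_def m_def[symmetric] by (simp only: mult_ac)
    qed
    finally show ?thesis .
  qed
  then show ?thesis using V unfolding m_def end_bound_def by (intro exI[of _ V]) simp
qed

end

end

text \<open>Each weight comes with a bound of the cylinder metric by the chart norm over its
  support; both are independent of \<open>t\<close>.\<close>

lemma (in cyl_embedding) end_partition:
  "EX n (\<rho> :: nat => 's => real) c D K. (ALL j<(n::nat). c j : AS & compact (D j) & D j \<subseteq> dom_of (c j) & continuous_on UNIV (\<rho> j) &
      (ALL s. 0 <= \<rho> j s & \<rho> j s <= 1) & (ALL s. s ~: D j --> \<rho> j s = 0) &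
      (ALL s:D j. ALL t u. N (c j) (t, coord (c j) s) u <= K j * norm u)) & (ALL s. (SUM j<n. \<rho> j s) = 1)"
proof -
  define P where "P b cDK \<longleftrightarrow> (case cDK of (c, D, K) => c : AS & compact D & D \<subseteq> dom_of c & continuous_on UNIV b &
      (ALL s. 0 <= b s & b s <= 1) & (ALL s. s ~: D --> b s = 0) & (ALL s:D. ALL t u. N c (t, coord c s) u <= K * norm u))"
    for b :: "'s => real" and cDK :: "('s, 'e) chart \<times> 's set \<times> real"
  have bump: "EX b a V. P b a & open V & s : V & (ALL x:V. b x = 1)" for s
  proof -
    obtain c where c: "c : AS" "s : dom_of c" using S.cover .
    define x0 where "x0 = coord c s"
    have x0: "x0 : range_of c" using c by (simp add: x0_def S.coord_in)
    obtain K r where K: "K > 0" "r > 0" "ball x0 r \<subseteq> range_of c"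
      and K': "ALL x:ball x0 r. ALL t u. norm u <= K * N c (t, x) u & N c (t, x) u <= K * norm u"
      using S.cyl_metric_comparable[OF gS c(1) x0] by (elim exE conjE) (rule that)
    define U where "U = point c ` ball x0 r"
    have U: "open U" "s : U"
    proof -
      show "open U" unfolding U_def by (rule S.open_point_image[OF c(1) open_ball K(3)])
      show "s : U" using imageI[of x0 "ball x0 r" "point c"] K(2) by (simp add: U_def x0_def S.point_coord[OF c])
    qed
    obtain b D V where b: "smooth_scalar AS b" "!!q. 0 <= b q & b q <= 1" "open V" "s : V" "!!q. q : V ==> b q = 1"
      "compact D" "D \<subseteq> dom_of c Int U" "!!q. q ~: D ==> b q = 0"
      using S.bump_function[OF c(2,1) U] by metis
    have "N c (t, coord c q) u <= K * norm u" if "q : D" for q t u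
    proof -
      have "q : point c ` ball x0 r" using that b(7) by (auto simp: U_def)
      then obtain y where y: "y : ball x0 r" "q = point c y" by auto
      then have "coord c q = y" using S.coord_point[OF c(1)] K(3) by auto
      then show ?thesis using K'[rule_format, OF y(1), of u t] by simp
    qed
    then have "P b (c, D, K)" unfolding P_def using c(1) b S.smooth_scalar_continuous[OF b(1)] by simp
    then show ?thesis using b(3-5) by blast
  qed
  obtain n b a V where ba: "!!j. j < n ==> P (b j) (a j)" and V: "UNIV \<subseteq> V"
    and s1: "!!p. p : V ==> (SUM j<(n::nat). unity_part b j p) = 1"
    using bump_cover[OF compact_S bump] by metis
  define c D K where "c j = fst (a j)" and "D j = fst (snd (a j))" and "K j = snd (snd (a j))" for j
  have B: "c j : AS" "compact (D j)" "D j \<subseteq> dom_of (c j)" "continuous_on UNIV (b j)" "!!s. 0 <= b j s & b j s <= 1"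
    "!!s. s ~: D j ==> b j s = 0" "ALL s:D j. ALL t u. N (c j) (t, coord (c j) s) u <= K j * norm u" if "j < n" for j
    using ba[OF that] unfolding P_def c_def D_def K_def split_beta by auto
  have "continuous_on UNIV (unity_part b j)" if "j < n" for j
    using that B(4) by (auto intro!: continuous_unity_part)
  moreover have "0 <= unity_part b j s & unity_part b j s <= 1" if "j < n" for j s
    using that B(5) by (intro unity_part_range) auto
  moreover have "s ~: D j ==> unity_part b j s = 0" if "j < n" for j s
    using B(6)[OF that] by (simp add: unity_part_def)
  ultimately show ?thesis using B(1-3,7) s1[OF subsetD[OF V UNIV_I]]
    by (intro exI[of _ n] exI[of _ "unity_part b"] exI[of _ c] exI[of _ D] exI[of _ K] conjI allI impI) auto
qed

context conical_exact
begin

text \<open>The partition is taken on the compact cross-section and pulled back along the end, so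
  the number of pieces and their constants do not depend on \<open>T\<close>.\<close>

lemma volume_bound:
  assumes \<iota>': "bij_betw (\<iota>' :: 'm => real * 'e) UNIV Basis"
  shows "EX V. end_bound I UNIV V"
proof -
  obtain n c D K and \<rho> :: "nat => 's => real" where P: "ALL j<(n::nat). c j : AS & compact (D j) & D j \<subseteq> dom_of (c j) & continuous_on UNIV (\<rho> j) &
      (ALL s. 0 <= \<rho> j s & \<rho> j s <= 1) & (ALL s. s ~: D j --> \<rho> j s = 0) &
      (ALL s:D j. ALL t u. N (c j) (t, coord (c j) s) u <= K j * norm u)" and s1: "ALL s. (SUM j<n. \<rho> j s) = 1"
    using end_partition by (elim exE conjE) (rule that)
  have c: "c j : AS" "compact (D j)" "D j \<subseteq> dom_of (c j)" "continuous_on UNIV (\<rho> j)" "0 <= \<rho> j s" "\<rho> j s <= 1"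
    "s ~: D j ==> \<rho> j s = 0" "s : D j ==> N (c j) (t, coord (c j) s) u <= K j * norm u" if "j < n" for j s t u
    using P[rule_format, OF that] by blast+
  have "EX V. ALL j<n. end_bound (wint (wr \<iota>' (c j))) (D j) (V j)"
    by (rule choice_below, rule wint_end_bound[OF \<iota>' c(1,2,3,8)])
  then obtain V where V: "!!j. j < n ==> end_bound (wint (wr \<iota>' (c j))) (D j) (V j)" by blast
  have "\<bar>I g\<bar> <= (SUM j<n. V j) * exp (real CARD('m) * T) * b"
    if T: "T > T1" and g: "csupp g UNIV" and sp: "!!p. g p ~= 0 ==> p : \<Psi> ` ({T..T + 1} \<times> UNIV)"
      and b: "!!p. \<bar>g p\<bar> <= b" for T g b
  proof -
    \<comment> \<open>This need not be continuous on the whole manifold; its product with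
      \<open>g\<close>, supported in the slab, is.\<close>
    define \<sigma> where "\<sigma> j p = (if p : W then \<rho> j (snd (\<Phi> p)) else 0)" for j p
    have \<sigma>\<Psi>: "\<sigma> j (\<Psi> (t, s)) = \<rho> j s" for j t s by (simp add: \<sigma>_def)
    have \<sigma>b: "\<bar>\<sigma> j p\<bar> <= 1" if "j < n" for j p using c(5,6)[OF that] by (simp add: \<sigma>_def)
    have sp': "p : \<Psi> ` ({T..T + 1} \<times> D j)" if j: "j < n" and nz: "\<sigma> j p * g p ~= 0" for j p
    proof -
      obtain t s where ts: "p = \<Psi> (t, s)" "t : {T..T + 1}" using sp[of p] nz by auto
      have "\<rho> j s ~= 0" using nz by (simp add: ts(1) \<sigma>\<Psi>)
      then show ?thesis using c(7)[OF j] ts by blast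
    qed
    have cs: "csupp (%p. \<sigma> j p * g p) (wdom (wr \<iota>' (c j)))" if j: "j < n" for j
    proof -
      define Z where "Z = \<Psi> ` ({T..T + 1} \<times> D j)"
      have Z: "compact Z" unfolding Z_def
        by (intro compact_continuous_image continuous_on_subset[OF E.cont_fwd] compact_Times compact_Icc c j) auto
      have z0: "\<sigma> j p * g p = 0" if "p ~: Z" for p
        using sp'[OF j, of p] that by (auto simp: Z_def)
      have "continuous_on UNIV (%p. \<sigma> j p * g p)"
      proof (rule continuous_on_zero_extension[OF E.open_W compact_imp_closed[OF Z] _ _ z0])
        show "Z \<subseteq> W" by (auto simp: Z_def)
        have "continuous_on W (%p. \<rho> j (snd (\<Phi> p)) * g p)" using g
          by (intro continuous_intros E.cont_bwd continuous_on_compose2[OF c(4)[OF j], of W "%p. snd (\<Phi> p)"])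
            (auto simp: csupp_def intro: continuous_on_subset)
        then show "continuous_on W (%p. \<sigma> j p * g p)" by (rule continuous_on_eq) (simp add: \<sigma>_def)
      qed
      moreover have "Z \<subseteq> wdom (wr \<iota>' (c j))"
        unfolding Z_def wr_def[OF \<iota>'] metric_wchart_simps E.push_chart_simps S.cyl_chart_simps using c(3)[OF j] by auto
      ultimately show ?thesis unfolding csupp_def using Z z0 by blast
    qed
    have sum1: "(SUM j<n. \<sigma> j p) = 1" if nz: "g p ~= 0" for p
      using sp[OF nz] s1 by (auto simp: \<sigma>\<Psi>)
    have "I g = (SUM j<n. wint (wr \<iota>' (c j)) (%p. \<sigma> j p * g p))"
    proof (rule I_eq_sum[OF g _ _ cs sum1])
      show "wvalid (wr \<iota>' (c j))" if "j < n" for j by (rule wvalid_wr[OF \<iota>' c(1)[OF that]])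
      show "wcompat a (wr \<iota>' (c j))" if j: "j < n" and a: "a : wq ` A" for a j
      proof -
        obtain d where "d : A" "a = wq d" using a by (rule imageE)
        then show ?thesis using wcompat_wr[OF \<iota>' _ c(1)[OF j]] by simp
      qed
    qed
    then have "\<bar>I g\<bar> <= (SUM j<n. \<bar>wint (wr \<iota>' (c j)) (%p. \<sigma> j p * g p)\<bar>)" by (simp add: sum_abs)
    also have "... <= (SUM j<n. V j * exp (real CARD('m) * T) * b)"
    proof (rule sum_mono)
      fix j assume "j : {..<n}"
      then have j: "j < n" by simp
      show "\<bar>wint (wr \<iota>' (c j)) (%p. \<sigma> j p * g p)\<bar> <= V j * exp (real CARD('m) * T) * b"
      proof (rule end_boundD(2)[OF V[OF j] csupp_subset[OF cs[OF j]] T sp'[OF j]])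
        show "\<bar>\<sigma> j p * g p\<bar> <= b" for p
          using mult_mono[OF \<sigma>b[OF j] b, of p p] by (simp add: abs_mult)
      qed simp
    qed
    finally show ?thesis by (simp add: sum_distrib_right)
  qed
  moreover have "0 <= (SUM j<n. V j)" using end_boundD(1)[OF V] by (intro sum_nonneg) auto
  ultimately show ?thesis unfolding end_bound_def by (intro exI[of _ "SUM j<n. V j"]) auto
qed

text \<open>If \<open>Q\<close> were positive somewhere, its integrals against the cutoffs would
  stay above a fixed positive number. The flux bounds them by a multiple of
  \<open>exp ((CARD('m) - 2 * lam - 4) * T)\<close>, which tends to 0.\<close>

theorem Q_eq_zero:
  assumes \<iota>': "bij_betw (\<iota>' :: 'm => real * 'e) UNIV Basis" and big: "2 * lam + 4 > real CARD('m)"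
  shows "Q p0 = 0"
proof (rule ccontr)
  assume "Q p0 ~= 0"
  then have Q0: "Q p0 > 0" using Q_nonneg[of p0] by simp
  obtain c where c: "c : A" "p0 : dom_of c" using cover .
  obtain b Z U where b: "smooth_scalar A b" "!!q. 0 <= b q & b q <= 1" "open U" "p0 : U" "!!q. q : U ==> b q = 1"
    "compact Z" "Z \<subseteq> dom_of c Int UNIV" "!!q. q ~: Z ==> b q = 0"
    using bump_function[OF c(2,1) open_UNIV UNIV_I] by metis
  define g where "g p = b p * Q p" for p
  have gs: "csupp g (dom_of c)" unfolding g_def
    by (rule csupp_mult) (use b smooth_scalar_continuous[OF b(1)] continuous_Q in \<open>auto simp: csupp_def\<close>)
  have "wint (wq c) g > 0"
    by (rule wint_pos[OF wvalid_wq[OF c(1)], of _ p0]) (use gs b Q_nonneg Q0 in \<open>auto simp: g_def wdom_wq\<close>)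
  moreover have "I g = wint (wq c) g" by (rule I_eq_wint) (use gs c in \<open>auto simp: wdom_wq\<close>)
  ultimately have Ig: "I g > 0" by simp
  obtain T4 where T4: "!!p. p : Z ==> par p <= T4"
  proof -
    from compact_imp_bounded[OF compact_continuous_image[OF continuous_on_subset[OF cont_par] b(6)]]
    obtain B where "ALL p:Z. \<bar>par p\<bar> <= B" unfolding bounded_iff by auto
    then show thesis using that[of B] by (auto simp: abs_le_iff)
  qed
  obtain V where V: "end_bound I UNIV V" using volume_bound[OF \<iota>'] by blast
  define H where "H = V * (16 * M * B1 * C)"
  have le: "I g <= H * exp ((real CARD('m) - (2 * lam + 4)) * T)" if T: "T > T3 + 1" "T >= T4" for T
  proof -
    have T1': "T > T1" using T(1) T2 T3(1) by simp
    have cT: "compact (- \<Psi> ` ({T + 1<..} \<times> UNIV))" by (rule ends)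
    have c0: "cut T p = 0" if "p ~: - \<Psi> ` ({T + 1<..} \<times> UNIV)" for p
      by (rule cut_support[OF _ that]) (use T in simp)
    note fl = flux_identity[OF smooth_cut cT c0 C1_hfun]
    have "csupp (cut T) UNIV" unfolding csupp_def
      using smooth_scalar_continuous[OF smooth_cut] cT c0 by blast
    then have cs: "csupp (%p. cut T p * Q p) UNIV" by (rule csupp_mult) (rule continuous_Q)
    have "I g <= I (%p. cut T p * Q p)"
    proof (rule I_mono[OF csupp_subset[OF gs] cs])
      fix p
      have "b p <= cut T p"
      proof (cases "p : Z")
        case True
        then have "cut T p = 1" using T4[OF True] T(2) by (intro cut_1) simp
        then show ?thesis using b(2)[of p] by simp
      next
        case False
        then show ?thesis using b(8)[OF False] cut_range by simp
      qed
      then show "g p <= cut T p * Q p" unfolding g_def by (rule mult_right_mono[OF _ Q_nonneg])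
    qed simp
    also have "... = I (PF (cut T) \<beta>)" by (rule fl(1))
    also have "... <= \<bar>I (PF (cut T) \<beta>)\<bar>" by simp
    also have "... <= V * exp (real CARD('m) * T) * (16 * M * B1 * C * exp (- (2 * lam + 4) * T))"
      by (rule end_boundD(2)[OF V fl(2) T1' PF_cut[OF T(1)]])
    also have "... = H * exp ((real CARD('m) - (2 * lam + 4)) * T)"
    proof -
      have "exp (real CARD('m) * T) * exp (- (2 * lam + 4) * T) = exp ((real CARD('m) - (2 * lam + 4)) * T)"
        by (simp add: exp_add[symmetric] algebra_simps)
      then show ?thesis unfolding H_def by (metis mult.assoc mult.left_commute)
    qed
    finally show ?thesis .
  qed
  have "((%T. H * exp ((real CARD('m) - (2 * lam + 4)) * T)) \<longlongrightarrow> H * 0) at_top"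
    using big by (intro tendsto_intros filterlim_compose[OF exp_at_bot]
        filterlim_tendsto_neg_mult_at_bot[OF tendsto_const] filterlim_ident) simp_all
  then have "\<forall>\<^sub>F T in at_top. H * exp ((real CARD('m) - (2 * lam + 4)) * T) < I g"
    using Ig by (intro order_tendstoD(2)) auto
  then obtain T5 where T5: "!!T. T >= T5 ==> H * exp ((real CARD('m) - (2 * lam + 4)) * T) < I g"
    unfolding eventually_at_top_linorder by blast
  \<comment> \<open>The summand 2 yields the strict inequality \<open>T > T3 + 1\<close>.\<close>
  define T where "T = max T5 (max T4 (T3 + 2))"
  have "H * exp ((real CARD('m) - (2 * lam + 4)) * T) < I g" by (rule T5) (simp add: T_def)
  moreover have "I g <= H * exp ((real CARD('m) - (2 * lam + 4)) * T)" by (rule le) (auto simp: T_def)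
  ultimately show False by simp
qed

end

section \<open>From the hypotheses to the estimates on the end\<close>

lemma tensor_field_zero:
  "tensor_field A k T ==> ~ (c : A & x : range_of c & length vs = k) ==> T c x vs = 0"
  unfolding tensor_field_def by (drule conjunct1) (elim allE impE)

lemma tensor_field_linear:
  "tensor_field A k T ==> c : A ==> x : range_of c ==> length vs = k ==> i < k ==> linear (%v. T c x (vs[i := v]))"
  unfolding tensor_field_def by (drule conjunct2, drule conjunct1) simp

lemma (in smooth_manifold) tensor_field_diff:
  assumes T: "tensor_field A k T" "tensor_field A k T'" shows "tensor_field A k (diff_tensor T T')"
  unfolding tensor_field_def
proof (intro conjI allI impI ballI)
  show "diff_tensor T T' c x vs = 0" if "~ (c : A & x : range_of c & length vs = k)" for c x vs
    by (simp add: diff_tensor_def tensor_field_zero[OF T(1) that] tensor_field_zero[OF T(2) that])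
  show "linear (%v. diff_tensor T T' c x (vs[i := v]))" if "c : A" "x : range_of c" "length vs = k" "i < k" for c x vs i
    unfolding diff_tensor_def
    by (intro linear_compose_sub tensor_field_linear[OF T(1) that] tensor_field_linear[OF T(2) that])
  show "smooth_fun_on (range_of c) (%x. diff_tensor T T' c x vs)" if "c : A" "length vs = k" for c vs
    unfolding smooth_fun_on_def diff_tensor_def
    by (intro allI Ck_on_diff chart(2) tensor_smooth[OF T(1)] tensor_smooth[OF T(2)] that)
  show "diff_tensor T T' c x vs = diff_tensor T T' d (transition c d x) (map (dir (transition c d) x) vs)"
    if "c : A" "d : A" "x : overlap c d" "length vs = k" for c d x vs
    using tensor_transition[OF T(1) that] tensor_transition[OF T(2) that] by (simp add: diff_tensor_def)
qed

lemma basis_bij: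
  assumes "CARD('m::finite) = DIM('e::euclidean_space)"
  obtains \<iota> :: "'m::finite => 'e::euclidean_space" where "bij_betw \<iota> UNIV Basis"
  using finite_same_card_bij[of "UNIV :: 'm set" "Basis :: 'e set"] assms by auto

text \<open>Relative to the cylinder metric the rescaled metric has an error of at most
  \<open>M * exp (- \<delta> * t)\<close>, which is below 1/2 far out. The ratio then lies between
  1/2 and 3/2, and the latter is weakened to 2.\<close>

lemma (in cyl_embedding) conical_comparable:
  assumes g: "tensor_field A 2 g" and par: "!!t s. t > T0 ==> par (\<Psi> (t, s)) = t"
    and cyl: "cylindrical_metric A AS gS \<Psi> (mult_tensor (%p. exp (- 2 * par p)) g)"
  shows "EX T. cone_like (%d y u v. g d y [u, v]) T"
proof -
  obtain \<delta> k where \<delta>: "\<delta> > 0" and Ck: "Ck_finite_on_end AS gS k 2 (mult_tensor (%p. exp (\<delta> * fst p))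
      (diff_tensor (pullback (cyl_atlas AS) A 2 \<Psi> (mult_tensor (%p. exp (- 2 * par p)) g)) (g_cyl AS gS)))"
    using cyl unfolding cylindrical_metric_def by blast
  obtain M T1 where M: "M >= 0" and b: "ALL c d t x u v. at_end c d t x & t >= T1 -->
    \<bar>exp (\<delta> * fst (t, point c x)) * (exp (- 2 * par (\<Psi> (t, point c x))) * pb2 g c d (t, x) u v - G c (t, x) u v)\<bar>
      <= M * N c (t, x) u * N c (t, x) v"
    using pulled_metric_bound[OF g Ck] by (elim exE conjE) (rule that)
  have "((%t. M * exp (- \<delta> * t)) \<longlongrightarrow> M * 0) at_top"
    by (intro tendsto_intros exp_decay[OF \<delta>])
  then have "\<forall>\<^sub>F t in at_top. M * exp (- \<delta> * t) < 1 / 2" by (intro order_tendstoD(2)) auto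
  then obtain T2 where T2: "!!t. t >= T2 ==> M * exp (- \<delta> * t) < 1 / 2" unfolding eventually_at_top_linorder by blast
  define T where "T = max T0 (max T1 T2)"
  have "exp (2 * t) / 2 * G c (t, x) v v <= pb2 g c d (t, x) v v &
      pb2 g c d (t, x) v v <= 2 * exp (2 * t) * G c (t, x) v v"
    if e: "at_end c d t x" and t: "t > T" for c d t x v
  proof -
    define a where "a = pb2 g c d (t, x) v v"
    define G0 where "G0 = G c (t, x) v v"
    have G0: "G0 >= 0" unfolding G0_def by (rule posdefD(5)[OF posdef_G[OF e]])
    have "exp (\<delta> * t) * \<bar>exp (- 2 * t) * a - G0\<bar> <= M * G0"
      using b[rule_format, of c d t x v v] e t par[of t "point c x"] G0 real_sqrt_mult_self[of "G c (t, x) v v"]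
      by (simp add: T_def a_def G0_def abs_mult mult.assoc)
    then have "exp (- \<delta> * t) * (exp (\<delta> * t) * \<bar>exp (- 2 * t) * a - G0\<bar>) <= exp (- \<delta> * t) * (M * G0)"
      by (rule mult_left_mono) simp
    then have "\<bar>exp (- 2 * t) * a - G0\<bar> <= (M * exp (- \<delta> * t)) * G0" by (simp add: exp_minus field_simps)
    also have "... <= (1 / 2) * G0" using T2[of t] t G0 by (intro mult_right_mono) (auto simp: T_def)
    finally have "\<bar>exp (- 2 * t) * a - G0\<bar> <= (1 / 2) * G0" .
    then have "exp (- 2 * t) * a - G0 <= G0 / 2" "- (exp (- 2 * t) * a - G0) <= G0 / 2" unfolding abs_le_iff by linarith+
    then have "G0 / 2 <= exp (- 2 * t) * a" "exp (- 2 * t) * a <= 2 * G0" using G0 by linarith+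
    then have "exp (2 * t) * (G0 / 2) <= exp (2 * t) * (exp (- 2 * t) * a)" "exp (2 * t) * (exp (- 2 * t) * a) <= exp (2 * t) * (2 * G0)"
      by simp_all
    then show ?thesis by (simp add: a_def[symmetric] G0_def[symmetric] exp_minus field_simps)
  qed
  then show ?thesis unfolding cone_like_def by blast
qed

text \<open>Far out the extended parameter is \<open>t\<close> itself, so the exponential weight can
  be divided out.\<close>

lemma (in cyl_embedding) decaying_exists:
  assumes T: "tensor_field A 2 T" and par: "!!t s. t > T0 ==> par (\<Psi> (t, s)) = t"
    and "Ck_finite_on_end AS gS k 2 (pullback (cyl_atlas AS) A 2 \<Psi> (mult_tensor (%p. exp (lam * par p)) T))"
  obtains M T1 where "M >= 0" "decaying lam M T1 T"
proof -
  obtain M T1 where M: "M >= 0" and b: "ALL c d t x u v. at_end c d t x & t >= T1 -->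
    \<bar>exp (lam * par (\<Psi> (t, point c x))) * pb2 T c d (t, x) u v\<bar> <= M * N c (t, x) u * N c (t, x) v"
    using pulled_tensor_bound[OF T assms(3)] by (elim exE conjE) (rule that)
  have "\<bar>pb2 T c d (t, x) u v\<bar> <= M * exp (- lam * t) * N c (t, x) u * N c (t, x) v"
    if "at_end c d t x" "t > max T0 T1" for c d t x u v
  proof -
    have "exp (lam * t) * \<bar>pb2 T c d (t, x) u v\<bar> <= M * N c (t, x) u * N c (t, x) v"
      using b[rule_format, of c d t x u v] that par[of t "point c x"] by (simp add: abs_mult)
    then show ?thesis by (simp add: exp_minus field_simps)
  qed
  then show thesis using that[OF M, of "max T0 T1"] unfolding decaying_def by blast
qed

theorem theorem1p8:
  fixes AX :: "('x::{t2_space,second_countable_topology}, complex ^ 'n) chart set"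
    and AS :: "('s::{t2_space,second_countable_topology}, 'e::euclidean_space) chart set"
    and gS :: "('s, 'e) tensor"
    and K :: "'x set" and \<Psi> :: "real \<times> 's \<Rightarrow> 'x" and t :: "'x \<Rightarrow> real"
    and \<omega> \<omega>' :: "('x, complex ^ 'n) tensor"
    and lam :: real and k :: nat
  assumes n: "CARD('n) \<ge> 2"
    and X: "complex_atlas AX"
    and S: "smooth_atlas AS" "compact (UNIV :: 's set)" "DIM('e) = 2 * CARD('n) - 1"
    and gS: "riemannian_metric AS gS"
    and cyl: "cylindrical_boundary AX AS K \<Psi>"
    and t: "extended_parameter AX \<Psi> t"
    and H1: "deRham AS 1 = {deRham_class AS 1 zero_tensor}"
    and \<omega>: "conical_kaehler AX AS gS \<Psi> t \<omega>" "ricci_flat AX (kaehler_metric_of \<omega>)"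
    and \<omega>': "conical_kaehler AX AS gS \<Psi> t \<omega>'" "ricci_flat AX (kaehler_metric_of \<omega>')"
    and cohom: "deRham_class AX 2 \<omega> = deRham_class AX 2 \<omega>'"
    and k: "k \<ge> 2"
    and lam_gt: "lam > real CARD('n) - 2"
    and decay: "Ck_finite_on_end AS gS k 2
      (pullback (cyl_atlas AS) AX 2 \<Psi>
        (mult_tensor (\<lambda>p. exp (lam * t p)) (diff_tensor \<omega> \<omega>')))"
  shows "\<omega> = \<omega>'"
proof -
  \<comment> \<open>The type \<open>'n bit0\<close> has \<open>2 * CARD('n)\<close> elements, the
    real dimension of both the manifold and the cylinder, and it is finite and well-ordered as the
    change of variables requires.\<close>
  have cards: "CARD('n bit0) = DIM(complex ^ 'n)" "CARD('n bit0) = DIM(real * 'e)"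
    using S(3) n by simp_all
  obtain \<iota> :: "'n bit0 => complex ^ 'n" where \<iota>: "bij_betw \<iota> UNIV Basis" by (rule basis_bij[OF cards(1)])
  obtain \<iota>' :: "'n bit0 => real * 'e" where \<iota>': "bij_betw \<iota>' UNIV Basis" by (rule basis_bij[OF cards(2)])
  \<comment> \<open>From \<open>CARD('n) >= 2\<close> the decay rate is positive, so the differences
    converge on the end.\<close>
  have lam: "lam > 0" using lam_gt n by linarith
  have kf: "kaehler_form AX \<omega>" "kaehler_form AX \<omega>'" using \<omega>(1) \<omega>'(1) by (auto simp: conical_kaehler_def)
  have sX: "smooth_manifold AX" using X by (simp add: smooth_manifold_def complex_atlas_def)
  interpret KP: kaehler_pair AX \<omega> \<omega>' \<iota>
  proof (rule kaehler_pair.intro[OF sX kaehler_pair_axioms.intro])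
    show "dir (transition c d) x (mulI v) = mulI (dir (transition c d) x v)"
      if "c : AX" "d : AX" "x : overlap c d" for c d x v
      using X that unfolding complex_atlas_def by blast
  qed (fact kf \<iota>)+
  interpret S: smooth_manifold AS using S(1) by (simp add: smooth_manifold_def)
  obtain \<Phi> where \<Phi>: "homeomorphism UNIV (- K) \<Psi> \<Phi>" "smooth_map_on (cyl_atlas AS) AX UNIV \<Psi>"
      "smooth_map_on AX (cyl_atlas AS) (- K) \<Phi>"
    using cyl unfolding cylindrical_boundary_def by blast
  have K: "open (- K)" using cyl unfolding cylindrical_boundary_def by (simp add: compact_imp_closed open_Compl)
  have ends: "compact (- \<Psi> ` ({T<..} \<times> UNIV))" for T using cyl unfolding cylindrical_boundary_def by blast
  interpret C: cyl_embedding AS AX \<Psi> \<Phi> "- K" gS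
  proof (rule cyl_embedding.intro[OF S.smooth_manifold_axioms _ cyl_embedding_axioms.intro[OF gS S(2)]])
    show "open_embedding (cyl_atlas AS) AX \<Psi> \<Phi> (- K)"
      by (rule open_embedding.intro[OF _ sX open_embedding_axioms.intro[OF \<Phi>(1) K \<Phi>(2,3)]])
        (simp add: smooth_manifold_def S.smooth_cyl_atlas)
  qed
  obtain T0 where par: "!!u s. u > T0 ==> t (\<Psi> (u, s)) = u" and st: "smooth_scalar AX t"
    using t unfolding extended_parameter_def by blast
  have tf: "tensor_field AX 2 \<omega>" "tensor_field AX 2 \<omega>'"
    using kf by (auto simp: kaehler_form_def closed_form_def diff_form_def)
  obtain M Ta where M: "M >= 0" and Ta: "C.decaying lam M Ta (diff_tensor \<omega> \<omega>')"
    using C.decaying_exists[OF KP.tensor_field_diff[OF tf] par decay] .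
  have cm: "EX T. C.cone_like (kmet \<alpha>) T" if "conical_kaehler AX AS gS \<Psi> t \<alpha>" for \<alpha>
  proof -
    have "tensor_field AX 2 (kaehler_metric_of \<alpha>)"
      "cylindrical_metric AX AS gS \<Psi> (mult_tensor (%p. exp (- 2 * t p)) (kaehler_metric_of \<alpha>))"
      using that by (auto simp: conical_kaehler_def conical_metric_def riemannian_metric_def)
    from C.conical_comparable[OF this(1) par this(2)] show ?thesis by (simp add: kaehler_metric_of_def kmet_def[abs_def])
  qed
  obtain Tb Tc where Tbc: "C.cone_like (kmet \<omega>) Tb" "C.cone_like (kmet \<omega>') Tc" using cm[OF \<omega>(1)] cm[OF \<omega>'(1)] by blast
  \<comment> \<open>A common threshold beyond which comparability, decay and the identification of
    \<open>t\<close> with the cylinder parameter all hold.\<close>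
  define T1 where "T1 = max (max T0 Ta) (max Tb Tc)"
  have T1: "Ta <= T1" "Tb <= T1" "Tc <= T1" by (auto simp: T1_def)
  have comparable: "C.cone_like (kmet \<alpha>) T1" if "\<alpha> : {\<omega>, \<omega>'}" for \<alpha>
    using that C.end_mono(1)[OF T1(2) Tbc(1)] C.end_mono(1)[OF T1(3) Tbc(2)] by blast
  note dec = C.end_mono(2)[OF T1(1) Ta]
  interpret CP: conical_pair AX \<omega> \<omega>' \<iota> AS \<Psi> \<Phi> "- K" gS lam M T1
    by (rule conical_pair.intro[OF KP.kaehler_pair_axioms C.cyl_embedding_axioms conical_pair_axioms.intro])
      (fact lam M comparable dec ends)+
  have same_volume: "dir (KP.lnvol \<omega>' c) x v = dir (KP.lnvol \<omega> c) x v" if "c : AX" "x : range_of c" for c x v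
    by (rule KP.volratio_locally_constant[OF \<omega>(2) \<omega>'(2) CP.volratio_vanishes_at_infinity that])
  have "closed_form AX 2 \<omega>" using kf(1) by (simp add: kaehler_form_def)
  from cohomologous_imp_exact[OF this _ cohom]
  obtain \<eta> where \<eta>: "diff_form AX 1 \<eta>" "diff_tensor \<omega> \<omega>' = ext_deriv AX 1 \<eta>"
    by (auto simp: exact_form_def)
  interpret EK: exact_kaehler_pair AX \<omega> \<omega>' \<iota> \<eta>
    by (rule exact_kaehler_pair.intro[OF KP.kaehler_pair_axioms exact_kaehler_pair_axioms.intro]) (fact \<eta> same_volume)+
  have t\<eta>: "tensor_field AX 1 \<eta>" using \<eta>(1) by (simp add: diff_form_def)
  have "EX f. EX D>=0. (ALL c:AS. Ck_on 1 ({T1<..} \<times> range_of c) (rep c f)) &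
    (ALL c d u x w. C.at_end c d u x & u > T1 -->
      \<bar>C.pb1 \<eta> c d (u, x) w - dir (rep c f) (u, x) w\<bar> <= D * exp (- lam * u) * C.N c (u, x) w)"
    by (rule C.primitive_on_end[OF t\<eta> lam M H1 dec[unfolded \<eta>(2)]])
  then obtain f D where D: "D >= 0" and f: "ALL c:AS. Ck_on 1 ({T1<..} \<times> range_of c) (rep c f)"
    "ALL c d u x w. C.at_end c d u x & u > T1 -->
      \<bar>C.pb1 \<eta> c d (u, x) w - dir (rep c f) (u, x) w\<bar> <= D * exp (- lam * u) * C.N c (u, x) w"
    by (elim exE conjE) (rule that)
  have par': "t (\<Psi> (u, s)) = u" if "u > T1" for u s using par that by (simp add: T1_def)
  have fC: "Ck_on 1 ({T1<..} \<times> range_of c) (rep c f)" if "c : AS" for c using f(1) that by blast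
  have fd: "\<bar>C.pb1 \<eta> c d (u, x) w - dir (rep c f) (u, x) w\<bar> <= D * exp (- lam * u) * C.N c (u, x) w"
    if "C.at_end c d u x" "u > T1" for c d u x w using f(2)[rule_format, OF conjI[OF that]] .
  interpret CE: conical_exact AX \<omega> \<omega>' \<iota> \<eta> AS \<Psi> \<Phi> "- K" gS lam M T1 t T1 D f
    by (rule conical_exact.intro[OF EK.exact_kaehler_pair_axioms CP.conical_pair_axioms conical_exact_axioms.intro])
      (fact st par' order_refl fC D fd)+
  \<comment> \<open>The left-hand side is \<open>2 * CARD('n)\<close>, so this is the hypothesis on
    \<open>lam\<close> doubled.\<close>
  have "real CARD('n bit0) < 2 * lam + 4" using lam_gt by simp
  then have Q: "EK.Q p = 0" for p by (rule CE.Q_eq_zero[OF \<iota>'])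
  show ?thesis
  proof (intro ext)
    fix c x vs
    show "\<omega> c x vs = \<omega>' c x vs"
    proof (cases "c : AX & x : range_of c & length vs = 2")
      case True
      then obtain u v where "vs = [u, v]" by (auto simp: numeral_2_eq_2 length_Suc_conv)
      moreover have "EK.qdefect c x = 0" using EK.Q_point[of c x] Q True by simp
      ultimately show ?thesis using EK.qdefect_zero True by simp
    next
      case False
      then show ?thesis by (simp add: tensor_field_zero[OF tf(1)] tensor_field_zero[OF tf(2)])
    qed
  qed
qed

end
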